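(* Let $N\ge2$, let $d\ge3$ be an integer, let $\mathbf{v}=(v_1,\dots,v_N)\in(\mathbb{R}^d)^N$ be such that $v_i\neq v_j$ for $i\neq j$, and let $$\mathcal{A}'_{\mathbf{v}}=\Bigl\{\mathbf{A}=(A_1,\dots,A_N)\in GL_d(\mathbb{R})^N : 0<\max_{i\neq j}\frac{\|A_i\|+\|A_j\|}{|v_i-v_j|}\cdot\frac{\|\mathbf{v}\|}{1-\|\mathbf{A}\|}<\frac{2}{\sqrt{3}}-1\Bigr\}.$$ Then for every probability vector $\mathbf{p}\in(0,1)^N$ the corresponding self-affine measure $\mu=\mu_{\mathbf{A},\mathbf{v},\mathbf{p}}$ satisfies $$\dim\mu=\dim_{\mathrm L}\mu=\min\Bigl(\Bigl\{k+\frac{h_{\mathbf{p}}-\sum_{j=1}^k\chi_j(\mathbf{A},\mathbf{p})}{\chi_{k+1}(\mathbf{A},\mathbf{p})}:k\in\{0,\dots,d-1\}\Bigr\}\cup\{d\}\Bigr)$$ for $\mathcal{L}^{d^2N}$-almost all $\mathbf{A}\in\mathcal{A}'_{\mathbf{v}}$. Moreover, $$\dim_{\mathrm H}\pi_{\mathbf{A},\mathbf{v}}\mu_{\mathbf{A}}=\dim_{\mathrm H}E_{\mathbf{A},\mathbf{v}}=\overline{\dim}_{\mathrm M}E_{\mathbf{A},\mathbf{v}}=\dim_{\mathrm{aff}}\mathbf{A}$$ for $\mathcal{L}^{d^2N}$-almost all $\mathbf{A}\in\mathcal{A}'_{\mathbf{v}}\cap\mathcal{D}$, where $\mu_{\mathbf{A}}$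 is an ergodic $s$-equilibrium state of $\mathbf{A}$ for $s=\dim_{\mathrm{aff}}\mathbf{A}$.
   Context: Norms: $|\cdot|$ Euclidean norm, $\|A\|$ operator norm, $\|\mathbf{A}\|=\max_i\|A_i\|$, $\|\mathbf{v}\|=\max_i|v_i|$. $\mathcal{L}^{d^2N}$ is Lebesgue measure on $GL_d(\mathbb{R})^N\subset\mathbb{R}^{d^2N}$. (Tuples in $\mathcal{A}'_{\mathbf v}$ are contractive, i.e. $\|\mathbf A\|<1$.) For a contractive tuple $\mathbf{A}\in GL_d(\mathbb{R})^N$ and $\mathbf{v}\in(\mathbb{R}^d)^N$, let $f_i(x)=A_ix+v_i$; $E_{\mathbf{A},\mathbf{v}}$ is the unique nonempty compact set $E$ with $E=\bigcup_i f_i(E)$. $\Sigma=\{1,\dots,N\}^{\mathbb{N}}$ with left shift $\sigma$, $\Sigma_n=\{1,\dots,N\}^n$, $\Sigma_*=\bigcup_{n\ge0}\Sigma_n$; $[\mathbf{i}]\subset\Sigma$ is the cylinder of sequences beginning with $\mathbf{i}\in\Sigma_*$; $A_{\mathbf{i}}=A_{i_1}\cdots A_{i_n}$ ($A_\varnothing=I$); $\mathbf{i}|_n$ is the first $n$ symbols of $\mathbf{i}$. $\pi_{\mathbf{A},\mathbf{v}}(\mathbf{i})=\sum_{k\ge1}A_{\mathbf{i}|_{k-1}}v_{i_k}$, and $\pi_{\mathbf{A},\mathbf{v}}\nu=\nu\circ\pi_{\mathbf{A},\mathbf{v}}^{-1}$ for a measure $\nu$ on $\Sigma$. $\alpha_1(A)\ge\dots\ge\alpha_d(A)$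 are the singular values of $A$. $\varphi^s(A)=\alpha_1(A)\cdots\alpha_{\lfloor s\rfloor}(A)\alpha_{\lceil s\rceil}(A)^{s-\lfloor s\rfloor}$ for $0\le s\le d$, $\varphi^s(A)=|\det A|^{s/d}$ for $s>d$. $P_{\mathbf{A}}(s)=\lim_n\frac1n\log\sum_{\mathbf{i}\in\Sigma_n}\varphi^s(A_{\mathbf{i}})$, continuous and strictly decreasing with a unique zero; $\dim_{\mathrm{aff}}\mathbf{A}$ is the minimum of $d$ and this zero. $\nu_{\mathbf{p}}$ is the Bernoulli measure on $\Sigma$ with vector $\mathbf{p}$, $\mu_{\mathbf{A},\mathbf{v},\mathbf{p}}=\pi_{\mathbf{A},\mathbf{v}}\nu_{\mathbf{p}}$, $h_{\mathbf{p}}=-\sum_ip_i\log p_i$. For an ergodic $\sigma$-invariant probability measure $\nu$, the Lyapunov exponents $0<\chi_1(\mathbf{A},\nu)\le\dots\le\chi_d(\mathbf{A},\nu)<\infty$ satisfy $\chi_i(\mathbf{A},\nu)=-\lim_n\frac1n\log\alpha_i(A_{\mathbf{i}|_n})$ for $\nu$-a.e. $\mathbf{i}$; $\chi_i(\mathbf{A},\mathbf{p})=\chi_i(\mathbf{A},\nu_{\mathbf{p}})$. The entropy is $h_\nu=-\lim_n\frac1n\sum_{\mathbf{i}\in\Sigma_n}\nu([\mathbf{i}])\log\nu([\mathbf{i}])$. The Lyapunov dimension is $\dim_{\mathrm L}\pi_{\mathbf{A},\mathbf{v}}\nu=\dim_{\mathrm L}\nu=\min(\{k+(h_\nu-\sum_{j\le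 k}\chi_j(\mathbf{A},\nu))/\chi_{k+1}(\mathbf{A},\nu):0\le k\le d-1\}\cup\{d\})$. For $s=\dim_{\mathrm{aff}}\mathbf{A}$, an ergodic $s$-equilibrium state of $\mathbf{A}$ is an ergodic $\sigma$-invariant probability measure $\mu$ on $\Sigma$ with $h_\mu=-\lim_n\frac1n\sum_{\mathbf{i}\in\Sigma_n}\mu([\mathbf{i}])\log\varphi^s(A_{\mathbf{i}})=\sum_{j=1}^{\lfloor s\rfloor}\chi_j(\mathbf{A},\mu)+(s-\lfloor s\rfloor)\chi_{\lceil s\rceil}(\mathbf{A},\mu)$. $\mathcal{D}$ is the set of $\mathbf{A}\in GL_d(\mathbb{R})^N$ for which there exist $C\ge1$ and $0<\tau<1$ such that $\alpha_{i+1}(A_{\mathbf{i}})/\alpha_i(A_{\mathbf{i}})\le C\tau^{|\mathbf{i}|}$ for every $\mathbf{i}\in\Sigma_*$ and every $i\in\{1,\dots,d-1\}$, where $|\mathbf{i}|$ is the length of $\mathbf{i}$. A measure $\mu$ on $\mathbb{R}^d$ is exact-dimensional if $\lim_{r\downarrow0}\log\mu(B(x,r))/\log r$ exists and equals a constant, denoted $\dim\mu$, for $\mu$-a.e. $x$; writing $\dim\mu=c$ means $\mu$ is exact-dimensional with this value. For a measure, $\dim_{\mathrm H}\mu$ means the lower Hausdorff dimension $\inf\{\dim_{\mathrm H}B:B\text{ Borel},\ \mu(B)>0\}$. For sets, $\dim_{\mathrm H}$ and $\overline{\dim}_{\mathrm M}$ are Hausdorff and upper Minkowski dimension. *)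

theory Defs
  imports "HOL-Probability.Probability" "HOL-Computational_Algebra.Polynomial"
begin

text \<open>A tuple of \<open>N\<close> real \<open>d \<times> d\<close> matrices is an element of \<^typ>\<open>real^'d^'d^'n\<close> with
  \<open>d = CARD('d)\<close> and \<open>N = CARD('n)\<close>; the symbols are the elements of \<^typ>\<open>'n\<close>. This is a
  Euclidean space of dimension \<open>d\<^sup>2 N\<close>, and \<^const>\<open>lebesgue\<close> on it is Lebesgue measure.\<close>


section \<open>Singular values\<close>

definition charpoly :: "real^'d^'d \<Rightarrow> real poly" where
  "charpoly M = det (\<chi> i j. if i = j then [:- (M $ i $ j), 1:] else [:- (M $ i $ j):])"

text \<open>\<^const>\<open>proots\<close> lists the real roots with their multiplicities, so this is the
  non-increasing list of square roots of the eigenvalues of \<open>A\<^sup>T A\<close>.\<close>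

definition singular_values :: "real^'d^'d \<Rightarrow> real list" where
  "singular_values A =
     rev (sorted_list_of_multiset (image_mset sqrt (proots (charpoly (transpose A ** A)))))"

definition sval :: "nat \<Rightarrow> real^'d^'d \<Rightarrow> real" where  \<comment> \<open>\<open>\<alpha>\<^sub>k(A)\<close>, for \<open>1 \<le> k \<le> d\<close>\<close>
  "sval k A = singular_values A ! (k - 1)"

text \<open>For integral \<open>s\<close> the last factor has exponent \<open>0\<close> and equals \<open>1\<close> for invertible
  \<open>A\<close>; this includes \<open>s = 0\<close>, where \<^term>\<open>sval 0 A\<close> is \<^term>\<open>sval 1 A\<close> by truncated subtraction.\<close>

definition svf :: "real \<Rightarrow> real^'d^'d \<Rightarrow> real" where  \<comment> \<open>\<open>\<phi>\<^sup>s(A)\<close>, for \<open>s \<ge> 0\<close>\<close>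
  "svf s (A :: real^'d^'d) =
     (if s \<le> real CARD('d)
      then (\<Prod>j=1..nat \<lfloor>s\<rfloor>. sval j A) * sval (nat \<lceil>s\<rceil>) A powr (s - of_int \<lfloor>s\<rfloor>)
      else \<bar>det A\<bar> powr (s / real CARD('d)))"


section \<open>Matrix tuples and the affinity dimension\<close>

definition op_norm :: "real^'d^'d \<Rightarrow> real" where
  "op_norm A = onorm ((*v) A)"

definition GL_tuples :: "(real^'d^'d^'n) set" where
  "GL_tuples = {A. \<forall>i. invertible (A $ i)}"

text \<open>The norms of tuples are maxima over the index set, unlike the Euclidean
  \<^const>\<open>norm\<close> of these vectors.\<close>

definition mat_tuple_norm :: "real^'d^'d^'n \<Rightarrow> real" where
  "mat_tuple_norm A = Max (range (\<lambda>i. op_norm (A $ i)))"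

definition vec_tuple_norm :: "real^'d^'n \<Rightarrow> real" where
  "vec_tuple_norm v = Max (range (\<lambda>i. norm (v $ i)))"

definition word_mat :: "real^'d^'d^'n \<Rightarrow> 'n list \<Rightarrow> real^'d^'d" where
  "word_mat A w = foldr (\<lambda>i B. A $ i ** B) w (mat 1)"

definition words :: "nat \<Rightarrow> 'n list set" where
  "words n = {w. length w = n}"

definition pressure :: "real^'d^'d^'n \<Rightarrow> real \<Rightarrow> real" where
  "pressure A s = lim (\<lambda>n. ln (\<Sum>w\<in>words n. svf s (word_mat A w)) / real n)"

definition dim_aff :: "real^'d^'d^'n \<Rightarrow> real" where
  "dim_aff (A :: real^'d^'d^'n) = min (real CARD('d)) (THE s. 0 \<le> s \<and> pressure A s = 0)"

definition dominated_tuples :: "(real^'d^'d^'n) set" where  \<comment> \<open>the set \<open>\<D>\<close>\<close>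
  "dominated_tuples = {A :: real^'d^'d^'n. A \<in> GL_tuples \<and>
     (\<exists>C \<tau>. 1 \<le> C \<and> 0 < \<tau> \<and> \<tau> < 1 \<and>
       (\<forall>w. \<forall>i\<in>{1..CARD('d) - 1}.
          sval (i + 1) (word_mat A w) / sval i (word_mat A w) \<le> C * \<tau> ^ length w))}"

definition admissible_tuples :: "real^'d^'n \<Rightarrow> (real^'d^'d^'n) set" where  \<comment> \<open>the set \<open>\<A>'\<^sub>v\<close>\<close>
  "admissible_tuples v = {A \<in> GL_tuples.
     let m = Max {(op_norm (A $ i) + op_norm (A $ j)) / norm (v $ i - v $ j) | i j. i \<noteq> j}
               * (vec_tuple_norm v / (1 - mat_tuple_norm A))
     in 0 < m \<and> m < 2 / sqrt 3 - 1}"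

text \<open>The positivity condition implies contractivity, which is therefore not a separate condition.\<close>

lemma admissible_tuples_contractive:
  fixes v :: "real^'d^'n"
  assumes A: "A \<in> admissible_tuples v" and N: "CARD('n) \<ge> 2"
  shows "mat_tuple_norm A < 1"
proof (rule ccontr)
  assume "\<not> mat_tuple_norm A < 1"
  define S where "S = {(op_norm (A $ i) + op_norm (A $ j)) / norm (v $ i - v $ j) | i j. i \<noteq> j}"
  have "S = (\<lambda>(i, j). (op_norm (A $ i) + op_norm (A $ j)) / norm (v $ i - v $ j))
              ` {(i, j). i \<noteq> j}"
    unfolding S_def by auto
  then have fin: "finite S" by simp
  obtain i j :: 'n where "i \<noteq> j"
    using N card_2_iff' ex_card[OF N] by (metis (full_types))
  then have ij: "(op_norm (A $ i) + op_norm (A $ j)) / norm (v $ i - v $ j) \<in> S"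
    unfolding S_def by blast
  have op: "0 \<le> op_norm B" for B :: "real^'d^'d"
    unfolding op_norm_def by (rule onorm_pos_le) (rule matrix_vector_mul_bounded_linear)
  have "0 \<le> (op_norm (A $ i) + op_norm (A $ j)) / norm (v $ i - v $ j)"
    using op by (simp add: add_nonneg_nonneg)
  also have "\<dots> \<le> Max S" using fin ij by simp
  finally have "0 \<le> Max S" .
  moreover have "0 \<le> vec_tuple_norm v"
    unfolding vec_tuple_norm_def by (rule order_trans[OF norm_ge_zero Max_ge]) auto
  moreover have "vec_tuple_norm v / (1 - mat_tuple_norm A) \<le> 0"
    using \<open>\<not> mat_tuple_norm A < 1\<close> \<open>0 \<le> vec_tuple_norm v\<close> by (simp add: divide_nonneg_nonpos)
  ultimately have "Max S * (vec_tuple_norm v / (1 - mat_tuple_norm A)) \<le> 0"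
    by (simp only: mult_nonneg_nonpos)
  moreover have "0 < Max S * (vec_tuple_norm v / (1 - mat_tuple_norm A))"
    using A unfolding admissible_tuples_def Let_def S_def by blast
  ultimately show False by simp
qed


section \<open>The self-affine set and the symbolic space\<close>

definition self_affine_set :: "real^'d^'d^'n \<Rightarrow> real^'d^'n \<Rightarrow> (real^'d) set" where
  "self_affine_set A v =
     (THE E. E \<noteq> {} \<and> compact E \<and> E = (\<Union>i. (\<lambda>x. A $ i *v x + v $ i) ` E))"

text \<open>Infinite sequences are streams, with shift \<^const>\<open>stl\<close>. Symbols are counted from \<open>0\<close>:
  \<open>\<omega> !! k\<close> is the symbol following the word \<open>stake k \<omega>\<close>.\<close>

definition coding_map :: "real^'d^'d^'n \<Rightarrow> real^'d^'n \<Rightarrow> 'n stream \<Rightarrow> real^'d" where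
  "coding_map A v \<omega> = (\<Sum>k. word_mat A (stake k \<omega>) *v (v $ (\<omega> !! k)))"

definition projected_measure ::
    "real^'d^'d^'n \<Rightarrow> real^'d^'n \<Rightarrow> 'n stream measure \<Rightarrow> (real^'d) measure" where
  "projected_measure A v \<nu> = distr \<nu> borel (coding_map A v)"

definition cylinder :: "'n list \<Rightarrow> 'n stream set" where
  "cylinder w = {\<omega>. stake (length w) \<omega> = w}"

definition ergodic_shift_measure :: "'n stream measure \<Rightarrow> bool" where
  "ergodic_shift_measure \<nu> \<longleftrightarrow>
     prob_space \<nu> \<and> sets \<nu> = sets (stream_space (count_space UNIV)) \<and>
     distr \<nu> \<nu> stl = \<nu> \<and>
     (\<forall>B\<in>sets \<nu>. stl -` B = B \<longrightarrow> measure \<nu> B = 0 \<or> measure \<nu> B = 1)"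

definition prob_vector :: "real^'n \<Rightarrow> bool" where
  "prob_vector p \<longleftrightarrow> (\<forall>i. 0 < p $ i \<and> p $ i < 1) \<and> (\<Sum>i\<in>UNIV. p $ i) = 1"

definition bernoulli_measure :: "real^'n \<Rightarrow> 'n stream measure" where
  "bernoulli_measure p = stream_space (point_measure UNIV (\<lambda>i. ennreal (p $ i)))"

definition vector_entropy :: "real^'n \<Rightarrow> real" where  \<comment> \<open>\<open>h\<^sub>p\<close>\<close>
  "vector_entropy p = - (\<Sum>i\<in>UNIV. p $ i * ln (p $ i))"

definition shift_entropy :: "'n::finite stream measure \<Rightarrow> real" where  \<comment> \<open>\<open>h\<^sub>\<nu>\<close>\<close>
  "shift_entropy \<nu> =
     - lim (\<lambda>n. (\<Sum>w\<in>words n. measure \<nu> (cylinder w) * ln (measure \<nu> (cylinder w))) / real n)"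

text \<open>For ergodic \<open>\<nu>\<close> and \<open>1 \<le> i \<le> d\<close>, the almost sure limit exists by the subadditive ergodic
  theorem, and it is unique.\<close>

definition lyapunov_exponent :: "real^'d^'d^'n \<Rightarrow> 'n stream measure \<Rightarrow> nat \<Rightarrow> real" where
  "lyapunov_exponent A \<nu> i =
     (THE c. AE \<omega> in \<nu>. (\<lambda>n. - (ln (sval i (word_mat A (stake n \<omega>))) / real n)) \<longlonglongrightarrow> c)"

definition lyapunov_dim :: "real^'d^'d^'n \<Rightarrow> 'n stream measure \<Rightarrow> real" where
  "lyapunov_dim (A :: real^'d^'d^'n) \<nu> =
     Min ((\<lambda>k. real k + (shift_entropy \<nu> - (\<Sum>j=1..k. lyapunov_exponent A \<nu> j))
                          / lyapunov_exponent A \<nu> (k + 1)) ` {0..CARD('d) - 1}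
          \<union> {real CARD('d)})"

definition equilibrium_state :: "real^'d^'d^'n \<Rightarrow> real \<Rightarrow> 'n stream measure \<Rightarrow> bool" where
  "equilibrium_state A s \<mu> \<longleftrightarrow>
     ergodic_shift_measure \<mu> \<and>
     shift_entropy \<mu> =
       - lim (\<lambda>n. (\<Sum>w\<in>words n. measure \<mu> (cylinder w) * ln (svf s (word_mat A w))) / real n) \<and>
     shift_entropy \<mu> =
       (\<Sum>j=1..nat \<lfloor>s\<rfloor>. lyapunov_exponent A \<mu> j)
         + (s - of_int \<lfloor>s\<rfloor>) * lyapunov_exponent A \<mu> (nat \<lceil>s\<rceil>)"


section \<open>Dimensions of measures and sets\<close>

definition exact_dimensional :: "'a::metric_space measure \<Rightarrow> real \<Rightarrow> bool" where
    \<comment> \<open>\<open>dim \<mu> = c\<close>\<close>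
  "exact_dimensional \<mu> c \<longleftrightarrow>
     (AE x in \<mu>. ((\<lambda>r. ln (measure \<mu> (cball x r)) / ln r) \<longlongrightarrow> c) (at_right 0))"

text \<open>Only used for \<open>s > 0\<close>. Boundedness is required because \<^const>\<open>diameter\<close> is
  meaningless for unbounded sets.\<close>

definition hausdorff_content :: "real \<Rightarrow> real \<Rightarrow> 'a::metric_space set \<Rightarrow> ennreal" where
  "hausdorff_content s \<delta> S =
     (INF U\<in>{U :: nat \<Rightarrow> 'a set. S \<subseteq> (\<Union>i. U i) \<and> (\<forall>i. bounded (U i) \<and> diameter (U i) \<le> \<delta>)}.
        \<Sum>i. ennreal (diameter (U i) powr s))"

definition hausdorff_measure :: "real \<Rightarrow> 'a::metric_space set \<Rightarrow> ennreal" where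
  "hausdorff_measure s S = (SUP \<delta>\<in>{0<..}. hausdorff_content s \<delta> S)"

definition hausdorff_dim :: "'a::euclidean_space set \<Rightarrow> real" where
  "hausdorff_dim S = Inf {s. 0 < s \<and> hausdorff_measure s S = 0}"

definition lower_hausdorff_dim :: "'a::euclidean_space measure \<Rightarrow> real" where
  "lower_hausdorff_dim \<mu> = Inf {hausdorff_dim B | B. B \<in> sets borel \<and> 0 < emeasure \<mu> B}"

definition covering_number :: "'a::metric_space set \<Rightarrow> real \<Rightarrow> nat" where
  "covering_number S r = (LEAST n. \<exists>F. finite F \<and> card F = n \<and> S \<subseteq> (\<Union>x\<in>F. cball x r))"

definition upper_minkowski_dim :: "'a::metric_space set \<Rightarrow> ereal" where  \<comment> \<open>for totally bounded sets\<close>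
  "upper_minkowski_dim S =
     Limsup (at_right 0) (\<lambda>r. ereal (ln (real (covering_number S r)) / ln (1 / r)))"

end

theory Submission
  imports Defs "HOL-Real_Asymp.Real_Asymp"
begin

text \<open>Conjugating every \<open>A $ i\<close> by a matrix \<open>B\<close> turns the coding map of \<open>A\<close> with translations \<open>v\<close> into that of
 the conjugate tuple with translations \<open>B v $ i\<close>, which is linear in \<open>B\<close>. Falconer's transversality
 argument, usually run over the translations, therefore applies to \<open>B\<close> along a conjugacy class, and
 Fubini yields a single \<open>B\<close> near the identity that is good for almost every \<open>A\<close>. The separation
 condition is what makes the linear map \<open>B \<mapsto>\<close> difference of two coded points nondegenerate.

 Finite energies, with respect to the singular value function, of weights dominating the given measure on a large set
 bound the local dimensions from below: for Bernoulli measures the cylinder masses are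
 capped by the singular value function, for equilibrium states the singular value function itself
 serves as weight. Upper bounds come from covering the images of cylinders by balls. An
 ergodic equilibrium state is obtained among the shift invariant measures of maximal free energy as
 a maximiser of a strictly convex functional. The same separation condition gives
 \<open>(\<Sum>i. \<bar>det (A $ i)\<bar>) \<le> 1\<close>, so that the pressure vanishes at some point of \<open>[0, d]\<close>.\<close>

text \<open>The obstacle is that the translations are fixed and only the matrices are random. A
  fixed conjugate of \<open>A\<close> still sees the translations \<open>mat_vecs B v\<close>, and
  the rank one perturbations \<open>outer x e\<close> of \<open>B\<close>, with \<open>e\<close>
  along \<open>v$i - v$j\<close>, already give the d directions that a volume estimate needs. The
  matrix \<open>B\<close> is chosen before \<open>A\<close>, and the estimates are made for the
  conjugate tuple. Its norms grow by at most 5/3; the bound \<open>2 / sqrt 3 - 1 < 31/200\<close>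
  leaves room for that, which is how \<open>relaxed_tuples\<close> arises. An equilibrium state
  depends on \<open>A\<close>, so a statement for almost every \<open>A\<close> and one given
  measure would not reach it. Its energy weights involve \<open>A\<close> alone, and exponents and
  bounds run through countable sets. Estimates for \<open>svf\<close> go through
  \<open>svcap\<close>, which counts, up to constants, the balls of radius \<open>1 / l\<close> that
  cover an ellipsoid: \<open>svf t M\<close> is the minimum over \<open>l > 0\<close> of
  \<open>l powr (- t) * svcap l M\<close>. Submultiplicativity up to a constant then follows by
  playing coverings against volumes.\<close>

lemma greedy_orthonormal:
 fixes M :: "real^'d^'d"
 assumes "k <= CARD('d)"
 shows "\<exists>q :: nat => real^'d. (\<forall>i<k. norm (q i) = 1) \<and> (\<forall>i<k. \<forall>j<k. i \<noteq> j --> q i \<bullet> q j = 0) \<and>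
  (\<forall>i<k. \<forall>x. (\<forall>j<i. q j \<bullet> x = 0) --> norm (M *v x) <= norm (M *v q i)*norm x)"
 using assms
proof (induction k)
 case 0
 thus ?case by simp
next
 case (Suc k)
 then obtain q :: "nat => real^'d" where q: "\<forall>i<k. norm (q i) = 1"
  "\<forall>i<k. \<forall>j<k. i \<noteq> j --> q i \<bullet> q j = 0"
  "\<forall>i<k. \<forall>x. (\<forall>j<i. q j \<bullet> x = 0) --> norm (M *v x) <= norm (M *v q i)*norm x"
  by auto
 \<comment> \<open>The next vector maximises the norm of the image on the unit sphere of the
   orthogonal complement, which is compact and, because fewer than \<open>CARD('d)\<close> vectors
   have been chosen, nonempty.\<close>
 define S where "S = {x :: real^'d. norm x = 1 \<and> (\<forall>j<k. q j \<bullet> x = 0)}"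
 have "dim (q ` {..<k}) <= card (q ` {..<k})" by (rule dim_le_card') simp
 also have "... <= k" using card_image_le[of "{..<k}" q] by simp
 also have "... < DIM(real^'d)" using Suc.prems by simp
 finally obtain x where x: "x \<noteq> 0" "\<And>y. y \<in> span (q ` {..<k}) ==> orthogonal x y"
  using orthogonal_to_subspace_exists by blast
 have "x /\<^sub>R norm x \<in> S"
 proof -
  have "q j \<bullet> x = 0" if "j < k" for j
   using x(2)[OF span_base, of "q j"] that by (auto simp: orthogonal_def inner_commute)
  thus ?thesis using x(1) by (simp add: S_def)
 qed
 hence ne: "S \<noteq> {}" by auto
 have "S = sphere 0 1 \<inter> (\<Inter>j\<in>{..<k}. {x. q j \<bullet> x = 0})" by (auto simp: S_def)
 moreover have "closed (\<Inter>j\<in>{..<k}. {x. q j \<bullet> x = 0})"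
  by (intro closed_INT ballI closed_hyperplane)
 ultimately have "compact S" using compact_Int_closed by (metis compact_sphere)
 moreover have "continuous_on S (\<lambda>x. norm (M *v x))" by (intro continuous_intros)
 ultimately obtain z where z: "z \<in> S" "\<And>y. y \<in> S ==> norm (M *v y) <= norm (M *v z)"
  using continuous_attains_sup[of S] ne by blast
 have zz: "norm (M *v x) <= norm (M *v z)*norm x" if "\<forall>j<k. q j \<bullet> x = 0" for x
 proof (cases "x = 0")
  case False
  hence "x /\<^sub>R norm x \<in> S" using that by (simp add: S_def)
  from z(2)[OF this] have "norm (M *v x)/norm x <= norm (M *v z)"
   by (simp add: scaleR_matrix_vector_assoc[symmetric] matrix_vector_mult_scaleR divide_inverse mult.commute)
  with False show ?thesis by (simp add: field_simps)
 qed simp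
 define q' where "q' = q(k := z)"
 have zS: "norm z = 1" "\<And>j. j < k ==> q j \<bullet> z = 0" using z(1) by (auto simp: S_def)
 have "(\<forall>i<Suc k. norm (q' i) = 1) \<and> (\<forall>i<Suc k. \<forall>j<Suc k. i \<noteq> j --> q' i \<bullet> q' j = 0) \<and>
  (\<forall>i<Suc k. \<forall>x. (\<forall>j<i. q' j \<bullet> x = 0) --> norm (M *v x) <= norm (M *v q' i)*norm x)"
  using q zS zz by (auto simp: q'_def less_Suc_eq inner_commute)
 thus ?case by blast
qed

text \<open>First variation: a linear term that is dominated by a quadratic one near zero must
  vanish. This turns maximality of a frame vector into orthogonality of the images.\<close>

lemma quadratic_zero:
 fixes b c :: real
 assumes "\<And>t. 2*t*b <= t\<^sup>2 * c"
 shows "b = 0"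
proof (rule ccontr)
 assume "b \<noteq> 0"
 define t where "t = b/(\<bar>c\<bar> + 1)"
 have t: "t*(\<bar>c\<bar> + 1) = b" by (simp add: t_def)
 have "2*t*b <= t\<^sup>2 * c" by (rule assms)
 also have "... <= t\<^sup>2*(\<bar>c\<bar> + 1)" by (intro mult_left_mono) auto
 also have "... = t*b" by (simp only: power2_eq_square mult.assoc t)
 finally have "t*b <= 0" by (simp add: mult.commute)
 moreover have "t*b > 0" using \<open>b \<noteq> 0\<close>
  by (simp add: t_def zero_less_divide_iff zero_less_mult_iff) (auto simp: linorder_neq_iff)
 ultimately show False by simp
qed

lemma orthonormal_family_expansion:
 fixes q :: "nat => real^'d"
 assumes "\<forall>i<CARD('d). norm (q i) = 1" "\<forall>i<CARD('d). \<forall>j<CARD('d). i \<noteq> j --> q i \<bullet> q j = 0"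
 shows "x = (\<Sum>i<CARD('d). (x \<bullet> q i) *\<^sub>R q i)"
proof -
 let ?B = "q ` {..<CARD('d)}"
 have qq: "q i \<bullet> q j = (if i = j then 1 else 0)" if "i < CARD('d)" "j < CARD('d)" for i j
  using assms that by (auto simp: dot_square_norm)
 have inj: "inj_on q {..<CARD('d)}"
  by (rule inj_onI) (metis qq lessThan_iff zero_neq_one)
 have orth: "pairwise orthogonal ?B"
  using qq by (auto simp: pairwise_def orthogonal_def)
 have "0 \<notin> ?B" using assms(1) by force
 hence ind: "independent ?B" using pairwise_orthogonal_independent[OF orth] by simp
 have "card ?B = CARD('d)" using card_image[OF inj] by simp
 hence "dim (UNIV :: (real^'d) set) <= card ?B" by simp
 hence "UNIV \<subseteq> span ?B" by (rule card_ge_dim_independent[OF subset_UNIV ind])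
 hence span: "span ?B = UNIV" by (rule top.extremum_uniqueI)
 define y where "y = x - (\<Sum>i<CARD('d). (x \<bullet> q i) *\<^sub>R q i)"
 have "orthogonal y z" if z: "z \<in> ?B" for z
 proof -
  obtain j where j: "j < CARD('d)" "z = q j" using z by auto
  have "(\<Sum>i<CARD('d). (x \<bullet> q i) *\<^sub>R q i) \<bullet> q j = (\<Sum>i<CARD('d). (x \<bullet> q i)*(q i \<bullet> q j))"
   by (simp add: inner_sum_left)
  also have "... = (\<Sum>i<CARD('d). if i = j then x \<bullet> q j else 0)"
   by (rule sum.cong) (auto simp: qq j)
  also have "... = x \<bullet> q j" using j by simp
  finally show ?thesis by (simp add: y_def orthogonal_def inner_diff_left j)
 qed
 hence "orthogonal y y"
  using orthogonal_to_span[of y ?B y] span by (simp add: orthogonal_commute)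
 thus ?thesis by (simp add: y_def orthogonal_def)
qed

lemma const_poly_sum: "[:sum f A:] = (\<Sum>x\<in>A. [:f x:])"
proof (induction A rule: infinite_finite_induct)
 case (insert x F)
 have "[:f x + sum f F:] = [:f x:] + [:sum f F:]" by simp
 thus ?case using insert by simp
qed simp_all

lemma sum_single_mset: "(\<Sum>k<n. {#f k#}) = mset (map f [0..<n])"
 by (induction n) simp_all

lemma ring_matrix_diff:
 fixes A :: "'a::comm_ring_1^'m^'n"
 shows "A**(B - C) = A**B - A**C" "(D - E)**A = D**A - E**A"
 by (simp_all add: matrix_matrix_mult_def vec_eq_iff sum_subtractf left_diff_distrib right_diff_distrib)

text \<open>Over the polynomial ring the scalar matrix \<open>X\<close> commutes with every constant
  matrix, so conjugation by \<open>C Q\<close> does not change the determinant of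
  \<open>X - C D\<close>, and that matrix is diagonal.\<close>

lemma charpoly_conj_diagonal:
 fixes Q S :: "real^'d^'d"
 assumes Q: "Q**transpose Q = mat 1" and S: "S = Q**(\<chi> i j. if i = j then a i else 0)**transpose Q"
 shows "charpoly S = (\<Prod>i\<in>UNIV. [:- a i, 1:])"
proof -
 define C :: "real^'d^'d => real poly^'d^'d" where "C M = (\<chi> i j. [:M$i$j:])" for M
 define X :: "real poly^'d^'d" where "X = (\<chi> i j. if i = j then [:0,1:] else 0)"
 define D :: "real^'d^'d" where "D = (\<chi> i j. if i = j then a i else 0)"
 have Cmult: "C (A**B) = C A**C B" for A B
  by (simp add: C_def matrix_matrix_mult_def vec_eq_iff const_poly_sum mult.commute)
 have XC: "X**C A = C A**X" for A
 proof -
  have "(\<Sum>k\<in>UNIV. (if i = k then [:0,1:] else 0)*[:A$k$j:]) =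
    (\<Sum>k\<in>UNIV. [:A$i$k:]*(if k = j then [:0,1:] else 0))" for i j
  proof -
   have "(\<Sum>k\<in>UNIV. (if i = k then [:0,1:] else 0)*[:A$k$j:]) = (\<Sum>k\<in>UNIV. if k = i then [:0,1:]*[:A$k$j:] else 0)"
    by (rule sum.cong) auto
   moreover have "(\<Sum>k\<in>UNIV. [:A$i$k:]*(if k = j then [:0,1:] else 0)) = (\<Sum>k\<in>UNIV. if k = j then [:A$i$k:]*[:0,1:] else 0)"
    by (rule sum.cong) auto
   ultimately show ?thesis by simp
  qed
  thus ?thesis by (simp add: X_def C_def matrix_matrix_mult_def vec_eq_iff)
 qed
 have C1: "C (mat 1) = mat 1" by (simp add: C_def mat_def vec_eq_iff one_pCons)
 have ch: "charpoly M = det (X - C M)" for M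
  unfolding charpoly_def by (rule arg_cong[where f = det]) (simp add: X_def C_def vec_eq_iff)
 have "C Q**(X - C D)**C (transpose Q) = C Q**X**C (transpose Q) - C Q**C D**C (transpose Q)"
  by (simp add: ring_matrix_diff)
 also have "C Q**X**C (transpose Q) = X**(C Q**C (transpose Q))"
  by (simp add: XC[symmetric] matrix_mul_assoc)
 also have "C Q**C (transpose Q) = mat 1" using Q C1 by (simp add: Cmult[symmetric])
 also have "C Q**C D**C (transpose Q) = C S" by (simp add: S D_def Cmult)
 finally have "det (X - C S) = det (C Q)*det (X - C D)*det (C (transpose Q))"
  by (simp flip: det_mul)
 also have "... = det (X - C D)*det (C Q**C (transpose Q))" by (simp add: det_mul mult_ac)
 also have "C Q**C (transpose Q) = mat 1" using Q C1 by (simp add: Cmult[symmetric])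
 also have "det (X - C D) = (\<Prod>i\<in>UNIV. (X - C D)$i$i)"
  by (rule det_diagonal) (simp add: X_def C_def D_def)
 also have "... = (\<Prod>i\<in>UNIV. [:- a i, 1:])" by (simp add: X_def C_def D_def)
 finally show ?thesis by (simp add: ch)
qed

text \<open>In the greedy frame the matrix \<open>transpose M ** M\<close> is diagonal with the
  squared norms of the images as entries. These are therefore the roots of its characteristic
  polynomial with multiplicity, which ties the geometric frame to \<open>sval\<close>, defined
  through \<open>proots\<close>.\<close>

theorem svd_exists:
 fixes M :: "real^'d^'d"
 obtains q :: "nat => real^'d" where
  "\<And>i. i < CARD('d) ==> norm (q i) = 1"
  "\<And>i j. i < CARD('d) ==> j < CARD('d) ==> i \<noteq> j ==> q i \<bullet> q j = 0"
  "\<And>i j. i < CARD('d) ==> j < CARD('d) ==> i \<noteq> j ==> (M *v q i) \<bullet> (M *v q j) = 0"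
  "\<And>i. i < CARD('d) ==> norm (M *v q i) = sval (Suc i) M"
  "\<And>i j. i <= j ==> j < CARD('d) ==> norm (M *v q j) <= norm (M *v q i)"
  "\<bar>det M\<bar> = (\<Prod>i<CARD('d). norm (M *v q i))"
proof -
 let ?d = "CARD('d)"
 obtain q :: "nat => real^'d" where q: "\<forall>i<?d. norm (q i) = 1"
  "\<forall>i<?d. \<forall>j<?d. i \<noteq> j --> q i \<bullet> q j = 0"
  "\<forall>i<?d. \<forall>x. (\<forall>j<i. q j \<bullet> x = 0) --> norm (M *v x) <= norm (M *v q i)*norm x"
  using greedy_orthonormal[of ?d M] by auto
 \<comment> \<open>For \<open>i < j\<close> the vector \<open>q i\<close> plus a multiple of
   \<open>q j\<close> is an admissible competitor in the maximisation that defined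
   \<open>q i\<close>; varying the multiple kills the mixed term.\<close>
 have orth_lt: "(M *v q i) \<bullet> (M *v q j) = 0" if "i < j" "j < ?d" for i j
 proof (rule quadratic_zero)
  fix t :: real
  let ?x = "q i + t *\<^sub>R q j"
  have "\<forall>l<i. q l \<bullet> ?x = 0" using q(2) that by (auto simp: inner_add_right)
  hence "norm (M *v ?x) <= norm (M *v q i)*norm ?x" using q(3) that by auto
  hence "(norm (M *v ?x))\<^sup>2 <= (norm (M *v q i))\<^sup>2*(norm ?x)\<^sup>2"
   by (metis norm_ge_zero power_mono power_mult_distrib)
  moreover have "(norm ?x)\<^sup>2 = 1 + t\<^sup>2"
  proof -
   have "q i \<bullet> q i = 1" "q j \<bullet> q j = 1" "q i \<bullet> q j = 0" "q j \<bullet> q i = 0"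
    using q(1,2) that by (auto simp: dot_square_norm)
   thus ?thesis
    unfolding power2_norm_eq_inner by (simp add: inner_add_left inner_add_right power2_eq_square)
  qed
  moreover have "(norm (M *v ?x))\<^sup>2 = (norm (M *v q i))\<^sup>2 + 2*t*((M *v q i) \<bullet> (M *v q j)) + t\<^sup>2*(norm (M *v q j))\<^sup>2"
   unfolding power2_norm_eq_inner
   by (simp add: inner_add_left inner_add_right inner_commute power2_eq_square
      matrix_vector_right_distrib matrix_vector_mult_scaleR algebra_simps)
  ultimately show "2*t*((M *v q i) \<bullet> (M *v q j)) <= t\<^sup>2*((norm (M *v q i))\<^sup>2 - (norm (M *v q j))\<^sup>2)"
   by (simp add: algebra_simps)
 qed
 hence orth: "(M *v q i) \<bullet> (M *v q j) = 0" if "i \<noteq> j" "i < ?d" "j < ?d" for i j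
  using that orth_lt[of i j] orth_lt[of j i] by (cases "i < j") (auto simp: inner_commute)
 have mono: "norm (M *v q j) <= norm (M *v q i)" if "i <= j" "j < ?d" for i j
 proof -
  have "\<forall>l<i. q l \<bullet> q j = 0" using q(2) that by auto
  hence "norm (M *v q j) <= norm (M *v q i)*norm (q j)"
   using q(3)[rule_format, of i "q j"] that by simp
  thus ?thesis using q(1) that by simp
 qed
 \<comment> \<open>The frame is indexed by numbers, the columns of a matrix by the type
   \<open>'d\<close>; \<open>h\<close> translates.\<close>
 obtain h :: "'d => nat" where h: "bij_betw h UNIV {..<?d}"
  by (metis bij_betw_iff_card card_lessThan finite finite_lessThan)
 have hlt: "h i < ?d" for i using h by (auto simp: bij_betw_def)
 have hinj: "h i = h j \<longleftrightarrow> i = j" for i j using h by (auto simp: bij_betw_def inj_on_def)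
 define Q :: "real^'d^'d" where "Q = (\<chi> i j. q (h j)$i)"
 have "transpose Q**Q = mat 1"
 proof -
  have "(\<Sum>k\<in>UNIV. q (h i)$k*q (h j)$k) = (if i = j then 1 else 0)" for i j
  proof -
   have "(\<Sum>k\<in>UNIV. q (h i)$k*q (h j)$k) = q (h i) \<bullet> q (h j)" by (simp add: inner_vec_def)
   thus ?thesis using q(1,2) hlt hinj by (auto simp: dot_square_norm)
  qed
  thus ?thesis by (simp add: matrix_matrix_mult_def transpose_def Q_def mat_def vec_eq_iff)
 qed
 hence QQ: "Q**transpose Q = mat 1" using matrix_left_right_inverse by blast
 define a where "a i = (norm (M *v q (h i)))\<^sup>2" for i
 define S where "S = transpose M**M"
 have SQ: "S = Q**(\<chi> i j. if i = j then a i else 0)**transpose Q"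
 proof -
  have "transpose Q**S**Q = (\<chi> i j. if i = j then a i else 0)"
  proof -
   have "(transpose Q**S**Q)$i$j = (if i = j then a i else 0)" for i j
   proof -
    have "transpose Q**S**Q = transpose (M**Q)**(M**Q)"
     by (simp add: S_def matrix_transpose_mul matrix_mul_assoc)
    moreover have "(M**Q)$k$j = (M *v q (h j))$k" for k j
     by (simp add: matrix_matrix_mult_def matrix_vector_mult_def Q_def)
    moreover have "(transpose (M**Q)**(M**Q))$i$j = (\<Sum>k\<in>UNIV. (M**Q)$k$i*(M**Q)$k$j)"
     unfolding matrix_matrix_mult_def[of "transpose (M**Q)"] by (simp add: transpose_def)
    ultimately have "(transpose Q**S**Q)$i$j = (M *v q (h i)) \<bullet> (M *v q (h j))"
     by (simp add: inner_vec_def)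
    thus ?thesis using orth[of "h i" "h j"] hlt hinj by (auto simp: a_def dot_square_norm)
   qed
   thus ?thesis by (simp add: vec_eq_iff)
  qed
  hence "Q**(\<chi> i j. if i = j then a i else 0)**transpose Q = Q**(transpose Q**S**Q)**transpose Q"
   by (simp only:)
  also have "... = (Q**transpose Q)**S**(Q**transpose Q)"
   by (simp only: matrix_mul_assoc)
  finally show ?thesis by (simp add: QQ)
 qed
 have "det S = det (\<chi> i j. if i = j then a i else 0)*det (Q**transpose Q)"
  unfolding SQ det_mul by (simp add: mult_ac)
 also have "det (\<chi> i j. if i = j then a i else 0) = (\<Prod>i\<in>UNIV. (\<chi> i j. if i = j then a i else 0)$i$i)"
  by (rule det_diagonal) simp
 finally have "(det M)\<^sup>2 = (\<Prod>i\<in>UNIV. a i)"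
  by (simp add: QQ S_def det_mul power2_eq_square)
 also have "... = (\<Prod>k<?d. (norm (M *v q k))\<^sup>2)"
  unfolding a_def by (rule prod.reindex_bij_betw[OF h, of "\<lambda>k. (norm (M *v q k))\<^sup>2"])
 finally have "\<bar>det M\<bar>\<^sup>2 = (\<Prod>k<?d. norm (M *v q k))\<^sup>2"
  by (simp add: prod_power_distrib)
 hence detM: "\<bar>det M\<bar> = (\<Prod>k<?d. norm (M *v q k))"
  by (rule power2_eq_imp_eq) (simp_all add: prod_nonneg)
 have "charpoly S = (\<Prod>i\<in>UNIV. [:- a i, 1:])" by (rule charpoly_conj_diagonal[OF QQ SQ])
 also have "... = (\<Prod>k<?d. [:- (norm (M *v q k))\<^sup>2, 1:])"
  unfolding a_def by (rule prod.reindex_bij_betw[OF h, of "\<lambda>k. [:- (norm (M *v q k))\<^sup>2, 1:]"])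
 also have "proots ... = (\<Sum>k<?d. {#(norm (M *v q k))\<^sup>2#})"
  by (subst proots_prod) auto
 also have "(\<Sum>k<?d. {#(norm (M *v q k))\<^sup>2#}) = mset (map (\<lambda>k. (norm (M *v q k))\<^sup>2) [0..<?d])"
  by (rule sum_single_mset)
 finally have m: "image_mset sqrt (proots (charpoly S)) = mset (rev (map (\<lambda>k. norm (M *v q k)) [0..<?d]))"
  by (simp add: image_mset.compositionality comp_def)
 \<comment> \<open>\<open>singular_values\<close> reverses an increasing list, so the decreasing
   list of norms is reversed before the two are compared.\<close>
 have "sorted (rev (map (\<lambda>k. norm (M *v q k)) [0..<?d]))"
  unfolding sorted_iff_nth_mono
 proof (intro allI impI)
  fix i j assume ij: "i <= j" "j < length (rev (map (\<lambda>k. norm (M *v q k)) [0..<?d]))"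
  hence "j < ?d" by simp
  hence "norm (M *v q (?d - Suc i)) <= norm (M *v q (?d - Suc j))"
   using ij(1) by (intro mono) linarith+
  thus "rev (map (\<lambda>k. norm (M *v q k)) [0..<?d]) ! i <= rev (map (\<lambda>k. norm (M *v q k)) [0..<?d]) ! j"
   using ij(1) \<open>j < ?d\<close> by (simp add: rev_nth)
 qed
 hence sv: "singular_values M = map (\<lambda>k. norm (M *v q k)) [0..<?d]"
  unfolding singular_values_def S_def[symmetric] m sorted_list_of_multiset_mset
  by (subst sorted_sort_id) simp_all
 show ?thesis
 proof (rule that[of q])
  show "norm (M *v q i) = sval (Suc i) M" if "i < ?d" for i
   using that by (simp add: sval_def sv)
  show "norm (q i) = 1" if "i < ?d" for i using q(1) that by blast
  show "q i \<bullet> q j = 0" if "i < ?d" "j < ?d" "i \<noteq> j" for i j using q(2) that by blast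
  show "(M *v q i) \<bullet> (M *v q j) = 0" if "i < ?d" "j < ?d" "i \<noteq> j" for i j using orth that by blast
  show "norm (M *v q j) <= norm (M *v q i)" if "i <= j" "j < ?d" for i j using mono that by blast
  show "\<bar>det M\<bar> = (\<Prod>i<?d. norm (M *v q i))" by (rule detM)
 qed
qed

section \<open>Singular values and the singular value function\<close>

definition orthonormal_family :: "(nat => real^'d) => bool" where
 "orthonormal_family (q :: nat => real^'d) \<longleftrightarrow> (\<forall>i<CARD('d). norm (q i) = 1) \<and>
   (\<forall>i<CARD('d). \<forall>j<CARD('d). i \<noteq> j --> q i \<bullet> q j = 0)"

lemma orthonormal_inner:
 fixes q :: "nat => real^'d"
 assumes "orthonormal_family q" "i < CARD('d)" "j < CARD('d)"
 shows "q i \<bullet> q j = (if i = j then 1 else 0)"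
 using assms unfolding orthonormal_family_def by (auto simp: dot_square_norm)

lemma orthonormal_expansion:
 fixes q :: "nat => real^'d"
 assumes "orthonormal_family q"
 shows "x = (\<Sum>i<CARD('d). (x \<bullet> q i) *\<^sub>R q i)"
 using orthonormal_family_expansion[of q x] assms unfolding orthonormal_family_def by blast

lemma norm_sum_orthogonal:
 fixes p :: "nat => 'a::real_inner"
 assumes "\<And>i j. i < n ==> j < n ==> i \<noteq> j ==> p i \<bullet> p j = 0"
 shows "(norm (\<Sum>i<n. c i *\<^sub>R p i))\<^sup>2 = (\<Sum>i<n. (c i)\<^sup>2*(norm (p i))\<^sup>2)"
proof -
 have "(norm (\<Sum>i<n. c i *\<^sub>R p i))\<^sup>2 = (\<Sum>i<n. \<Sum>j<n. c i*(c j*(p i \<bullet> p j)))"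
  unfolding power2_norm_eq_inner
  by (simp add: inner_sum_left inner_sum_right sum_distrib_left mult_ac inner_commute)
 also have "... = (\<Sum>i<n. \<Sum>j<n. if j = i then c i*(c i*(p i \<bullet> p i)) else 0)"
  using assms by (intro sum.cong) auto
 also have "... = (\<Sum>i<n. (c i)\<^sup>2*(norm (p i))\<^sup>2)"
  unfolding power2_norm_eq_inner by (simp add: power2_eq_square mult_ac)
 finally show ?thesis .
qed

definition svd_frame :: "real^'d^'d => (nat => real^'d) => bool" where
 "svd_frame M q \<longleftrightarrow> orthonormal_family q \<and>
   (\<forall>i<CARD('d). \<forall>j<CARD('d). i \<noteq> j --> (M *v q i) \<bullet> (M *v q j) = 0) \<and>
   (\<forall>i<CARD('d). norm (M *v q i) = sval (Suc i) M)"

lemma svd: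
 fixes M :: "real^'d^'d"
 obtains q where "svd_frame M q"
proof (rule svd_exists[of M])
 fix q :: "nat => real^'d"
 assume a: "\<And>i. i < CARD('d) ==> norm (q i) = 1"
  "\<And>i j. i < CARD('d) ==> j < CARD('d) ==> i \<noteq> j ==> q i \<bullet> q j = 0"
  "\<And>i j. i < CARD('d) ==> j < CARD('d) ==> i \<noteq> j ==> (M *v q i) \<bullet> (M *v q j) = 0"
  "\<And>i. i < CARD('d) ==> norm (M *v q i) = sval (Suc i) M"
 show thesis by (rule that[of q]) (simp add: svd_frame_def orthonormal_family_def a)
qed

lemma frame_norm:
 fixes M :: "real^'d^'d"
 assumes "svd_frame M q"
 shows "(norm x)\<^sup>2 = (\<Sum>i<CARD('d). (x \<bullet> q i)\<^sup>2)"
  "(norm (M *v x))\<^sup>2 = (\<Sum>i<CARD('d). (x \<bullet> q i)\<^sup>2*(sval (Suc i) M)\<^sup>2)"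
  "M *v x = (\<Sum>i<CARD('d). (x \<bullet> q i) *\<^sub>R (M *v q i))"
proof -
 have q: "orthonormal_family q" using assms by (simp add: svd_frame_def)
 note e = orthonormal_expansion[OF q, of x]
 have "(norm x)\<^sup>2 = (norm (\<Sum>i<CARD('d). (x \<bullet> q i) *\<^sub>R q i))\<^sup>2" using e by simp
 also have "... = (\<Sum>i<CARD('d). (x \<bullet> q i)\<^sup>2*(norm (q i))\<^sup>2)"
  by (rule norm_sum_orthogonal) (simp add: orthonormal_inner[OF q])
 also have "... = (\<Sum>i<CARD('d). (x \<bullet> q i)\<^sup>2)"
  using q by (intro sum.cong) (auto simp: orthonormal_family_def)
 finally show "(norm x)\<^sup>2 = (\<Sum>i<CARD('d). (x \<bullet> q i)\<^sup>2)" .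
 have "M *v x = M *v (\<Sum>i<CARD('d). (x \<bullet> q i) *\<^sub>R q i)" using e by simp
 also have "... = (\<Sum>i<CARD('d). (x \<bullet> q i) *\<^sub>R (M *v q i))"
  by (simp add: linear_sum[OF matrix_vector_mul_linear] matrix_vector_mult_scaleR)
 finally show Mx: "M *v x = (\<Sum>i<CARD('d). (x \<bullet> q i) *\<^sub>R (M *v q i))" .
 have "(norm (M *v x))\<^sup>2 = (\<Sum>i<CARD('d). (x \<bullet> q i)\<^sup>2*(norm (M *v q i))\<^sup>2)"
  unfolding Mx by (rule norm_sum_orthogonal) (use assms in \<open>auto simp: svd_frame_def\<close>)
 also have "... = (\<Sum>i<CARD('d). (x \<bullet> q i)\<^sup>2*(sval (Suc i) M)\<^sup>2)"
  using assms by (intro sum.cong) (auto simp: svd_frame_def)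
 finally show "(norm (M *v x))\<^sup>2 = (\<Sum>i<CARD('d). (x \<bullet> q i)\<^sup>2*(sval (Suc i) M)\<^sup>2)" .
qed

lemma sval_antimono:
 fixes M :: "real^'d^'d"
 assumes "1 <= i" "i <= j" "j <= CARD('d)"
 shows "sval j M <= sval i M"
proof (rule svd_exists[of M])
 fix q :: "nat => real^'d"
 assume "\<And>i. i < CARD('d) ==> norm (M *v q i) = sval (Suc i) M"
  "\<And>i j. i <= j ==> j < CARD('d) ==> norm (M *v q j) <= norm (M *v q i)"
 from this(1)[of "i - 1"] this(1)[of "j - 1"] this(2)[of "i - 1" "j - 1"] show ?thesis
  using assms by simp
qed

lemma abs_det_eq_prod_sval:
 fixes M :: "real^'d^'d"
 shows "\<bar>det M\<bar> = (\<Prod>j=1..CARD('d). sval j M)"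
proof (rule svd_exists[of M])
 fix q :: "nat => real^'d"
 assume 1: "\<And>i. i < CARD('d) ==> norm (M *v q i) = sval (Suc i) M"
  and 2: "\<bar>det M\<bar> = (\<Prod>i<CARD('d). norm (M *v q i))"
 have "(\<Prod>i<CARD('d). norm (M *v q i)) = (\<Prod>i<CARD('d). sval (Suc i) M)"
  using 1 by (intro prod.cong) auto
 thus ?thesis using 2 by (simp add: prod.atLeast1_atMost_eq)
qed

lemma sval_attained:
 fixes M :: "real^'d^'d"
 assumes "1 <= k" "k <= CARD('d)"
 obtains x where "norm x = 1" "norm (M *v x) = sval k M"
proof -
 obtain q where "svd_frame M q" by (rule svd)
 hence "norm (q (k - 1)) = 1" "norm (M *v q (k - 1)) = sval k M"
  using assms by (auto simp: svd_frame_def orthonormal_family_def)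
 thus thesis by (rule that)
qed

section \<open>Operator norm, positivity and continuity of singular values\<close>

lemma norm_matrix_vector_le_op_norm: "norm (M *v x) <= op_norm M*norm x"
 for M :: "real^'d^'d"
 unfolding op_norm_def by (rule onorm) (rule matrix_vector_mul_bounded_linear)

lemma op_norm_nonneg: "0 <= op_norm M"
 unfolding op_norm_def by (rule onorm_pos_le) (rule matrix_vector_mul_bounded_linear)

lemma op_norm_le: "(\<And>x. norm (M *v x) <= b*norm x) ==> op_norm M <= b"
 unfolding op_norm_def by (rule onorm_le) (simp add: mult.commute)

lemma op_norm_mult_le: "op_norm (A**B) <= op_norm A * op_norm B"
proof (rule op_norm_le)
 fix x :: "real^'a"
 have "norm ((A**B) *v x) <= op_norm A*norm (B *v x)"
  by (simp add: norm_matrix_vector_le_op_norm flip: matrix_vector_mul_assoc)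
 also have "... <= op_norm A*(op_norm B*norm x)"
  by (intro mult_left_mono norm_matrix_vector_le_op_norm op_norm_nonneg)
 finally show "norm ((A**B) *v x) <= op_norm A * op_norm B*norm x" by (simp add: mult.assoc)
qed

lemma sval_le_op_norm:
 fixes M :: "real^'d^'d"
 assumes "1 <= k" "k <= CARD('d)"
 shows "sval k M <= op_norm M"
 using sval_attained[OF assms, of M] norm_matrix_vector_le_op_norm by (metis mult.right_neutral)

lemma sval_ge:
 fixes M :: "real^'d^'d"
 assumes "1 <= k" "k <= CARD('d)" "\<And>x. b*norm x <= norm (M *v x)"
 shows "b <= sval k M"
 using sval_attained[OF assms(1,2), of M] assms(3) by (metis mult.right_neutral)

lemma sval_nonneg:
 fixes M :: "real^'d^'d"
 assumes "1 <= k" "k <= CARD('d)"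
 shows "0 <= sval k M"
 by (rule sval_ge[OF assms]) simp

lemma invertible_mult_vec_inj:
 fixes M :: "real^'d^'d"
 assumes "invertible M" "M *v x = 0" shows "x = 0"
 using assms by (metis invertible_def matrix_vector_mul_assoc matrix_vector_mul_lid matrix_vector_mult_0_right)

lemma sval_pos:
 fixes M :: "real^'d^'d"
 assumes "invertible M" "1 <= k" "k <= CARD('d)"
 shows "0 < sval k M"
proof -
 obtain x where x: "norm x = 1" "norm (M *v x) = sval k M" by (rule sval_attained[OF assms(2,3)])
 hence "x \<noteq> 0" by auto
 hence "M *v x \<noteq> 0" using invertible_mult_vec_inj[OF assms(1)] by blast
 thus ?thesis using x(2) by (metis zero_less_norm_iff)
qed

text \<open>Courant-Fischer argument: the first \<open>k - 1\<close> frame vectors of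
  \<open>M'\<close> and the last \<open>d - k\<close> of \<open>M\<close> span less than the whole
  space, so some nonzero \<open>x\<close> is orthogonal to all of them. On it \<open>M\<close>
  stretches by at least \<open>sval k M\<close> and \<open>M'\<close> by at most
  \<open>sval k M'\<close>.\<close>

lemma sval_perturb:
 fixes M M' :: "real^'d^'d"
 assumes k: "1 <= k" "k <= CARD('d)" and e: "\<And>x. norm (M *v x) <= norm (M' *v x) + e*norm x"
 shows "sval k M <= sval k M' + e"
proof -
 let ?d = "CARD('d)"
 obtain q where q: "svd_frame M q" by (rule svd)
 obtain p where p: "svd_frame M' p" by (rule svd)
 define W where "W = p ` {..<k-1} \<union> q ` {k..<?d}"
 have "dim W <= card W" by (rule dim_le_card') (simp add: W_def)
 also have "... <= card (p ` {..<k-1}) + card (q ` {k..<?d})" unfolding W_def by (rule card_Un_le)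
 also have "... <= (k - 1) + (?d - k)"
  using card_image_le[of "{..<k-1}" p] card_image_le[of "{k..<?d}" q] by simp
 also have "... < DIM(real^'d)" using k by simp
 finally obtain x where x: "x \<noteq> 0" "\<And>y. y \<in> span W ==> orthogonal x y"
  using orthogonal_to_subspace_exists by blast
 have xp: "x \<bullet> p j = 0" if "j < k - 1" for j
  using x(2)[OF span_base, of "p j"] that by (auto simp: W_def orthogonal_def)
 have xq: "x \<bullet> q j = 0" if "k <= j" "j < ?d" for j
  using x(2)[OF span_base, of "q j"] that by (auto simp: W_def orthogonal_def)
 have "(sval k M)\<^sup>2*(norm x)\<^sup>2 = (\<Sum>i<?d. (x \<bullet> q i)\<^sup>2*(sval k M)\<^sup>2)"
  by (simp add: frame_norm(1)[OF q] sum_distrib_left sum_distrib_right mult_ac)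
 also have "... <= (\<Sum>i<?d. (x \<bullet> q i)\<^sup>2*(sval (Suc i) M)\<^sup>2)"
 proof (rule sum_mono)
  fix i assume "i \<in> {..<?d}"
  thus "(x \<bullet> q i)\<^sup>2*(sval k M)\<^sup>2 <= (x \<bullet> q i)\<^sup>2*(sval (Suc i) M)\<^sup>2"
   using xq[of i] k sval_antimono[of "Suc i" k M] sval_nonneg[OF k, of M]
   by (cases "i < k") (auto intro!: mult_left_mono power_mono)
 qed
 also have "... = (norm (M *v x))\<^sup>2" by (simp add: frame_norm(2)[OF q])
 finally have "(sval k M*norm x)\<^sup>2 <= (norm (M *v x))\<^sup>2" by (simp add: power_mult_distrib)
 hence 1: "sval k M*norm x <= norm (M *v x)" by (rule power2_le_imp_le) simp
 have "(norm (M' *v x))\<^sup>2 = (\<Sum>i<?d. (x \<bullet> p i)\<^sup>2*(sval (Suc i) M')\<^sup>2)"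
  by (rule frame_norm(2)[OF p])
 also have "... <= (\<Sum>i<?d. (x \<bullet> p i)\<^sup>2*(sval k M')\<^sup>2)"
 proof (rule sum_mono)
  fix i assume "i \<in> {..<?d}"
  thus "(x \<bullet> p i)\<^sup>2*(sval (Suc i) M')\<^sup>2 <= (x \<bullet> p i)\<^sup>2*(sval k M')\<^sup>2"
   using xp[of i] k sval_antimono[of k "Suc i" M'] sval_nonneg[of "Suc i" M']
   by (cases "i < k - 1") (auto intro!: mult_left_mono power_mono)
 qed
 also have "... = (sval k M'*norm x)\<^sup>2"
  by (simp add: frame_norm(1)[OF p] sum_distrib_left sum_distrib_right mult_ac power_mult_distrib)
 finally have 2: "norm (M' *v x) <= sval k M'*norm x"
  by (rule power2_le_imp_le) (simp add: sval_nonneg[OF k])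
 have "sval k M*norm x <= (sval k M' + e)*norm x"
  using 1 2 e[of x] by (simp add: distrib_right)
 thus ?thesis using x(1) by simp
qed

lemma continuous_sval:
 assumes k: "1 <= k" "k <= CARD('d)"
 shows "continuous_on UNIV (sval k :: real^'d^'d => real)"
proof -
 define L where "L = real CARD('d)*real CARD('d)"
 have L: "op_norm N <= L*norm N" for N :: "real^'d^'d"
 proof -
  have "\<bar>N$i$j\<bar> <= norm N" for i j
   using component_le_norm_cart[of "N$i" j] Finite_Cartesian_Product.norm_nth_le[of N i] by linarith
  thus ?thesis unfolding op_norm_def L_def by (rule onorm_le_matrix_component)
 qed
 have *: "sval k A <= sval k B + L*norm (A - B)" for A B :: "real^'d^'d"
 proof (rule sval_perturb[OF k])
  fix x :: "real^'d"
  have "A *v x = B *v x + (A - B) *v x" by (simp add: matrix_vector_mult_diff_rdistrib)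
  hence "norm (A *v x) <= norm (B *v x) + norm ((A - B) *v x)" by (metis norm_triangle_ineq)
  also have "norm ((A - B) *v x) <= op_norm (A - B)*norm x" by (rule norm_matrix_vector_le_op_norm)
  also have "... <= L*norm (A - B)*norm x" by (intro mult_right_mono L) simp
  finally show "norm (A *v x) <= norm (B *v x) + L*norm (A - B)*norm x" by simp
 qed
 have "L-lipschitz_on UNIV (sval k :: real^'d^'d => real)"
 proof (rule lipschitz_onI)
  fix A B :: "real^'d^'d"
  show "dist (sval k A) (sval k B) <= L*dist A B"
   using *[of A B] *[of B A] by (simp add: dist_real_def dist_norm norm_minus_commute abs_le_iff)
 qed (simp add: L_def)
 thus ?thesis by (rule lipschitz_on_continuous_on)
qed

text \<open>The exponent of the \<open>j\<close>-th singular value in \<open>svf t\<close>: it is 1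
  up to the integer part of \<open>t\<close>, the fractional part at the next index and 0 beyond.
  With it \<open>svf t\<close> is one product, without a case distinction at integers.\<close>

definition svexp :: "real => nat => real" where
 "svexp t j = min 1 (max 0 (t - (real j - 1)))"

lemma svexp_nonneg: "0 <= svexp t j" and svexp_le_1: "svexp t j <= 1"
 by (auto simp: svexp_def)

lemma svexp_mono: "t <= t' ==> svexp t j <= svexp t' j"
 by (auto simp: svexp_def)

lemma sum_svexp:
 assumes "0 <= t" "t <= real n"
 shows "(\<Sum>j=1..n. svexp t j) = t"
proof -
 have "(\<Sum>j=1..n. svexp t j) = min t (real n)" if "0 <= t" for n
  using that by (induction n) (auto simp: svexp_def min_def max_def)
 thus ?thesis using assms by simp
qed

lemma svf_eq_prod:
 fixes M :: "real^'d^'d"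
 assumes M: "invertible M" and t: "0 <= t" "t <= real CARD('d)"
 shows "svf t M = (\<Prod>j=1..CARD('d). sval j M powr svexp t j)"
proof -
 let ?d = "CARD('d)"
 define k where "k = nat \<lfloor>t\<rfloor>"
 have k: "real k = of_int \<lfloor>t\<rfloor>" using t by (simp add: k_def)
 have kt: "real k <= t" "t < real k + 1" using k by linarith+
 have kd: "k <= ?d" using kt t by linarith
 have "(\<Prod>j=1..?d. sval j M powr svexp t j) =
   (\<Prod>j=1..k. sval j M powr svexp t j)*(\<Prod>j=k+1..?d. sval j M powr svexp t j)"
  using prod.ub_add_nat[of 1 k "\<lambda>j. sval j M powr svexp t j" "?d - k"] kd by simp
 also have "(\<Prod>j=1..k. sval j M powr svexp t j) = (\<Prod>j=1..k. sval j M)"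
  using kt kd sval_pos[OF M] by (intro prod.cong) (auto simp: svexp_def powr_one less_imp_le)
 also have "(\<Prod>j=k+1..?d. sval j M powr svexp t j) = sval (nat \<lceil>t\<rceil>) M powr (t - of_int \<lfloor>t\<rfloor>)"
 proof (cases "t = real k")
  case True
  \<comment> \<open>Positivity matters because \<open>0 powr 0\<close> is \<open>0\<close>. For
    \<open>k = 0\<close> the index 0 stands for the first singular value by truncated
    subtraction.\<close>
  have "0 < sval (nat \<lceil>t\<rceil>) M"
  proof (cases "k = 0")
   case True
   thus ?thesis using sval_pos[OF M, of 1] \<open>t = real k\<close> by (simp add: sval_def Suc_leI)
  next
   case False
   thus ?thesis using sval_pos[OF M, of k] kd \<open>t = real k\<close> by simp
  qed
  moreover have "(\<Prod>j=k+1..?d. sval j M powr svexp t j) = (\<Prod>j=k+1..?d. 1)"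
  proof (rule prod.cong)
   fix j assume "j \<in> {k+1..?d}"
   thus "sval j M powr svexp t j = 1" using True sval_pos[OF M, of j] by (simp add: svexp_def)
  qed simp
  moreover have "(\<Prod>j=k+1..?d. 1) = (1::real)" by simp
  moreover have "t - of_int \<lfloor>t\<rfloor> = 0" using True by simp
  ultimately show ?thesis by (metis powr_zero_eq_one less_irrefl)
 next
  case False
  hence "k + 1 <= ?d" using kt t by linarith
  have "\<lceil>t\<rceil> = int (k + 1)" using kt False by (intro ceiling_unique) auto
  hence c: "nat \<lceil>t\<rceil> = k + 1" by simp
  have "(\<Prod>j=k+1..?d. sval j M powr svexp t j) =
    sval (k + 1) M powr svexp t (k + 1)*(\<Prod>j=k+2..?d. sval j M powr svexp t j)"
   using \<open>k + 1 \<le> ?d\<close> prod.atLeast_Suc_atMost[of "k+1" ?d "\<lambda>j. sval j M powr svexp t j"] by simp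
  also have "(\<Prod>j=k+2..?d. sval j M powr svexp t j) = (\<Prod>j=k+2..?d. 1)"
  proof (rule prod.cong)
   fix j assume "j \<in> {k+2..?d}"
   thus "sval j M powr svexp t j = 1" using kt sval_pos[OF M, of j] by (auto simp: svexp_def)
  qed simp
  also have "svexp t (k + 1) = t - real k" using kt by (simp add: svexp_def)
  finally show ?thesis by (simp add: c k)
 qed
 finally show ?thesis using t by (simp add: svf_def k_def)
qed

lemma svf_pos:
 fixes M :: "real^'d^'d"
 assumes "invertible M" "0 <= t" "t <= real CARD('d)"
 shows "0 < svf t M"
 unfolding svf_eq_prod[OF assms] using sval_pos[OF assms(1)]
 by (intro prod_pos) (auto simp: powr_gt_zero less_imp_neq[symmetric])

lemma svf_0: "invertible M ==> svf 0 M = 1" for M :: "real^'d^'d"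
proof -
 assume M: "invertible M"
 have "sval j M powr svexp 0 j = 1" if "j \<in> {1..CARD('d)}" for j
  using sval_pos[OF M, of j] that by (simp add: svexp_def)
 thus ?thesis using M by (simp add: svf_eq_prod prod.neutral)
qed

text \<open>From \<open>s\<close> to \<open>t\<close> the exponents grow by \<open>t - s\<close> in
  total, and each extra factor is a power of a number at most \<open>b\<close>.\<close>

lemma svf_le_svf:
 fixes M :: "real^'d^'d"
 assumes M: "invertible M" and t: "0 <= s" "s <= t" "t <= real CARD('d)"
  and b: "\<And>j. 1 <= j ==> j <= CARD('d) ==> sval j M <= b"
 shows "svf t M <= svf s M*b powr (t - s)"
proof -
 let ?d = "CARD('d)"
 have st: "0 <= t" "s <= real ?d" using t by linarith+
 have "0 < sval 1 M" by (rule sval_pos[OF M]) (simp_all add: Suc_leI)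
 moreover have "sval 1 M <= b" by (rule b) (simp_all add: Suc_leI)
 ultimately have b0: "0 < b" by simp
 have "svf t M = (\<Prod>j=1..?d. sval j M powr svexp s j * sval j M powr (svexp t j - svexp s j))"
  unfolding svf_eq_prod[OF M st(1) t(3)] by (simp flip: powr_add)
 also have "... <= (\<Prod>j=1..?d. sval j M powr svexp s j*b powr (svexp t j - svexp s j))"
 proof (intro prod_mono conjI mult_left_mono powr_mono2)
  fix j assume "j \<in> {1..?d}"
  thus "0 <= svexp t j - svexp s j" "0 <= sval j M" "sval j M <= b"
   using svexp_mono[OF t(2)] sval_nonneg b by auto
 qed auto
 also have "... = svf s M*b powr (\<Sum>j=1..?d. svexp t j - svexp s j)"
  using b0 by (simp add: prod.distrib svf_eq_prod[OF M t(1) st(2)] powr_sum)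
 also have "(\<Sum>j=1..?d. svexp t j - svexp s j) = t - s"
  using t st by (simp add: sum_subtractf sum_svexp[unfolded One_nat_def])
 finally show ?thesis .
qed

lemma svf_ge_svf:
 fixes M :: "real^'d^'d"
 assumes M: "invertible M" and t: "0 <= s" "s <= t" "t <= real CARD('d)" and b0: "0 < b"
  and b: "\<And>j. 1 <= j ==> j <= CARD('d) ==> b <= sval j M"
 shows "svf s M*b powr (t - s) <= svf t M"
proof -
 let ?d = "CARD('d)"
 have st: "0 <= t" "s <= real ?d" using t by linarith+
 have "svf s M*b powr (t - s) = svf s M*b powr (\<Sum>j=1..?d. svexp t j - svexp s j)"
  using t st by (simp add: sum_subtractf sum_svexp[unfolded One_nat_def])
 also have "... = (\<Prod>j=1..?d. sval j M powr svexp s j*b powr (svexp t j - svexp s j))"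
  using b0 by (simp add: prod.distrib svf_eq_prod[OF M t(1) st(2)] powr_sum)
 also have "... <= (\<Prod>j=1..?d. sval j M powr svexp s j * sval j M powr (svexp t j - svexp s j))"
 proof (intro prod_mono conjI mult_left_mono powr_mono2)
  fix j assume "j \<in> {1..?d}"
  thus "0 <= svexp t j - svexp s j" "b <= sval j M"
   using svexp_mono[OF t(2)] b by auto
 qed (use b0 in auto)
 also have "... = svf t M"
  unfolding svf_eq_prod[OF M st(1) t(3)] by (simp flip: powr_add)
 finally show ?thesis .
qed

lemma svf_d: "invertible M ==> svf (real CARD('d)) M = \<bar>det M\<bar>" for M :: "real^'d^'d"
proof -
 assume M: "invertible M"
 have "svf (real CARD('d)) M = (\<Prod>j=1..CARD('d). sval j M)"
  unfolding svf_eq_prod[OF M of_nat_0_le_iff order_refl] using sval_nonneg[of _ M]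
  by (intro prod.cong) (auto simp: svexp_def)
 thus ?thesis by (simp add: abs_det_eq_prod_sval)
qed

text \<open>Up to constants, the number of balls of radius \<open>1 / l\<close> needed to cover the
  image of the unit ball: only axes longer than the radius count.\<close>

definition svcap :: "real => real^'d^'d => real" where
 "svcap l (M :: real^'d^'d) = (\<Prod>j=1..CARD('d). max 1 (l * sval j M))"

lemma svcap_ge_1: "1 <= svcap l M"
 unfolding svcap_def by (rule prod_ge_1) simp

text \<open>The exponents \<open>svexp t j\<close> sum to \<open>t\<close>, so the power of
  \<open>l\<close> can be distributed over the factors, and a power with exponent in [0, 1] of a
  positive number is at most its maximum with 1.\<close>

lemma svf_le_svcap:
 fixes M :: "real^'d^'d"
 assumes M: "invertible M" and t: "0 <= t" "t <= real CARD('d)" and l: "0 < l"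
 shows "l powr t * svf t M <= svcap l M"
proof -
 have "l powr t * svf t M = l powr (\<Sum>j=1..CARD('d). svexp t j) * svf t M" using t by (simp add: sum_svexp[unfolded One_nat_def])
 also have "... = (\<Prod>j=1..CARD('d). l powr svexp t j * sval j M powr svexp t j)"
  using l by (simp add: powr_sum prod.distrib svf_eq_prod[OF M t])
 also have "... <= svcap l M" unfolding svcap_def
 proof (intro prod_mono conjI)
  fix j assume "j \<in> {1..CARD('d)}"
  hence s: "0 < l * sval j M" using sval_pos[OF M] l by simp
  have "l powr svexp t j * sval j M powr svexp t j = (l * sval j M) powr svexp t j"
   using s l by (subst powr_mult) (auto simp: zero_less_mult_iff)
  also have "... <= max 1 (l * sval j M) powr svexp t j"
   using s by (intro powr_mono2) (auto simp: svexp_nonneg)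
  also have "... <= max 1 (l * sval j M) powr 1"
   by (intro powr_mono svexp_le_1) auto
  finally show "l powr svexp t j * sval j M powr svexp t j <= max 1 (l * sval j M)"
   by (simp add: powr_one)
 qed auto
 finally show ?thesis .
qed

text \<open>The optimal \<open>l\<close> is the reciprocal of the singular value that carries the
  fractional exponent. Earlier factors have exponent 1 and are at least 1 after scaling, later ones
  have exponent 0 and are at most 1.\<close>

lemma svf_eq_svcap:
 fixes M :: "real^'d^'d"
 assumes M: "invertible M" and t: "0 <= t" "t <= real CARD('d)"
 obtains l where "0 < l" "l powr t * svf t M = svcap l M"
proof -
 \<comment> \<open>The maximum with 1 only matters for \<open>t = 0\<close>, where every exponent
   vanishes and the largest singular value gives the scale.\<close>
 define m where "m = max 1 (nat \<lceil>t\<rceil>)"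
 have m: "1 <= m" "m <= CARD('d)" using t by (auto simp: m_def Suc_leI ceiling_le_iff nat_le_iff)
 define l where "l = 1/sval m M"
 have sm: "0 < sval m M" using sval_pos[OF M m] .
 have l: "0 < l" using sm by (simp add: l_def)
 have "l powr t * svf t M = l powr (\<Sum>j=1..CARD('d). svexp t j) * svf t M" using t by (simp add: sum_svexp[unfolded One_nat_def])
 also have "... = (\<Prod>j=1..CARD('d). l powr svexp t j * sval j M powr svexp t j)"
  using l by (simp add: powr_sum prod.distrib svf_eq_prod[OF M t])
 also have "... = svcap l M" unfolding svcap_def
 proof (intro prod.cong refl)
  fix j assume j: "j \<in> {1..CARD('d)}"
  hence s: "0 < l * sval j M" "0 < sval j M" using sval_pos[OF M] l by simp_all
  have e: "l powr svexp t j * sval j M powr svexp t j = (l * sval j M) powr svexp t j"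
   using s l by (subst powr_mult) (auto simp: zero_less_mult_iff)
  consider "j < m" | "j = m" | "m < j" by linarith
  thus "l powr svexp t j * sval j M powr svexp t j = max 1 (l * sval j M)"
  proof cases
   case 1
   hence "int j < \<lceil>t\<rceil>" using j by (auto simp: m_def)
   hence "real j < t" by (metis less_ceiling_iff of_int_of_nat_eq)
   hence "svexp t j = 1" by (simp add: svexp_def)
   moreover have "sval m M <= sval j M" using 1 j m by (intro sval_antimono) auto
   hence "1 <= l * sval j M" using sm by (simp add: l_def field_simps)
   ultimately show ?thesis unfolding e using s by simp
  next
   case 2
   hence "l * sval j M = 1" using sm by (simp add: l_def)
   thus ?thesis unfolding e by simp
  next
   case 3
   hence "\<lceil>t\<rceil> <= int j - 1" "1 < j" using m by (auto simp: m_def)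
   hence "t <= of_int (int j - 1)" by (simp only: ceiling_le_iff)
   hence "t <= real j - 1" by simp
   hence "svexp t j = 0" by (simp add: svexp_def)
   moreover have "sval j M <= sval m M" using 3 j m by (intro sval_antimono) auto
   hence "l * sval j M <= 1" using sm by (simp add: l_def field_simps)
   ultimately show ?thesis unfolding e using s l by simp
  qed
 qed
 finally show thesis using l that by blast
qed

section \<open>Covering numbers and volumes of ellipsoids\<close>

text \<open>The interval reaches one further down because the floor of a number in
  \<open>[- x, x]\<close> can be as small as \<open>- \<lfloor>x\<rfloor> - 1\<close>.\<close>

lemma card_signed_interval:
 fixes x :: real
 assumes "0 <= x"
 shows "real (card {- \<lfloor>x\<rfloor> - 1..\<lfloor>x\<rfloor>}) <= 2*x + 2"
proof -
 have "card {- \<lfloor>x\<rfloor> - 1..\<lfloor>x\<rfloor>} = nat (2*\<lfloor>x\<rfloor> + 2)" by simp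
 moreover have "0 <= \<lfloor>x\<rfloor>" using assms by simp
 ultimately have "real (card {- \<lfloor>x\<rfloor> - 1..\<lfloor>x\<rfloor>}) = 2 * of_int \<lfloor>x\<rfloor> + 2" by simp
 thus ?thesis using of_int_floor_le[of x] by linarith
qed

text \<open>A grid of mesh \<open>r / d\<close> in the coordinates of the frame: the d coordinate
  errors, each at most \<open>r / d\<close>, add up to \<open>r\<close>.\<close>

lemma box_covering:
 fixes q :: "nat => real^'d" and \<rho> :: "nat => real"
 assumes q: "orthonormal_family q" and r: "0 < r" and \<rho>: "\<And>i. i < CARD('d) ==> 0 <= \<rho> i"
 obtains F where "finite F" "real (card F) <= (\<Prod>i<CARD('d). 2*\<rho> i*CARD('d)/r + 2)"
  "{z. \<forall>i<CARD('d). \<bar>z \<bullet> q i\<bar> <= \<rho> i} \<subseteq> (\<Union>c\<in>F. cball c r)"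
proof -
 let ?d = "CARD('d)"
 define x where "x i = \<rho> i*?d/r" for i
 have x0: "0 <= x i" if "i < ?d" for i using \<rho>[OF that] r by (simp add: x_def)
 define P where "P = (\<Pi>\<^sub>E i\<in>{..<?d}. {- \<lfloor>x i\<rfloor> - 1..\<lfloor>x i\<rfloor>})"
 define g where "g m = (\<Sum>i<?d. (of_int (m i)*(r/?d)) *\<^sub>R q i)" for m
 have fin: "finite P" unfolding P_def by (intro finite_PiE) auto
 have "real (card (g ` P)) <= real (card P)" using fin by (simp add: card_image_le)
 also have "... = (\<Prod>i<?d. real (card {- \<lfloor>x i\<rfloor> - 1..\<lfloor>x i\<rfloor>}))" by (simp add: P_def card_PiE)
 also have "... <= (\<Prod>i<?d. 2*x i + 2)"
  by (intro prod_mono conjI card_signed_interval x0) auto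
 finally have card: "real (card (g ` P)) <= (\<Prod>i<?d. 2*\<rho> i*?d/r + 2)" by (simp add: x_def mult.assoc)
 have "z \<in> (\<Union>c\<in>g ` P. cball c r)" if z: "\<forall>i<?d. \<bar>z \<bullet> q i\<bar> <= \<rho> i" for z
 proof -
  define m where "m = (\<lambda>i\<in>{..<?d}. \<lfloor>(z \<bullet> q i)*?d/r\<rfloor>)"
  have "m \<in> P" unfolding P_def
  proof (rule PiE_I)
   fix i assume i: "i \<in> {..<?d}"
   have "\<bar>(z \<bullet> q i)*?d/r\<bar> <= x i"
    using z i r by (auto simp: x_def abs_mult intro!: divide_right_mono mult_right_mono)
   hence "- x i <= (z \<bullet> q i)*?d/r" "(z \<bullet> q i)*?d/r <= x i" by linarith+
   hence "\<lfloor>- x i\<rfloor> <= m i" "m i <= \<lfloor>x i\<rfloor>" using i by (auto simp: m_def intro: floor_mono)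
   thus "m i \<in> {- \<lfloor>x i\<rfloor> - 1..\<lfloor>x i\<rfloor>}" by (simp add: floor_minus) linarith
  qed (simp add: m_def)
  moreover have "norm (g m - z) <= r"
  proof -
   have "g m - z = (\<Sum>i<?d. (of_int (m i)*(r/?d) - z \<bullet> q i) *\<^sub>R q i)"
    by (subst orthonormal_expansion[OF q, of z]) (simp add: g_def sum_subtractf scaleR_left_diff_distrib)
   also have "norm ... <= (\<Sum>i<?d. r/?d)"
   proof (rule sum_norm_le)
    fix i assume i: "i \<in> {..<?d}"
    have "\<bar>of_int (m i) - (z \<bullet> q i)*?d/r\<bar> <= 1" using i by (simp add: m_def) linarith
    hence "\<bar>of_int (m i) - (z \<bullet> q i)*?d/r\<bar>*(r/?d) <= 1*(r/?d)"
     using r by (intro mult_right_mono) auto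
    also have "\<bar>of_int (m i) - (z \<bullet> q i)*?d/r\<bar>*(r/?d) = \<bar>(of_int (m i) - (z \<bullet> q i)*?d/r)*(r/?d)\<bar>"
     using r by (simp add: abs_mult)
    also have "(of_int (m i) - (z \<bullet> q i)*?d/r)*(r/?d) = of_int (m i)*(r/?d) - z \<bullet> q i"
     using r by (simp add: field_simps)
    finally show "norm ((of_int (m i)*(r/?d) - z \<bullet> q i) *\<^sub>R q i) <= r/?d"
     using q i by (simp add: orthonormal_family_def)
   qed
   finally show ?thesis by simp
  qed
  ultimately show ?thesis by (auto simp: dist_norm)
 qed
 thus thesis using that[of "g ` P"] fin card by blast
qed

text \<open>The normalised images of the right singular vectors are orthonormal, and the ellipsoid
  lies in the box along them whose half sides are \<open>R\<close> times the singular
  values.\<close>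

lemma ellipsoid_covering:
 fixes M :: "real^'d^'d" and R :: real
 assumes M: "invertible M" and r: "0 < r" and R: "0 <= R"
 obtains F where "finite F" "real (card F) <= (2 * R*CARD('d) + 2)^CARD('d) * svcap (1/r) M"
  "(*v) M ` cball 0 R \<subseteq> (\<Union>c\<in>F. cball c r)"
proof -
 let ?d = "CARD('d)"
 obtain q where q: "svd_frame M q" by (rule svd)
 define a where "a i = sval (Suc i) M" for i
 have a: "0 < a i" if "i < ?d" for i using sval_pos[OF M, of "Suc i"] that by (simp add: a_def)
 define p where "p i = (M *v q i) /\<^sub>R a i" for i
 have "orthonormal_family p"
  using q a by (auto simp: orthonormal_family_def p_def svd_frame_def abs_of_pos simp flip: a_def)
   (metis less_irrefl right_inverse mult.commute)
 then obtain F where F: "finite F" "real (card F) <= (\<Prod>i<?d. 2*(R*a i)*?d/r + 2)"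
  "{z. \<forall>i<?d. \<bar>z \<bullet> p i\<bar> <= R*a i} \<subseteq> (\<Union>c\<in>F. cball c r)"
  by (rule box_covering[OF _ r, of p "\<lambda>i. R*a i"]) (use R a in \<open>auto simp: less_imp_le\<close>)
 have "(\<Prod>i<?d. 2*(R*a i)*?d/r + 2) <= (\<Prod>i<?d. (2 * R*?d + 2)*max 1 (1/r*a i))"
 proof (intro prod_mono conjI)
  fix i assume "i \<in> {..<?d}"
  hence "0 < a i" by (simp add: a)
  thus "0 <= 2*(R*a i)*?d/r + 2" using R r by simp
  have "2*(R*a i)*?d/r + 2 = (2 * R*?d)*(1/r*a i) + 2*1" by (simp add: field_simps)
  also have "... <= (2 * R*?d)*max 1 (1/r*a i) + 2*max 1 (1/r*a i)"
   using R by (intro add_mono mult_left_mono) auto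
  finally show "2*(R*a i)*?d/r + 2 <= (2 * R*?d + 2)*max 1 (1/r*a i)"
   by (simp add: distrib_right)
 qed
 also have "... = (2 * R*?d + 2) ^ ?d * svcap (1/r) M"
  by (simp add: prod.distrib svcap_def a_def prod.atLeast1_atMost_eq)
 finally have card: "real (card F) <= (2 * R*?d + 2) ^ ?d * svcap (1/r) M" using F(2) by linarith
 have "(*v) M ` cball 0 R \<subseteq> {z. \<forall>i<?d. \<bar>z \<bullet> p i\<bar> <= R*a i}"
 proof clarify
  fix x :: "real^'d" and j assume x: "x \<in> cball 0 R" and j: "j < ?d"
  have "(M *v x) \<bullet> p j = (\<Sum>i<?d. (x \<bullet> q i)*((M *v q i) \<bullet> p j))"
   by (simp add: frame_norm(3)[OF q, of x] inner_sum_left)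
  also have "... = (\<Sum>i<?d. if i = j then (x \<bullet> q i)*a j else 0)"
  proof (rule sum.cong)
   fix i assume i: "i \<in> {..<?d}"
   show "(x \<bullet> q i)*((M *v q i) \<bullet> p j) = (if i = j then (x \<bullet> q i)*a j else 0)"
   proof (cases "i = j")
    case True
    have "(M *v q j) \<bullet> (M *v q j) = (a j)\<^sup>2"
     using q j by (simp add: svd_frame_def a_def dot_square_norm)
    thus ?thesis using True a[OF j] by (simp add: p_def power2_eq_square)
   qed (use q i j in \<open>auto simp: p_def svd_frame_def\<close>)
  qed simp
  also have "... = (x \<bullet> q j)*a j" using j by simp
  finally have "\<bar>(M *v x) \<bullet> p j\<bar> = \<bar>x \<bullet> q j\<bar>*a j" using a[OF j] by (simp add: abs_mult)
  moreover have "\<bar>x \<bullet> q j\<bar> <= norm x*norm (q j)" by (rule Cauchy_Schwarz_ineq2)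
  moreover have "norm (q j) = 1" using q j by (simp add: svd_frame_def orthonormal_family_def)
  ultimately show "\<bar>(M *v x) \<bullet> p j\<bar> <= R*a j"
   using x a[OF j] by (auto intro!: mult_right_mono)
 qed
 thus thesis using that F(1,3) card by blast
qed

text \<open>The set lies in a box with half sides \<open>\<rho> i\<close>. Covering this box by
  balls whose radius is its shortest half side loses only a constant factor of volume, so no volume
  formula for boxes in a rotated frame is needed.\<close>

lemma ellipsoid_volume:
 fixes M :: "real^'d^'d" and R :: real
 assumes M: "invertible M" and r: "0 < r" and R: "1 <= R"
 shows "emeasure lborel {z. norm z <= R \<and> norm (M *v z) <= r} <=
  ennreal (unit_ball_vol (CARD('d))*(4*real CARD('d) * R)^CARD('d)/svcap (1/r) M)"
proof -
 let ?d = "CARD('d)"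
 obtain q where q: "svd_frame M q" by (rule svd)
 define a where "a i = sval (Suc i) M" for i
 have a: "0 < a i" if "i < ?d" for i using sval_pos[OF M, of "Suc i"] that by (simp add: a_def)
 define \<rho> where "\<rho> i = min R (r/a i)" for i
 have \<rho>: "0 < \<rho> i" if "i < ?d" for i using R r a[OF that] by (simp add: \<rho>_def)
 define \<delta> where "\<delta> = Min (\<rho> ` {..<?d})"
 have \<delta>_in: "\<delta> \<in> \<rho> ` {..<?d}" unfolding \<delta>_def by (rule Min_in) (auto simp: lessThan_empty_iff)
 hence \<delta>0: "0 < \<delta>" using \<rho> by auto
 have \<delta>_le: "\<delta> <= \<rho> i" if "i < ?d" for i unfolding \<delta>_def using that by (intro Min_le) auto
 define S where "S = {z. norm z <= R \<and> norm (M *v z) <= r}"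
 have "orthonormal_family q" using q by (simp add: svd_frame_def)
 then obtain F where F: "finite F" "real (card F) <= (\<Prod>i<?d. 2*\<rho> i*?d / \<delta> + 2)"
  "{z. \<forall>i<?d. \<bar>z \<bullet> q i\<bar> <= \<rho> i} \<subseteq> (\<Union>c\<in>F. cball c \<delta>)"
  by (rule box_covering[OF _ \<delta>0, of q \<rho>]) (use \<rho> in \<open>auto simp: less_imp_le\<close>)
 have "\<bar>z \<bullet> q i\<bar> <= \<rho> i" if z: "z \<in> S" and i: "i < ?d" for z i
 proof -
  have "(z \<bullet> q i)\<^sup>2 <= (norm z)\<^sup>2" unfolding frame_norm(1)[OF q, of z]
   using i by (intro member_le_sum) auto
  hence 1: "\<bar>z \<bullet> q i\<bar> <= norm z" by (simp add: abs_le_square_iff[symmetric])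
  have "(z \<bullet> q i)\<^sup>2*(a i)\<^sup>2 <= (norm (M *v z))\<^sup>2" unfolding frame_norm(2)[OF q, of z] a_def
   using i by (intro member_le_sum[where f = "\<lambda>i. (z \<bullet> q i)\<^sup>2*(sval (Suc i) M)\<^sup>2"]) auto
  hence "((z \<bullet> q i)*a i)\<^sup>2 <= (norm (M *v z))\<^sup>2" by (simp add: power_mult_distrib)
  hence "\<bar>z \<bullet> q i\<bar>*a i <= norm (M *v z)" using a[OF i] by (simp add: abs_le_square_iff[symmetric] abs_mult)
  hence "\<bar>z \<bullet> q i\<bar>*a i <= r" using z by (simp add: S_def)
  thus ?thesis using 1 z a[OF i] by (simp add: S_def \<rho>_def field_simps)
 qed
 hence S: "S \<subseteq> (\<Union>c\<in>F. cball c \<delta>)" using F(3) by blast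
 have "emeasure lborel S <= emeasure lborel (\<Union>c\<in>F. cball c \<delta>)" by (rule emeasure_mono[OF S]) (use F(1) in auto)
 also have "... <= (\<Sum>c\<in>F. emeasure lborel (cball c \<delta>))" by (rule emeasure_subadditive_finite) (use F(1) in auto)
 also have "... = ennreal (card F*(unit_ball_vol ?d*\<delta> ^ ?d))"
  using \<delta>0 by (simp add: emeasure_cball ennreal_mult'' ennreal_of_nat_eq_real_of_nat)
 also have "... <= ennreal ((\<Prod>i<?d. 4*real ?d * R/max 1 (1/r*a i))*unit_ball_vol ?d)"
 proof (rule ennreal_leI)
  have "real (card F)*\<delta> ^ ?d <= (\<Prod>i<?d. 2*\<rho> i*?d / \<delta> + 2)*\<delta> ^ ?d"
   using F(2) \<delta>0 by (intro mult_right_mono) auto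
  also have "... = (\<Prod>i<?d. (2*\<rho> i*?d / \<delta> + 2)*\<delta>)" by (simp add: prod.distrib)
  also have "... <= (\<Prod>i<?d. 4*real ?d * R/max 1 (1/r*a i))"
  proof (intro prod_mono conjI)
   fix i assume "i \<in> {..<?d}"
   hence i: "i < ?d" by simp
   show "0 <= (2*\<rho> i*?d / \<delta> + 2)*\<delta>" using \<rho>[OF i] \<delta>0 by simp
   have "\<rho> i <= real ?d*\<rho> i" using \<rho>[OF i] by (simp add: Suc_leI)
   moreover have "(2*\<rho> i*?d / \<delta> + 2)*\<delta> = 2*(?d*\<rho> i) + 2*\<delta>" using \<delta>0 by (simp add: field_simps)
   ultimately have 1: "(2*\<rho> i*?d / \<delta> + 2)*\<delta> <= 4*real ?d*\<rho> i" using \<delta>_le[OF i] by linarith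
   have 2: "\<rho> i <= R/max 1 (1/r*a i)"
   proof (cases "1 <= 1/r*a i")
    case True
    have "1*(r/a i) <= R*(r/a i)" using R r a[OF i] by (intro mult_right_mono) auto
    thus ?thesis using True r a[OF i] by (simp add: \<rho>_def max_def min_le_iff_disj)
   qed (simp add: \<rho>_def max_def)
   have "4*real ?d*\<rho> i <= 4*real ?d*(R/max 1 (1/r*a i))" by (rule mult_left_mono[OF 2]) simp
   with 1 show "(2*\<rho> i*?d / \<delta> + 2)*\<delta> <= 4*real ?d * R/max 1 (1/r*a i)"
    by (simp only: times_divide_eq_right)
  qed
  finally show "real (card F)*(unit_ball_vol ?d*\<delta> ^ ?d) <= (\<Prod>i<?d. 4*real ?d * R/max 1 (1/r*a i))*unit_ball_vol ?d"
   by (simp add: mult_ac mult_left_mono)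
 qed
 also have "(\<Prod>i<?d. 4*real ?d * R/max 1 (1/r*a i)) = (4*real ?d * R) ^ ?d/svcap (1/r) M"
  by (simp add: prod_dividef svcap_def a_def prod.atLeast1_atMost_eq)
 finally show ?thesis unfolding S_def by (simp add: mult_ac)
qed

section \<open>Submultiplicativity of the singular value function\<close>

lemma svcap_half:
 fixes M :: "real^'d^'d"
 assumes "0 <= l"
 shows "svcap l M <= 2^CARD('d) * svcap (l/2) M"
proof -
 have "svcap l M <= (\<Prod>j=1..CARD('d). 2*max 1 (l/2 * sval j M))"
  unfolding svcap_def using assms by (intro prod_mono) auto
 thus ?thesis by (simp add: prod.distrib svcap_def)
qed

text \<open>The constant of \<open>svcap_mult\<close>: \<open>16 * n\<close> combines the 2 of
  \<open>svcap_half\<close> with the 8 of \<open>ellipsoid_volume\<close> for radius 2, and the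
  other factor comes from two coverings of unit ball images.\<close>

definition svf_const :: "nat => real" where
 "svf_const n = (16*real n)^n*(2*real n + 2)^(2*n)"

lemma svf_const_ge_1: "1 <= n ==> 1 <= svf_const n"
 unfolding svf_const_def
 using mult_mono[of 1 "(16*real n)^n" 1 "(2*real n + 2)^(2*n)"] one_le_power[of "16*real n" n]
  one_le_power[of "2*real n + 2" "2*n"] by simp

lemma emeasure_lborel_translate:
 fixes S :: "'a::euclidean_space set"
 assumes "S \<in> sets borel"
 shows "emeasure lborel {z. z - c \<in> S} = emeasure lborel S"
proof -
 have "emeasure lborel S = emeasure (distr lborel borel ((+) (- c))) S" by (simp add: lborel_distr_plus)
 also have "... = emeasure lborel ((+) (- c) -` S \<inter> space lborel)"
  by (rule emeasure_distr) (use assms in auto)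
 also have "(+) (- c) -` S \<inter> space lborel = {z. z - c \<in> S}" by auto
 finally show ?thesis ..
qed

text \<open>Composing a covering for \<open>B\<close> at scale \<open>1 / m\<close> with one for
  \<open>A\<close> at scale \<open>1 / l\<close> covers the image of the unit ball under
  \<open>A ** B\<close> by balls of radius \<open>1 / (l * m)\<close>. The preimages of these balls
  fill the unit ball, while each has volume of order at most \<open>1 / svcap (l*m) (A**B)\<close>;
  so there must be many of them.\<close>

lemma svcap_mult:
 fixes A B :: "real^'d^'d"
 assumes inv: "invertible A" "invertible B" and l: "0 < l" and m: "0 < m"
 shows "svcap (l*m) (A**B) <= svf_const (CARD('d)) * svcap l A * svcap m B"
proof -
 let ?d = "CARD('d)"
 define r where "r = 1/(l*m)"
 have r: "0 < r" using l m by (simp add: r_def)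
 have AB: "invertible (A**B)" using inv by (simp add: invertible_mult)
 have l1: "0 < 1/l" and m1: "0 < 1/m" using l m by simp_all
 obtain F1 where F1: "finite F1" "real (card F1) <= (2*1*real ?d + 2) ^ ?d * svcap (1/(1/m)) B"
  "(*v) B ` cball 0 1 \<subseteq> (\<Union>c\<in>F1. cball c (1/m))"
  by (rule ellipsoid_covering[OF inv(2) m1 zero_le_one]) (rule that)
 obtain F2 where F2: "finite F2" "real (card F2) <= (2*1*real ?d + 2) ^ ?d * svcap (1/(1/l)) A"
  "(*v) A ` cball 0 1 \<subseteq> (\<Union>c\<in>F2. cball c (1/l))"
  by (rule ellipsoid_covering[OF inv(1) l1 zero_le_one]) (rule that)
 have pw: "x^(2*?d) = x ^ ?d*x ^ ?d" for x :: real by (simp add: mult_2 power_add)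
 define G where "G = (\<lambda>(c, c'). A *v c + (1/m) *\<^sub>R c') ` (F1 \<times> F2)"
 have G: "finite G" using F1 F2 by (simp add: G_def)
 have "card G <= card F1 * card F2"
  unfolding G_def using F1(1) F2(1) by (metis card_image_le card_cartesian_product finite_cartesian_product)
 hence "real (card G) <= real (card F1)*real (card F2)" by (metis of_nat_le_iff of_nat_mult)
 also have "... <= ((2*real ?d + 2) ^ ?d * svcap m B)*((2*real ?d + 2) ^ ?d * svcap l A)"
  using F1(2) F2(2) svcap_ge_1[of m B] by (intro mult_mono) auto
 finally have cardG: "real (card G) <= (2*real ?d + 2)^(2*?d) * svcap l A * svcap m B"
  by (simp only: pw) (simp only: mult_ac)
 define S where "S c = {z. norm z <= 1 \<and> norm (A**B *v z - c) <= r}" for c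
 have cover: "cball 0 1 \<subseteq> (\<Union>c\<in>G. S c)"
 proof
  fix z :: "real^'d" assume z: "z \<in> cball 0 1"
  then obtain c where c: "c \<in> F1" "norm (B *v z - c) <= 1/m"
   using F1(3) by (force simp: dist_norm norm_minus_commute)
  hence "norm (m *\<^sub>R (B *v z - c)) <= 1" unfolding norm_scaleR using m by (simp add: field_simps)
  then obtain c' where c': "c' \<in> F2" "norm (A *v (m *\<^sub>R (B *v z - c)) - c') <= 1/l"
   using F2(3) by (force simp: dist_norm norm_minus_commute)
  have eq: "A**B *v z - (A *v c + (1/m) *\<^sub>R c') = (1/m) *\<^sub>R (A *v (m *\<^sub>R (B *v z - c)) - c')"
   using m by (simp add: matrix_vector_mult_scaleR matrix_vector_mult_diff_distrib scaleR_diff_right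
     flip: matrix_vector_mul_assoc)
  hence "norm (A**B *v z - (A *v c + (1/m) *\<^sub>R c')) <= r"
   unfolding eq norm_scaleR using c'(2) m l by (simp add: r_def field_simps)
  thus "z \<in> (\<Union>c\<in>G. S c)" using z c(1) c'(1) by (auto simp: S_def G_def)
 qed
 have closedS: "closed (S c)" for c
  unfolding S_def by (intro closed_Collect_conj closed_Collect_le continuous_intros)
 \<comment> \<open>Differences of two points of one piece lie in the centred set of twice the size,
   hence the radius 2 and the scale \<open>2 * r\<close>.\<close>
 define V where "V = unit_ball_vol ?d*(4*real ?d*2) ^ ?d/svcap (1/(2*r)) (A**B)"
 have V0: "0 <= V" using svcap_ge_1[of "1/(2*r)" "A**B"] by (simp add: V_def)
 have SV: "emeasure lborel (S c) <= ennreal V" for c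
 proof (cases "S c = {}")
  case False
  then obtain z0 where z0: "z0 \<in> S c" by auto
  let ?T = "{z. norm z <= 2 \<and> norm (A**B *v z) <= 2*r}"
  have T: "?T \<in> sets borel"
   by (intro borel_closed closed_Collect_conj closed_Collect_le continuous_intros)
  have "S c \<subseteq> {z. z - z0 \<in> ?T}"
  proof
   fix z assume z: "z \<in> S c"
   have "norm (z - z0) <= norm z + norm z0" by (rule norm_triangle_ineq4)
   moreover have "norm (A**B *v (z - z0)) <= norm (A**B *v z - c) + norm (A**B *v z0 - c)"
    using norm_triangle_ineq4[of "A**B *v z - c" "A**B *v z0 - c"] by (simp add: matrix_vector_mult_diff_distrib)
   ultimately show "z \<in> {z. z - z0 \<in> ?T}"
    using z z0 by (auto simp: S_def)
  qed
  moreover have "{z. z - z0 \<in> ?T} \<in> sets lborel"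
  proof -
   have "(\<lambda>z. z - z0) -` ?T \<inter> space lborel \<in> sets lborel"
    by (rule measurable_sets[OF _ T]) measurable
   thus ?thesis by (simp add: vimage_def)
  qed
  ultimately have "emeasure lborel (S c) <= emeasure lborel {z. z - z0 \<in> ?T}" by (rule emeasure_mono)
  also have "... = emeasure lborel ?T"
   by (rule emeasure_lborel_translate[OF T])
  also have "... <= ennreal V" unfolding V_def
   by (rule ellipsoid_volume[OF AB]) (use r in auto)
  finally show ?thesis .
 qed simp
 have "ennreal (unit_ball_vol ?d) = emeasure lborel (cball (0::real^'d) 1)" by (simp add: emeasure_cball)
 also have "... <= emeasure lborel (\<Union>c\<in>G. S c)" by (rule emeasure_mono[OF cover]) (use G closedS in auto)
 also have "... <= (\<Sum>c\<in>G. emeasure lborel (S c))" by (rule emeasure_subadditive_finite) (use G closedS in auto)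
 also have "... <= (\<Sum>c\<in>G. ennreal V)" by (intro sum_mono SV)
 also have "... = ennreal (card G*V)"
  by (simp add: ennreal_mult' ennreal_of_nat_eq_real_of_nat)
 finally have "unit_ball_vol ?d <= card G*V"
  using V0 by simp
 hence "unit_ball_vol ?d*1 <= unit_ball_vol ?d*(card G*(8*real ?d) ^ ?d/svcap (1/(2*r)) (A**B))"
  by (simp add: V_def mult_ac)
 hence "1 <= card G*(8*real ?d) ^ ?d/svcap (1/(2*r)) (A**B)"
  by (subst (asm) mult_le_cancel_left_pos) auto
 hence "svcap (1/(2*r)) (A**B) <= card G*(8*real ?d) ^ ?d"
  using svcap_ge_1[of "1/(2*r)" "A**B"] by (simp add: field_simps)
 moreover have "svcap (l*m) (A**B) <= 2 ^ ?d * svcap (1/(2*r)) (A**B)"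
  using svcap_half[of "l*m" "A**B"] l m by (simp add: r_def)
 ultimately have "svcap (l*m) (A**B) <= 2 ^ ?d*(card G*(8*real ?d) ^ ?d)"
  by (meson mult_left_mono order_trans zero_le_numeral zero_le_power)
 also have "... = (16*real ?d) ^ ?d * card G" by (simp add: power_mult_distrib flip: power_mult_distrib[of 2 8])
 also have "... <= (16*real ?d) ^ ?d*((2*real ?d + 2)^(2*?d) * svcap l A * svcap m B)"
  using cardG by (intro mult_left_mono) auto
 finally show ?thesis by (simp add: svf_const_def mult_ac)
qed

text \<open>Take for \<open>A\<close> and for \<open>B\<close> the scales at which
  \<open>svf\<close> and \<open>svcap\<close> agree; at the product of these scales
  \<open>svf\<close> of the product is still bounded by \<open>svcap\<close>.\<close>

theorem svf_mult:
 fixes A B :: "real^'d^'d"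
 assumes inv: "invertible A" "invertible B" and t: "0 <= t" "t <= real CARD('d)"
 shows "svf t (A**B) <= svf_const (CARD('d)) * svf t A * svf t B"
proof -
 obtain l where l: "0 < l" "l powr t * svf t A = svcap l A" by (rule svf_eq_svcap[OF inv(1) t])
 obtain m where m: "0 < m" "m powr t * svf t B = svcap m B" by (rule svf_eq_svcap[OF inv(2) t])
 have "(l*m) powr t * svf t (A**B) <= svcap (l*m) (A**B)"
  using inv t l m by (intro svf_le_svcap) (auto simp: invertible_mult)
 also have "... <= svf_const (CARD('d)) * svcap l A * svcap m B" by (rule svcap_mult[OF inv l(1) m(1)])
 also have "... = (l*m) powr t*(svf_const (CARD('d)) * svf t A * svf t B)"
  using l m by (simp add: powr_mult mult_ac flip: l(2) m(2))
 finally show ?thesis using l(1) m(1) by (subst (asm) mult_le_cancel_left_pos) auto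
qed

section \<open>Ergodic theorems\<close>

locale ergodic_system = prob_space M for M :: "'a measure" +
 fixes T :: "'a => 'a"
 assumes T_measurable [measurable]: "T \<in> measurable M M"
  and T_invariant: "distr M M T = M"
  and T_ergodic: "\<And>B. B \<in> sets M ==> T -` B \<inter> space M = B ==> prob B = 0 \<or> prob B = 1"
begin

lemma funpow_T_measurable [measurable]: "T ^^ k \<in> measurable M M"
proof (induction k)
 case (Suc k)
 show ?case unfolding funpow.simps by (rule measurable_comp[OF Suc T_measurable])
qed (unfold funpow.simps, rule measurable_ident)

lemma funpow_T_space: "x \<in> space M ==> (T ^^ k) x \<in> space M"
 by (rule measurable_space[OF funpow_T_measurable])

lemma distr_funpow_T: "distr M M (T ^^ k) = M"
proof (induction k)
 case 0
 thus ?case by (simp add: id_def)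
next
 case (Suc k)
 have eq: "distr M M (T ^^ Suc k) = distr (distr M M (T ^^ k)) M T"
  by (subst distr_distr) simp_all
 show ?case unfolding eq Suc T_invariant ..
qed

lemma sum_orbit_split:
 fixes g :: "'a => real"
 shows "(\<Sum>k<m+n. g ((T ^^ k) x)) = (\<Sum>k<m. g ((T ^^ k) x)) + (\<Sum>k<n. g ((T ^^ k) ((T ^^ m) x)))"
proof (induction n)
 case (Suc n)
 have "(T ^^ (m + n)) x = (T ^^ n) ((T ^^ m) x)" by (simp add: funpow_add add.commute[of m])
 thus ?case using Suc by simp
qed simp

lemma integral_funpow_T:
 fixes g :: "'a => real"
 assumes [measurable]: "g \<in> borel_measurable M"
 shows "(\<integral>x. g ((T ^^ k) x) \<partial>M) = (\<integral>x. g x \<partial>M)"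
proof -
 have "(\<integral>x. g x \<partial>M) = (\<integral>x. g x \<partial>(distr M M (T ^^ k)))" by (simp add: distr_funpow_T)
 also have "... = (\<integral>x. g ((T ^^ k) x) \<partial>M)" by (rule integral_distr) simp_all
 finally show ?thesis ..
qed

lemma bounded_integrable:
 fixes g :: "'a => real"
 assumes "g \<in> borel_measurable M" "\<And>x. x \<in> space M ==> \<bar>g x\<bar> <= K"
 shows "integrable M g"
 by (rule integrable_const_bound[of _ K]) (use assms in auto)

text \<open>The preimages of \<open>{x. c < g x}\<close> increase but keep their measure, so their
  union is invariant with that same measure, which must be 0 or 1. With \<open>c\<close> the mean,
  measure 1 is impossible and measure 0 leaves only \<open>g = c\<close>.\<close>

lemma subinvariant_const:
 fixes g :: "'a => real"
 assumes g [measurable]: "g \<in> borel_measurable M" and K: "\<And>x. x \<in> space M ==> \<bar>g x\<bar> <= K"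
  and inv: "\<And>x. x \<in> space M ==> g x <= g (T x)"
 shows "AE x in M. g x = expectation g"
proof -
 define c where "c = expectation g"
 have int: "integrable M g" by (rule bounded_integrable[OF g K])
 have int0: "(\<integral>x. g x - c \<partial>M) = 0" "(\<integral>x. c - g x \<partial>M) = 0" using int by (simp_all add: c_def prob_space)
 define B where "B = {x \<in> space M. c < g x}"
 define A where "A k = (T ^^ k) -` B \<inter> space M" for k
 have B [measurable]: "B \<in> sets M" unfolding B_def by measurable
 have A [measurable]: "A k \<in> sets M" for k unfolding A_def by measurable
 have "incseq A"
  unfolding A_def B_def by (rule incseq_SucI) (use inv funpow_T_space in \<open>fastforce intro: less_le_trans\<close>)
 moreover have "prob (A k) = prob B" for k
  using measure_distr[OF funpow_T_measurable B, of k] by (simp add: distr_funpow_T A_def)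
 ultimately have "prob (\<Union>k. A k) = prob B"
  using finite_Lim_measure_incseq[of A, OF image_subsetI[OF A]] by (simp add: LIMSEQ_const_iff)
 moreover have "T -` (\<Union>k. A k) \<inter> space M = (\<Union>k. A k)"
 proof -
  have "T -` A k \<inter> space M = A (Suc k)" for k
   using measurable_space[OF T_measurable] by (auto simp: A_def funpow_swap1)
  hence "T -` (\<Union>k. A k) \<inter> space M = (\<Union>k. A (Suc k))" by auto
  also have "... = (\<Union>k. A k)" using \<open>incseq A\<close> by (auto dest: incseq_SucD)
  finally show ?thesis .
 qed
 ultimately have "prob B = 0 \<or> prob B = 1" using T_ergodic[of "\<Union>k. A k"] by auto
 hence "AE x in M. g x <= c"
 proof
  assume "prob B = 0"
  hence "AE x in M. x \<notin> B" using B prob_eq_0 by blast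
  thus ?thesis using AE_space by eventually_elim (auto simp: B_def)
 next
  assume "prob B = 1"
  hence lt: "AE x in M. c < g x" using prob_eq_1[OF B] by (auto simp: B_def)
  hence "AE x in M. g x - c = 0"
   using integral_nonneg_eq_0_iff_AE[of M "\<lambda>x. g x - c"] int int0 by (simp add: eventually_mono)
  with lt have "AE x in M. False" by eventually_elim simp
  thus ?thesis by simp
 qed
 hence "AE x in M. c - g x = 0"
  using integral_nonneg_eq_0_iff_AE[of M "\<lambda>x. c - g x"] int int0 by simp
 thus ?thesis unfolding c_def[symmetric] by eventually_elim simp
qed

text \<open>The tiling argument of Katznelson and Weiss: along an orbit, either a block of length at most
 \<open>N\<close> with average at most \<open>c\<close> starts here, or one symbol is skipped.\<close>

lemma tiling_bound:
 fixes f :: "nat => 'a => real"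
 assumes sub: "\<And>m n x. x \<in> space M ==> f (m + n) x <= f m x + f n ((T ^^ m) x)"
  and K: "\<And>n x. x \<in> space M ==> f n x <= K*real n" and D: "\<And>n. n <= N ==> K*real n <= c*real n + D"
  and b: "\<And>x. x \<in> space M ==> c <= b x"
  and tile: "\<And>x. x \<in> space M ==> K <= b x \<or> (\<exists>n\<in>{1..N}. f n x <= c*real n)"
  and x: "x \<in> space M"
 shows "f n x <= (\<Sum>k<n. b ((T ^^ k) x)) + D"
 using x
proof (induction n arbitrary: x rule: less_induct)
 case (less n)
 note x = less.prems
 have low: "c*real m <= (\<Sum>k<m. b ((T ^^ k) x))" for m
  using sum_bounded_below[of "{..<m}" c "\<lambda>k. b ((T ^^ k) x)"] b funpow_T_space[OF x] by (simp add: mult.commute)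
 show ?case
 proof (cases "n <= N")
  case True
  thus ?thesis using K[OF x, of n] D[of n] low[of n] by linarith
 next
  case False
  have "\<exists>m\<in>{1..n}. f m x <= (\<Sum>k<m. b ((T ^^ k) x))"
   using tile[OF x]
  proof
   assume "K <= b x"
   thus ?thesis using K[OF x, of 1] False by (intro bexI[of _ 1]) auto
  next
   assume "\<exists>m\<in>{1..N}. f m x <= c*real m"
   then obtain m where "m \<in> {1..N}" "f m x <= c*real m" by blast
   thus ?thesis using low[of m] False by (intro bexI[of _ m]) auto
  qed
  then obtain m where m: "1 <= m" "m <= n" "f m x <= (\<Sum>k<m. b ((T ^^ k) x))" by auto
  hence "f (n - m) ((T ^^ m) x) <= (\<Sum>k<n-m. b ((T ^^ k) ((T ^^ m) x))) + D"
   by (intro less.IH funpow_T_space x) auto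
  thus ?thesis using sub[OF x, of m "n - m"] sum_orbit_split[of b x m "n - m"] m by simp
 qed
qed

text \<open>The lower limit of the averages grows along orbits, hence is a constant
  \<open>c\<close>. Except on a small set, a point starts a block of length at most \<open>N\<close>
  with average at most \<open>c + e/2\<close>, and the tiling bound then dominates every
  \<open>f n\<close> by Birkhoff sums of one bounded function of mean at most \<open>c + e\<close>.
  Both ergodic theorems below are read off from this.\<close>

lemma subadditive_dominated:
 fixes f :: "nat => 'a => real"
 assumes f [measurable]: "\<And>n. f n \<in> borel_measurable M"
  and sub: "\<And>m n x. x \<in> space M ==> f (m + n) x <= f m x + f n ((T ^^ m) x)"
  and K: "\<And>n x. x \<in> space M ==> \<bar>f n x\<bar> <= K*real n"
 shows "\<exists>c. (AE x in M. \<forall>e>0. \<forall>\<^sub>F n in sequentially. c - e < f n x/n) \<and>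
  (\<forall>e>0. \<exists>b D. b \<in> borel_measurable M \<and> (\<forall>x\<in>space M. \<bar>b x\<bar> <= D) \<and> expectation b <= c + e \<and>
   (\<forall>x\<in>space M. \<forall>n. f n x <= (\<Sum>k<n. b ((T ^^ k) x)) + D))"
proof -
 obtain x0 where "x0 \<in> space M" using not_empty by auto
 from K[OF this, of 1] have K0: "0 <= K" by auto
 define L where "L x = liminf (\<lambda>n. ereal (f n x/n))" for x
 define g where "g x = real_of_ereal (L x)" for x
 have g_meas [measurable]: "g \<in> borel_measurable M" unfolding g_def L_def by measurable
 have g: "L x = ereal (g x)" "\<bar>g x\<bar> <= K" if x: "x \<in> space M" for x
 proof -
  have n: "- K <= f n x/n" "f n x/n <= K" if "0 < n" for n using K[OF x, of n] that by (auto simp: field_simps)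
  have "ereal (- K) <= L x" unfolding L_def
   by (rule Liminf_bounded) (use n in \<open>auto intro: eventually_sequentiallyI[of 1]\<close>)
  moreover have "L x <= limsup (\<lambda>n. ereal (f n x/n))" unfolding L_def by (rule Liminf_le_Limsup) simp
  moreover have "... <= ereal K"
   by (rule Limsup_bounded) (use n in \<open>auto intro: eventually_sequentiallyI[of 1]\<close>)
  ultimately have L: "ereal (- K) <= L x" "L x <= ereal K" by auto
  thus "L x = ereal (g x)" by (cases "L x") (auto simp: g_def)
  with L show "\<bar>g x\<bar> <= K" by auto
 qed
 have "g x <= g (T x)" if x: "x \<in> space M" for x
 proof -
  have Tx: "T x \<in> space M" using funpow_T_space[OF x, of 1] by simp
  have lim: "(\<lambda>n. ereal (- (2*K)/real n)) \<longlonglongrightarrow> ereal 0" by (intro tendsto_ereal lim_const_over_n)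
  have "L x = liminf (\<lambda>n. ereal (f (n + 1) x/real (n + 1)))"
   unfolding L_def by (rule liminf_shift[symmetric])
  also have "... = liminf (\<lambda>n. ereal (- (2*K)/real n) + ereal (f (n + 1) x/real (n + 1)))"
   by (subst ereal_liminf_lim_add[OF lim]) (simp_all flip: zero_ereal_def)
  also have "... <= L (T x)" unfolding L_def
  proof (rule Liminf_mono, use eventually_gt_at_top[of 0] in eventually_elim)
   case (elim n)
   have "f (n + 1) x <= K + f n (T x)" using sub[OF x, of 1 n] K[OF x, of 1] by simp
   moreover have "real n*(f (n + 1) x/real (n + 1)) = f (n + 1) x - f (n + 1) x/real (n + 1)" by (simp add: field_simps)
   moreover have "- K <= f (n + 1) x/real (n + 1)" using K[OF x, of "n + 1"] by (simp add: field_simps)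
   ultimately have "real n*(f (n + 1) x/real (n + 1)) <= f n (T x) + 2*K" by linarith
   hence "f (n + 1) x/real (n + 1) <= (f n (T x) + 2*K)/n" using elim by (simp add: pos_le_divide_eq mult.commute)
   thus ?case by (simp add: add_divide_distrib)
  qed
  finally show ?thesis using g(1)[OF x] g(1)[OF Tx] by simp
 qed
 hence "AE x in M. g x = expectation g" by (intro subinvariant_const[where K = K] g(2)) auto
 then obtain c where gc: "AE x in M. g x = c" by blast
 hence "AE x in M. \<bar>c\<bar> <= K" using AE_space by eventually_elim (use g(2) in blast)
 hence cK: "\<bar>c\<bar> <= K" by simp
 from gc AE_space have Lc: "AE x in M. L x = ereal c" by eventually_elim (use g(1) in simp)
 have "\<exists>b D. b \<in> borel_measurable M \<and> (\<forall>x\<in>space M. \<bar>b x\<bar> <= D) \<and> expectation b <= c + e \<and>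
   (\<forall>x\<in>space M. \<forall>n. f n x <= (\<Sum>k<n. b ((T ^^ k) x)) + D)" if e: "0 < e" for e
 proof -
  define A where "A N = {x \<in> space M. \<exists>n\<in>{1..N}. f n x <= (c + e/2)*real n}" for N
  have A [measurable]: "A N \<in> sets M" for N unfolding A_def by measurable
  have "AE x in M. x \<in> (\<Union>N. A N)"
   using Lc AE_space
  proof eventually_elim
   case (elim x)
   show ?case
   proof (rule ccontr)
    assume "x \<notin> (\<Union>N. A N)"
    hence "(c + e/2)*real n < f n x" if "0 < n" for n using elim(2) that by (fastforce simp: A_def not_le)
    hence "ereal (c + e/2) <= L x" unfolding L_def
     by (intro Liminf_bounded eventually_sequentiallyI[of 1]) (auto simp: pos_le_divide_eq less_imp_le)
    thus False using elim(1) e by simp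
   qed
  qed
  hence "prob (\<Union>N. A N) = 1" by (subst prob_eq_1) auto
  moreover have "incseq A" by (auto simp: incseq_def A_def)
  ultimately have "(\<lambda>N. prob (A N)) \<longlonglongrightarrow> 1"
   using finite_Lim_measure_incseq[of A, OF image_subsetI[OF A]] by simp
  hence "(\<lambda>N. 2*K*(1 - prob (A N))) \<longlonglongrightarrow> 2*K*(1 - 1)" by (intro tendsto_intros)
  hence "\<forall>\<^sub>F N in sequentially. 2*K*(1 - prob (A N)) < e/2" by (rule order_tendstoD) (use e in simp)
  then obtain N where N: "2*K*(1 - prob (A N)) < e/2" by (auto simp: eventually_sequentially)
  \<comment> \<open>Off \<open>A N\<close> the crude bound \<open>K\<close> for one symbol has to be
    paid; as \<open>c\<close> is at least \<open>- K\<close>, adding \<open>2 * K\<close>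
    suffices.\<close>
  define b where "b x = c + e/2 + 2*K*(1 - indicator (A N) x)" for x
  have "integrable M (indicator (A N) :: 'a => real)" by (rule bounded_integrable[of _ 1]) (simp, simp add: indicator_def)
  hence "expectation b = c + e/2 + 2*K*(1 - prob (A N))" by (simp add: b_def[abs_def] prob_space)
  moreover have "f n x <= (\<Sum>k<n. b ((T ^^ k) x)) + 2*K*real N" if "x \<in> space M" for n x
  proof (rule tiling_bound[where K = K and c = "c + e/2" and N = N])
   show "K*real n <= (c + e/2)*real n + 2*K*real N" if "n <= N" for n
   proof -
    have "(K - c)*real n <= 2*K*real N" using that cK by (intro mult_mono) auto
    moreover have "0 <= e/2*real n" using e by simp
    ultimately show ?thesis by (simp only: left_diff_distrib distrib_right)
   qed
   show "K <= b x \<or> (\<exists>n\<in>{1..N}. f n x <= (c + e/2)*real n)" if "x \<in> space M" for x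
    using that cK e by (cases "x \<in> A N") (auto simp: b_def A_def)
  qed (use sub K that K0 in \<open>auto simp: b_def abs_le_iff indicator_def\<close>)
  moreover have "b \<in> borel_measurable M" unfolding b_def by measurable
  moreover have "\<bar>b x\<bar> <= 2*K*real N + (3*K + e)" for x
  proof -
   have "\<bar>b x\<bar> <= 3*K + e" using cK e K0 by (auto simp: b_def indicator_def)
   thus ?thesis using K0 by (intro add_increasing[of "2*K*real N"]) auto
  qed
  moreover have "u + 2*K*real N <= u + (2*K*real N + (3*K + e))" for u using K0 e by simp
  ultimately show ?thesis using N
   by (intro exI[of _ b] exI[of _ "2*K*real N + (3*K + e)"] conjI ballI allI) (assumption, blast, linarith, meson order_trans)
 qed
 moreover have "AE x in M. \<forall>e>0. \<forall>\<^sub>F n in sequentially. c - e < f n x/n"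
  using Lc
 proof eventually_elim
  case (elim x)
  have "\<forall>\<^sub>F n in sequentially. ereal (c - e) < ereal (f n x/n)" if "0 < e" for e
   using elim that unfolding L_def by (intro less_LiminfD) simp
  thus ?case by simp
 qed
 ultimately show ?thesis by blast
qed

text \<open>Orbit sums of \<open>h\<close> and of \<open>- h\<close> are both subadditive, so two
  lower bounds give the limit. That the constant is at least the mean follows by integrating the
  domination and dividing by \<open>n\<close>.\<close>

lemma birkhoff_sum_tendsto:
 fixes h :: "'a => real"
 assumes h: "h \<in> borel_measurable M" and K: "\<And>x. x \<in> space M ==> \<bar>h x\<bar> <= K"
 shows "AE x in M. (\<lambda>n. (\<Sum>k<n. h ((T ^^ k) x))/n) \<longlonglongrightarrow> expectation h"
proof -
 have low: "AE x in M. \<forall>e>0. \<forall>\<^sub>F n in sequentially. expectation h - e < (\<Sum>k<n. h ((T ^^ k) x))/n"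
  if h [measurable]: "h \<in> borel_measurable M" and K: "\<And>x. x \<in> space M ==> \<bar>h x\<bar> <= K" for h :: "'a => real"
 proof -
  let ?f = "\<lambda>n x. \<Sum>k<n. h ((T ^^ k) x)"
  have "\<bar>?f n x\<bar> <= K*real n" if "x \<in> space M" for n x
   using order_trans[OF sum_abs sum_bounded_above[of "{..<n}" "\<lambda>k. \<bar>h ((T ^^ k) x)\<bar>" K]] K funpow_T_space[OF that]
   by (simp add: mult.commute)
  then obtain c where c: "AE x in M. \<forall>e>0. \<forall>\<^sub>F n in sequentially. c - e < ?f n x/n"
   and dom: "\<And>e. 0 < e ==> \<exists>b D. b \<in> borel_measurable M \<and> (\<forall>x\<in>space M. \<bar>b x\<bar> <= D) \<and> expectation b <= c + e \<and>
    (\<forall>x\<in>space M. \<forall>n. ?f n x <= (\<Sum>k<n. b ((T ^^ k) x)) + D)"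
   using subadditive_dominated[of ?f K] by (auto simp: sum_orbit_split)
  have E: "integrable M (\<lambda>x. \<Sum>k<n. h ((T ^^ k) x))" "expectation (\<lambda>x. \<Sum>k<n. h ((T ^^ k) x)) = real n*expectation h"
   if "h \<in> borel_measurable M" "\<And>x. x \<in> space M ==> \<bar>h x\<bar> <= K" for n :: nat and K and h :: "'a => real"
  proof -
   have "integrable M (\<lambda>x. h ((T ^^ k) x))" for k
    using that funpow_T_space by (intro bounded_integrable[of _ K]) auto
   thus "integrable M (\<lambda>x. \<Sum>k<n. h ((T ^^ k) x))" "expectation (\<lambda>x. \<Sum>k<n. h ((T ^^ k) x)) = real n*expectation h"
    using that(1) by (simp_all add: integral_funpow_T integral_sum)
  qed
  have "expectation h <= c"
  proof (rule field_le_epsilon)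
   fix e :: real assume "0 < e"
   then obtain b D where b: "b \<in> borel_measurable M" "\<And>x. x \<in> space M ==> \<bar>b x\<bar> <= D" "expectation b <= c + e"
    "\<And>x n. x \<in> space M ==> ?f n x <= (\<Sum>k<n. b ((T ^^ k) x)) + D" using dom by blast
   have Eh: "integrable M (?f n)" "expectation (?f n) = real n*expectation h" for n :: nat
    by (rule E[of h K]; use h K in auto)+
   have Eb: "integrable M (\<lambda>x. \<Sum>k<n. b ((T ^^ k) x))" "expectation (\<lambda>x. \<Sum>k<n. b ((T ^^ k) x)) = real n*expectation b" for n :: nat
    by (rule E[of b D]; use b in auto)+
   have "real n*expectation h <= real n*expectation b + D" for n
   proof -
    have "expectation (?f n) <= expectation (\<lambda>x. (\<Sum>k<n. b ((T ^^ k) x)) + D)"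
     by (intro integral_mono Bochner_Integration.integrable_add Eh Eb b(4)) auto
    thus ?thesis using Eh Eb by (simp add: prob_space)
   qed
   hence "real n*(expectation h - expectation b) <= D" for n by (simp add: algebra_simps)
   hence "expectation h <= expectation b" by (meson diff_gt_0_iff_gt not_less reals_Archimedean3)
   thus "expectation h <= c + e" using b(3) by linarith
  qed
  with c show ?thesis by (auto elim!: eventually_mono)
 qed
 have "AE x in M. \<forall>e>0. \<forall>\<^sub>F n in sequentially. expectation (\<lambda>x. - h x) - e < (\<Sum>k<n. - h ((T ^^ k) x))/n"
  by (rule low) (use h K in auto)
 moreover have "AE x in M. \<forall>e>0. \<forall>\<^sub>F n in sequentially. expectation h - e < (\<Sum>k<n. h ((T ^^ k) x))/n"
  by (rule low) (use h K in auto)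
 ultimately show ?thesis
 proof eventually_elim
  case (elim x)
  show ?case
  proof (rule order_tendstoI)
   fix a assume "a < expectation h"
   thus "\<forall>\<^sub>F n in sequentially. a < (\<Sum>k<n. h ((T ^^ k) x))/n"
    using elim(2)[rule_format, of "expectation h - a"] by simp
  next
   fix a assume "expectation h < a"
   thus "\<forall>\<^sub>F n in sequentially. (\<Sum>k<n. h ((T ^^ k) x))/n < a"
    using elim(1)[rule_format, of "a - expectation h"] by (simp add: sum_negf)
  qed
 qed
qed

text \<open>Adding \<open>C\<close> to all terms of positive index, and setting the term of index 0
  to 0, restores exact subadditivity. The upper bound is Birkhoff's theorem for the dominating
  function; the means converge by dominated convergence. The constant \<open>C\<close> is there
  because \<open>svf\<close> is submultiplicative only up to \<open>svf_const\<close>.\<close>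

theorem kingman:
 fixes f :: "nat => 'a => real"
 assumes f [measurable]: "\<And>n. f n \<in> borel_measurable M"
  and sub: "\<And>m n x. x \<in> space M ==> m > 0 ==> n > 0 ==> f (m + n) x <= f m x + f n ((T ^^ m) x) + C"
  and K: "\<And>n x. x \<in> space M ==> \<bar>f n x\<bar> <= K*real n"
 shows "\<exists>c. (AE x in M. (\<lambda>n. f n x/n) \<longlonglongrightarrow> c) \<and> (\<lambda>n. expectation (f n)/n) \<longlonglongrightarrow> c"
proof -
 define g where "g n x = (if n = 0 then 0 else f n x + C)" for n x
 have "\<bar>g n x\<bar> <= (K + \<bar>C\<bar>)*real n" if "x \<in> space M" for n x
 proof (cases "n = 0")
  case False
  hence "\<bar>C\<bar>*1 <= \<bar>C\<bar>*real n" by (intro mult_left_mono) auto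
  thus ?thesis using K[OF that, of n] False by (simp add: g_def distrib_right)
 qed (simp add: g_def)
 moreover have "g n \<in> borel_measurable M" for n unfolding g_def by measurable
 moreover have "g (m + n) x <= g m x + g n ((T ^^ m) x)" if "x \<in> space M" for m n x
  using sub[OF that, of m n] by (auto simp: g_def)
 ultimately obtain c where c: "AE x in M. \<forall>e>0. \<forall>\<^sub>F n in sequentially. c - e < g n x/n"
  and dom: "\<And>e. 0 < e ==> \<exists>b D. b \<in> borel_measurable M \<and> (\<forall>x\<in>space M. \<bar>b x\<bar> <= D) \<and> expectation b <= c + e \<and>
   (\<forall>x\<in>space M. \<forall>n. g n x <= (\<Sum>k<n. b ((T ^^ k) x)) + D)"
  using subadditive_dominated[of g "K + \<bar>C\<bar>"] by blast
 have up: "AE x in M. \<forall>\<^sub>F n in sequentially. g n x/n < c + e" if e: "0 < e" for e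
 proof -
  have "0 < e/2" using e by simp
  then obtain b D where b: "b \<in> borel_measurable M" "\<And>x. x \<in> space M ==> \<bar>b x\<bar> <= D" "expectation b <= c + e/2"
   "\<And>x n. x \<in> space M ==> g n x <= (\<Sum>k<n. b ((T ^^ k) x)) + D" using dom by blast
  have "AE x in M. (\<lambda>n. (\<Sum>k<n. b ((T ^^ k) x))/n) \<longlonglongrightarrow> expectation b"
   by (rule birkhoff_sum_tendsto) (use b in auto)
  from this AE_space show ?thesis
  proof eventually_elim
   case (elim x)
   have "(\<lambda>n. (\<Sum>k<n. b ((T ^^ k) x))/n + D/n) \<longlonglongrightarrow> expectation b + 0"
    by (intro tendsto_add elim(1) lim_const_over_n)
   hence "\<forall>\<^sub>F n in sequentially. (\<Sum>k<n. b ((T ^^ k) x))/n + D/n < c + e" by (rule order_tendstoD) (use b(3) e in simp)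
   thus ?case
   proof eventually_elim
    case (elim n)
    have "g n x/n <= ((\<Sum>k<n. b ((T ^^ k) x)) + D)/n" using b(4)[OF \<open>x \<in> space M\<close>] by (intro divide_right_mono) auto
    thus ?case using elim by (simp add: add_divide_distrib)
   qed
  qed
 qed
 have "AE x in M. \<forall>j. \<forall>\<^sub>F n in sequentially. g n x/n < c + inverse (Suc j)"
  by (subst AE_all_countable) (intro allI up, simp)
 with c have AE: "AE x in M. (\<lambda>n. f n x/n) \<longlonglongrightarrow> c"
 proof eventually_elim
  case (elim x)
  have "(\<lambda>n. g n x/n) \<longlonglongrightarrow> c"
  proof (rule order_tendstoI)
   fix a assume "a < c"
   thus "\<forall>\<^sub>F n in sequentially. a < g n x/n" using elim(1)[rule_format, of "c - a"] by simp
  next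
   fix a assume "c < a"
   then obtain j where "inverse (Suc j) < a - c" using reals_Archimedean[of "a - c"] by auto
   with elim(2) show "\<forall>\<^sub>F n in sequentially. g n x/n < a" by (auto elim!: eventually_mono dest!: spec[of _ j])
  qed
  hence "(\<lambda>n. g n x/n - C/n) \<longlonglongrightarrow> c - 0" by (intro tendsto_diff lim_const_over_n)
  moreover have "\<forall>\<^sub>F n in sequentially. g n x/n - C/n = f n x/n"
   using eventually_gt_at_top[of 0] by eventually_elim (simp add: g_def add_divide_distrib)
  ultimately show ?case using tendsto_cong by force
 qed
 have "\<bar>f n x/n\<bar> <= \<bar>K\<bar>" if "x \<in> space M" for n x
  using order_trans[OF K[OF that, of n] mult_right_mono[OF abs_ge_self]] by (cases "n = 0") (auto simp: field_simps)
 hence "(\<lambda>n. expectation (\<lambda>x. f n x/n)) \<longlonglongrightarrow> expectation (\<lambda>_. c)"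
  by (intro integral_dominated_convergence[where w = "\<lambda>_. \<bar>K\<bar>"] AE AE_I2) auto
 with AE show ?thesis by (auto simp: prob_space)
qed

end

section \<open>Words, cylinders and entropy\<close>

abbreviation streamM :: "'n stream measure" where
 "streamM \<equiv> stream_space (count_space UNIV)"

lemma space_streamM [simp]: "space streamM = UNIV"
 by (simp add: space_stream_space)

lemma finite_words [simp]: "finite (words n :: 'n::finite list set)"
 using finite_lists_length_eq[of "UNIV :: 'n set" n] by (simp add: words_def)

lemma words_0 [simp]: "words 0 = {[]}"
 by (auto simp: words_def)

lemma card_words: "card (words n :: 'n::finite list set) = CARD('n)^n"
 using card_lists_length_eq[of "UNIV :: 'n set" n] by (simp add: words_def)

lemma stake_in_words [simp]: "stake n \<xi> \<in> words n"
 by (simp add: words_def)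

lemma words_add: "words (m + n) = (\<lambda>(u, v). u @ v) ` (words m \<times> words n)"
proof (intro equalityI subsetI)
 fix w :: "'a list" assume "w \<in> words (m + n)"
 hence "w = take m w @ drop m w" "take m w \<in> words m" "drop m w \<in> words n" by (auto simp: words_def)
 thus "w \<in> (\<lambda>(u, v). u @ v) ` (words m \<times> words n)" by (metis (no_types, lifting) SigmaI case_prod_conv image_eqI)
qed (auto simp: words_def)

lemma sum_words_add:
 fixes F :: "'a list => 'b::comm_monoid_add"
 shows "(\<Sum>w\<in>words (m + n). F w) = (\<Sum>u\<in>words m. \<Sum>v\<in>words n. F (u @ v))"
proof -
 have "inj_on (\<lambda>(u, v). u @ v) (words m \<times> words n :: ('a list \<times> 'a list) set)"
  by (auto simp: inj_on_def words_def)
 thus ?thesis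
  unfolding words_add by (subst sum.reindex) (simp_all add: sum.cartesian_product case_prod_unfold)
qed

lemma sum_words_split:
 fixes f g :: "'n list => 'b::comm_semiring_0"
 assumes "m <= n"
 shows "(\<Sum>w\<in>words n. f (take m w)*g (drop m w)) = (\<Sum>u\<in>words m. f u)*(\<Sum>v\<in>words (n - m). g v)"
proof -
 have "(\<Sum>w\<in>words (m + (n - m)). f (take m w)*g (drop m w)) = (\<Sum>u\<in>words m. \<Sum>v\<in>words (n - m). f u*g v)"
  unfolding sum_words_add by (intro sum.cong refl) (simp add: words_def)
 thus ?thesis using assms by (simp add: sum_product)
qed

lemma sum_words_Suc:
 fixes F :: "'a list => 'b::comm_monoid_add"
 shows "(\<Sum>w\<in>words (Suc n). F w) = (\<Sum>i\<in>UNIV. \<Sum>v\<in>words n. F (i # v))"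
proof -
 have "(\<Sum>w\<in>words (Suc n). F w) = (\<Sum>u\<in>words 1. \<Sum>v\<in>words n. F (u @ v))"
  using sum_words_add[of F 1 n] by simp
 also have "words 1 = (\<lambda>i. [i]) ` (UNIV :: 'a set)" by (auto simp: words_def length_Suc_conv)
 finally show ?thesis by (simp add: sum.reindex inj_on_def)
qed

lemma cylinder_sets [measurable]: "cylinder w \<in> sets (streamM :: 'n::finite stream measure)"
proof -
 have "cylinder w = (\<lambda>\<xi>. stake (length w) \<xi>) -` {w} \<inter> space streamM" by (auto simp: cylinder_def)
 also have "... \<in> sets streamM" by (rule measurable_sets[OF measurable_stake]) simp
 finally show ?thesis .
qed

lemma cylinder_eq_sstart: "cylinder w = sstart UNIV w"
proof (induction w)
 case (Cons a w)
 have *: "\<xi> \<in> cylinder (a # w) \<longleftrightarrow> shd \<xi> = a \<and> stl \<xi> \<in> cylinder w" for \<xi> by (simp add: cylinder_def)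
 show ?case by (rule set_eqI) (simp only: * in_sstart Cons)
qed (simp add: cylinder_def)

lemma stream_measure_eqI:
 fixes M N :: "'n::finite stream measure"
 assumes "prob_space M" "prob_space N" "sets M = sets streamM" "sets N = sets streamM"
  and "\<And>w. emeasure M (cylinder w) = emeasure N (cylinder w)"
 shows "M = N"
 by (rule stream_space_eq_sstart[of UNIV]) (use assms in \<open>auto simp: cylinder_eq_sstart\<close>)

lemma funpow_stl: "(stl ^^ n) \<xi> = sdrop n \<xi>"
 by (induction n arbitrary: \<xi>) (simp_all add: funpow_swap1)

text \<open>Gibbs' inequality; terms with \<open>p = 0\<close> vanish, so \<open>q\<close> only has to be positive where \<open>p\<close> is.\<close>

lemma gibbs_inequality:
 fixes p q :: "'b => real"
 assumes A: "finite A" and p: "\<And>a. a \<in> A ==> 0 <= p a" and q: "\<And>a. a \<in> A ==> 0 <= q a"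
  and pq: "\<And>a. a \<in> A ==> 0 < p a ==> 0 < q a"
 shows "(\<Sum>a\<in>A. p a*ln (q a)) - (\<Sum>a\<in>A. p a*ln (p a)) <= (\<Sum>a\<in>A. q a) - (\<Sum>a\<in>A. p a)"
proof -
 have "p a*ln (q a) - p a*ln (p a) <= q a - p a" if a: "a \<in> A" for a
 proof (cases "p a = 0")
  case False
  hence "0 < p a" "0 < q a" using p[OF a] pq[OF a] by auto
  hence "ln (q a) - ln (p a) <= q a/p a - 1"
   using ln_le_minus_one[of "q a/p a"] by (simp add: ln_div)
  hence "p a*(ln (q a) - ln (p a)) <= p a*(q a/p a - 1)"
   using \<open>0 < p a\<close> by (intro mult_left_mono) auto
  thus ?thesis using \<open>0 < p a\<close> by (simp add: algebra_simps)
 qed (use q[OF a] in simp)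
 hence "(\<Sum>a\<in>A. p a*ln (q a) - p a*ln (p a)) <= (\<Sum>a\<in>A. q a - p a)" by (rule sum_mono)
 thus ?thesis by (simp add: sum_subtractf)
qed

lemma fekete:
 fixes a :: "nat => real"
 assumes sub: "\<And>m n. m > 0 ==> n > 0 ==> a (m + n) <= a m + a n" and lower: "\<And>n. - K*real n <= a n"
 shows "\<exists>L. (\<lambda>n. a n/n) \<longlonglongrightarrow> L \<and> (\<forall>n>0. L <= a n/n)"
proof -
 define L where "L = (INF n\<in>{0<..}. a n/real n)"
 have bdd: "bdd_below ((\<lambda>n. a n/real n) ` {0<..})"
 proof (rule bdd_belowI2)
  fix n :: nat assume "n \<in> {0<..}"
  thus "- K <= a n/real n" using lower[of n] by (simp add: field_simps)
 qed
 have L: "L <= a n/n" if "n > 0" for n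
  unfolding L_def using that by (intro cINF_lower[OF bdd]) auto
 have mult: "a (k*m + r) <= k*a m + a r" if "m > 0" "r > 0" for k m r
 proof (induction k)
  case (Suc k)
  have "a (Suc k*m + r) = a (m + (k*m + r))" by (simp add: algebra_simps)
  also have "... <= a m + a (k*m + r)" using that by (intro sub) auto
  finally show ?case using Suc by (simp add: algebra_simps)
 qed simp
 have "(\<lambda>n. a n/n) \<longlonglongrightarrow> L"
 proof (rule LIMSEQ_I)
  fix e :: real assume e: "e > 0"
  have "L < L + e/2" using e by simp
  then obtain m :: nat where m: "m > 0" "a m/m < L + e/2"
   unfolding L_def using cINF_less_iff[OF _ bdd] by (metis (no_types, lifting) greaterThan_iff image_is_empty greaterThan_non_empty)
  define C where "C = Max ((\<lambda>r. \<bar>a r\<bar>) ` {1..m}) + \<bar>a m\<bar> + \<bar>L + e/2\<bar>*m"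
  have C: "\<bar>a r\<bar> <= Max ((\<lambda>r. \<bar>a r\<bar>) ` {1..m})" if "r \<in> {1..m}" for r using that by (intro Max_ge) auto
  obtain N :: nat where N: "2*C/e < N" using reals_Archimedean2 by blast
  show "\<exists>no. \<forall>n\<ge>no. norm (a n/n - L) < e"
  proof (intro exI allI impI)
   fix n assume n: "n >= max 1 N"
   \<comment> \<open>Dividing \<open>n - 1\<close> instead of \<open>n\<close> puts the remainder
     \<open>r\<close> into \<open>{1..m}\<close>, as subadditivity is assumed for positive indices
     only.\<close>
   define k where "k = (n - 1) div m"
   define r where "r = (n - 1) mod m + 1"
   have nk: "n = k*m + r" "r \<in> {1..m}" using n m(1) by (auto simp: k_def r_def Suc_leI mod_less_divisor)
   have "a n <= k*a m + a r" using mult[OF m(1), of r k] nk by auto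
   also have "k*a m <= k*((L + e/2)*m)" using m by (intro mult_left_mono) (auto simp: field_simps)
   also have "... = (L + e/2)*(real n - real r)" using nk(1) by (simp add: algebra_simps)
   also have "... <= (L + e/2)*n + \<bar>L + e/2\<bar>*m"
   proof -
    have "- ((L + e/2)*real r) <= \<bar>L + e/2\<bar>*real r" by (metis abs_ge_minus_self mult_minus_left mult_right_mono of_nat_0_le_iff)
    also have "... <= \<bar>L + e/2\<bar>*m" using nk(2) by (intro mult_left_mono) auto
    finally show ?thesis by (simp add: right_diff_distrib)
   qed
   also have "a r <= Max ((\<lambda>r. \<bar>a r\<bar>) ` {1..m})" using C[OF nk(2)] by simp
   finally have "a n <= (L + e/2)*n + C" unfolding C_def by linarith
   hence "a n/n <= L + e/2 + C/n" using n by (simp add: field_simps)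
   moreover have "C/n < e/2"
   proof -
    have "2*C < e*N" using N e by (simp add: field_simps)
    also have "... <= e*n" using n e by (intro mult_left_mono) auto
    finally show ?thesis using n by (simp add: field_simps)
   qed
   moreover have "L <= a n/n" using n by (intro L) auto
   ultimately show "norm (a n/n - L) < e" unfolding real_norm_def abs_less_iff using e by linarith
  qed
 qed
 thus ?thesis using L by blast
qed

section \<open>Entropy of shift invariant measures\<close>

locale shift_measure = prob_space \<nu> for \<nu> :: "'n::finite stream measure" +
 assumes sets_nu [measurable_cong]: "sets \<nu> = sets streamM"
  and shift_invariant: "distr \<nu> \<nu> stl = \<nu>"
begin

lemma space_nu [simp]: "space \<nu> = UNIV"
 using sets_eq_imp_space_eq[OF sets_nu] by simp

lemma prob_UNIV [simp]: "prob UNIV = 1"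
 using prob_space by simp

lemma cylinder_nu [measurable, simp]: "cylinder w \<in> sets \<nu>"
 by (simp add: sets_nu)

lemma stl_nu: "stl \<in> measurable \<nu> \<nu>"
 by (simp add: measurable_cong_sets[OF sets_nu sets_nu])

lemma stake_nu [measurable]: "stake n \<in> measurable \<nu> (count_space UNIV)"
 by (simp add: measurable_cong_sets[OF sets_nu refl])

lemma fun_stake_measurable: "(\<lambda>\<xi>. f (stake n \<xi>)) \<in> borel_measurable \<nu>"
 by measurable

lemma expectation_stake:
 fixes f :: "'n list => real"
 shows "expectation (\<lambda>\<xi>. f (stake n \<xi>)) = (\<Sum>w\<in>words n. prob (cylinder w)*f w)"
proof -
 have "f (stake n \<xi>) = (\<Sum>w\<in>words n. indicator (cylinder w) \<xi>*f w)" for \<xi>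
 proof -
  have "(\<Sum>w\<in>words n. indicator (cylinder w) \<xi>*f w) = (\<Sum>w\<in>words n. if w = stake n \<xi> then f w else 0)"
   by (intro sum.cong) (auto simp: cylinder_def words_def indicator_def)
  thus ?thesis by simp
 qed
 hence "expectation (\<lambda>\<xi>. f (stake n \<xi>)) = expectation (\<lambda>\<xi>. \<Sum>w\<in>words n. indicator (cylinder w) \<xi>*f w)" by simp
 also have "... = (\<Sum>w\<in>words n. expectation (\<lambda>\<xi>. indicator (cylinder w) \<xi>*f w))"
  by (rule Bochner_Integration.integral_sum) (auto intro!: integrable_mult_left integrable_real_indicator simp: emeasure_eq_measure)
 finally show ?thesis by simp
qed

lemma sum_prob_cylinder: "(\<Sum>w\<in>words n. prob (cylinder w)) = 1"
 using expectation_stake[of "\<lambda>_. 1" n] by (simp add: prob_space)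

lemma distr_sdrop: "distr \<nu> \<nu> (sdrop n) = \<nu>"
proof (induction n)
 case 0
 have "sdrop 0 = (\<lambda>\<xi> :: 'n stream. \<xi>)" by auto
 thus ?case by simp
next
 case (Suc n)
 have sd: "sdrop n \<in> measurable \<nu> \<nu>" by (simp add: measurable_cong_sets[OF sets_nu sets_nu])
 have "(sdrop (Suc n) :: 'n stream => _) = sdrop n \<circ> stl" by auto
 hence eq: "distr \<nu> \<nu> (sdrop (Suc n)) = distr (distr \<nu> \<nu> stl) \<nu> (sdrop n)"
  by (simp only: distr_distr[OF sd stl_nu])
 show ?case unfolding eq shift_invariant Suc ..
qed

lemma expectation_sdrop:
 fixes g :: "'n stream => real"
 assumes "g \<in> borel_measurable \<nu>"
 shows "expectation (\<lambda>\<xi>. g (sdrop n \<xi>)) = expectation g"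
proof -
 have sd: "sdrop n \<in> measurable \<nu> \<nu>" by (simp add: measurable_cong_sets[OF sets_nu sets_nu])
 have "expectation g = integral\<^sup>L (distr \<nu> \<nu> (sdrop n)) g" by (simp only: distr_sdrop)
 also have "... = expectation (\<lambda>\<xi>. g (sdrop n \<xi>))" by (rule integral_distr[OF sd assms])
 finally show ?thesis ..
qed

lemma prob_cylinder_append1: "prob (cylinder (u @ v)) <= prob (cylinder u)"
proof (rule finite_measure_mono)
 show "cylinder (u @ v) \<subseteq> cylinder u"
 proof
  fix \<xi> assume "\<xi> \<in> cylinder (u @ v)"
  hence "take (length u) (stake (length u + length v) \<xi>) = u" by (simp add: cylinder_def)
  thus "\<xi> \<in> cylinder u" by (simp add: cylinder_def take_stake)
 qed
qed simp

lemma prob_cylinder_append2: "prob (cylinder (u @ v)) <= prob (cylinder v)"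
proof -
 have sd: "sdrop (length u) \<in> measurable \<nu> \<nu>" by (simp add: measurable_cong_sets[OF sets_nu sets_nu])
 have "cylinder (u @ v) \<subseteq> sdrop (length u) -` cylinder v \<inter> space \<nu>"
  by (auto simp: cylinder_def simp flip: stake_add)
 hence "prob (cylinder (u @ v)) <= prob (sdrop (length u) -` cylinder v \<inter> space \<nu>)"
  by (rule finite_measure_mono) (rule measurable_sets[OF sd], simp)
 also have "... = measure (distr \<nu> \<nu> (sdrop (length u))) (cylinder v)"
  by (rule measure_distr[OF sd, symmetric]) simp
 finally show ?thesis by (simp only: distr_sdrop)
qed

definition ent :: "nat => real" where
 "ent n = - (\<Sum>w\<in>words n. prob (cylinder w)*ln (prob (cylinder w)))"

lemma ent_nonneg: "0 <= ent n"
proof -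
 have "prob (cylinder w)*ln (prob (cylinder w)) <= 0" for w
  by (cases "prob (cylinder w) = 0") (auto intro!: mult_nonneg_nonpos simp: zero_less_measure_iff)
 hence "(\<Sum>w\<in>words n. prob (cylinder w)*ln (prob (cylinder w))) <= 0" by (intro sum_nonpos)
 thus ?thesis by (simp add: ent_def)
qed

lemma ent_le:
 assumes "\<And>w. w \<in> words n ==> 0 <= q w" "\<And>w. w \<in> words n ==> 0 < prob (cylinder w) ==> 0 < q w"
  and "(\<Sum>w\<in>words n. q w) <= 1"
 shows "ent n <= - (\<Sum>w\<in>words n. prob (cylinder w)*ln (q w))"
 using gibbs_inequality[of "words n" "\<lambda>w. prob (cylinder w)" q] assms sum_prob_cylinder[of n]
 by (simp add: ent_def)

text \<open>Gibbs' inequality against the product of the masses of the first \<open>m\<close> and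
  the last \<open>n\<close> letters; invariance turns the second marginal into the law of the first
  \<open>n\<close> letters.\<close>

lemma ent_subadditive: "ent (m + n) <= ent m + ent n"
proof -
 define q where "q w = prob (cylinder (take m w))*prob (cylinder (drop m w))" for w
 have pos: "0 < prob (cylinder (take m w)) \<and> 0 < prob (cylinder (drop m w))" if "0 < prob (cylinder w)" for w
  using that prob_cylinder_append1[of "take m w" "drop m w"] prob_cylinder_append2[of "take m w" "drop m w"] by simp
 have "ent (m + n) <= - (\<Sum>w\<in>words (m + n). prob (cylinder w)*ln (q w))"
 proof (rule ent_le)
  have "(\<Sum>w\<in>words (m + n). q w) = (\<Sum>u\<in>words m. prob (cylinder u))*(\<Sum>v\<in>words (m + n - m). prob (cylinder v))"
   unfolding q_def by (rule sum_words_split) simp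
  thus "(\<Sum>w\<in>words (m + n). q w) <= 1" by (simp add: sum_prob_cylinder)
 qed (use pos in \<open>auto simp: q_def\<close>)
 also have "(\<Sum>w\<in>words (m + n). prob (cylinder w)*ln (q w)) =
   (\<Sum>w\<in>words (m + n). prob (cylinder w)*(ln (prob (cylinder (take m w))) + ln (prob (cylinder (drop m w)))))"
 proof (rule sum.cong[OF refl])
  fix w :: "'n list"
  show "prob (cylinder w)*ln (q w) = prob (cylinder w)*(ln (prob (cylinder (take m w))) + ln (prob (cylinder (drop m w))))"
   using pos[of w] by (cases "prob (cylinder w) = 0") (auto simp: q_def ln_mult zero_less_measure_iff)
 qed
 also have "... = expectation (\<lambda>\<xi>. ln (prob (cylinder (take m (stake (m + n) \<xi>)))) + ln (prob (cylinder (drop m (stake (m + n) \<xi>)))))"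
  by (rule expectation_stake[symmetric])
 also have "... = expectation (\<lambda>\<xi>. ln (prob (cylinder (stake m \<xi>))) + ln (prob (cylinder (stake n (sdrop m \<xi>)))))"
  by (simp flip: stake_add)
 also have "... = expectation (\<lambda>\<xi>. ln (prob (cylinder (stake m \<xi>)))) + expectation (\<lambda>\<xi>. ln (prob (cylinder (stake n (sdrop m \<xi>)))))"
 proof (rule Bochner_Integration.integral_add)
  have fin: "finite (range (\<lambda>\<xi>. ln (prob (cylinder (stake k (g \<xi>))))))" for k and g :: "'n stream => 'n stream"
   by (rule finite_subset[of _ "(\<lambda>w. ln (prob (cylinder w))) ` words k"]) auto
  have int: "integrable \<nu> (\<lambda>\<xi>. ln (prob (cylinder (stake k (g \<xi>)))))" if g: "g \<in> measurable \<nu> \<nu>" for k g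
  proof (rule integrable_const_bound[of _ "Max (abs ` range (\<lambda>\<xi>. ln (prob (cylinder (stake k (g \<xi>))))))"])
   show "AE \<xi> in \<nu>. norm (ln (prob (cylinder (stake k (g \<xi>))))) <= Max (abs ` range (\<lambda>\<xi>. ln (prob (cylinder (stake k (g \<xi>))))))"
    using fin[of k g] by (intro AE_I2) (auto intro!: Max_ge)
   show "(\<lambda>\<xi>. ln (prob (cylinder (stake k (g \<xi>))))) \<in> borel_measurable \<nu>"
    using measurable_compose[OF g fun_stake_measurable[of "\<lambda>w. ln (prob (cylinder w))" k]] .
  qed
  show "integrable \<nu> (\<lambda>\<xi>. ln (prob (cylinder (stake m \<xi>))))" using int[of "\<lambda>\<xi>. \<xi>" m] by simp
  show "integrable \<nu> (\<lambda>\<xi>. ln (prob (cylinder (stake n (sdrop m \<xi>)))))"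
   using int[of "sdrop m" n] by (simp add: measurable_cong_sets[OF sets_nu sets_nu])
 qed
 also have "expectation (\<lambda>\<xi>. ln (prob (cylinder (stake n (sdrop m \<xi>))))) = expectation (\<lambda>\<xi>. ln (prob (cylinder (stake n \<xi>))))"
  by (rule expectation_sdrop[OF fun_stake_measurable])
 finally show ?thesis unfolding expectation_stake[of "\<lambda>w. ln (prob (cylinder w))"] by (simp add: ent_def)
qed

lemma ent_limit:
 shows "(\<lambda>n. ent n/n) \<longlonglongrightarrow> shift_entropy \<nu>" and "n > 0 ==> shift_entropy \<nu> <= ent n/n"
proof -
 obtain L where L: "(\<lambda>n. ent n/n) \<longlonglongrightarrow> L" "\<forall>n>0. L <= ent n/n"
  using fekete[of ent 0] ent_subadditive ent_nonneg by auto
 have "(\<lambda>n. (\<Sum>w\<in>words n. prob (cylinder w)*ln (prob (cylinder w)))/n) \<longlonglongrightarrow> - L"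
  using tendsto_minus[OF L(1)] by (simp add: ent_def)
 hence "shift_entropy \<nu> = L" unfolding shift_entropy_def by (simp add: limI)
 thus "(\<lambda>n. ent n/n) \<longlonglongrightarrow> shift_entropy \<nu>" and "n > 0 ==> shift_entropy \<nu> <= ent n/n" using L by auto
qed

end

section \<open>Entropy bounds the cylinder measures\<close>

text \<open>The sum over all ways to cut \<open>w\<close> into nonempty blocks of the product of
  \<open>x * b u\<close> over the blocks \<open>u\<close>, written as a recursion on the first
  block.\<close>

function tile_weight :: "real => ('a list => real) => 'a list => real" where
 "tile_weight x b w = (if w = [] then 1 else
   x*(\<Sum>m\<in>{1..length w}. b (take m w)*tile_weight x b (drop m w)))"
 by pat_completeness auto
termination by (relation "Wellfounded.measure (\<lambda>(x, b, w). length w)") auto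

declare tile_weight.simps [simp del]

lemma tile_weight_Nil [simp]: "tile_weight x b [] = 1"
 by (simp add: tile_weight.simps)

lemma tile_weight_nonneg:
 assumes "0 <= x" "\<And>u. 0 <= b u"
 shows "0 <= tile_weight x b w"
proof (induction w rule: length_induct)
 case (1 w)
 show ?case
 proof (cases "w = []")
  case False
  thus ?thesis using 1 assms
   by (subst tile_weight.simps) (auto intro!: mult_nonneg_nonneg sum_nonneg)
 qed simp
qed

lemma tile_weight_ge:
 assumes x: "0 <= x" "\<And>u. 0 <= b u" and m: "1 <= m" "m <= length w"
 shows "x*(b (take m w)*tile_weight x b (drop m w)) <= tile_weight x b w"
proof -
 have "w \<noteq> []" using m by auto
 have t: "0 <= tile_weight x b u" for u by (rule tile_weight_nonneg) (use x in auto)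
 have "b (take m w)*tile_weight x b (drop m w) <= (\<Sum>m\<in>{1..length w}. b (take m w)*tile_weight x b (drop m w))"
  by (rule member_le_sum) (use m x t in auto)
 thus ?thesis using \<open>w \<noteq> []\<close> x by (subst (2) tile_weight.simps) (simp add: mult_left_mono)
qed

text \<open>Summed over words, the recursion is a renewal inequality; inserting the bound for
  shorter words gives a geometric sum with value \<open>(1 + 2*x)^n - 1\<close>.\<close>

lemma sum_tile_weight_le:
 fixes b :: "'n::finite list => real"
 assumes x: "0 <= x" "\<And>u. 0 <= b u" and b: "\<And>m. (\<Sum>u\<in>words m. b u) <= 2"
 shows "(\<Sum>w\<in>words n. tile_weight x b w) <= (1 + 2*x)^n"
proof (induction n rule: less_induct)
 case (less n)
 show ?case
 proof (cases "n = 0")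
  case False
  have t: "0 <= tile_weight x b u" for u by (rule tile_weight_nonneg) (use x in auto)
  have "(\<Sum>w\<in>words n. tile_weight x b w) =
    (\<Sum>w\<in>words n. x*(\<Sum>m\<in>{1..n}. b (take m w)*tile_weight x b (drop m w)))"
   using False by (intro sum.cong refl, subst tile_weight.simps) (auto simp: words_def)
  also have "... = x*(\<Sum>m\<in>{1..n}. \<Sum>w\<in>words n. b (take m w)*tile_weight x b (drop m w))"
   by (subst sum.swap) (simp add: sum_distrib_left)
  also have "(\<Sum>m\<in>{1..n}. \<Sum>w\<in>words n. b (take m w)*tile_weight x b (drop m w)) =
    (\<Sum>m\<in>{1..n}. (\<Sum>u\<in>words m. b u)*(\<Sum>v\<in>words (n - m). tile_weight x b v))"
   by (intro sum.cong refl sum_words_split) auto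
  also have "... <= (\<Sum>m\<in>{1..n}. 2*(1 + 2*x)^(n - m))"
   using less.IH x t by (intro sum_mono mult_mono b) (auto intro: sum_nonneg)
  also have "... = (\<Sum>j<n. 2*(1 + 2*x)^j)"
   by (rule sum.reindex_bij_witness[of _ "\<lambda>j. n - j" "\<lambda>m. n - m"]) auto
  also have "x*... = (1 + 2*x)^n - 1"
  proof -
   have "(1 + 2*x - 1)*(\<Sum>j<n. (1 + 2*x)^j) = (1 + 2*x)^n - 1"
    by (rule power_diff_1_eq[symmetric])
   thus ?thesis by (simp add: sum_distrib_left mult_ac)
  qed
  finally show ?thesis using x by (simp add: mult_left_mono)
 qed simp
qed

text \<open>A tiling of \<open>u\<close> followed by a tiling of \<open>v\<close> is a tiling of
  \<open>u @ v\<close>, and the remaining tilings contribute nonnegative terms.\<close>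

lemma tile_weight_mult:
 assumes x: "0 <= x" "\<And>u. 0 <= b u"
 shows "tile_weight x b u*tile_weight x b v <= tile_weight x b (u @ v)"
proof (induction u rule: length_induct)
 case (1 u)
 have t: "0 <= tile_weight x b u" for u by (rule tile_weight_nonneg) (use x in auto)
 show ?case
 proof (cases "u = []")
  case False
  have "tile_weight x b u*tile_weight x b v = x*(\<Sum>m\<in>{1..length u}. b (take m u)*(tile_weight x b (drop m u)*tile_weight x b v))"
   using False by (subst tile_weight.simps) (simp add: sum_distrib_right mult.assoc)
  also have "... <= x*(\<Sum>m\<in>{1..length u}. b (take m (u @ v))*tile_weight x b (drop m (u @ v)))"
  proof (intro mult_left_mono sum_mono x(1))
   fix m assume m: "m \<in> {1..length u}"
   hence "tile_weight x b (drop m u)*tile_weight x b v <= tile_weight x b (drop m u @ v)" using 1 by auto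
   thus "b (take m u)*(tile_weight x b (drop m u)*tile_weight x b v) <= b (take m (u @ v))*tile_weight x b (drop m (u @ v))"
    using m x(2) by (simp add: mult_left_mono)
  qed
  also have "... <= x*(\<Sum>m\<in>{1..length (u @ v)}. b (take m (u @ v))*tile_weight x b (drop m (u @ v)))"
   using x t by (intro mult_left_mono sum_mono2) auto
  also have "... = tile_weight x b (u @ v)" using False by (subst (2) tile_weight.simps) simp
  finally show ?thesis .
 qed simp
qed

context shift_measure
begin

lemma stake_pred_sets: "{\<xi>. P (stake n \<xi>)} \<in> sets \<nu>"
proof -
 have "{\<xi>. P (stake n \<xi>)} = stake n -` {w. P w} \<inter> space \<nu>" by auto
 also have "... \<in> sets \<nu>" by (rule measurable_sets[OF stake_nu]) simp
 finally show ?thesis .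
qed

end

locale ergodic_shift = shift_measure \<nu> for \<nu> :: "'n::finite stream measure" +
 assumes shift_ergodic: "\<And>B. B \<in> sets \<nu> ==> stl -` B = B ==> prob B = 0 \<or> prob B = 1"

sublocale ergodic_shift \<subseteq> ergodic_system \<nu> stl
 by unfold_locales (use stl_nu shift_invariant shift_ergodic in auto)

lemma ergodic_shift_measure_iff: "ergodic_shift_measure \<nu> \<longleftrightarrow> ergodic_shift \<nu>"
 unfolding ergodic_shift_measure_def ergodic_shift_def ergodic_shift_axioms_def shift_measure_def shift_measure_axioms_def
 by auto

context ergodic_shift
begin

text \<open>The weights of \<open>\<nu>\<close>-tilings are supermultiplicative, dominate the cylinder measures and sum
 to at most \<open>(1 + 2 x) ^ n\<close> with \<open>x\<close> small; apply Kingman's theorem to their negative logarithms.\<close>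

theorem prob_cylinder_upper:
 assumes e: "0 < e"
 shows "AE \<xi> in \<nu>. \<forall>\<^sub>F n in sequentially. prob (cylinder (stake n \<xi>)) <= exp (- (n*(shift_entropy \<nu> - e)))"
proof -
 define x where "x = min 1 (e/8)"
 have x: "0 < x" "x <= 1" "8*x <= e" using e by (auto simp: x_def)
 define c where "c = 1/real CARD('n)"
 have c: "0 < c" "c <= 1" by (auto simp: c_def Suc_leI)
 \<comment> \<open>The second term is the uniform probability on words of a given length. It keeps
   all weights positive and their logarithms linearly bounded, as Kingman's theorem
   requires.\<close>
 define b where "b u = prob (cylinder u) + c^length u" for u :: "'n list"
 define R where "R = tile_weight x b"
 have b0: "0 <= b u" for u using c by (simp add: b_def)
 have bsum: "(\<Sum>u\<in>words m. b u) <= 2" for m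
 proof -
  have "(\<Sum>u\<in>words m. c^length (u :: 'n list)) = (\<Sum>u\<in>(words m :: 'n list set). c^m)"
   by (intro sum.cong refl) (simp add: words_def)
  also have "... = 1" by (simp add: card_words c_def power_divide)
  finally show ?thesis by (simp add: b_def sum.distrib sum_prob_cylinder)
 qed
 have R_ge: "x*b w <= R w" if "w \<noteq> []" for w
  using tile_weight_ge[of x b "length w" w] x b0 that by (simp add: R_def Suc_leI)
 have R_low: "(x * c)^length w <= R w" for w
 proof (cases "w = []")
  case False
  have "(x * c)^length w <= x * c^length w"
   unfolding power_mult_distrib using False x c power_decreasing[of 1 "length w" x] by (intro mult_right_mono) (auto simp: Suc_leI)
  also have "... <= x*b w" using x by (simp add: b_def)
  finally show ?thesis using R_ge[OF False] by linarith
 qed (simp add: R_def)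
 have R0: "0 < R w" for w using R_low[of w] x c by (meson less_le_trans mult_pos_pos zero_less_power)
 have R_sum: "(\<Sum>w\<in>words n. R w) <= (1 + 2*x)^n" for n
  unfolding R_def by (rule sum_tile_weight_le) (use x b0 bsum in auto)
 have R_up: "R w <= (1 + 2*x)^length w" for w
  by (rule order_trans[OF _ R_sum], rule member_le_sum) (simp add: words_def, use R0 in \<open>simp_all add: less_imp_le\<close>)
 let ?f = "\<lambda>n \<xi>. - ln (R (stake n \<xi>))"
 have "\<exists>g. (AE \<xi> in \<nu>. (\<lambda>n. ?f n \<xi>/n) \<longlonglongrightarrow> g) \<and> (\<lambda>n. expectation (?f n)/n) \<longlonglongrightarrow> g"
 proof (rule kingman)
  show "?f n \<in> borel_measurable \<nu>" for n by (rule fun_stake_measurable)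
  show "?f (m + n) \<xi> <= ?f m \<xi> + ?f n ((stl ^^ m) \<xi>) + 0" for m n \<xi>
  proof -
   have "R (stake m \<xi>) * R (stake n (sdrop m \<xi>)) <= R (stake (m + n) \<xi>)"
    using tile_weight_mult[of x b "stake m \<xi>" "stake n (sdrop m \<xi>)"] x b0 by (simp add: R_def stake_add)
   hence "ln (R (stake m \<xi>) * R (stake n (sdrop m \<xi>))) <= ln (R (stake (m + n) \<xi>))" using R0 by simp
   thus ?thesis using R0 by (simp add: ln_mult_pos funpow_stl)
  qed
  show "\<bar>?f n \<xi>\<bar> <= (ln (1 + 2*x) - ln (x * c))*real n" for n \<xi>
  proof -
   have "ln ((x * c)^n) <= ln (R (stake n \<xi>))" "ln (R (stake n \<xi>)) <= ln ((1 + 2*x)^n)"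
    using R_low[of "stake n \<xi>"] R_up[of "stake n \<xi>"] R0 x c by simp_all
   moreover have "ln ((x * c)^n) = n*ln (x * c)" "ln ((1 + 2*x)^n) = n*ln (1 + 2*x)" by (simp_all add: ln_realpow)
   moreover have "n*ln (x * c) <= 0" "0 <= n*ln (1 + 2*x)"
    using x c by (auto intro!: mult_nonneg_nonpos simp: mult_le_one)
   ultimately show ?thesis by (simp add: abs_le_iff algebra_simps)
  qed
 qed
 then obtain g where g: "AE \<xi> in \<nu>. (\<lambda>n. ?f n \<xi>/n) \<longlonglongrightarrow> g" "(\<lambda>n. expectation (?f n)/n) \<longlonglongrightarrow> g" by blast
 \<comment> \<open>Gibbs' inequality against the normalised weights \<open>R w / (1 + 2*x)^n\<close>
   shows that the entropy exceeds the decay rate \<open>g\<close> of the weights by at most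
   \<open>2 * x\<close>; cylinder masses, being at most \<open>R w / x\<close>, inherit that
   rate.\<close>
 have "ent n/n <= expectation (?f n)/n + 2*x" if n: "0 < n" for n
 proof -
  have "ent n <= - (\<Sum>w\<in>words n. prob (cylinder w)*ln (R w/(1 + 2*x)^n))"
   using R_sum[of n] x R0 by (intro ent_le) (auto simp: sum_divide_distrib[symmetric] less_imp_le)
  also have "... = (\<Sum>w\<in>words n. prob (cylinder w)*- ln (R w)) + n*ln (1 + 2*x)*(\<Sum>w\<in>words n. prob (cylinder w))"
  proof -
   have "ln (R w/(1 + 2*x)^n) = ln (R w) - n*ln (1 + 2*x)" for w
    using R0[of w] x by (simp add: ln_div ln_realpow less_imp_neq[symmetric])
   thus ?thesis by (simp add: right_diff_distrib sum_subtractf sum_negf sum_distrib_right mult.commute)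
  qed
  also have "... <= expectation (?f n) + n*(2*x)"
   using expectation_stake[of "\<lambda>w. - ln (R w)" n] ln_add_one_self_le_self[of "2*x"] x by (simp add: sum_prob_cylinder mult_left_mono)
  finally show ?thesis using n by (simp add: field_simps)
 qed
 hence "\<forall>\<^sub>F n in sequentially. ent n/n <= expectation (?f n)/n + 2*x"
  by (rule eventually_mono[OF eventually_gt_at_top[of 0]])
 hence hg: "shift_entropy \<nu> <= g + 2*x"
  by (rule tendsto_le[OF sequentially_bot tendsto_add[OF g(2) tendsto_const] ent_limit(1)])
 show ?thesis using g(1)
 proof eventually_elim
  case (elim \<xi>)
  have "\<forall>\<^sub>F n in sequentially. g - x < ?f n \<xi>/n" by (rule order_tendstoD(1)[OF elim]) (use x in simp)
  moreover have "\<forall>\<^sub>F n in sequentially. - ln x/real n < x" by (rule order_tendstoD(2)[OF lim_const_over_n]) (use x in simp)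
  ultimately show ?case using eventually_gt_at_top[of 0]
  proof eventually_elim
   case (elim n)
   have "x*prob (cylinder (stake n \<xi>)) <= x*b (stake n \<xi>)" using x c by (simp add: b_def)
   also have "... <= R (stake n \<xi>)" using elim(3) by (intro R_ge) auto
   also have "... = exp (- ?f n \<xi>)" using R0 by simp
   also have "... <= exp (- (n*(g - x)))" using elim(1,3) by (simp add: field_simps)
   finally have "prob (cylinder (stake n \<xi>)) <= exp (- (n*(g - x)))/x" using x by (simp add: field_simps)
   also have "... = exp (- (n*(g - x)) - ln x)" using x by (simp add: exp_diff)
   also have "... <= exp (- (n*(shift_entropy \<nu> - e)))"
   proof -
    have "- ln x <= n*x" using elim(2,3) by (simp add: field_simps)
    moreover have "n*(shift_entropy \<nu> - e) <= n*(g - 2*x)" using hg x by (intro mult_left_mono) auto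
    ultimately show ?thesis by (simp add: algebra_simps)
   qed
   finally show ?case .
  qed
 qed
qed

end

section \<open>Bernoulli measures\<close>

lemma bernoulli_sets: "sets (bernoulli_measure p) = sets streamM"
 unfolding bernoulli_measure_def by (rule sets_stream_space_cong) (simp add: sets_point_measure)

lemma prob_space_point:
 assumes "prob_vector p"
 shows "prob_space (point_measure UNIV (\<lambda>i. ennreal (p$i)))"
proof
 show "emeasure (point_measure UNIV (\<lambda>i. ennreal (p$i))) (space (point_measure UNIV (\<lambda>i. ennreal (p$i)))) = 1"
  using assms by (simp add: space_point_measure emeasure_point_measure_finite sum_ennreal prob_vector_def less_imp_le)
qed

lemma bernoulli_emeasure:
 fixes p :: "real^'n"
 assumes p: "prob_vector p" and X: "X \<in> sets streamM"
 shows "emeasure (bernoulli_measure p) X = (\<Sum>i\<in>UNIV. ennreal (p$i)*emeasure (bernoulli_measure p) {\<xi>. i ## \<xi> \<in> X})"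
proof -
 interpret P: prob_space "point_measure UNIV (\<lambda>i. ennreal (p$i))" by (rule prob_space_point[OF p])
 have X': "X \<in> sets (stream_space (point_measure UNIV (\<lambda>i. ennreal (p$i))))"
  using X bernoulli_sets[of p] by (simp add: bernoulli_measure_def)
 have sp: "space (stream_space (point_measure UNIV (\<lambda>i. ennreal (p$i)))) = UNIV"
  by (simp add: space_stream_space space_point_measure)
 show ?thesis unfolding bernoulli_measure_def P.emeasure_stream_space[OF X'] sp
  by (simp add: nn_integral_point_measure_finite)
qed

text \<open>Prepending a letter does not leave an invariant set \<open>B\<close>, so
  \<open>B\<close> is independent of every cylinder. If \<open>B\<close> is not null, the
  conditional measure on \<open>B\<close> then agrees with the Bernoulli measure on cylinders, hence
  everywhere, and evaluating both at \<open>B\<close> gives measure 1.\<close>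

lemma bernoulli_shift:
 fixes p :: "real^'n"
 assumes p: "prob_vector p"
 shows "ergodic_shift (bernoulli_measure p)" and
  "measure (bernoulli_measure p) (cylinder w) = prod_list (map (($) p) w)"
proof -
 let ?\<nu> = "bernoulli_measure p"
 interpret P: prob_space "point_measure UNIV (\<lambda>i. ennreal (p$i))" by (rule prob_space_point[OF p])
 interpret prob_space ?\<nu> unfolding bernoulli_measure_def by (rule P.prob_space_stream_space)
 have sp: "space ?\<nu> = UNIV" using sets_eq_imp_space_eq[OF bernoulli_sets[of p]] by simp
 have psum: "(\<Sum>i\<in>UNIV. ennreal (p$i)) = 1"
  using p by (simp add: sum_ennreal prob_vector_def less_imp_le)
 have stl: "stl \<in> measurable ?\<nu> ?\<nu>" by (simp add: measurable_cong_sets[OF bernoulli_sets bernoulli_sets])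
 have inv: "distr ?\<nu> ?\<nu> stl = ?\<nu>"
 proof (rule measure_eqI)
  fix A assume "A \<in> sets (distr ?\<nu> ?\<nu> stl)"
  hence A: "A \<in> sets ?\<nu>" by simp
  hence A': "stl -` A \<inter> space ?\<nu> \<in> sets ?\<nu>" by (rule measurable_sets[OF stl])
  have "emeasure (distr ?\<nu> ?\<nu> stl) A = emeasure ?\<nu> (stl -` A \<inter> space ?\<nu>)" by (rule emeasure_distr[OF stl A])
  also have "... = (\<Sum>i\<in>UNIV. ennreal (p$i)*emeasure ?\<nu> A)"
   by (subst bernoulli_emeasure[OF p]) (use A' in \<open>auto simp: bernoulli_sets sp\<close>)
  also have "... = emeasure ?\<nu> A" by (simp add: psum flip: sum_distrib_right)
  finally show "emeasure (distr ?\<nu> ?\<nu> stl) A = emeasure ?\<nu> A" .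
 qed simp
 have cyl: "emeasure ?\<nu> (B \<inter> cylinder w) = emeasure ?\<nu> B*ennreal (prod_list (map (($) p) w))"
  if B: "B \<in> sets ?\<nu>" "stl -` B = B" for B w
 proof (induction w)
  case (Cons a w)
  have nonneg: "0 <= prod_list (map (($) p) w)" using p by (induction w) (auto simp: prob_vector_def less_imp_le)
  have pre: "{\<xi>. i ## \<xi> \<in> B \<inter> cylinder (a # w)} = (if i = a then B \<inter> cylinder w else {})" for i
  proof -
   have "i ## \<xi> \<in> B \<longleftrightarrow> \<xi> \<in> B" for \<xi>
   proof -
    have "i ## \<xi> \<in> stl -` B \<longleftrightarrow> \<xi> \<in> B" by simp
    thus ?thesis by (simp only: B(2))
   qed
   thus ?thesis by (auto simp: cylinder_def)
  qed
  have "emeasure ?\<nu> (B \<inter> cylinder (a # w)) = (\<Sum>i\<in>UNIV. if i = a then ennreal (p$a)*emeasure ?\<nu> (B \<inter> cylinder w) else 0)"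
  proof (subst bernoulli_emeasure[OF p])
   show "B \<inter> cylinder (a # w) \<in> sets streamM" using B(1) by (simp add: bernoulli_sets)
   show "(\<Sum>i\<in>UNIV. ennreal (p$i)*emeasure ?\<nu> {\<xi>. i ## \<xi> \<in> B \<inter> cylinder (a # w)}) =
    (\<Sum>i\<in>UNIV. if i = a then ennreal (p$a)*emeasure ?\<nu> (B \<inter> cylinder w) else 0)"
    unfolding pre by (rule sum.cong) auto
  qed
  also have "... = ennreal (p$a)*emeasure ?\<nu> (B \<inter> cylinder w)" by simp
  finally show ?case using p nonneg unfolding Cons
   by (simp add: ennreal_mult prob_vector_def less_imp_le mult_ac)
 qed (simp add: cylinder_def)
 have cyl1: "emeasure ?\<nu> (cylinder w) = ennreal (prod_list (map (($) p) w))" for w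
  using cyl[of UNIV w] sp emeasure_space_1 sets.top[of ?\<nu>] by simp
 have "0 <= prod_list (map (($) p) w)" using p by (induction w) (auto simp: prob_vector_def less_imp_le)
 thus "measure ?\<nu> (cylinder w) = prod_list (map (($) p) w)" using cyl1[of w] by (simp add: measure_def)
 show "ergodic_shift ?\<nu>"
 proof unfold_locales
  show "sets ?\<nu> = sets streamM" by (rule bernoulli_sets)
  show "distr ?\<nu> ?\<nu> stl = ?\<nu>" by (rule inv)
  fix B assume B: "B \<in> sets ?\<nu>" "stl -` B = B"
  show "prob B = 0 \<or> prob B = 1"
  proof (cases "emeasure ?\<nu> B = 0")
   case False
   have "uniform_measure ?\<nu> B = ?\<nu>"
   proof (rule stream_measure_eqI)
    show "prob_space (uniform_measure ?\<nu> B)" using False by (intro prob_space_uniform_measure) simp_all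
    fix w
    show "emeasure (uniform_measure ?\<nu> B) (cylinder w) = emeasure ?\<nu> (cylinder w)"
     using False B(1)
      by (simp add: emeasure_uniform_measure bernoulli_sets cyl[OF B] cyl1 mult.commute[of "emeasure ?\<nu> B"] ennreal_mult_divide_eq)
   qed (simp_all add: bernoulli_sets prob_space_axioms)
   hence "emeasure ?\<nu> B = emeasure (uniform_measure ?\<nu> B) B" by simp
   also have "... = 1" using False B(1)
    by (simp add: emeasure_uniform_measure emeasure_eq_measure divide_ennreal zero_less_measure_iff)
   finally show ?thesis by (simp add: measure_def)
  qed (simp add: measure_def)
 qed
qed

lemma bernoulli_entropy:
 fixes p :: "real^'n"
 assumes p: "prob_vector p"
 shows "shift_entropy (bernoulli_measure p) = vector_entropy p"
proof -
 define P where "P w = prod_list (map (($) p) w)" for w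
 have Ppos: "0 < P w" for w using p by (induction w) (auto simp: P_def prob_vector_def)
 have p1: "(\<Sum>i\<in>UNIV. p$i) = 1" using p by (simp add: prob_vector_def)
 have Psum: "(\<Sum>w\<in>words n. P w) = 1" for n
  by (induction n) (simp_all add: sum_words_Suc P_def p1 flip: sum_distrib_left)
 have "(\<Sum>w\<in>words n. P w*ln (P w)) = - real n * vector_entropy p" for n
 proof (induction n)
  case (Suc n)
  have "(\<Sum>w\<in>words (Suc n). P w*ln (P w)) = (\<Sum>i\<in>UNIV. \<Sum>v\<in>words n. p$i*ln (p$i)*P v + p$i*(P v * ln (P v)))"
  proof (unfold sum_words_Suc, intro sum.cong refl)
   fix i v
   have "P (i # v) = p$i*P v" by (simp add: P_def)
   moreover have "0 < p$i" using p by (simp add: prob_vector_def)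
   ultimately show "P (i # v)*ln (P (i # v)) = p$i*ln (p$i)*P v + p$i*(P v * ln (P v))"
    using Ppos[of v] by (simp add: ln_mult algebra_simps)
  qed
  also have "... = (\<Sum>i\<in>UNIV. p$i*ln (p$i))*(\<Sum>v\<in>words n. P v) + (\<Sum>i\<in>UNIV. p$i)*(\<Sum>v\<in>words n. P v * ln (P v))"
   by (simp add: sum.distrib sum_product)
  finally show ?case by (simp add: Psum p1 Suc vector_entropy_def algebra_simps)
 qed (simp add: P_def)
 hence "(\<lambda>n. (\<Sum>w\<in>words n. measure (bernoulli_measure p) (cylinder w)*ln (measure (bernoulli_measure p) (cylinder w)))/real n)
   = (\<lambda>n. - real n * vector_entropy p/real n)"
  by (simp add: bernoulli_shift(2)[OF p] P_def)
 moreover have "(\<lambda>n. - real n * vector_entropy p/real n) \<longlonglongrightarrow> - vector_entropy p"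
 proof (rule tendsto_eventually)
  show "\<forall>\<^sub>F n in sequentially. - real n * vector_entropy p/real n = - vector_entropy p"
   using eventually_gt_at_top[of 0] by eventually_elim simp
 qed
 ultimately show ?thesis unfolding shift_entropy_def by (simp add: limI)
qed

section \<open>Matrix products, pressure and Lyapunov exponents\<close>

lemma word_mat_Nil [simp]: "word_mat A [] = mat 1"
 by (simp add: word_mat_def)

lemma word_mat_Cons [simp]: "word_mat A (i # w) = A$i**word_mat A w"
 by (simp add: word_mat_def)

lemma word_mat_append: "word_mat A (u @ w) = word_mat A u**word_mat A w"
 by (induction u) (simp_all add: matrix_mul_assoc)

lemma invertible_mat_1: "invertible (mat 1 :: real^'d^'d)"
 unfolding invertible_def by (rule exI[of _ "mat 1"]) simp

lemma svf_nat:
 fixes M :: "real^'d^'d"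
 assumes M: "invertible M" and k: "k <= CARD('d)"
 shows "svf (real k) M = (\<Prod>j=1..k. sval j M)"
proof -
 have "0 < sval (nat \<lceil>real k\<rceil>) M"
 proof (cases "k = 0")
  case True
  thus ?thesis using sval_pos[OF M, of 1] by (simp add: sval_def Suc_leI)
 next
  case False
  thus ?thesis using sval_pos[OF M, of k] k by simp
 qed
 thus ?thesis using k by (simp add: svf_def)
qed

lemma sum_svexp_eq:
 fixes c :: "nat => real"
 assumes t: "0 <= t" "t <= real d"
 shows "(\<Sum>j=1..d. svexp t j * c j) = (\<Sum>j=1..nat \<lfloor>t\<rfloor>. c j) + (t - of_int \<lfloor>t\<rfloor>) * c (nat \<lceil>t\<rceil>)"
proof -
 define k where "k = nat \<lfloor>t\<rfloor>"
 have k: "real k = of_int \<lfloor>t\<rfloor>" using t by (simp add: k_def)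
 have kt: "real k <= t" "t < real k + 1" using k by linarith+
 have kd: "k <= d" using kt t by linarith
 have "(\<Sum>j=1..d. svexp t j * c j) = (\<Sum>j=1..k. svexp t j * c j) + (\<Sum>j=k+1..d. svexp t j * c j)"
  using sum.ub_add_nat[of 1 k "\<lambda>j. svexp t j * c j" "d - k"] kd by simp
 also have "(\<Sum>j=1..k. svexp t j * c j) = (\<Sum>j=1..k. c j)"
  using kt by (intro sum.cong) (auto simp: svexp_def)
 also have "(\<Sum>j=k+1..d. svexp t j * c j) = (t - of_int \<lfloor>t\<rfloor>) * c (nat \<lceil>t\<rceil>)"
 proof (cases "t = real k")
  case True
  have "(\<Sum>j=k+1..d. svexp t j * c j) = (\<Sum>j=k+1..d. 0)"
   using True by (intro sum.cong) (auto simp: svexp_def)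
  thus ?thesis using True by simp
 next
  case False
  hence "k + 1 <= d" using kt t by linarith
  have "\<lceil>t\<rceil> = int (k + 1)" using kt False by (intro ceiling_unique) auto
  hence ceil: "nat \<lceil>t\<rceil> = k + 1" by simp
  have "(\<Sum>j=k+1..d. svexp t j * c j) = svexp t (k + 1) * c (k + 1) + (\<Sum>j=k+2..d. svexp t j * c j)"
   using \<open>k + 1 \<le> d\<close> sum.atLeast_Suc_atMost[of "k+1" d "\<lambda>j. svexp t j * c j"] by simp
  also have "(\<Sum>j=k+2..d. svexp t j * c j) = (\<Sum>j=k+2..d. 0)"
   using kt by (intro sum.cong) (auto simp: svexp_def)
  also have "svexp t (k + 1) = t - real k" using kt by (simp add: svexp_def)
  finally show ?thesis by (simp add: ceil k)
 qed
 finally show ?thesis by (simp add: k_def)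
qed

section \<open>Contractive tuples, partition sums and pressure\<close>

locale contractive_tuple =
 fixes A :: "real^'d^'d^'n"
 assumes GL: "A \<in> GL_tuples" and contractive: "mat_tuple_norm A < 1"
begin

abbreviation "rho \<equiv> mat_tuple_norm A"

lemma invertible_A: "invertible (A$i)"
 using GL by (simp add: GL_tuples_def)

lemma invertible_word [simp]: "invertible (word_mat A w)"
 by (induction w) (simp_all add: invertible_mult invertible_A invertible_mat_1)

lemma op_norm_A_le: "op_norm (A$i) <= rho"
 unfolding mat_tuple_norm_def by (rule Max_ge) auto

lemma op_norm_A_pos: "0 < op_norm (A$i)"
proof -
 have "0 < sval 1 (A$i)" by (rule sval_pos[OF invertible_A]) (simp_all add: Suc_leI)
 also have "... <= op_norm (A$i)" by (rule sval_le_op_norm) (simp_all add: Suc_leI)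
 finally show ?thesis .
qed

lemma rho_pos: "0 < rho"
 using op_norm_A_pos op_norm_A_le by (rule less_le_trans)

lemma norm_word_le: "norm (word_mat A w *v x) <= rho^length w*norm x"
proof (induction w)
 case (Cons i w)
 have "norm (word_mat A (i # w) *v x) <= op_norm (A$i)*norm (word_mat A w *v x)"
  by (simp add: norm_matrix_vector_le_op_norm flip: matrix_vector_mul_assoc)
 also have "... <= rho*(rho^length w*norm x)"
  using rho_pos by (intro mult_mono Cons op_norm_A_le) auto
 finally show ?case by (simp add: mult.assoc)
qed simp

lemma op_norm_word_le: "op_norm (word_mat A w) <= rho^length w"
 by (rule op_norm_le) (rule norm_word_le)

lemma ex_lower_rate: "\<exists>b. 0 < b \<and> b < 1 \<and> (\<forall>w x. b^length w*norm x <= norm (word_mat A w *v x))"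
proof -
 have "\<forall>i. \<exists>B. B**(A$i) = mat 1" using invertible_A unfolding invertible_def by blast
 then obtain inv where inv: "inv i**(A$i) = mat 1" for i by metis
 \<comment> \<open>The summand 2 makes the rate \<open>1 / C\<close> strictly smaller than
   1.\<close>
 define C where "C = 2 + (\<Sum>i\<in>UNIV. op_norm (inv i))"
 have C2: "2 <= C" by (simp add: C_def sum_nonneg op_norm_nonneg)
 have 1: "norm x/C <= norm (A$i *v x)" for i x
 proof -
  have "norm x = norm (inv i *v (A$i *v x))" by (simp add: matrix_vector_mul_assoc inv)
  also have "... <= op_norm (inv i)*norm (A$i *v x)" by (rule norm_matrix_vector_le_op_norm)
  also have "... <= C*norm (A$i *v x)"
  proof (rule mult_right_mono)
   have "op_norm (inv i) <= (\<Sum>i\<in>UNIV. op_norm (inv i))"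
    by (rule member_le_sum) (auto simp: op_norm_nonneg)
   thus "op_norm (inv i) <= C" by (simp add: C_def)
  qed simp
  finally show ?thesis using C2 by (simp add: field_simps)
 qed
 have "(1/C)^length w*norm x <= norm (word_mat A w *v x)" for w x
 proof (induction w)
  case (Cons i w)
  have "(1/C)^length (i # w)*norm x = ((1/C)^length w*norm x)/C" by simp
  also have "... <= norm (word_mat A w *v x)/C" using C2 by (intro divide_right_mono Cons) auto
  also have "... <= norm (A$i *v (word_mat A w *v x))" by (rule 1)
  finally show ?case by (simp add: matrix_vector_mul_assoc)
 qed simp
 thus ?thesis using C2 by (intro exI[of _ "1/C"]) auto
qed

definition lower_rate :: real where
 "lower_rate = (SOME b. 0 < b \<and> b < 1 \<and> (\<forall>w x. b^length w*norm x <= norm (word_mat A w *v x)))"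

lemma lower_rate: "0 < lower_rate" "lower_rate < 1"
  "lower_rate^length w*norm x <= norm (word_mat A w *v x)"
 using someI_ex[OF ex_lower_rate] unfolding lower_rate_def by blast+

lemma sval_word_bounds:
 assumes "1 <= k" "k <= CARD('d)"
 shows "lower_rate^length w <= sval k (word_mat A w)" "sval k (word_mat A w) <= rho^length w"
proof -
 show "lower_rate^length w <= sval k (word_mat A w)" by (rule sval_ge[OF assms]) (rule lower_rate)
 show "sval k (word_mat A w) <= rho^length w"
  using sval_le_op_norm[OF assms, of "word_mat A w"] op_norm_word_le[of w] by linarith
qed

definition phi :: "real => 'n list => real" where
 "phi t w = svf t (word_mat A w)"

lemma phi_pos: "0 <= t ==> t <= real CARD('d) ==> 0 < phi t w"
 unfolding phi_def by (rule svf_pos) simp_all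

lemma phi_mult: "0 <= t ==> t <= real CARD('d) ==> phi t (u @ w) <= svf_const (CARD('d))*phi t u*phi t w"
 unfolding phi_def word_mat_append by (rule svf_mult) simp_all

lemma phi_le: "0 <= s ==> s <= t ==> t <= real CARD('d) ==> phi t w <= phi s w*(rho^length w) powr (t - s)"
 unfolding phi_def by (rule svf_le_svf) (simp_all add: sval_word_bounds)

lemma phi_ge: "0 <= s ==> s <= t ==> t <= real CARD('d) ==> phi s w*(lower_rate^length w) powr (t - s) <= phi t w"
 unfolding phi_def by (rule svf_ge_svf) (simp_all add: sval_word_bounds lower_rate)

lemma phi_0 [simp]: "phi 0 w = 1"
 unfolding phi_def by (rule svf_0) simp

lemma phi_le_rho: "0 <= t ==> t <= real CARD('d) ==> phi t w <= (rho^length w) powr t"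
 using phi_le[of 0 t w] by simp

lemma ln_phi_bound:
 assumes "0 <= t" "t <= real CARD('d)"
 shows "\<bar>ln (phi t w)\<bar> <= t*(- ln lower_rate)*length w"
proof -
 have lr: "ln lower_rate <= 0" using lower_rate by simp
 have "ln (phi t w) <= ln ((rho^length w) powr t)" using phi_le_rho[OF assms, of w] phi_pos[OF assms, of w]
  using rho_pos by (subst ln_le_cancel_iff) auto
 also have "... = t*(length w*ln rho)" using rho_pos by (simp add: ln_powr ln_realpow)
 also have "... <= 0" using rho_pos contractive assms by (intro mult_nonneg_nonpos) auto
 also have "0 <= t*(- ln lower_rate)*length w" using assms lr by (intro mult_nonneg_nonneg) auto
 finally have 1: "ln (phi t w) <= t*(- ln lower_rate)*length w" .
 have "(lower_rate^length w) powr t <= phi t w" using phi_ge[of 0 t w] assms by simp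
 hence "ln ((lower_rate^length w) powr t) <= ln (phi t w)"
  using lower_rate phi_pos[OF assms, of w] by (subst ln_le_cancel_iff) auto
 hence "t*(length w*ln lower_rate) <= ln (phi t w)" using lower_rate by (simp add: ln_powr ln_realpow)
 with 1 show ?thesis by (simp add: abs_le_iff mult_ac)
qed

definition Zsum :: "real => nat => real" where
 "Zsum t n = (\<Sum>w\<in>words n. phi t w)"

lemma words_nonempty: "(words n :: 'n list set) \<noteq> {}"
 using card_words[where 'n = 'n, of n] by force

lemma Zsum_pos: "0 <= t ==> t <= real CARD('d) ==> 0 < Zsum t n"
 unfolding Zsum_def using words_nonempty by (intro sum_pos) (simp_all add: phi_pos)

lemma Zsum_mult:
 assumes t: "0 <= t" "t <= real CARD('d)"
 shows "Zsum t (m + n) <= svf_const (CARD('d))*Zsum t m*Zsum t n"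
proof -
 have "Zsum t (m + n) = (\<Sum>u\<in>words m. \<Sum>w\<in>words n. phi t (u @ w))" by (simp add: Zsum_def sum_words_add)
 also have "... <= (\<Sum>u\<in>words m. \<Sum>w\<in>words n. svf_const (CARD('d))*phi t u*phi t w)"
  by (intro sum_mono phi_mult t)
 also have "... = svf_const (CARD('d))*Zsum t m*Zsum t n"
  by (simp only: Zsum_def sum_distrib_left[of _ _ "words m"] sum_product)
 finally show ?thesis .
qed

lemma svf_const_pos: "0 < svf_const (CARD('d))"
 using svf_const_ge_1[of "CARD('d)"] by (simp add: Suc_leI)

text \<open>Multiplied by \<open>svf_const\<close>, the partition sums are submultiplicative, so
  Fekete's lemma applies to their logarithms; the constant disappears after division by
  \<open>n\<close>.\<close>

lemma pressure_limit:
 assumes t: "0 <= t" "t <= real CARD('d)"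
 shows "(\<lambda>n. ln (Zsum t n)/n) \<longlonglongrightarrow> pressure A t"
  and "\<And>n. n > 0 ==> pressure A t <= ln (svf_const (CARD('d))*Zsum t n)/n"
proof -
 let ?C = "svf_const (CARD('d))"
 define a where "a n = ln (?C*Zsum t n)" for n
 have lnC: "0 <= ln ?C" using svf_const_ge_1[of "CARD('d)"] by (simp add: Suc_leI)
 have pos: "0 < ?C*Zsum t n" for n using svf_const_pos Zsum_pos[OF t] by simp
 have a_eq: "a n = ln ?C + ln (Zsum t n)" for n using svf_const_pos Zsum_pos[OF t] by (simp add: a_def ln_mult_pos)
 have "a (m + n) <= a m + a n" for m n
 proof -
  have "?C*Zsum t (m + n) <= (?C*Zsum t m)*(?C*Zsum t n)"
   using mult_left_mono[OF Zsum_mult[OF t, of m n], of ?C] svf_const_pos by (simp add: mult_ac)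
  hence "a (m + n) <= ln ((?C*Zsum t m)*(?C*Zsum t n))"
   unfolding a_def using pos by (subst ln_le_cancel_iff) auto
  also have "... = a m + a n" unfolding a_def by (rule ln_mult_pos[OF pos pos])
  finally show ?thesis .
 qed
 moreover have "- (t*(- ln lower_rate))*real n <= a n" for n
 proof -
  obtain w :: "'n list" where w: "w \<in> words n" using words_nonempty by auto
  have "phi t w <= Zsum t n" unfolding Zsum_def
   by (rule member_le_sum[OF w]) (use phi_pos[OF t] in \<open>auto simp: less_imp_le\<close>)
  hence "ln (phi t w) <= ln (Zsum t n)" using phi_pos[OF t, of w] by simp
  moreover have "- (t*(- ln lower_rate)*real n) <= ln (phi t w)"
   using ln_phi_bound[OF t, of w] w by (simp add: words_def abs_le_iff)
  ultimately show ?thesis using lnC by (simp add: a_eq)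
 qed
 ultimately obtain L where L: "(\<lambda>n. a n/n) \<longlonglongrightarrow> L" "\<forall>n>0. L <= a n/n"
  using fekete[of a "t*(- ln lower_rate)"] by blast
 have "(\<lambda>n. a n/n - ln ?C/n) \<longlonglongrightarrow> L - 0"
  by (intro tendsto_diff L lim_const_over_n)
 hence lim: "(\<lambda>n. ln (Zsum t n)/n) \<longlonglongrightarrow> L" by (simp add: a_eq add_divide_distrib)
 hence "pressure A t = L" unfolding pressure_def Zsum_def phi_def by (rule limI)
 thus "(\<lambda>n. ln (Zsum t n)/n) \<longlonglongrightarrow> pressure A t"
  and "\<And>n. n > 0 ==> pressure A t <= ln (?C*Zsum t n)/n" using lim L(2) by (auto simp: a_def)
qed

lemma pressure_mono:
 assumes "0 <= s" "s <= t" "t <= real CARD('d)"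
 shows "pressure A t <= pressure A s + (t - s)*ln rho" "pressure A s + (t - s)*ln lower_rate <= pressure A t"
proof -
 have s: "s <= real CARD('d)" and t: "0 <= t" using assms by linarith+
 have aux: "ln (x*(b^n) powr (t - s))/n = ln x/n + (t - s)*ln b" if "0 < x" "0 < b" "n > 0" for x b :: real and n :: nat
  using that by (simp add: ln_mult_pos ln_powr ln_realpow add_divide_distrib)
 have "\<forall>\<^sub>F n in sequentially. ln (Zsum t n)/n <= ln (Zsum s n)/n + (t - s)*ln rho"
  using eventually_gt_at_top[of 0]
 proof eventually_elim
  case (elim n)
  have "Zsum t n <= (\<Sum>w\<in>words n. phi s w*(rho^n) powr (t - s))"
   unfolding Zsum_def using phi_le[OF assms] by (intro sum_mono) (metis (mono_tags, lifting) mem_Collect_eq words_def)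
  also have "... = Zsum s n*(rho^n) powr (t - s)" by (simp add: Zsum_def sum_distrib_right)
  finally have "ln (Zsum t n)/n <= ln (Zsum s n*(rho^n) powr (t - s))/n"
   using Zsum_pos[OF t assms(3), of n] by (intro divide_right_mono) (auto simp: ln_mono)
  thus ?case using aux[OF Zsum_pos[OF assms(1) s] rho_pos elim] by simp
 qed
 thus "pressure A t <= pressure A s + (t - s)*ln rho"
  by (rule tendsto_le[OF sequentially_bot tendsto_add[OF pressure_limit(1)[OF assms(1) s] tendsto_const] pressure_limit(1)[OF t assms(3)]])
 have "\<forall>\<^sub>F n in sequentially. ln (Zsum s n)/n + (t - s)*ln lower_rate <= ln (Zsum t n)/n"
  using eventually_gt_at_top[of 0]
 proof eventually_elim
  case (elim n)
  have "Zsum s n*(lower_rate^n) powr (t - s) = (\<Sum>w\<in>words n. phi s w*(lower_rate^n) powr (t - s))"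
   by (simp add: Zsum_def sum_distrib_right)
  also have "... <= Zsum t n"
   unfolding Zsum_def using phi_ge[OF assms] by (intro sum_mono) (metis (mono_tags, lifting) mem_Collect_eq words_def)
  finally have "ln (Zsum s n*(lower_rate^n) powr (t - s))/n <= ln (Zsum t n)/n"
   using Zsum_pos[OF assms(1) s, of n] lower_rate by (intro divide_right_mono) (auto simp: ln_mono)
  thus ?case using aux[OF Zsum_pos[OF assms(1) s] lower_rate(1) elim] by simp
 qed
 thus "pressure A s + (t - s)*ln lower_rate <= pressure A t"
  by (rule tendsto_le[OF sequentially_bot pressure_limit(1)[OF t assms(3)] tendsto_add[OF pressure_limit(1)[OF assms(1) s] tendsto_const]])
qed

lemma pressure_0: "pressure A 0 = ln (CARD('n))"
proof -
 have "(\<lambda>n. ln (Zsum 0 n)/n) \<longlonglongrightarrow> ln (CARD('n))"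
 proof (rule tendsto_eventually)
  show "\<forall>\<^sub>F n in sequentially. ln (Zsum 0 n)/n = ln (CARD('n))"
   using eventually_gt_at_top[of 0] by eventually_elim (simp add: Zsum_def card_words ln_realpow)
 qed
 thus ?thesis using pressure_limit(1)[of 0] LIMSEQ_unique by force
qed

lemma sum_det_powr:
 "(\<Sum>w\<in>words n. \<bar>det (word_mat A w)\<bar> powr x) = (\<Sum>i\<in>UNIV. \<bar>det (A$i)\<bar> powr x)^n"
proof (induction n)
 case (Suc n)
 have "(\<Sum>w\<in>words (Suc n). \<bar>det (word_mat A w)\<bar> powr x) =
   (\<Sum>i\<in>UNIV. \<bar>det (A$i)\<bar> powr x*(\<Sum>w\<in>words n. \<bar>det (word_mat A w)\<bar> powr x))"
  by (simp add: sum_words_Suc det_mul abs_mult powr_mult sum_distrib_left)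
 thus ?case by (simp add: Suc sum_distrib_right)
qed simp

text \<open>From dimension d on, \<open>svf\<close> is a power of the determinant and hence
  multiplicative, so the sum over words is an exact power.\<close>

lemma pressure_ge_d:
 assumes "real CARD('d) <= t"
 shows "pressure A t = ln (\<Sum>i\<in>UNIV. \<bar>det (A$i)\<bar> powr (t/CARD('d)))"
proof -
 let ?S = "\<Sum>i\<in>UNIV. \<bar>det (A$i)\<bar> powr (t/CARD('d))"
 have eq: "svf t (word_mat A w) = \<bar>det (word_mat A w)\<bar> powr (t/CARD('d))" for w
 proof (cases "t = real CARD('d)")
  case True
  thus ?thesis using svf_d[OF invertible_word[of w]] by simp
 qed (use assms in \<open>simp add: svf_def\<close>)
 have "\<bar>det (A$i)\<bar> powr (t/CARD('d)) > 0" for i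
  using invertible_A[of i] by (simp add: invertible_det_nz)
 hence S: "0 < ?S" by (intro sum_pos) auto
 have "(\<lambda>n. ln (\<Sum>w\<in>words n. svf t (word_mat A w))/n) \<longlonglongrightarrow> ln ?S"
 proof (rule tendsto_eventually)
  show "\<forall>\<^sub>F n in sequentially. ln (\<Sum>w\<in>words n. svf t (word_mat A w))/n = ln ?S"
   using eventually_gt_at_top[of 0] by eventually_elim (simp add: eq sum_det_powr ln_realpow)
 qed
 thus ?thesis unfolding pressure_def by (rule limI)
qed

lemma abs_det_le: "\<bar>det (A$i)\<bar> <= rho^CARD('d)"
proof -
 have "(\<Prod>j=1..CARD('d). sval j (A$i)) <= (\<Prod>j=1..CARD('d). rho)"
 proof (intro prod_mono conjI)
  fix j assume "j \<in> {1..CARD('d)}"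
  thus "0 <= sval j (A$i)" "sval j (A$i) <= rho"
   using sval_nonneg sval_le_op_norm[of j "A$i"] op_norm_A_le[of i] by auto
 qed
 thus ?thesis by (simp add: abs_det_eq_prod_sval)
qed

lemma pressure_neg:
 assumes t: "real CARD('d) < t" and det: "(\<Sum>i\<in>UNIV. \<bar>det (A$i)\<bar>) <= 1"
 shows "pressure A t < 0"
proof -
 let ?d = "real CARD('d)"
 have pos: "0 < \<bar>det (A$i)\<bar>" for i using invertible_A[of i] by (simp add: invertible_det_nz)
 have "(\<Sum>i\<in>UNIV. \<bar>det (A$i)\<bar> powr (t/?d)) < (\<Sum>i\<in>UNIV. \<bar>det (A$i)\<bar>)"
 proof (rule sum_strict_mono)
  fix i
  have "\<bar>det (A$i)\<bar> < 1" using abs_det_le[of i] rho_pos contractive power_less_one_iff[of rho "CARD('d)"] by simp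
  moreover have "1 < t/?d" using t by simp
  ultimately have "\<bar>det (A$i)\<bar> powr (t/?d) < \<bar>det (A$i)\<bar> powr 1" using pos[of i] by (intro powr_less_mono') auto
  thus "\<bar>det (A$i)\<bar> powr (t/?d) < \<bar>det (A$i)\<bar>" by simp
 qed auto
 also note det
 finally have 1: "(\<Sum>i\<in>UNIV. \<bar>det (A$i)\<bar> powr (t/?d)) < 1" .
 have "0 < (\<Sum>i\<in>UNIV. \<bar>det (A$i)\<bar> powr (t/?d))" using pos by (intro sum_pos) (auto simp: less_imp_neq[symmetric])
 with 1 show ?thesis using t by (simp add: pressure_ge_d)
qed

text \<open>The pressure is Lipschitz on [0, d], positive at 0 because there are at least two
  symbols, and at most 0 at d by the determinant condition. It decreases strictly on [0, d] and is
  negative beyond, so the definite description in \<open>dim_aff\<close> denotes the only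
  zero.\<close>

lemma dim_aff_root:
 assumes det: "(\<Sum>i\<in>UNIV. \<bar>det (A$i)\<bar>) <= 1" and N: "CARD('n) >= 2"
 shows "0 < dim_aff A" "dim_aff A <= real CARD('d)" "pressure A (dim_aff A) = 0"
proof -
 let ?d = "real CARD('d)"
 have lr: "ln rho < 0" using rho_pos contractive by simp
 have pd: "pressure A ?d <= 0"
 proof -
  have "0 < (\<Sum>i\<in>UNIV. \<bar>det (A$i)\<bar>)"
   using invertible_A by (intro sum_pos) (auto simp: invertible_det_nz)
  thus ?thesis using det by (simp add: pressure_ge_d)
 qed
 have p0: "0 < pressure A 0" using N by (simp add: pressure_0)
 have "(- ln lower_rate)-lipschitz_on {0..?d} (pressure A)"
 proof (rule lipschitz_onI)
  have *: "dist (pressure A s) (pressure A t) <= - ln lower_rate*dist s t" if "0 <= s" "s <= t" "t <= ?d" for s t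
  proof -
   have "(t - s)*ln rho <= 0" using that lr by (intro mult_nonneg_nonpos) auto
   thus ?thesis using pressure_mono[OF that] that by (simp add: dist_real_def abs_le_iff algebra_simps)
  qed
  fix s t assume "s \<in> {0..?d}" "t \<in> {0..?d}"
  thus "dist (pressure A s) (pressure A t) <= - ln lower_rate*dist s t"
   using *[of s t] *[of t s] by (cases "s <= t") (auto simp: dist_commute)
 qed (use lower_rate in simp)
 hence "continuous_on {0..?d} (pressure A)" by (rule lipschitz_on_continuous_on)
 then obtain s where s: "0 <= s" "s <= ?d" "pressure A s = 0"
  using IVT2'[of "pressure A" ?d 0 0] pd p0 by auto
 have uniq: "t = s" if t: "0 <= t" "pressure A t = 0" for t
 proof -
  have td: "t <= ?d" using pressure_neg[OF _ det, of t] t by (cases "t <= ?d") auto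
  consider "s < t" | "t < s" | "s = t" by linarith
  thus ?thesis
  proof cases
   case 1
   thus ?thesis using pressure_mono(1)[of s t] s t td lr mult_pos_neg[of "t - s" "ln rho"] by simp
  next
   case 2
   thus ?thesis using pressure_mono(1)[of t s] s t lr mult_pos_neg[of "s - t" "ln rho"] by simp
  qed simp
 qed
 have "(THE s. 0 <= s \<and> pressure A s = 0) = s"
 proof (rule the_equality)
  show "0 <= s \<and> pressure A s = 0" using s by simp
  show "t = s" if "0 <= t \<and> pressure A t = 0" for t using uniq[of t] that by blast
 qed
 hence d: "dim_aff A = s" using s by (simp add: dim_aff_def)
 have "s \<noteq> 0" using s(3) p0 by auto
 thus "0 < dim_aff A" "dim_aff A <= ?d" "pressure A (dim_aff A) = 0" using s d by auto
qed

end

section \<open>Lyapunov exponents of ergodic measures\<close>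

locale ergodic_cocycle = contractive_tuple A + ergodic_shift \<nu>
 for A :: "real^'d^'d^'n" and \<nu> :: "'n stream measure"
begin

lemma phi_growth:
 assumes t: "0 <= t" "t <= real CARD('d)"
 shows "\<exists>c. (AE \<xi> in \<nu>. (\<lambda>n. ln (phi t (stake n \<xi>))/n) \<longlonglongrightarrow> c) \<and>
  (\<lambda>n. (\<Sum>w\<in>words n. prob (cylinder w)*ln (phi t w))/n) \<longlonglongrightarrow> c"
proof -
 have "\<exists>c. (AE \<xi> in \<nu>. (\<lambda>n. ln (phi t (stake n \<xi>))/n) \<longlonglongrightarrow> c) \<and>
   (\<lambda>n. expectation (\<lambda>\<xi>. ln (phi t (stake n \<xi>)))/n) \<longlonglongrightarrow> c"
 proof (rule kingman)
  show "(\<lambda>\<xi>. ln (phi t (stake n \<xi>))) \<in> borel_measurable \<nu>" for n by (rule fun_stake_measurable)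
  show "\<bar>ln (phi t (stake n \<xi>))\<bar> <= t*(- ln lower_rate)*real n" for n \<xi>
   using ln_phi_bound[OF t, of "stake n \<xi>"] by simp
  show "ln (phi t (stake (m + n) \<xi>)) <= ln (phi t (stake m \<xi>)) + ln (phi t (stake n ((stl ^^ m) \<xi>))) + ln (svf_const (CARD('d)))"
   for m n \<xi>
  proof -
   have "phi t (stake m \<xi> @ stake n (sdrop m \<xi>)) <= svf_const (CARD('d))*phi t (stake m \<xi>)*phi t (stake n (sdrop m \<xi>))"
    by (rule phi_mult[OF t])
   hence "ln (phi t (stake (m + n) \<xi>)) <= ln (svf_const (CARD('d))*phi t (stake m \<xi>)*phi t (stake n (sdrop m \<xi>)))"
    using phi_pos[OF t] by (simp add: ln_mono)
   also have "... = ln (svf_const (CARD('d))) + ln (phi t (stake m \<xi>)) + ln (phi t (stake n (sdrop m \<xi>)))"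
    using phi_pos[OF t] svf_const_pos by (simp add: ln_mult_pos)
   finally show ?thesis by (simp add: funpow_stl)
  qed
 qed
 thus ?thesis unfolding expectation_stake[of "\<lambda>w. ln (phi t w)"] .
qed

text \<open>The \<open>k\<close>-th singular value is the quotient of \<open>svf k\<close> and
  \<open>svf (k - 1)\<close>, and both have growth rates by Kingman's theorem. Uniqueness of the
  limit makes the definite description in \<open>lyapunov_exponent\<close> meaningful.\<close>

lemma lyapunov_AE:
 assumes k: "1 <= k" "k <= CARD('d)"
 shows "AE \<xi> in \<nu>. (\<lambda>n. - (ln (sval k (word_mat A (stake n \<xi>)))/n)) \<longlonglongrightarrow> lyapunov_exponent A \<nu> k"
proof -
 have k1: "real (k - 1) <= real CARD('d)" "real k <= real CARD('d)" using k by auto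
 obtain a where a: "AE \<xi> in \<nu>. (\<lambda>n. ln (phi (real k) (stake n \<xi>))/n) \<longlonglongrightarrow> a" using phi_growth[of "real k"] k1 by auto
 obtain b where b: "AE \<xi> in \<nu>. (\<lambda>n. ln (phi (real (k - 1)) (stake n \<xi>))/n) \<longlonglongrightarrow> b" using phi_growth[of "real (k - 1)"] k1 by auto
 have eq: "ln (sval k (word_mat A w)) = ln (phi (real k) w) - ln (phi (real (k - 1)) w)" for w
 proof -
  have "phi (real k) w = (\<Prod>j=1..k. sval j (word_mat A w))"
   unfolding phi_def by (rule svf_nat) (use k in auto)
  also have "... = (\<Prod>j=1..k - 1. sval j (word_mat A w)) * sval k (word_mat A w)"
   using k by (cases k) (simp_all add: prod.nat_ivl_Suc')
  also have "(\<Prod>j=1..k - 1. sval j (word_mat A w)) = phi (real (k - 1)) w"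
   unfolding phi_def by (rule svf_nat[symmetric]) (use k in auto)
  finally show ?thesis using phi_pos[of "real (k - 1)" w] sval_pos[OF invertible_word k] k1 by (simp add: ln_mult_pos)
 qed
 have AE: "AE \<xi> in \<nu>. (\<lambda>n. - (ln (sval k (word_mat A (stake n \<xi>)))/n)) \<longlonglongrightarrow> b - a"
  using a b
 proof eventually_elim
  case (elim \<xi>)
  from tendsto_diff[OF elim(2,1)] show ?case by (simp add: eq diff_divide_distrib)
 qed
 have "lyapunov_exponent A \<nu> k = b - a" unfolding lyapunov_exponent_def
 proof (rule the_equality)
  show "AE \<xi> in \<nu>. (\<lambda>n. - (ln (sval k (word_mat A (stake n \<xi>)))/n)) \<longlonglongrightarrow> b - a" by (rule AE)
  fix c assume "AE \<xi> in \<nu>. (\<lambda>n. - (ln (sval k (word_mat A (stake n \<xi>)))/n)) \<longlonglongrightarrow> c"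
  with AE have "AE \<xi> in \<nu>. c = b - a" by eventually_elim (rule LIMSEQ_unique)
  thus "c = b - a" by simp
 qed
 thus ?thesis using AE by simp
qed

lemma lyapunov_bounds:
 assumes k: "1 <= k" "k <= CARD('d)"
 shows "- ln rho <= lyapunov_exponent A \<nu> k"
proof -
 have "AE \<xi> in \<nu>. - ln rho <= lyapunov_exponent A \<nu> k"
  using lyapunov_AE[OF k]
 proof eventually_elim
  case (elim \<xi>)
  show ?case
  proof (rule tendsto_lowerbound[OF elim])
   show "\<forall>\<^sub>F n in sequentially. - ln rho <= - (ln (sval k (word_mat A (stake n \<xi>)))/n)"
    using eventually_gt_at_top[of 0]
   proof eventually_elim
    case (elim n)
    have "ln (sval k (word_mat A (stake n \<xi>))) <= ln (rho^n)"
     using sval_word_bounds(2)[OF k, of "stake n \<xi>"] sval_pos[OF invertible_word k] by (simp add: ln_mono)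
    also have "... = n*ln rho" using rho_pos by (simp add: ln_realpow)
    finally show ?case using elim by (simp add: field_simps)
   qed
  qed simp
 qed
 thus ?thesis by simp
qed

lemma lyapunov_pos: "1 <= k ==> k <= CARD('d) ==> 0 < lyapunov_exponent A \<nu> k"
 using lyapunov_bounds[of k] rho_pos contractive ln_less_zero[of rho] by linarith

lemma lyapunov_mono:
 assumes "1 <= j" "j <= k" "k <= CARD('d)"
 shows "lyapunov_exponent A \<nu> j <= lyapunov_exponent A \<nu> k"
proof -
 have jk: "j <= CARD('d)" "1 <= k" using assms by auto
 have "AE \<xi> in \<nu>. lyapunov_exponent A \<nu> j <= lyapunov_exponent A \<nu> k"
  using lyapunov_AE[OF assms(1) jk(1)] lyapunov_AE[OF jk(2) assms(3)]
 proof eventually_elim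
  case (elim \<xi>)
  show ?case
  proof (rule tendsto_le[OF _ elim(2,1)])
   show "\<forall>\<^sub>F n in sequentially. - (ln (sval j (word_mat A (stake n \<xi>)))/n) <= - (ln (sval k (word_mat A (stake n \<xi>)))/n)"
    using sval_antimono[OF assms] sval_pos[OF invertible_word jk(2) assms(3)]
    by (intro always_eventually) (auto intro!: divide_right_mono ln_mono)
  qed simp
 qed
 thus ?thesis by simp
qed

text \<open>The exponential decay rate of \<open>phi t\<close> along a typical sequence. Comparing
  it with the entropy decides whether cylinder masses are dominated by \<open>phi t\<close>.\<close>

definition energy_rate :: "real => real" where
 "energy_rate t = (\<Sum>j=1..CARD('d). svexp t j*lyapunov_exponent A \<nu> j)"

lemma phi_rate:
 assumes t: "0 <= t" "t <= real CARD('d)"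
 shows "AE \<xi> in \<nu>. (\<lambda>n. ln (phi t (stake n \<xi>))/n) \<longlonglongrightarrow> - energy_rate t"
  and "(\<lambda>n. (\<Sum>w\<in>words n. prob (cylinder w)*ln (phi t w))/n) \<longlonglongrightarrow> - energy_rate t"
proof -
 have "AE \<xi> in \<nu>. \<forall>k\<in>{1..CARD('d)}. (\<lambda>n. - (ln (sval k (word_mat A (stake n \<xi>)))/n)) \<longlonglongrightarrow> lyapunov_exponent A \<nu> k"
  by (rule AE_finite_allI) (use lyapunov_AE in auto)
 thus 1: "AE \<xi> in \<nu>. (\<lambda>n. ln (phi t (stake n \<xi>))/n) \<longlonglongrightarrow> - energy_rate t"
 proof eventually_elim
  case (elim \<xi>)
  have "ln (phi t w) = (\<Sum>j=1..CARD('d). svexp t j*ln (sval j (word_mat A w)))" for w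
   unfolding phi_def svf_eq_prod[OF invertible_word t] using sval_pos[OF invertible_word]
   by (subst ln_prod) (auto simp: ln_powr less_imp_neq[symmetric])
  hence eq: "ln (phi t (stake n \<xi>))/n = - (\<Sum>j=1..CARD('d). svexp t j*- (ln (sval j (word_mat A (stake n \<xi>)))/n))" for n
   by (simp add: sum_negf sum_divide_distrib)
  show ?case unfolding eq energy_rate_def
   by (intro tendsto_minus tendsto_sum tendsto_mult tendsto_const) (use elim in auto)
 qed
 obtain c where c: "AE \<xi> in \<nu>. (\<lambda>n. ln (phi t (stake n \<xi>))/n) \<longlonglongrightarrow> c"
  "(\<lambda>n. (\<Sum>w\<in>words n. prob (cylinder w)*ln (phi t w))/n) \<longlonglongrightarrow> c" using phi_growth[OF t] by blast
 have "AE \<xi> in \<nu>. c = - energy_rate t" using c(1) 1 by eventually_elim (rule LIMSEQ_unique)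
 thus "(\<lambda>n. (\<Sum>w\<in>words n. prob (cylinder w)*ln (phi t w))/n) \<longlonglongrightarrow> - energy_rate t" using c(2) by simp
qed

text \<open>By \<open>phi_rate\<close> and \<open>sum_svexp_eq\<close> both right-hand sides in the
  definition of an equilibrium state are the same number, so a single equation remains.\<close>

lemma equilibrium_state_iff:
 assumes t: "0 <= t" "t <= real CARD('d)"
 shows "equilibrium_state A t \<nu> \<longleftrightarrow> shift_entropy \<nu> = energy_rate t"
proof -
 have "lim (\<lambda>n. (\<Sum>w\<in>words n. prob (cylinder w)*ln (svf t (word_mat A w)))/real n) = - energy_rate t"
  using phi_rate(2)[OF t] unfolding phi_def by (rule limI)
 moreover have "ergodic_shift_measure \<nu>" by (simp add: ergodic_shift_measure_iff ergodic_shift_axioms)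
 ultimately show ?thesis unfolding equilibrium_state_def energy_rate_def
  by (auto simp: sum_svexp_eq[OF t, unfolded One_nat_def])
qed

end

section \<open>Shift invariant measures from their cylinder weights\<close>

text \<open>The condition on appended letters is Kolmogorov consistency, the one on prepended
  letters is shift invariance.\<close>

definition invariant_weights :: "('n::finite list => real) => bool" where
 "invariant_weights m \<longleftrightarrow> m [] = 1 \<and> (\<forall>w. 0 <= m w) \<and>
   (\<forall>w. (\<Sum>i\<in>UNIV. m (w @ [i])) = m w) \<and> (\<forall>w. (\<Sum>i\<in>UNIV. m (i # w)) = m w)"

lemma invariant_weights_append_le:
 assumes "invariant_weights m" shows "m (w @ [i]) <= m w"
 using assms member_le_sum[of i UNIV "\<lambda>i. m (w @ [i])"] by (simp add: invariant_weights_def)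

lemma invariant_weights_le_1:
 assumes "invariant_weights m" shows "m w <= 1"
proof (induction w rule: rev_induct)
 case (snoc i w)
 thus ?case using invariant_weights_append_le[OF assms, of w i] by simp
qed (use assms in \<open>simp add: invariant_weights_def\<close>)

text \<open>A point of the product assigns to every word the letter that follows it; reading off letters
 along the resulting path gives a stream whose cylinders have the prescribed weights.\<close>

primrec path_word :: "('n list => 'n) => nat => 'n list" where
 "path_word x 0 = []"
| "path_word x (Suc k) = path_word x k @ [x (path_word x k)]"

definition path_stream :: "('n list => 'n) => 'n stream" where
 "path_stream x = to_stream (\<lambda>k. x (path_word x k))"

lemma stake_path_stream: "stake n (path_stream x) = path_word x n"
proof (induction n)
 case (Suc n)
 have nth: "path_stream x !! n = x (path_word x n)" by (simp add: path_stream_def to_stream_def)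
 show ?case unfolding stake_Suc Suc path_word.simps nth ..
qed simp

lemma path_word_eq_iff:
 "path_word x (length w) = w \<longleftrightarrow> (\<forall>k<length w. x (take k w) = w ! k)"
proof (induction w rule: rev_induct)
 case (snoc i w)
 have "(\<forall>k<length w. x (take k (w @ [i])) = (w @ [i]) ! k) \<longleftrightarrow> (\<forall>k<length w. x (take k w) = w ! k)"
  by (auto simp: nth_append)
 thus ?case using snoc by (auto simp: less_Suc_eq)
qed simp

lemma cylinder_disjoint: "length u = length v ==> u \<noteq> v ==> cylinder u \<inter> cylinder v = {}"
 by (auto simp: cylinder_def)

text \<open>Independent letters are drawn for all words at once, each with the conditional law of
  the next letter. Following the path through them realises the conditional laws without a
  construction by successive kernels.\<close>

theorem invariant_weights_measure:
 fixes m :: "'n::finite list => real"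
 assumes m: "invariant_weights m"
 obtains \<nu> where "shift_measure \<nu>" "\<And>w. measure \<nu> (cylinder w) = m w"
proof -
 have nonneg: "0 <= m w" for w using m by (simp add: invariant_weights_def)
 have sum1: "(\<Sum>i\<in>UNIV. m (w @ [i])) = m w" and sum2: "(\<Sum>i\<in>UNIV. m (i # w)) = m w" for w
  using m by (auto simp: invariant_weights_def)
 \<comment> \<open>Where \<open>m w\<close> vanishes the uniform law is an arbitrary default; longer
   words then have weight 0 as well, so the product formula is not affected.\<close>
 define f where "f w i = (if m w = 0 then 1/real CARD('n) else m (w @ [i])/m w)" for w i
 define K where "K w = embed_pmf (f w)" for w
 have K: "pmf (K w) i = f w i" for w i
  unfolding K_def
 proof (rule pmf_embed_pmf)
  show "0 <= f w x" for x by (simp add: f_def nonneg)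
  have "(\<Sum>x\<in>UNIV. f w x) = 1"
   by (cases "m w = 0") (simp_all add: f_def sum1 flip: sum_divide_distrib)
  thus "(\<integral>\<^sup>+ x. ennreal (f w x) \<partial>count_space UNIV) = 1"
   by (simp add: nn_integral_count_space_finite f_def nonneg sum_ennreal)
 qed
 interpret P: product_prob_space "\<lambda>w. measure_pmf (K w)" UNIV
  by (intro product_prob_spaceI prob_space_measure_pmf)
 define X where "X = PiM UNIV (\<lambda>w :: 'n list. measure_pmf (K w))"
 have comp: "(\<lambda>x. x w) \<in> measurable X (count_space UNIV)" for w
 proof -
  have "(\<lambda>x. x w) \<in> measurable X (measure_pmf (K w))" unfolding X_def by (rule measurable_component_singleton) simp
  thus ?thesis by simp
 qed
 have pw: "(\<lambda>x. path_word x k) \<in> measurable X (count_space UNIV)" for k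
 proof (induction k)
  case (Suc k)
  have "(\<lambda>x. x (path_word x k)) \<in> measurable X (count_space UNIV)"
   by (rule measurable_compose_countable[OF comp Suc])
  thus ?case using Suc by simp
 qed simp
 have nx: "(\<lambda>x. x (path_word x k)) \<in> measurable X (count_space UNIV)" for k
  by (rule measurable_compose_countable[OF comp pw])
 have ps: "path_stream \<in> measurable X streamM"
 proof (rule measurable_stream_space2)
  fix k show "(\<lambda>x. path_stream x !! k) \<in> measurable X (count_space UNIV)"
   using nx[of k] by (simp add: path_stream_def to_stream_def)
 qed
 define \<nu> where "\<nu> = distr X streamM path_stream"
 interpret X: prob_space X unfolding X_def by (rule P.P.prob_space_axioms)
 have prob: "prob_space \<nu>" unfolding \<nu>_def by (rule X.prob_space_distr[OF ps])
 have sets: "sets \<nu> = sets streamM" by (simp add: \<nu>_def)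
 have cyl: "emeasure \<nu> (cylinder w) = ennreal (m w)" for w
 proof -
  \<comment> \<open>The event that the path follows \<open>w\<close> fixes the coordinates at the
    proper prefixes of \<open>w\<close>. These are distinct, so its probability is the product of
    the conditional probabilities.\<close>
  define J where "J = (\<lambda>k. take k w) ` {..<length w}"
  have inj: "inj_on (\<lambda>k. take k w) {..<length w}"
   by (rule inj_on_inverseI[where g = length]) simp
  define Y where "Y u = {w ! length u}" for u :: "'n list"
  have "path_stream -` cylinder w \<inter> space X = {x. path_word x (length w) = w}"
   by (auto simp: cylinder_def stake_path_stream X_def space_PiM)
  also have "... = {x. \<forall>u\<in>J. x u \<in> Y u}"
   unfolding path_word_eq_iff by (auto simp: J_def Y_def)
  also have "... = P.emb UNIV J (Pi\<^sub>E J Y)"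
   by (auto simp: prod_emb_def space_PiM)
  finally have eq: "path_stream -` cylinder w \<inter> space X = P.emb UNIV J (Pi\<^sub>E J Y)" .
  have "emeasure \<nu> (cylinder w) = emeasure X (path_stream -` cylinder w \<inter> space X)"
   unfolding \<nu>_def by (rule emeasure_distr[OF ps]) simp
  also have "... = (\<Prod>u\<in>J. emeasure (measure_pmf (K u)) (Y u))"
   unfolding eq unfolding X_def by (rule P.emeasure_PiM_emb) (auto simp: J_def)
  also have "... = (\<Prod>k<length w. emeasure (measure_pmf (K (take k w))) {w ! k})"
   unfolding J_def by (subst prod.reindex[OF inj]) (simp add: Y_def)
  also have "... = (\<Prod>k<length w. ennreal (f (take k w) (w ! k)))"
   by (simp add: emeasure_pmf_single K)
  also have "... = ennreal (\<Prod>k<length w. f (take k w) (w ! k))"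
   by (rule prod_ennreal) (simp add: f_def nonneg)
  also have "(\<Prod>k<length w. f (take k w) (w ! k)) = m w"
  proof (induction w rule: rev_induct)
   case Nil
   thus ?case using m by (simp add: invariant_weights_def)
  next
   case (snoc i w)
   have "(\<Prod>k<length (w @ [i]). f (take k (w @ [i])) ((w @ [i]) ! k)) = (\<Prod>k<length w. f (take k w) (w ! k))*f w i"
    by (simp add: nth_append)
   also have "... = m w*f w i" by (simp only: snoc)
   also have "... = m (w @ [i])"
    using invariant_weights_append_le[OF m, of w i] nonneg[of "w @ [i]"] by (simp add: f_def)
   finally show ?case .
  qed
  finally show ?thesis .
 qed
 have stl: "stl \<in> measurable \<nu> \<nu>" by (simp add: measurable_cong_sets[OF sets sets])
 interpret nu: prob_space \<nu> by (rule prob)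
 have "distr \<nu> \<nu> stl = \<nu>"
 proof (rule stream_measure_eqI)
  show "prob_space (distr \<nu> \<nu> stl)" by (rule nu.prob_space_distr[OF stl])
  show "emeasure (distr \<nu> \<nu> stl) (cylinder w) = emeasure \<nu> (cylinder w)" for w
  proof -
   have "emeasure (distr \<nu> \<nu> stl) (cylinder w) = emeasure \<nu> (stl -` cylinder w \<inter> space \<nu>)"
    by (rule emeasure_distr[OF stl]) (simp add: sets)
   also have "stl -` cylinder w \<inter> space \<nu> = (\<Union>i\<in>UNIV. cylinder (i # w))"
    using sets_eq_imp_space_eq[OF sets] by (auto simp: cylinder_def)
   also have "emeasure \<nu> (\<Union>i\<in>UNIV. cylinder (i # w)) = (\<Sum>i\<in>UNIV. emeasure \<nu> (cylinder (i # w)))"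
    by (rule sum_emeasure[symmetric]) (auto simp: sets disjoint_family_on_def cylinder_disjoint)
   also have "... = emeasure \<nu> (cylinder w)"
    by (simp add: cyl sum_ennreal nonneg sum2)
   finally show ?thesis .
  qed
 qed (simp_all add: sets prob)
 hence "shift_measure \<nu>"
  using prob sets by (simp add: shift_measure_def shift_measure_axioms_def)
 moreover have "measure \<nu> (cylinder w) = m w" for w using cyl[of w] nonneg[of w] by (simp add: measure_def)
 ultimately show thesis by (rule that)
qed

lemma (in shift_measure) invariant_weights_cylinder: "invariant_weights (\<lambda>w. prob (cylinder w))"
proof -
 have c0: "cylinder [] = (UNIV :: 'n stream set)" by (simp add: cylinder_def)
 have "(\<Sum>i\<in>UNIV. prob (cylinder (w @ [i]))) = prob (\<Union>i\<in>UNIV. cylinder (w @ [i]))" for w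
  by (rule finite_measure_finite_Union[symmetric]) (auto simp: disjoint_family_on_def cylinder_disjoint)
 moreover have "(\<Union>i\<in>UNIV. cylinder (w @ [i])) = cylinder w" for w :: "'n list"
  by (auto simp: cylinder_def stake_Suc simp del: stake.simps)
 moreover have "(\<Sum>i\<in>UNIV. prob (cylinder (i # w))) = prob (\<Union>i\<in>UNIV. cylinder (i # w))" for w
  by (rule finite_measure_finite_Union[symmetric]) (auto simp: disjoint_family_on_def cylinder_disjoint)
 moreover have "(\<Union>i\<in>UNIV. cylinder (i # w)) = stl -` cylinder w \<inter> space \<nu>" for w
  by (auto simp: cylinder_def)
 moreover have "prob (stl -` cylinder w \<inter> space \<nu>) = prob (cylinder w)" for w
  using measure_distr[OF stl_nu, of "cylinder w"] by (simp add: shift_invariant)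
 ultimately show ?thesis by (simp add: invariant_weights_def c0)
qed

lemma compact_unit_functions: "compact {m :: 'a => real. \<forall>w. m w \<in> {0..1}}"
proof -
 have "compactin (product_topology (\<lambda>i. euclidean) UNIV) (PiE (UNIV :: 'a set) (\<lambda>_. {0..1::real}))"
  unfolding compactin_PiE by auto
 thus ?thesis by (simp add: euclidean_product_topology PiE_UNIV_domain Pi_def)
qed

lemma continuous_on_coordinate: "continuous_on S (\<lambda>m :: 'a => real. m w)"
 by (rule continuous_on_subset[OF continuous_on_product_coordinates]) simp

text \<open>Tychonoff's theorem gives compactness; as the index set is countable, the product is
  first countable and compactness yields convergent subsequences.\<close>

lemma unit_functions_convergent_subseq:
 fixes x :: "nat => 'a::countable => real"
 assumes "\<And>n w. x n w \<in> {0..1}"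
 obtains l r where "strict_mono (r :: nat => nat)" "\<And>w. (\<lambda>k. x (r k) w) \<longlonglongrightarrow> l w" "\<And>w. l w \<in> {0..1}"
proof -
 have "seq_compact {m :: 'a => real. \<forall>w. m w \<in> {0..1}}"
  by (rule compact_imp_seq_compact[OF compact_unit_functions])
 then obtain l r where l: "l \<in> {m. \<forall>w. m w \<in> {0..1}}" "strict_mono r" "(x \<circ> r) \<longlonglongrightarrow> l"
  using assms by (elim seq_compactE[of _ x]) auto
 have "(\<lambda>k. (x \<circ> r) k w) \<longlonglongrightarrow> l w" for w
  using continuous_on_tendsto_compose[OF continuous_on_product_coordinates[of w] l(3)] by simp
 thus thesis using l by (intro that[of r l]) auto
qed

lemma continuous_on_x_ln_x: "continuous_on {0..} (\<lambda>x::real. x*ln x)"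
proof (rule continuous_on_eq_continuous_within[THEN iffD2], rule ballI)
 fix x :: real assume x: "x \<in> {0..}"
 show "continuous (at x within {0..}) (\<lambda>x. x*ln x)"
 proof (cases "x = 0")
  case False
  thus ?thesis by (intro continuous_intros) auto
 next
  case True
  \<comment> \<open>The upper bound is \<open>ln y <= y - 1\<close>; the lower one is the same
    inequality at \<open>1 / sqrt y\<close>.\<close>
  have bound: "\<bar>y*ln y\<bar> <= 2 * sqrt y + y\<^sup>2" if y: "0 <= y" for y :: real
  proof (cases "y = 0")
   case False
   hence y0: "0 < y" using y by simp
   have "ln y <= y - 1" using y0 by (rule ln_le_minus_one)
   hence "y*ln y <= y*(y - 1)" using y by (intro mult_left_mono) auto
   hence 1: "y*ln y <= y\<^sup>2" using y by (simp add: power2_eq_square algebra_simps)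
   have "ln (1/sqrt y) <= 1/sqrt y - 1" using y0 by (intro ln_le_minus_one) simp
   hence "- ln y <= 2*(1/sqrt y)" using y0 by (simp add: ln_div ln_sqrt)
   hence "y*(- ln y) <= y*(2*(1/sqrt y))" using y by (intro mult_left_mono) auto
   also have "... = 2 * sqrt y" using y0 by (simp add: field_simps real_div_sqrt)
   finally have "- (y*ln y) <= 2 * sqrt y" by simp
   with 1 show ?thesis using y by (simp add: abs_le_iff add_increasing add_increasing2)
  qed simp
  have "((\<lambda>y. 2 * sqrt y + y\<^sup>2) \<longlongrightarrow> 2 * sqrt 0 + 0\<^sup>2) (at (0::real) within {0..})"
   by (intro tendsto_intros)
  hence "((\<lambda>y. 2 * sqrt y + y\<^sup>2) \<longlongrightarrow> 0) (at (0::real) within {0..})" by simp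
  hence "((\<lambda>y. y*ln y) \<longlongrightarrow> 0) (at (0::real) within {0..})"
   by (rule Lim_null_comparison[rotated]) (simp add: eventually_at_filter bound)
  thus ?thesis using True by (simp add: continuous_within)
 qed
qed

section \<open>Existence of ergodic equilibrium states\<close>

locale critical_tuple = contractive_tuple A for A :: "real^'d^'d^'n" +
 fixes s :: real
 assumes s: "0 <= s" "s <= real CARD('d)" and critical: "pressure A s = 0"
begin

text \<open>With the constant absorbed the weights are exactly submultiplicative.\<close>

definition Phi :: "'n list => real" where
 "Phi w = svf_const (CARD('d))*phi s w"

lemma Phi_pos: "0 < Phi w"
 unfolding Phi_def using svf_const_pos phi_pos[OF s] by simp

lemma ln_Phi_append: "ln (Phi (u @ v)) <= ln (Phi u) + ln (Phi v)"
proof -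
 have "Phi (u @ v) <= Phi u*Phi v"
  using mult_left_mono[OF phi_mult[OF s, of u v], of "svf_const (CARD('d))"] svf_const_pos
  by (simp add: Phi_def mult_ac)
 hence "ln (Phi (u @ v)) <= ln (Phi u*Phi v)" using Phi_pos by (subst ln_le_cancel_iff) auto
 thus ?thesis using Phi_pos by (simp add: ln_mult_pos)
qed

definition lC :: real where "lC = ln (svf_const (CARD('d)))"

lemma lC_nonneg: "0 <= lC"
 unfolding lC_def using svf_const_ge_1[of "CARD('d)"] by (simp add: Suc_leI)

lemma phi_le_1: "phi s w <= 1"
proof -
 have "phi s w <= (rho^length w) powr s" by (rule phi_le_rho[OF s])
 also have "... <= 1 powr s" using rho_pos contractive s by (intro powr_mono2) (auto intro: power_le_one)
 finally show ?thesis by simp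
qed

lemma ln_Phi_eq: "ln (Phi w) = lC + ln (phi s w)"
 unfolding Phi_def lC_def using svf_const_pos phi_pos[OF s, of w] by (simp add: ln_mult_pos)

lemma ln_Phi_le: "ln (Phi w) <= lC"
 using phi_le_1[of w] phi_pos[OF s, of w] by (simp add: ln_Phi_eq)

lemma ln_Phi_pieces:
 "J*n <= length w ==> ln (Phi w) <= lC + (\<Sum>j<J. ln (Phi (take n (drop (j*n) w))))"
proof (induction J arbitrary: w)
 case (Suc J)
 have "J*n <= length (drop n w)" using Suc.prems by simp
 note IH = Suc.IH[OF this]
 have "ln (Phi (take n w @ drop n w)) <= ln (Phi (take n w)) + ln (Phi (drop n w))" by (rule ln_Phi_append)
 moreover have "(\<Sum>j<Suc J. ln (Phi (take n (drop (j*n) w)))) = ln (Phi (take n w)) + (\<Sum>j<J. ln (Phi (take n (drop (j*n) (drop n w)))))"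
  by (subst sum.lessThan_Suc_shift) (simp add: add.commute)
 ultimately show ?case using IH by simp
qed (use ln_Phi_le in simp)

section \<open>Averages of finite Gibbs weights over positions\<close>

definition wt :: "nat => 'n list => real" where "wt N w = phi s w/Zsum s N"

lemma wt_pos: "0 < wt N w"
 unfolding wt_def using phi_pos[OF s] Zsum_pos[OF s] by simp

lemma sum_wt: "(\<Sum>w\<in>words N. wt N w) = 1"
 using Zsum_pos[OF s, of N] by (simp add: wt_def Zsum_def flip: sum_divide_distrib)

definition occ :: "nat => nat => 'n list => real" where
 "occ N k u = (\<Sum>w\<in>words N. if take (length u) (drop k w) = u then wt N w else 0)"

lemma occ_bounds: "0 <= occ N k u" "occ N k u <= 1"
proof -
 show "0 <= occ N k u" unfolding occ_def using wt_pos by (intro sum_nonneg) (auto simp: less_imp_le)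
 have "occ N k u <= (\<Sum>w\<in>words N. wt N w)" unfolding occ_def using wt_pos by (intro sum_mono) (auto simp: less_imp_le)
 thus "occ N k u <= 1" by (simp add: sum_wt)
qed

text \<open>The number of available positions depends on \<open>length u\<close>, but the
  denominator is common to all words. Consistency and invariance then fail only by the contribution
  of one boundary position, of size \<open>1 / (N + 1)\<close>.\<close>

definition avg :: "nat => 'n list => real" where
 "avg N u = (\<Sum>k<N + 1 - length u. occ N k u)/(real N + 1)"

lemma avg_bounds: "avg N u \<in> {0..1}"
proof -
 have "(\<Sum>k<N + 1 - length u. occ N k u) <= (\<Sum>k<N + 1 - length u. 1)" by (intro sum_mono occ_bounds)
 also have "... <= real N + 1" by simp
 finally show ?thesis using occ_bounds(1) by (simp add: avg_def sum_nonneg)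
qed

lemma occ_append:
 assumes "k + length u < N"
 shows "(\<Sum>i\<in>UNIV. occ N k (u @ [i])) = occ N k u"
proof -
 have "(\<Sum>i\<in>UNIV. occ N k (u @ [i])) =
   (\<Sum>w\<in>words N. \<Sum>i\<in>UNIV. if take (length (u @ [i])) (drop k w) = u @ [i] then wt N w else 0)"
  unfolding occ_def by (rule sum.swap)
 also have "... = (\<Sum>w\<in>words N. \<Sum>i\<in>UNIV. if i = drop k w ! length u then (if take (length u) (drop k w) = u then wt N w else 0) else 0)"
 proof (intro sum.cong refl)
  fix w :: "'n list" and i assume "w \<in> words N"
  hence "length u < length (drop k w)" using assms by (simp add: words_def)
  from take_Suc_conv_app_nth[OF this]
  show "(if take (length (u @ [i])) (drop k w) = u @ [i] then wt N w else 0) =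
    (if i = drop k w ! length u then (if take (length u) (drop k w) = u then wt N w else 0) else 0)" by auto
 qed
 finally show ?thesis by (simp add: occ_def)
qed

lemma occ_Cons:
 assumes "k + length u < N"
 shows "(\<Sum>i\<in>UNIV. occ N k (i # u)) = occ N (Suc k) u"
proof -
 have "(\<Sum>i\<in>UNIV. occ N k (i # u)) =
   (\<Sum>w\<in>words N. \<Sum>i\<in>UNIV. if take (length (i # u)) (drop k w) = i # u then wt N w else 0)"
  unfolding occ_def by (rule sum.swap)
 also have "... = (\<Sum>w\<in>words N. \<Sum>i\<in>UNIV. if i = w ! k then (if take (length u) (drop (Suc k) w) = u then wt N w else 0) else 0)"
 proof (intro sum.cong refl)
  fix w :: "'n list" and i assume "w \<in> words N"
  hence "k < length w" using assms by (simp add: words_def)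
  hence "drop k w = w ! k # drop (Suc k) w" by (rule Cons_nth_drop_Suc[symmetric])
  thus "(if take (length (i # u)) (drop k w) = i # u then wt N w else 0) =
    (if i = w ! k then (if take (length u) (drop (Suc k) w) = u then wt N w else 0) else 0)" by auto
 qed
 finally show ?thesis by (simp add: occ_def)
qed

lemma avg_append:
 assumes "length u < N"
 shows "\<bar>(\<Sum>i\<in>UNIV. avg N (u @ [i])) - avg N u\<bar> <= 1/(real N + 1)"
  and "\<bar>(\<Sum>i\<in>UNIV. avg N (i # u)) - avg N u\<bar> <= 1/(real N + 1)"
proof -
 let ?l = "length u"
 have l: "N + 1 - ?l = Suc (N - ?l)" using assms by simp
 have "(\<Sum>i\<in>UNIV. avg N (u @ [i])) = (\<Sum>k<N - ?l. \<Sum>i\<in>UNIV. occ N k (u @ [i]))/(real N + 1)"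
  unfolding avg_def by (subst sum.swap) (simp add: sum_divide_distrib)
 also have "... = (\<Sum>k<N - ?l. occ N k u)/(real N + 1)"
  by (intro arg_cong2[where f = "(/)"] sum.cong refl occ_append) auto
 finally have "(\<Sum>i\<in>UNIV. avg N (u @ [i])) - avg N u = - (occ N (N - ?l) u/(real N + 1))"
  unfolding avg_def l by (simp add: add_divide_distrib)
 thus "\<bar>(\<Sum>i\<in>UNIV. avg N (u @ [i])) - avg N u\<bar> <= 1/(real N + 1)"
  using occ_bounds[of N "N - ?l" u] by (simp add: divide_right_mono)
 have "(\<Sum>i\<in>UNIV. avg N (i # u)) = (\<Sum>k<N - ?l. \<Sum>i\<in>UNIV. occ N k (i # u))/(real N + 1)"
  unfolding avg_def by (subst sum.swap) (simp add: sum_divide_distrib)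
 also have "... = (\<Sum>k<N - ?l. occ N (Suc k) u)/(real N + 1)"
  by (intro arg_cong2[where f = "(/)"] sum.cong refl occ_Cons) auto
 finally have "(\<Sum>i\<in>UNIV. avg N (i # u)) - avg N u = - (occ N 0 u/(real N + 1))"
  unfolding avg_def l sum.lessThan_Suc_shift by (simp add: add_divide_distrib)
 thus "\<bar>(\<Sum>i\<in>UNIV. avg N (i # u)) - avg N u\<bar> <= 1/(real N + 1)"
  using occ_bounds[of N 0 u] by (simp add: divide_right_mono)
qed

text \<open>Free energy at level \<open>n\<close>: entropy of the \<open>n\<close>-blocks plus the
  mean of \<open>ln (Phi w)\<close>. Using \<open>Phi\<close> instead of \<open>phi\<close> makes it
  subadditive in \<open>n\<close> for invariant measures.\<close>

definition score :: "nat => ('n list => real) => real" where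
 "score n m = (\<Sum>w\<in>words n. m w*(ln (Phi w) - ln (m w)))"

text \<open>Product weights of \<open>J\<close> independent blocks of length \<open>n\<close> with
  law \<open>m\<close>, followed by uniform letters that fill the rest of the word.\<close>

definition tile :: "('n list => real) => nat => nat => 'n list => real" where
 "tile m n J w = (\<Prod>j<J. m (take n (drop (j*n) w)))*(1/real CARD('n))^(length w - J*n)"

lemma sum_const_words: "(\<Sum>w\<in>(words N :: 'n list set). (1/real CARD('n))^N) = 1"
 by (simp add: card_words power_divide)

lemma sum_tile_le:
 assumes m: "\<And>u. 0 <= m u" "(\<Sum>u\<in>words n. m u) <= 1"
 shows "J*n <= N ==> (\<Sum>w\<in>words N. tile m n J w) <= 1"
proof (induction J arbitrary: N)
 case 0
 have "(\<Sum>w\<in>words N. tile m n 0 w) = (\<Sum>w\<in>(words N :: 'n list set). (1/real CARD('n))^N)"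
  by (intro sum.cong refl) (simp add: tile_def words_def)
 thus ?case by (simp only: sum_const_words)
next
 case (Suc J)
 hence n: "n <= N" by simp
 have "(\<Sum>w\<in>words N. tile m n (Suc J) w) = (\<Sum>w\<in>words N. m (take n w)*tile m n J (drop n w))"
 proof (intro sum.cong refl)
  fix w :: "'n list" assume "w \<in> words N"
  show "tile m n (Suc J) w = m (take n w)*tile m n J (drop n w)"
   unfolding tile_def by (subst prod.lessThan_Suc_shift) (simp add: add.commute)
 qed
 also have "... = (\<Sum>u\<in>words n. m u)*(\<Sum>v\<in>words (N - n). tile m n J v)" by (rule sum_words_split[OF n])
 also have "... <= 1*1"
  using Suc m by (intro mult_mono) (auto intro!: sum_nonneg mult_nonneg_nonneg prod_nonneg simp: tile_def)
 finally show ?case by simp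
qed

lemma avg_pos: "w \<in> words N ==> k + n <= N ==> 0 < avg N (take n (drop k w))"
proof -
 assume w: "w \<in> words N" and k: "k + n <= N"
 let ?u = "take n (drop k w)"
 have len: "length ?u = n" using w k by (simp add: words_def)
 have "wt N w <= occ N k ?u" unfolding occ_def len
  using w wt_pos[of N] member_le_sum[of w "words N" "\<lambda>x. if take n (drop k x) = ?u then wt N x else 0"]
  by (auto simp: less_imp_le)
 hence "0 < occ N k ?u" using wt_pos[of N w] by linarith
 also have "occ N k ?u <= (\<Sum>k<N + 1 - length ?u. occ N k ?u)"
  unfolding len using k by (intro member_le_sum) (auto simp: occ_bounds)
 finally show ?thesis by (simp add: avg_def)
qed

lemma sum_avg_le: "(\<Sum>u\<in>words n. avg N u) <= 1"
proof -
 have one: "(\<Sum>u\<in>words n. occ N k u) = 1" if "k + n <= N" for k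
 proof -
  have "(\<Sum>u\<in>words n. occ N k u) = (\<Sum>u\<in>words n. \<Sum>w\<in>words N. if take n (drop k w) = u then wt N w else 0)"
   unfolding occ_def by (intro sum.cong refl) (simp add: words_def)
  also have "... = (\<Sum>w\<in>words N. \<Sum>u\<in>words n. if take n (drop k w) = u then wt N w else 0)" by (rule sum.swap)
  also have "... = (\<Sum>w\<in>words N. wt N w)"
  proof (intro sum.cong refl)
   fix w :: "'n list" assume "w \<in> words N"
   hence "take n (drop k w) \<in> words n" using that by (simp add: words_def)
   thus "(\<Sum>u\<in>words n. if take n (drop k w) = u then wt N w else 0) = wt N w" by simp
  qed
  finally show ?thesis by (simp add: sum_wt)
 qed
 have "(\<Sum>u\<in>words n. avg N u) = (\<Sum>u\<in>words n. (\<Sum>k<N + 1 - n. occ N k u)/(real N + 1))"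
  unfolding avg_def by (intro sum.cong refl) (simp add: words_def)
 also have "... = (\<Sum>k<N + 1 - n. \<Sum>u\<in>words n. occ N k u)/(real N + 1)"
  by (subst sum.swap) (simp add: sum_divide_distrib)
 also have "(\<Sum>k<N + 1 - n. \<Sum>u\<in>words n. occ N k u) = (\<Sum>k<N + 1 - n. 1)"
  by (intro sum.cong refl one) auto
 finally show ?thesis by simp
qed

text \<open>A position \<open>k\<close> is determined by its offset \<open>k mod n\<close> and its
  block number \<open>k div n\<close>; the bounds say that a block of length \<open>n\<close>
  starting there fits into a word of length \<open>N\<close>.\<close>

lemma sum_offsets:
 fixes f :: "nat => real"
 assumes n: "0 < n" "n <= N"
 shows "(\<Sum>r<n. \<Sum>j<(N - r) div n. f (r + j*n)) = (\<Sum>k<N + 1 - n. f k)"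
proof -
 have "(\<Sum>r<n. \<Sum>j<(N - r) div n. f (r + j*n)) = (\<Sum>(r, j)\<in>(SIGMA r:{..<n}. {..<(N - r) div n}). f (r + j*n))"
  by (simp add: sum.Sigma)
 also have "... = (\<Sum>k<N + 1 - n. f k)"
 proof (rule sum.reindex_bij_witness[of _ "\<lambda>k. (k mod n, k div n)" "\<lambda>(r, j). r + j*n"])
  fix a assume "a \<in> (SIGMA r:{..<n}. {..<(N - r) div n})"
  then obtain r j where a: "a = (r, j)" "r < n" "j < (N - r) div n" by auto
  have "Suc j*n <= N - r"
  proof -
   have "Suc j*n <= (N - r) div n*n" using a(3) by (intro mult_right_mono) auto
   also have "... <= N - r" by (rule div_times_less_eq_dividend)
   finally show ?thesis .
  qed
  hence "j*n + n <= N - r" by simp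
  thus "(\<lambda>(r, j). r + j*n) a \<in> {..<N + 1 - n}" using a n by simp
  show "((\<lambda>(r, j). r + j*n) a mod n, (\<lambda>(r, j). r + j*n) a div n) = a" using a n by simp
 next
  fix k assume k: "k \<in> {..<N + 1 - n}"
  show "(\<lambda>(r, j). r + j*n) (k mod n, k div n) = k" by simp
  have "k div n*n + k mod n = k" by simp
  hence "k div n*n + n <= N - k mod n" using k n by (simp only: lessThan_iff)
  hence "Suc (k div n)*n <= N - k mod n" by simp
  hence "Suc (k div n) <= (N - k mod n) div n" using n by (simp add: less_eq_div_iff_mult_less_eq)
  thus "(k mod n, k div n) \<in> (SIGMA r:{..<n}. {..<(N - r) div n})" using n by auto
 qed auto
 finally show ?thesis .
qed

text \<open>Misiurewicz's argument for the variational principle. For each offset \<open>r\<close>,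
  Gibbs' inequality compares the weights \<open>wt N\<close> with the product weights on blocks
  starting at \<open>r\<close>, \<open>r + n\<close> and so on; summing over the \<open>n\<close>
  offsets reaches every position once and produces the averaged weights. At most
  \<open>2 * n\<close> letters stay outside the blocks, and cutting \<open>Phi\<close> costs at most
  \<open>2 * lC\<close>.\<close>

lemma score_avg_lower:
 assumes n: "0 < n" "n <= N"
 shows "n*ln (Zsum s N) - n*(2*lC + 2*n*ln (CARD('n))) <= (real N + 1) * score n (avg N)"
proof -
 let ?c = "1/real CARD('n)"
 define \<psi> where "\<psi> u = ln (Phi u) - ln (avg N u)" for u
 have lnc: "0 <= ln (CARD('n))" by (simp add: Suc_leI)
 have per_r: "ln (Zsum s N) <= 2*lC + 2*n*ln (CARD('n)) +
   (\<Sum>w\<in>words N. wt N w*(\<Sum>j<(N - r) div n. \<psi> (take n (drop (r + j*n) w))))" if r: "r < n" for r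
 proof -
  define J where "J = (N - r) div n"
  have J: "J*n <= N - r" unfolding J_def by (rule div_times_less_eq_dividend)
  have rJ: "r <= N" using r n by simp
  define q where "q w = ?c^r*tile (avg N) n J (drop r w)" for w
  have pos: "0 < avg N (take n (drop (r + j*n) w))" if "w \<in> words N" "j < J" for w j
  proof (rule avg_pos[OF that(1)])
   have "Suc j*n <= J*n" using that(2) by (intro mult_right_mono) auto
   thus "r + j*n + n <= N" using J rJ by simp
  qed
  have lnq: "ln (Phi w) - ln (q w) <= 2*lC + 2*n*ln (CARD('n)) + (\<Sum>j<J. \<psi> (take n (drop (r + j*n) w)))"
   and qpos: "0 < q w" if w: "w \<in> words N" for w
  proof -
   have prod: "0 < (\<Prod>j<J. avg N (take n (drop (r + j*n) w)))" using pos[OF w] by (intro prod_pos) auto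
   have q: "q w = ?c^r*((\<Prod>j<J. avg N (take n (drop (r + j*n) w)))*?c^(N - r - J*n))"
    using w by (simp add: q_def tile_def words_def add.commute)
   show "0 < q w" unfolding q using prod by simp
   have "ln (q w) = r*ln ?c + ((\<Sum>j<J. ln (avg N (take n (drop (r + j*n) w)))) + (N - r - J*n)*ln ?c)"
    unfolding q using prod pos[OF w] by (simp add: ln_mult_pos ln_realpow ln_prod[symmetric])
     (subst ln_prod, auto simp: less_imp_neq[symmetric] pos[OF w] ln_div)
   hence 1: "ln (q w) = (\<Sum>j<J. ln (avg N (take n (drop (r + j*n) w)))) - (r + (N - r - J*n))*ln (CARD('n))"
    by (simp add: ln_div algebra_simps)
   have "N - r - J*n < n" using n(1) by (simp add: J_def minus_div_mult_eq_mod)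
   hence "real (r + (N - r - J*n)) <= 2*n" using r by simp
   hence 2: "(r + (N - r - J*n))*ln (CARD('n)) <= 2*n*ln (CARD('n))" using lnc by (rule mult_right_mono)
   have "ln (Phi (take r w @ drop r w)) <= ln (Phi (take r w)) + ln (Phi (drop r w))" by (rule ln_Phi_append)
   moreover have "ln (Phi (take r w)) <= lC" by (rule ln_Phi_le)
   moreover have "ln (Phi (drop r w)) <= lC + (\<Sum>j<J. ln (Phi (take n (drop (j*n) (drop r w)))))"
    by (rule ln_Phi_pieces) (use J w in \<open>simp add: words_def\<close>)
   ultimately have "ln (Phi w) <= 2*lC + (\<Sum>j<J. ln (Phi (take n (drop (r + j*n) w))))"
    by (simp add: add.commute)
   with 1 2 show "ln (Phi w) - ln (q w) <= 2*lC + 2*n*ln (CARD('n)) + (\<Sum>j<J. \<psi> (take n (drop (r + j*n) w)))"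
    by (simp add: \<psi>_def sum_subtractf)
  qed
  have "(\<Sum>w\<in>words N. q w) = (\<Sum>u\<in>(words r :: 'n list set). ?c^r)*(\<Sum>v\<in>words (N - r). tile (avg N) n J v)"
   unfolding q_def by (rule sum_words_split[OF rJ, of "\<lambda>_. ?c^r"])
  also have "... <= 1*1"
   unfolding sum_const_words using avg_bounds sum_avg_le J by (intro mult_left_mono sum_tile_le) auto
  finally have "(\<Sum>w\<in>words N. q w) <= 1" by simp
  hence "(\<Sum>w\<in>words N. wt N w*ln (q w)) - (\<Sum>w\<in>words N. wt N w*ln (wt N w)) <= 0"
   using gibbs_inequality[of "words N" "wt N" q] qpos wt_pos by (auto simp: less_imp_le sum_wt)
  moreover have "(\<Sum>w\<in>words N. wt N w*ln (wt N w)) = (\<Sum>w\<in>words N. wt N w*ln (phi s w)) - ln (Zsum s N)"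
  proof -
   have "ln (wt N w) = ln (phi s w) - ln (Zsum s N)" for w
    unfolding wt_def using phi_pos[OF s, of w] Zsum_pos[OF s, of N] by (simp add: ln_div)
   thus ?thesis by (simp add: right_diff_distrib sum_subtractf sum_wt flip: sum_distrib_right)
  qed
  ultimately have "ln (Zsum s N) <= (\<Sum>w\<in>words N. wt N w*(ln (phi s w) - ln (q w)))"
   by (simp add: right_diff_distrib sum_subtractf)
  also have "... <= (\<Sum>w\<in>words N. wt N w*(2*lC + 2*n*ln (CARD('n)) + (\<Sum>j<J. \<psi> (take n (drop (r + j*n) w)))))"
  proof (intro sum_mono mult_left_mono)
   fix w :: "'n list" assume "w \<in> words N"
   thus "ln (phi s w) - ln (q w) <= 2*lC + 2*n*ln (CARD('n)) + (\<Sum>j<J. \<psi> (take n (drop (r + j*n) w)))"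
    using lnq[of w] lC_nonneg by (simp add: ln_Phi_eq)
  qed (use wt_pos in \<open>simp add: less_imp_le\<close>)
  also have "... = 2*lC + 2*n*ln (CARD('n)) + (\<Sum>w\<in>words N. wt N w*(\<Sum>j<J. \<psi> (take n (drop (r + j*n) w))))"
   by (simp add: distrib_left sum.distrib sum_wt flip: sum_distrib_right)
  finally show ?thesis by (simp add: J_def)
 qed
 have "n*ln (Zsum s N) = (\<Sum>r<n. ln (Zsum s N))" by simp
 also have "... <= (\<Sum>r<n. 2*lC + 2*n*ln (CARD('n)) +
   (\<Sum>w\<in>words N. wt N w*(\<Sum>j<(N - r) div n. \<psi> (take n (drop (r + j*n) w)))))"
  by (intro sum_mono per_r) auto
 also have "... = n*(2*lC + 2*n*ln (CARD('n))) +
   (\<Sum>w\<in>words N. wt N w*(\<Sum>r<n. \<Sum>j<(N - r) div n. \<psi> (take n (drop (r + j*n) w))))"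
  by (subst sum_distrib_left, subst sum.distrib, subst sum.swap) simp
 also have "(\<Sum>w\<in>words N. wt N w*(\<Sum>r<n. \<Sum>j<(N - r) div n. \<psi> (take n (drop (r + j*n) w)))) =
   (\<Sum>w\<in>words N. wt N w*(\<Sum>k<N + 1 - n. \<psi> (take n (drop k w))))"
  by (subst sum_offsets[OF n]) simp
 also have "... = (\<Sum>k<N + 1 - n. \<Sum>w\<in>words N. wt N w*\<psi> (take n (drop k w)))"
  by (subst sum.swap) (simp add: sum_distrib_left)
 also have "... = (\<Sum>k<N + 1 - n. \<Sum>w\<in>words N. \<Sum>u\<in>words n. if take n (drop k w) = u then wt N w*\<psi> u else 0)"
 proof (intro sum.cong refl)
  fix k and w :: "'n list" assume "k \<in> {..<N + 1 - n}" "w \<in> words N"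
  hence "take n (drop k w) \<in> words n" by (simp add: words_def)
  thus "wt N w*\<psi> (take n (drop k w)) = (\<Sum>u\<in>words n. if take n (drop k w) = u then wt N w*\<psi> u else 0)" by simp
 qed
 also have "... = (\<Sum>k<N + 1 - n. \<Sum>u\<in>words n. \<Sum>w\<in>words N. (if take n (drop k w) = u then wt N w else 0)*\<psi> u)"
  by (rule sum.cong[OF refl], subst sum.swap, intro sum.cong refl) auto
 also have "... = (\<Sum>u\<in>words n. \<Sum>k<N + 1 - n. (\<Sum>w\<in>words N. if take n (drop k w) = u then wt N w else 0)*\<psi> u)"
  by (subst sum.swap) (simp add: sum_distrib_right)
 also have "... = (\<Sum>u\<in>words n. (real N + 1)*(avg N u*\<psi> u))"
  by (intro sum.cong refl) (simp add: avg_def occ_def words_def sum_distrib_right)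
 also have "... = (real N + 1) * score n (avg N)"
  by (simp add: score_def \<psi>_def sum_distrib_left)
 finally show ?thesis by simp
qed

text \<open>The limit of \<open>score n / n\<close> is at most 0 when the pressure vanishes, and it
  is a lower bound for all its terms. The invariant weights of maximal, that is zero, free energy
  are thus those with nonnegative scores, and these are closed conditions.\<close>

definition candidates :: "('n list => real) set" where
 "candidates = {m. invariant_weights m \<and> (\<forall>n. 0 <= score n m)}"

lemma continuous_score: "continuous_on {m. \<forall>w. m w \<in> {0..1}} (score n)"
proof -
 have "continuous_on {m :: 'n list => real. \<forall>w. m w \<in> {0..1}} (\<lambda>m. \<Sum>w\<in>words n. m w*ln (Phi w) - m w*ln (m w))"
 proof (intro continuous_on_sum continuous_on_diff continuous_on_mult_right continuous_on_coordinate)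
  fix w :: "'n list"
  show "continuous_on {m :: 'n list => real. \<forall>w. m w \<in> {0..1}} (\<lambda>m. m w*ln (m w))"
   by (rule continuous_on_compose2[OF continuous_on_x_ln_x continuous_on_coordinate]) auto
 qed
 thus ?thesis unfolding score_def[abs_def] right_diff_distrib .
qed

text \<open>A coordinatewise limit of the averaged weights: the boundary defects vanish, and since
  the pressure is 0 the lower bound for the scores tends to 0.\<close>

lemma candidates_nonempty: "candidates \<noteq> {}"
proof -
 obtain m r where r: "strict_mono (r :: nat => nat)" and lim: "\<And>w. (\<lambda>k. avg (r k) w) \<longlonglongrightarrow> m w" and m01: "\<And>w. m w \<in> {0..1}"
  by (rule unit_functions_convergent_subseq[of avg, OF avg_bounds]) (rule that)
 have rk: "filterlim r at_top sequentially" using r by (rule filterlim_subseq)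
 have inv0: "(\<lambda>k. 1/(real (r k) + 1)) \<longlonglongrightarrow> 0"
 proof -
  have "(\<lambda>N. 1/(real N + 1)) \<longlonglongrightarrow> 0" using LIMSEQ_inverse_real_of_nat by (simp add: inverse_eq_divide add.commute)
  thus ?thesis by (rule filterlim_compose[OF _ rk])
 qed
 have big: "\<forall>\<^sub>F k in sequentially. K < r k" for K
 proof -
  have "\<forall>\<^sub>F k in sequentially. Suc K <= r k" using rk unfolding filterlim_at_top by blast
  thus ?thesis by eventually_elim simp
 qed
 have eq: "l = m u" if l: "(\<lambda>k. x (r k)) \<longlonglongrightarrow> l" and d: "\<And>N. length u < N ==> \<bar>x N - avg N u\<bar> <= 1/(real N + 1)" for x l u
 proof -
  have "\<forall>\<^sub>F k in sequentially. norm (x (r k) - avg (r k) u) <= 1/(real (r k) + 1)"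
   using big[of "length u"] by eventually_elim (simp add: d)
  hence "(\<lambda>k. x (r k) - avg (r k) u) \<longlonglongrightarrow> 0" by (rule Lim_null_comparison[OF _ inv0])
  from LIMSEQ_unique[OF this tendsto_diff[OF l lim[of u]]] show ?thesis by simp
 qed
 have "invariant_weights m"
  unfolding invariant_weights_def
 proof (intro conjI allI)
  have "avg N [] = 1" for N by (simp add: avg_def occ_def sum_wt)
  hence "(\<lambda>k. 1) \<longlonglongrightarrow> m []" using lim[of "[]"] by simp
  thus "m [] = 1" by (simp add: LIMSEQ_const_iff)
  show "0 <= m w" for w using m01[of w] by simp
  show "(\<Sum>i\<in>UNIV. m (w @ [i])) = m w" for w
   by (rule eq[of "\<lambda>N. \<Sum>i\<in>UNIV. avg N (w @ [i])"]) (auto intro!: tendsto_sum lim avg_append)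
  show "(\<Sum>i\<in>UNIV. m (i # w)) = m w" for w
   by (rule eq[of "\<lambda>N. \<Sum>i\<in>UNIV. avg N (i # w)"]) (auto intro!: tendsto_sum lim avg_append)
 qed
 moreover have "0 <= score n m" for n
 proof (cases "n = 0")
  case True
  have "0 <= ln (Phi [])" using ln_Phi_append[of "[]" "[]"] by simp
  thus ?thesis using True \<open>invariant_weights m\<close> by (simp add: score_def invariant_weights_def)
 next
  case False
  hence n: "0 < n" by simp
  define D where "D = n*(2*lC + 2*n*ln (CARD('n)))"
  have "(\<lambda>k. \<Sum>w\<in>words n. avg (r k) w*ln (Phi w) - avg (r k) w*ln (avg (r k) w)) \<longlonglongrightarrow>
    (\<Sum>w\<in>words n. m w*ln (Phi w) - m w*ln (m w))"
  proof (intro tendsto_sum tendsto_diff tendsto_mult_right lim)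
   fix w
   show "(\<lambda>k. avg (r k) w*ln (avg (r k) w)) \<longlonglongrightarrow> m w*ln (m w)"
    by (rule continuous_on_tendsto_compose[OF continuous_on_x_ln_x lim]) (use m01 avg_bounds in auto)
  qed
  hence sc: "(\<lambda>k. score n (avg (r k))) \<longlonglongrightarrow> score n m" by (simp add: score_def right_diff_distrib)
  have t1: "(\<lambda>N. ln (Zsum s N)/N) \<longlonglongrightarrow> 0" using pressure_limit(1)[OF s] critical by simp
  have t2: "(\<lambda>N. real N/real (Suc N)) \<longlonglongrightarrow> 1" by (rule LIMSEQ_n_over_Suc_n)
  have t3: "(\<lambda>N. 1/(real N + 1)) \<longlonglongrightarrow> 0" using LIMSEQ_inverse_real_of_nat by (simp add: inverse_eq_divide add.commute)
  have "(\<lambda>N. n*(ln (Zsum s N)/N*(real N/real (Suc N))) - D*(1/(real N + 1))) \<longlonglongrightarrow> real n*(0*1) - D*0"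
   by (intro tendsto_diff tendsto_mult_left tendsto_mult t1 t2 t3)
  hence "(\<lambda>N. n*(ln (Zsum s N)/N*(real N/real (Suc N))) - D*(1/(real N + 1))) \<longlonglongrightarrow> 0" by simp
  hence lo: "(\<lambda>k. n*(ln (Zsum s (r k))/r k*(real (r k)/real (Suc (r k)))) - D*(1/(real (r k) + 1))) \<longlonglongrightarrow> 0"
   by (rule filterlim_compose[OF _ rk])
  show ?thesis
  proof (rule tendsto_le[OF sequentially_bot sc lo])
   show "\<forall>\<^sub>F k in sequentially. n*(ln (Zsum s (r k))/r k*(real (r k)/real (Suc (r k)))) - D*(1/(real (r k) + 1)) <= score n (avg (r k))"
    using big[of n]
   proof eventually_elim
    case (elim k)
    have "n*ln (Zsum s (r k)) - D <= (real (r k) + 1) * score n (avg (r k))"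
     unfolding D_def using score_avg_lower[OF n, of "r k"] elim by simp
    hence "(n*ln (Zsum s (r k)) - D)/(real (r k) + 1) <= score n (avg (r k))"
     by (subst pos_divide_le_eq) (auto simp: mult.commute)
    moreover have "real (r k) \<noteq> 0" using elim by simp
    ultimately show ?case by (simp add: diff_divide_distrib add.commute)
   qed
  qed
 qed
 ultimately show ?thesis by (auto simp: candidates_def)
qed

end

section \<open>Scores of invariant measures and the choice of an ergodic one\<close>

context shift_measure
begin

lemma integrable_stake_sdrop:
 fixes f :: "'n list => real"
 shows "integrable \<nu> (\<lambda>\<xi>. f (stake n (sdrop m \<xi>)))"
proof (rule integrable_const_bound[of _ "Max ((\<lambda>w. \<bar>f w\<bar>) ` words n)"])
 show "AE \<xi> in \<nu>. norm (f (stake n (sdrop m \<xi>))) <= Max ((\<lambda>w. \<bar>f w\<bar>) ` words n)"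
  by (intro AE_I2) (auto intro!: Max_ge)
 have "sdrop m \<in> measurable \<nu> \<nu>" by (simp add: measurable_cong_sets[OF sets_nu sets_nu])
 thus "(\<lambda>\<xi>. f (stake n (sdrop m \<xi>))) \<in> borel_measurable \<nu>"
  by (rule measurable_compose[OF _ fun_stake_measurable])
qed

lemma sum_cylinder_subadditive:
 fixes f :: "'n list => real"
 assumes "\<And>u v. f (u @ v) <= f u + f v"
 shows "(\<Sum>w\<in>words (m + n). prob (cylinder w)*f w) <=
  (\<Sum>w\<in>words m. prob (cylinder w)*f w) + (\<Sum>w\<in>words n. prob (cylinder w)*f w)"
proof -
 have "expectation (\<lambda>\<xi>. f (stake (m + n) \<xi>)) <= expectation (\<lambda>\<xi>. f (stake m \<xi>) + f (stake n (sdrop m \<xi>)))"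
 proof (rule integral_mono)
  show "integrable \<nu> (\<lambda>\<xi>. f (stake (m + n) \<xi>))" using integrable_stake_sdrop[of f "m + n" 0] by simp
  show "integrable \<nu> (\<lambda>\<xi>. f (stake m \<xi>) + f (stake n (sdrop m \<xi>)))"
   using integrable_stake_sdrop[of f m 0] integrable_stake_sdrop[of f n m] by simp
  show "f (stake (m + n) \<xi>) <= f (stake m \<xi>) + f (stake n (sdrop m \<xi>))" for \<xi>
   using assms[of "stake m \<xi>" "stake n (sdrop m \<xi>)"] by simp
 qed
 also have "... = expectation (\<lambda>\<xi>. f (stake m \<xi>)) + expectation (\<lambda>\<xi>. f (stake n (sdrop m \<xi>)))"
  using integrable_stake_sdrop[of f m 0] integrable_stake_sdrop[of f n m]
  by (intro Bochner_Integration.integral_add) simp_all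
 also have "expectation (\<lambda>\<xi>. f (stake n (sdrop m \<xi>))) = expectation (\<lambda>\<xi>. f (stake n \<xi>))"
  by (rule expectation_sdrop[OF fun_stake_measurable])
 finally show ?thesis by (simp only: expectation_stake)
qed

lemma shift_measure_uniform:
 assumes B: "B \<in> sets \<nu>" "stl -` B = B" and pos: "prob B \<noteq> 0"
 shows "shift_measure (uniform_measure \<nu> B)" "C \<in> sets \<nu> ==> measure (uniform_measure \<nu> B) C = prob (B \<inter> C)/prob B"
proof -
 have em: "emeasure \<nu> B \<noteq> 0" using pos by (simp add: emeasure_eq_measure)
 have m: "emeasure (uniform_measure \<nu> B) C = emeasure \<nu> (B \<inter> C)/emeasure \<nu> B" if "C \<in> sets \<nu>" for C
  by (rule emeasure_uniform_measure[OF B(1) that])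
 have stl: "stl \<in> measurable (uniform_measure \<nu> B) (uniform_measure \<nu> B)" using stl_nu by simp
 have "distr (uniform_measure \<nu> B) (uniform_measure \<nu> B) stl = uniform_measure \<nu> B"
 proof (rule measure_eqI)
  fix C assume "C \<in> sets (distr (uniform_measure \<nu> B) (uniform_measure \<nu> B) stl)"
  hence C: "C \<in> sets \<nu>" by simp
  have C': "stl -` C \<in> sets \<nu>" using measurable_sets[OF stl_nu C] by simp
  have BC: "B \<inter> C \<in> sets \<nu>" using B C by simp
  have "emeasure (distr (uniform_measure \<nu> B) (uniform_measure \<nu> B) stl) C = emeasure (uniform_measure \<nu> B) (stl -` C)"
   using emeasure_distr[OF stl, of C] C by simp
  also have "... = emeasure \<nu> (B \<inter> stl -` C)/emeasure \<nu> B" by (rule m[OF C'])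
  also have "B \<inter> stl -` C = stl -` (B \<inter> C) \<inter> space \<nu>" using B(2) by auto
  also have "emeasure \<nu> (stl -` (B \<inter> C) \<inter> space \<nu>) = emeasure \<nu> (B \<inter> C)"
   using emeasure_distr[OF stl_nu BC] by (simp add: shift_invariant)
  also have ".../emeasure \<nu> B = emeasure (uniform_measure \<nu> B) C" by (rule m[OF C, symmetric])
  finally show "emeasure (distr (uniform_measure \<nu> B) (uniform_measure \<nu> B) stl) C = emeasure (uniform_measure \<nu> B) C" .
 qed simp
 moreover have "prob_space (uniform_measure \<nu> B)" using em by (intro prob_space_uniform_measure) simp_all
 ultimately show "shift_measure (uniform_measure \<nu> B)"
  by (simp add: shift_measure_def shift_measure_axioms_def sets_nu)
 show "measure (uniform_measure \<nu> B) C = prob (B \<inter> C)/prob B" if "C \<in> sets \<nu>"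
  using measure_uniform_measure[OF em _ that] by simp
qed

end

context critical_tuple
begin

lemma score_cylinder:
 assumes "shift_measure \<mu>"
 shows "score n (\<lambda>w. measure \<mu> (cylinder w)) = shift_measure.ent \<mu> n + (\<Sum>w\<in>words n. measure \<mu> (cylinder w)*ln (Phi w))"
 unfolding score_def shift_measure.ent_def[OF assms] by (simp add: right_diff_distrib sum_subtractf)

text \<open>Subadditivity gives the limit as an infimum. Gibbs' inequality against the normalised
  weights \<open>Phi\<close> bounds the score by \<open>lC + ln (Zsum s n)\<close>, which is of
  smaller order than \<open>n\<close> at zero pressure.\<close>

lemma score_limit:
 assumes \<mu>: "shift_measure \<mu>"
 obtains L where "(\<lambda>n. score n (\<lambda>w. measure \<mu> (cylinder w))/n) \<longlonglongrightarrow> L"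
  "\<And>n. n > 0 ==> L <= score n (\<lambda>w. measure \<mu> (cylinder w))/n" "L <= 0"
proof -
 interpret shift_measure \<mu> by (rule \<mu>)
 let ?a = "\<lambda>n. score n (\<lambda>w. prob (cylinder w))"
 have sub: "?a (m + n) <= ?a m + ?a n" for m n
  using ent_subadditive[of m n] sum_cylinder_subadditive[of "\<lambda>w. ln (Phi w)" m n, OF ln_Phi_append]
  by (simp add: score_cylinder[OF \<mu>])
 have lower: "- (s*(- ln lower_rate))*real n <= ?a n" for n
 proof -
  have "- (s*(- ln lower_rate))*real n = (\<Sum>w\<in>words n. prob (cylinder w)*(- (s*(- ln lower_rate))*real n))"
   by (simp add: sum_prob_cylinder flip: sum_distrib_right)
  also have "... <= (\<Sum>w\<in>words n. prob (cylinder w)*ln (Phi w))"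
  proof (intro sum_mono mult_left_mono)
   fix w :: "'n list" assume "w \<in> words n"
   thus "- (s*(- ln lower_rate))*real n <= ln (Phi w)"
    using ln_phi_bound[OF s, of w] lC_nonneg by (simp add: ln_Phi_eq words_def abs_le_iff)
  qed simp
  finally show ?thesis using ent_nonneg[of n] by (simp add: score_cylinder[OF \<mu>])
 qed
 obtain L where L: "(\<lambda>n. ?a n/n) \<longlonglongrightarrow> L" "\<forall>n>0. L <= ?a n/n"
  using fekete[of ?a "s*(- ln lower_rate)"] sub lower by blast
 have up: "?a n <= lC + ln (Zsum s n)" for n
 proof -
  define S where "S = svf_const (CARD('d))*Zsum s n"
  have S: "0 < S" using svf_const_pos Zsum_pos[OF s] by (simp add: S_def)
  have sumPhi: "(\<Sum>w\<in>words n. Phi w) = S" by (simp add: S_def Phi_def Zsum_def sum_distrib_left)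
  have "ent n <= - (\<Sum>w\<in>words n. prob (cylinder w)*ln (Phi w/S))"
  proof (rule ent_le)
   show "(\<Sum>w\<in>words n. Phi w/S) <= 1" using sumPhi S by (simp flip: sum_divide_distrib)
  qed (use Phi_pos S in \<open>auto intro!: divide_nonneg_pos divide_pos_pos less_imp_le\<close>)
  also have "(\<Sum>w\<in>words n. prob (cylinder w)*ln (Phi w/S)) = (\<Sum>w\<in>words n. prob (cylinder w)*ln (Phi w)) - ln S"
  proof -
   have "ln (Phi w/S) = ln (Phi w) - ln S" for w using Phi_pos[of w] S by (simp add: ln_div)
   thus ?thesis by (simp only: right_diff_distrib sum_subtractf sum_distrib_right[symmetric] sum_prob_cylinder mult_1_left)
  qed
  finally show ?thesis using svf_const_pos Zsum_pos[OF s, of n] by (simp add: score_cylinder[OF \<mu>] lC_def ln_mult_pos S_def)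
 qed
 have lim0: "(\<lambda>n. lC/n + ln (Zsum s n)/n) \<longlonglongrightarrow> 0 + 0"
  using pressure_limit(1)[OF s] critical by (intro tendsto_add lim_const_over_n) simp
 have "L <= 0 + 0"
  by (rule tendsto_le[OF sequentially_bot lim0 L(1)]) (auto intro!: always_eventually divide_right_mono up simp flip: add_divide_distrib)
 with L show thesis by (intro that[of L]) auto
qed

text \<open>Squares of all cylinder weights, with geometric factors along an enumeration of the
  words: strictly convex because every word occurs, continuous by uniform convergence.\<close>

definition Psi :: "('n list => real) => real" where
 "Psi m = (\<Sum>j. (1/2)^j*(m (from_nat j))\<^sup>2)"

lemma Psi_summable: "(\<And>w. \<bar>m w\<bar> <= 1) ==> summable (\<lambda>j. (1/2)^j*(m (from_nat j :: 'n list))\<^sup>2 :: real)"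
 by (rule summable_comparison_test'[where g = "\<lambda>j. (1/2)^j"])
  (auto simp: abs_mult abs_square_le_1 mult_left_le)

lemma continuous_Psi: "continuous_on {m. \<forall>w. m w \<in> {0..1}} Psi"
proof -
 have "uniform_limit {m :: 'n list => real. \<forall>w. m w \<in> {0..1}} (\<lambda>n m. \<Sum>j<n. (1/2)^j*(m (from_nat j))\<^sup>2)
   (\<lambda>m. suminf (\<lambda>j. (1/2)^j*(m (from_nat j))\<^sup>2)) sequentially"
  by (rule Weierstrass_m_test[where M = "\<lambda>j. (1/2)^j"])
   (auto simp: abs_mult abs_square_le_1 mult_left_le power_le_one)
 moreover have "\<forall>\<^sub>F n in sequentially. continuous_on {m :: 'n list => real. \<forall>w. m w \<in> {0..1}} (\<lambda>m. \<Sum>j<n. (1/2)^j*(m (from_nat j))\<^sup>2)"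
  by (intro always_eventually allI continuous_on_sum continuous_on_mult_left continuous_on_power continuous_on_coordinate)
 ultimately show ?thesis unfolding Psi_def[abs_def] by (intro uniform_limit_theorem) auto
qed

lemma compact_candidates: "compact candidates"
proof -
 let ?U = "{m :: 'n list => real. \<forall>w. m w \<in> {0..1}}"
 have U: "compact ?U" by (rule compact_unit_functions)
 have cl: "closed {m :: 'n list => real. f m = g m}" if "continuous_on UNIV f" "continuous_on UNIV g" for f g :: "_ => real"
  using that by (rule closed_Collect_eq)
 have c: "continuous_on UNIV (\<lambda>m :: 'n list => real. m w)" for w by (rule continuous_on_coordinate)
 have 1: "closed ({m :: 'n list => real. m [] = 1} \<inter> (\<Inter>w. {m. (\<Sum>i\<in>UNIV. m (w @ [i])) = m w}) \<inter> (\<Inter>w. {m. (\<Sum>i\<in>UNIV. m (i # w)) = m w}))"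
  by (intro closed_Int closed_INT ballI cl continuous_on_sum c continuous_on_const)
 have 2: "closed (\<Inter>n. ?U \<inter> score n -` {0..})"
  using continuous_score compact_imp_closed[OF U] by (intro closed_INT ballI continuous_closed_preimage) auto
 have "candidates = ?U \<inter> (({m :: 'n list => real. m [] = 1} \<inter> (\<Inter>w. {m. (\<Sum>i\<in>UNIV. m (w @ [i])) = m w}) \<inter> (\<Inter>w. {m. (\<Sum>i\<in>UNIV. m (i # w)) = m w}))
   \<inter> (\<Inter>n. ?U \<inter> score n -` {0..}))"
  using invariant_weights_le_1 by (auto simp: candidates_def invariant_weights_def)
 also have "compact ..." by (intro compact_Int_closed[OF U] closed_Int[OF 1 2])
 finally show ?thesis .
qed

text \<open>Suppose a maximiser of \<open>Psi\<close> gives an invariant set neither measure 0 nor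
  1. It is then a mixture of its conditional measures on the set and on the complement. Free energy
  is affine in the limit and never positive, so both parts are candidates; strict convexity of
  \<open>Psi\<close> makes them equal, although one lives on the set and the other off it.\<close>

theorem equilibrium_state_exists:
 obtains \<mu> where "equilibrium_state A s \<mu>"
proof -
 have U: "m \<in> candidates ==> m w \<in> {0..1}" for m w
  using invariant_weights_le_1[of m w] by (auto simp: candidates_def invariant_weights_def)
 hence "continuous_on candidates Psi" by (intro continuous_on_subset[OF continuous_Psi]) blast
 then obtain m where m: "m \<in> candidates" "\<And>m'. m' \<in> candidates ==> Psi m' <= Psi m"
  using continuous_attains_sup[OF compact_candidates candidates_nonempty] by blast
 obtain \<nu> where \<nu>: "shift_measure \<nu>" and cyl: "\<And>w. measure \<nu> (cylinder w) = m w"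
  using invariant_weights_measure[of m] m(1) by (auto simp: candidates_def)
 interpret shift_measure \<nu> by (rule \<nu>)
 have score0: "0 <= score n (\<lambda>w. prob (cylinder w))" for n using m(1) by (simp add: cyl candidates_def)
 have erg: "prob B = 0 \<or> prob B = 1" if B: "B \<in> sets \<nu>" "stl -` B = B" for B
 proof (rule ccontr)
  assume "\<not> ?thesis"
  hence b0: "prob B \<noteq> 0" and b1: "prob B \<noteq> 1" by auto
  define D where "D = UNIV - B"
  have D: "D \<in> sets \<nu>" using sets.compl_sets[OF B(1)] by (simp add: D_def)
  have Dinv: "stl -` D = D" using B(2) by (auto simp: D_def)
  have pD: "prob D = 1 - prob B" using prob_compl[OF B(1)] by (simp add: D_def)
  define p where "p = prob B"
  have p: "0 < p" "p < 1" using b0 b1 prob_le_1[of B] measure_nonneg[of \<nu> B] unfolding p_def by linarith+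
  define \<nu>1 where "\<nu>1 = uniform_measure \<nu> B"
  define \<nu>2 where "\<nu>2 = uniform_measure \<nu> D"
  have s1: "shift_measure \<nu>1" unfolding \<nu>1_def using B b0 by (rule shift_measure_uniform)
  have s2: "shift_measure \<nu>2" unfolding \<nu>2_def using D Dinv pD b1 by (intro shift_measure_uniform) auto
  define x where "x w = measure \<nu>1 (cylinder w)" for w
  define y where "y w = measure \<nu>2 (cylinder w)" for w
  have x: "p*x w = prob (B \<inter> cylinder w)" for w
   unfolding x_def \<nu>1_def p_def using shift_measure_uniform(2)[OF B b0, of "cylinder w"] b0 by simp
  have y: "(1 - p)*y w = prob (D \<inter> cylinder w)" for w
   unfolding y_def \<nu>2_def p_def using shift_measure_uniform(2)[OF D Dinv, of "cylinder w"] pD b1 by simp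
  have mix: "m w = p*x w + (1 - p)*y w" for w
  proof -
   have "prob (cylinder w) = prob (B \<inter> cylinder w \<union> D \<inter> cylinder w)"
    by (rule arg_cong[where f = prob]) (auto simp: D_def)
   also have "... = prob (B \<inter> cylinder w) + prob (D \<inter> cylinder w)"
    using B(1) D by (intro finite_measure_Union) (auto simp: D_def)
   finally show ?thesis by (simp add: cyl x y)
  qed
  have x0: "0 <= x w" and y0: "0 <= y w" for w by (auto simp: x_def y_def)
  obtain L1 where L1: "(\<lambda>n. score n x/n) \<longlonglongrightarrow> L1" "\<And>n. n > 0 ==> L1 <= score n x/n" "L1 <= 0"
   using score_limit[OF s1] unfolding x_def by blast
  obtain L2 where L2: "(\<lambda>n. score n y/n) \<longlonglongrightarrow> L2" "\<And>n. n > 0 ==> L2 <= score n y/n" "L2 <= 0"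
   using score_limit[OF s2] unfolding y_def by blast
  \<comment> \<open>The entropy of the two-point distribution. It bounds the excess of the score of
    a mixture over the mixture of the scores, uniformly in \<open>n\<close>.\<close>
  define c where "c = - p*ln p - (1 - p)*ln (1 - p)"
  have sx: "(\<Sum>w\<in>words n. x w) = 1" and sy: "(\<Sum>w\<in>words n. y w) = 1" for n
   unfolding x_def y_def by (rule shift_measure.sum_prob_cylinder[OF s1], rule shift_measure.sum_prob_cylinder[OF s2])
  have mixscore: "score n m <= p * score n x + (1 - p) * score n y + c" for n
  proof -
   have tm: "m w*(ln (Phi w) - ln (m w)) <= p*(x w*(ln (Phi w) - ln (x w))) - p*ln p*x w
     + ((1 - p)*(y w*(ln (Phi w) - ln (y w))) - (1 - p)*ln (1 - p)*y w)" for w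
   proof -
    have *: "q*z*(ln (Phi w) - ln (m w)) <= q*(z*(ln (Phi w) - ln z)) - q*ln q*z"
     if "0 < q" "0 <= z" "q*z <= m w" for q z
    proof (cases "z = 0")
     case False
     hence "0 < q*z" using that by simp
     hence "ln (q*z) <= ln (m w)" using that(3) by simp
     moreover have "ln (q*z) = ln q + ln z" using that False by (intro ln_mult_pos) auto
     ultimately have "q*z*(ln (Phi w) - ln (m w)) <= q*z*(ln (Phi w) - ln z - ln q)"
      using \<open>0 < q * z\<close> by (intro mult_left_mono) auto
     thus ?thesis by (simp add: algebra_simps)
    qed simp
    have "p*x w <= m w" "(1 - p)*y w <= m w" using mix[of w] x0[of w] y0[of w] p by auto
    hence "p*x w*(ln (Phi w) - ln (m w)) + (1 - p)*y w*(ln (Phi w) - ln (m w)) <=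
     p*(x w*(ln (Phi w) - ln (x w))) - p*ln p*x w
     + ((1 - p)*(y w*(ln (Phi w) - ln (y w))) - (1 - p)*ln (1 - p)*y w)"
     using *[of p "x w"] *[of "1 - p" "y w"] p x0[of w] y0[of w] by (intro add_mono) auto
    thus ?thesis by (simp add: mix[of w] distrib_right)
   qed
   have "score n m <= (\<Sum>w\<in>words n. p*(x w*(ln (Phi w) - ln (x w))) - p*ln p*x w
     + ((1 - p)*(y w*(ln (Phi w) - ln (y w))) - (1 - p)*ln (1 - p)*y w))"
    unfolding score_def by (intro sum_mono tm)
   also have "... = p * score n x + (1 - p) * score n y + c"
    by (simp add: sum.distrib sum_subtractf score_def c_def sx sy flip: sum_distrib_left)
   finally show ?thesis .
  qed
  have "(\<lambda>n. p*(score n x/n) + (1 - p)*(score n y/n) + c/n) \<longlonglongrightarrow> p*L1 + (1 - p)*L2 + 0"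
   by (intro tendsto_add tendsto_mult_left L1(1) L2(1) lim_const_over_n)
  moreover have "0 <= p*(score n x/n) + (1 - p)*(score n y/n) + c/n" for n
  proof -
   have "0 <= (p * score n x + (1 - p) * score n y + c)/n"
    using mixscore[of n] score0[of n] by (intro divide_nonneg_nonneg) (auto simp: cyl)
   thus ?thesis by (simp add: add_divide_distrib)
  qed
  ultimately have "0 <= p*L1 + (1 - p)*L2 + 0" by (intro LIMSEQ_le_const) auto
  moreover have "p*L1 <= 0" "(1 - p)*L2 <= 0" using p L1(3) L2(3) by (auto intro!: mult_nonneg_nonpos)
  ultimately have "p*L1 = 0" "(1 - p)*L2 = 0" by linarith+
  hence L0: "L1 = 0" "L2 = 0" using p by auto
  have sc0: "0 <= score 0 z" if "z [] = 1" for z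
   using that ln_Phi_append[of "[]" "[]"] by (simp add: score_def)
  have "0 <= score n x" "0 <= score n y" for n
   using L1(2)[of n] L2(2)[of n] L0 sc0[of x] sc0[of y] sx[of 0] sy[of 0]
   by (cases "n = 0"; simp add: zero_le_divide_iff)+
  hence xc: "x \<in> candidates" and yc: "y \<in> candidates"
   using shift_measure.invariant_weights_cylinder[OF s1] shift_measure.invariant_weights_cylinder[OF s2]
   by (auto simp: candidates_def x_def[abs_def] y_def[abs_def])
  have abs1: "\<bar>z w\<bar> <= 1" if "z \<in> candidates" for z w using U[OF that, of w] by auto
  let ?g = "\<lambda>z j. (1/2)^j*(z (from_nat j :: 'n list))\<^sup>2 :: real"
  have gs: "summable (?g z)" if "z \<in> candidates" for z using Psi_summable[of z] abs1[OF that] by auto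
  \<comment> \<open>The convexity defect of the square: \<open>p x^2 + (1 - p) y^2\<close> exceeds
    the square of the mixture by \<open>p (1 - p) (x - y)^2\<close>.\<close>
  have "?g m j = p*?g x j + (1 - p)*?g y j - p*(1 - p)*?g (\<lambda>w. x w - y w) j" for j
   by (simp add: mix power2_eq_square algebra_simps)
  hence gd: "p*(1 - p)*?g (\<lambda>w. x w - y w) j = p*?g x j + (1 - p)*?g y j - ?g m j" for j by simp
  have "(\<lambda>j. p*?g x j + (1 - p)*?g y j - ?g m j) sums (p*Psi x + (1 - p)*Psi y - Psi m)"
   unfolding Psi_def by (intro sums_diff sums_add sums_mult summable_sums gs xc yc m(1))
  hence sd: "(\<lambda>j. p*(1 - p)*?g (\<lambda>w. x w - y w) j) sums (p*Psi x + (1 - p)*Psi y - Psi m)" by (simp only: gd)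
  have "p*Psi x + (1 - p)*Psi y <= p*Psi m + (1 - p)*Psi m"
   using m(2)[OF xc] m(2)[OF yc] p by (intro add_mono mult_left_mono) auto
  hence "p*Psi x + (1 - p)*Psi y - Psi m <= 0" by (simp add: algebra_simps)
  moreover have nn: "0 <= p*(1 - p)*?g (\<lambda>w. x w - y w) j" for j using p by simp
  ultimately have zero: "p*(1 - p)*?g (\<lambda>w. x w - y w) j = 0" for j
   using sd suminf_eq_zero_iff[of "\<lambda>j. p*(1 - p)*?g (\<lambda>w. x w - y w) j"] suminf_nonneg[of "\<lambda>j. p*(1 - p)*?g (\<lambda>w. x w - y w) j"]
   by (metis (no_types, lifting) antisym sums_iff)
  have xy: "x w = y w" for w
   using zero[of "to_nat w"] p by simp
  have "\<nu>1 = \<nu>2"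
  proof (rule stream_measure_eqI)
   show "prob_space \<nu>1" "prob_space \<nu>2" using s1 s2 by (auto simp: shift_measure_def)
   show "sets \<nu>1 = sets streamM" "sets \<nu>2 = sets streamM" using s1 s2 by (auto simp: shift_measure_def shift_measure_axioms_def)
   show "emeasure \<nu>1 (cylinder w) = emeasure \<nu>2 (cylinder w)" for w
    using xy[of w] s1 s2 by (simp add: x_def y_def shift_measure_def finite_measure.emeasure_eq_measure[OF prob_space.finite_measure])
  qed
  hence "measure \<nu>1 B = measure \<nu>2 B" by simp
  moreover have "measure \<nu>1 B = 1"
   unfolding \<nu>1_def using shift_measure_uniform(2)[OF B b0, of B] b0 B(1) by simp
  moreover have "measure \<nu>2 B = 0"
  proof -
   have "D \<inter> B = {}" by (auto simp: D_def)
   thus ?thesis unfolding \<nu>2_def using shift_measure_uniform(2)[OF D Dinv, of B] pD b1 B(1) by simp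
  qed
  ultimately show False by simp
 qed
 interpret E: ergodic_cocycle A \<nu>
  by unfold_locales (rule erg)
 obtain L where L: "(\<lambda>n. score n (\<lambda>w. prob (cylinder w))/n) \<longlonglongrightarrow> L" "L <= 0"
  using score_limit[OF \<nu>] by blast
 have L0: "L = 0"
 proof (rule antisym[OF L(2)])
  show "0 <= L" by (rule LIMSEQ_le_const[OF L(1)]) (simp add: score0)
 qed
 have eq: "score n (\<lambda>w. prob (cylinder w)) = ent n + lC + (\<Sum>w\<in>words n. prob (cylinder w)*ln (phi s w))" for n
  by (simp add: score_cylinder[OF \<nu>] ln_Phi_eq distrib_left sum.distrib sum_prob_cylinder flip: sum_distrib_right)
 have "(\<lambda>n. ent n/n + lC/n + (\<Sum>w\<in>words n. prob (cylinder w)*ln (phi s w))/n) \<longlonglongrightarrow> shift_entropy \<nu> + 0 + - E.energy_rate s"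
  by (intro tendsto_add ent_limit(1) lim_const_over_n E.phi_rate(2) s)
 hence "(\<lambda>n. score n (\<lambda>w. prob (cylinder w))/n) \<longlonglongrightarrow> shift_entropy \<nu> + 0 + - E.energy_rate s"
  by (simp only: eq add_divide_distrib)
 hence "shift_entropy \<nu> + 0 + - E.energy_rate s = 0"
  using L(1) unfolding L0 by (rule LIMSEQ_unique)
 hence "equilibrium_state A s \<nu>" using E.equilibrium_state_iff[OF s] by simp
 thus thesis by (rule that)
qed

end

section \<open>Coding maps\<close>

text \<open>The image of the origin under the composition of the affine maps along the word, a
  truncation of the series in \<open>coding_map\<close>.\<close>

primrec point :: "real^'d^'d^'n => real^'d^'n => 'n list => real^'d" where
 "point A v [] = 0"
| "point A v (i # w) = v$i + A$i *v point A v w"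

lemma point_append: "point A v (u @ w) = point A v u + word_mat A u *v point A v w"
 by (induction u) (simp_all add: matrix_vector_right_distrib matrix_vector_mul_assoc)

lemma point_snoc: "point A v (w @ [i]) = point A v w + word_mat A w *v (v$i)"
 by (simp add: point_append)

lemma point_add: "point A (x + y) w = point A x w + point A y w"
 by (induction w) (simp_all add: matrix_vector_right_distrib)

lemma point_scale: "point A (c *\<^sub>R x) w = c *\<^sub>R point A x w"
 by (induction w) (simp_all add: matrix_vector_mult_scaleR scaleR_right_distrib)

lemma point_stake: "point A v (stake n \<xi>) = (\<Sum>k<n. word_mat A (stake k \<xi>) *v (v$(\<xi> !! k)))"
proof (induction n)
 case (Suc n)
 show ?case unfolding stake_Suc point_snoc Suc by simp
qed simp

lemma vec_tuple_norm_ge: "norm (v$i) <= vec_tuple_norm v"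
 unfolding vec_tuple_norm_def by (rule Max_ge) auto

lemma vec_tuple_norm_nonneg: "0 <= vec_tuple_norm v"
 by (rule order_trans[OF norm_ge_zero vec_tuple_norm_ge])

context contractive_tuple
begin

text \<open>Each of the affine maps sends the closed ball of this radius about the origin into
  itself; see \<open>radius_eq\<close>.\<close>

definition radius :: "real^'d^'n => real" where
 "radius v = vec_tuple_norm v/(1 - rho)"

lemma radius_nonneg: "0 <= radius v"
 unfolding radius_def using contractive by (intro divide_nonneg_pos vec_tuple_norm_nonneg) simp

lemma radius_eq: "vec_tuple_norm v + rho*radius v = radius v"
 using contractive by (simp add: radius_def field_simps)

lemma map_norm_le:
 assumes "norm x <= radius v" shows "norm (v$i + A$i *v x) <= radius v"
proof -
 have "norm (A$i *v x) <= op_norm (A$i)*norm x" by (rule norm_matrix_vector_le_op_norm)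
 also have "... <= rho*radius v" using assms op_norm_A_le rho_pos by (intro mult_mono) auto
 finally have "norm (v$i + A$i *v x) <= vec_tuple_norm v + rho*radius v"
  using vec_tuple_norm_ge[of v i] norm_triangle_ineq[of "v$i" "A$i *v x"] by linarith
 thus ?thesis by (simp only: radius_eq)
qed

lemma norm_point_le: "norm (point A v w) <= radius v"
 by (induction w) (simp_all add: radius_nonneg map_norm_le)

lemma coding_summable: "summable (\<lambda>k. word_mat A (stake k \<xi>) *v (v$(\<xi> !! k)))"
proof (rule summable_comparison_test'[where g = "\<lambda>k. rho^k * vec_tuple_norm v"])
 show "summable (\<lambda>k. rho^k * vec_tuple_norm v)"
  using rho_pos contractive by (intro summable_mult2 summable_geometric) simp
 show "norm (word_mat A (stake k \<xi>) *v (v$(\<xi> !! k))) <= rho^k * vec_tuple_norm v" for k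
 proof -
  have "norm (word_mat A (stake k \<xi>) *v (v$(\<xi> !! k))) <= rho^k*norm (v$(\<xi> !! k))"
   using norm_word_le[of "stake k \<xi>"] by simp
  also have "... <= rho^k * vec_tuple_norm v" using rho_pos by (intro mult_left_mono vec_tuple_norm_ge) auto
  finally show ?thesis .
 qed
qed

lemma point_tendsto_coding: "(\<lambda>n. point A v (stake n \<xi>)) \<longlonglongrightarrow> coding_map A v \<xi>"
 unfolding point_stake coding_map_def using coding_summable summable_LIMSEQ by blast

lemma norm_coding_le: "norm (coding_map A v \<xi>) <= radius v"
 by (rule Lim_bounded[OF tendsto_norm[OF point_tendsto_coding]]) (auto intro: norm_point_le)

lemma coding_split: "coding_map A v \<xi> = point A v (stake n \<xi>) + word_mat A (stake n \<xi>) *v coding_map A v (sdrop n \<xi>)"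
proof (rule LIMSEQ_unique)
 show "(\<lambda>m. point A v (stake (m + n) \<xi>)) \<longlonglongrightarrow> coding_map A v \<xi>"
  using point_tendsto_coding by (rule LIMSEQ_ignore_initial_segment)
 have eq: "point A v (stake (m + n) \<xi>) = point A v (stake n \<xi>) + word_mat A (stake n \<xi>) *v point A v (stake m (sdrop n \<xi>))" for m
  by (simp add: add.commute[of m] flip: stake_add point_append)
 show "(\<lambda>m. point A v (stake (m + n) \<xi>)) \<longlonglongrightarrow> point A v (stake n \<xi>) + word_mat A (stake n \<xi>) *v coding_map A v (sdrop n \<xi>)"
  unfolding eq by (intro tendsto_add tendsto_const bounded_linear.tendsto[OF matrix_vector_mul_bounded_linear] point_tendsto_coding)
qed

lemma coding_approx: "norm (coding_map A v \<xi> - point A v (stake n \<xi>)) <= rho^n*radius v"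
proof -
 have "norm (coding_map A v \<xi> - point A v (stake n \<xi>)) = norm (word_mat A (stake n \<xi>) *v coding_map A v (sdrop n \<xi>))"
  by (subst coding_split[of v \<xi> n]) simp
 also have "... <= rho^n*norm (coding_map A v (sdrop n \<xi>))" using norm_word_le[of "stake n \<xi>"] by simp
 also have "... <= rho^n*radius v" using rho_pos by (intro mult_left_mono norm_coding_le) auto
 finally show ?thesis .
qed

lemma coding_measurable: "coding_map A v \<in> borel_measurable streamM"
proof (rule borel_measurable_LIMSEQ_metric)
 show "(\<lambda>\<xi>. point A v (stake n \<xi>)) \<in> borel_measurable streamM" for n
  by (rule measurable_compose[OF measurable_stake]) simp
 show "(\<lambda>n. point A v (stake n \<xi>)) \<longlonglongrightarrow> coding_map A v \<xi>" for \<xi> by (rule point_tendsto_coding)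
qed

end

section \<open>Transversality along conjugacy classes\<close>

definition mat_vecs :: "real^'d^'d => real^'d^'n => real^'d^'n" where
 "mat_vecs B v = (\<chi> i. B *v (v$i))"

lemma mat_vecs_add: "mat_vecs (B + C) v = mat_vecs B v + mat_vecs C v"
 by (simp add: mat_vecs_def vec_eq_iff matrix_vector_mult_add_rdistrib)

lemma continuous_point:
 "continuous_on UNIV (\<lambda>x :: (real^'d^'d^'n) \<times> (real^'d^'d). point (fst x) (mat_vecs (snd x) v) w)"
proof (induction w)
 case (Cons i w)
 have "continuous_on UNIV (\<lambda>x :: (real^'d^'d^'n) \<times> (real^'d^'d). mat_vecs (snd x) v$i)"
  unfolding mat_vecs_def by (simp add: matrix_vector_mult_def) (intro continuous_intros)
 moreover have "continuous_on UNIV (\<lambda>x :: (real^'d^'d^'n) \<times> (real^'d^'d). fst x$i *v point (fst x) (mat_vecs (snd x) v) w)"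
  unfolding matrix_vector_mult_def by (intro continuous_intros Cons)
 ultimately show ?case by (simp add: continuous_on_add)
qed simp

text \<open>The rank one matrix with rows along \<open>e\<close> and columns along
  \<open>x\<close>.\<close>

definition outer :: "real^'d => real^'d => real^'d^'d" where
 "outer x e = (\<chi> a. x$a *\<^sub>R e)"

lemma outer_mult: "outer x e *v y = (e \<bullet> y) *\<^sub>R x"
 by (simp add: outer_def matrix_vector_mult_def vec_eq_iff inner_vec_def sum_distrib_left sum_distrib_right mult_ac)

lemma norm_outer: "norm (outer x e) = norm x*norm e"
proof -
 have "norm (outer x e) = sqrt (\<Sum>a\<in>UNIV. (norm (x$a *\<^sub>R e))\<^sup>2)"
  by (simp add: outer_def norm_vec_def[of "\<chi> a. x$a *\<^sub>R e"] L2_set_def)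
 also have "(\<Sum>a\<in>UNIV. (norm (x$a *\<^sub>R e))\<^sup>2) = (\<Sum>a\<in>UNIV. (norm (x$a))\<^sup>2)*(norm e)\<^sup>2"
  by (simp add: power_mult_distrib sum_distrib_right)
 also have "sqrt ... = norm x*norm e"
  by (simp add: real_sqrt_mult norm_vec_def[of x] L2_set_def)
 finally show ?thesis .
qed

lemma outer_add: "outer (x + y) e = outer x e + outer y e"
 by (simp add: outer_def vec_eq_iff distrib_right)

lemma outer_scale: "outer (c *\<^sub>R x) e = c *\<^sub>R outer x e"
 by (simp add: outer_def vec_eq_iff)

lemma op_norm_eq_sval: "op_norm M = sval 1 M" for M :: "real^'d^'d"
proof (rule antisym)
 have k: "1 <= (1::nat)" "1 <= CARD('d)" by (simp_all add: Suc_leI)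
 show "sval 1 M <= op_norm M" by (rule sval_le_op_norm[OF k])
 obtain q where q: "svd_frame M q" by (rule svd)
 show "op_norm M <= sval 1 M"
 proof (rule op_norm_le)
  fix x
  have "(norm (M *v x))\<^sup>2 <= (\<Sum>i<CARD('d). (x \<bullet> q i)\<^sup>2*(sval 1 M)\<^sup>2)"
   unfolding frame_norm(2)[OF q]
   by (intro sum_mono mult_left_mono power_mono sval_antimono sval_nonneg) auto
  also have "... = (sval 1 M*norm x)\<^sup>2"
   by (simp add: power_mult_distrib frame_norm(1)[OF q] sum_distrib_left mult.commute)
  finally show "norm (M *v x) <= sval 1 M*norm x"
   by (rule power2_le_imp_le) (use sval_nonneg[OF k, of M] in simp)
 qed
qed

lemma svf_le_op_norm:
 fixes M :: "real^'d^'d"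
 assumes "invertible M" "0 <= t" "t <= real CARD('d)"
 shows "svf t M <= op_norm M powr t"
 using svf_le_svf[OF assms(1) order_refl assms(2,3), of "op_norm M"] sval_le_op_norm[of _ M] by (simp add: svf_0[OF assms(1)])

text \<open>\<open>L\<close> is invertible with inverse of norm at most \<open>1 / \<delta>\<close>.
  Writing \<open>M\<close> as \<open>M ** N\<close> times that inverse, submultiplicativity shows
  that inserting \<open>L\<close> costs at most the factor \<open>svf_const\<close> times
  \<open>(1 / \<delta>) powr t\<close>.\<close>

lemma ellipsoid_volume_linear:
 fixes M :: "real^'d^'d" and L :: "real^'d => real^'d"
 assumes M: "invertible M" and L: "linear L" and \<delta>: "0 < \<delta>" "\<And>x. \<delta>*norm x <= norm (L x)"
  and r: "0 < r" and t: "0 <= t" "t <= real CARD('d)"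
 shows "emeasure lborel {z. norm z <= 2 \<and> norm (M *v L z) <= r} <=
  ennreal (unit_ball_vol (CARD('d))*(8*real CARD('d))^CARD('d) * svf_const (CARD('d))*(1 / \<delta>) powr t*r powr t/svf t M)"
proof -
 define N where "N = matrix L"
 have N: "N *v x = L x" for x unfolding N_def
  using matrix_works[of L] L by (simp add: linear_def scalar_mult_eq_scaleR[abs_def])
 have "inj ((*v) N)"
 proof (rule injI)
  fix x y assume "N *v x = N *v y"
  hence "L (x - y) = 0" by (simp add: N linear_diff[OF L])
  thus "x = y" using \<delta>(2)[of "x - y"] \<delta>(1) by (simp add: mult_le_0_iff)
 qed
 then obtain N' where N': "N'**N = mat 1" using matrix_left_invertible_injective[of N] by blast
 hence N'': "N**N' = mat 1" using matrix_left_right_inverse by blast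
 have invN: "invertible N" "invertible N'" unfolding invertible_def using N' N'' by blast+
 have opN': "op_norm N' <= 1 / \<delta>"
 proof (rule op_norm_le)
  fix y
  have "\<delta>*norm (N' *v y) <= norm (N *v (N' *v y))" using \<delta>(2) by (simp add: N)
  also have "N *v (N' *v y) = y" by (simp add: matrix_vector_mul_assoc N'')
  finally show "norm (N' *v y) <= 1 / \<delta>*norm y" using \<delta>(1) by (simp add: field_simps)
 qed
 have MN: "invertible (M**N)" using M invN by (simp add: invertible_mult)
 have "svf t M = svf t ((M**N)**N')" by (simp add: N'' flip: matrix_mul_assoc)
 also have "... <= svf_const (CARD('d)) * svf t (M**N) * svf t N'" by (rule svf_mult[OF MN invN(2) t])
 also have "... <= svf_const (CARD('d)) * svf t (M**N)*(1 / \<delta>) powr t"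
 proof (rule mult_left_mono)
  have "svf t N' <= op_norm N' powr t" by (rule svf_le_op_norm[OF invN(2) t])
  also have "... <= (1 / \<delta>) powr t" using opN' op_norm_nonneg t by (intro powr_mono2) auto
  finally show "svf t N' <= (1 / \<delta>) powr t" .
  show "0 <= svf_const (CARD('d)) * svf t (M**N)"
   using svf_const_ge_1[of "CARD('d)"] svf_pos[OF MN t] by (simp add: Suc_leI)
 qed
 finally have svfM: "svf t M <= svf_const (CARD('d)) * svf t (M**N)*(1 / \<delta>) powr t" .
 have pos: "0 < svf t M" "0 < svf t (M**N)" using svf_pos[OF M t] svf_pos[OF MN t] by auto
 let ?c = "unit_ball_vol (CARD('d))*(4*real CARD('d)*2)^CARD('d)"
 have "emeasure lborel {z. norm z <= 2 \<and> norm (M *v L z) <= r} = emeasure lborel {z. norm z <= 2 \<and> norm (M**N *v z) <= r}"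
  by (simp add: N flip: matrix_vector_mul_assoc)
 also have "... <= ennreal (?c/svcap (1/r) (M**N))" by (rule ellipsoid_volume[OF MN r]) simp
 also have "... <= ennreal (?c*(svf_const (CARD('d))*(1 / \<delta>) powr t*r powr t/svf t M))"
 proof (rule ennreal_leI)
  have "1/svcap (1/r) (M**N) <= 1/((1/r) powr t * svf t (M**N))"
   using svf_le_svcap[OF MN t, of "1/r"] r pos svcap_ge_1[of "1/r" "M**N"]
   by (intro divide_left_mono mult_pos_pos) auto
  also have "... = r powr t/svf t (M**N)" using r by (simp add: powr_divide)
  also have "... <= svf_const (CARD('d))*(1 / \<delta>) powr t*r powr t/svf t M"
   using svfM pos r by (simp add: field_simps)
  finally have "?c*(1/svcap (1/r) (M**N)) <= ?c*(svf_const (CARD('d))*(1 / \<delta>) powr t*r powr t/svf t M)"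
   by (intro mult_left_mono) auto
  thus "?c/svcap (1/r) (M**N) <= ?c*(svf_const (CARD('d))*(1 / \<delta>) powr t*r powr t/svf t M)" by simp
 qed
 finally show ?thesis by (simp add: mult_ac)
qed

text \<open>The condition \<open>small\<close> lets the tails of two codes use up only half of the
  distance between the first translations; the other half is the transversality constant
  \<open>gap/2\<close>.\<close>

locale transversal_tuple = contractive_tuple A for A :: "real^'d^'d^'n" +
 fixes v :: "real^'d^'n" and gap :: real
 assumes gap: "0 < gap" "\<And>i j. i \<noteq> j ==> gap <= norm (v$i - v$j)"
  and small: "\<And>i j. i \<noteq> j ==> (op_norm (A$i) + op_norm (A$j))*radius v <= norm (v$i - v$j)/2"
begin

text \<open>Under \<open>outer x e\<close> the translation \<open>v$i\<close> becomes a multiple of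
  \<open>x\<close>, and by the choice of \<open>e\<close> the two leading terms differ by exactly
  \<open>norm (v$i - v$j)\<close> times \<open>x\<close>. The tails are linear in \<open>x\<close>
  too and by \<open>small\<close> cancel at most half of that.\<close>

lemma transversality_slice:
 assumes ij: "i \<noteq> j" and e: "e = (v$i - v$j) /\<^sub>R norm (v$i - v$j)"
 shows "gap/2*norm x <= norm (point A (mat_vecs (outer x e) v) (i # w) - point A (mat_vecs (outer x e) v) (j # w'))"
proof -
 let ?D = "norm (v$i - v$j)"
 define y where "y = mat_vecs (outer x e) v"
 have D: "0 < ?D" using gap(1) gap(2)[OF ij] by linarith
 have ne: "norm e = 1" using D by (simp add: e)
 have yk: "y$k = (e \<bullet> v$k) *\<^sub>R x" for k by (simp add: y_def mat_vecs_def outer_mult)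
 have "norm (y$k) <= norm x * vec_tuple_norm v" for k
 proof -
  have "\<bar>e \<bullet> v$k\<bar> <= norm e*norm (v$k)" by (rule Cauchy_Schwarz_ineq2)
  also have "... <= vec_tuple_norm v" using vec_tuple_norm_ge[of v k] ne by simp
  finally have "\<bar>e \<bullet> v$k\<bar>*norm x <= vec_tuple_norm v * norm x" by (rule mult_right_mono) simp
  thus ?thesis by (simp add: yk mult.commute)
 qed
 hence "vec_tuple_norm y <= norm x * vec_tuple_norm v"
  unfolding vec_tuple_norm_def[of y] by (subst Max_le_iff) auto
 hence ry: "radius y <= norm x*radius v"
  unfolding radius_def using contractive by (simp add: divide_right_mono)
 have Ap: "norm (A$k *v point A y u) <= op_norm (A$k)*(norm x*radius v)" for k u
 proof -
  have "norm (A$k *v point A y u) <= op_norm (A$k)*norm (point A y u)" by (rule norm_matrix_vector_le_op_norm)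
  also have "... <= op_norm (A$k)*(norm x*radius v)"
   using norm_point_le[of y u] ry by (intro mult_left_mono op_norm_nonneg) linarith
  finally show ?thesis .
 qed
 have "e \<bullet> v$i - e \<bullet> v$j = ?D"
 proof -
  have "e \<bullet> v$i - e \<bullet> v$j = inverse ?D*((v$i - v$j) \<bullet> (v$i - v$j))"
   by (simp only: e inner_scaleR_left inner_diff_right right_diff_distrib)
  also have "... = inverse ?D*(?D*?D)" by (simp only: dot_square_norm power2_eq_square)
  also have "... = ?D"
  proof -
   have "inverse c*(c * c) = c" if "c \<noteq> 0" for c :: real using that by simp
   thus ?thesis using D by (metis less_irrefl)
  qed
  finally show ?thesis .
 qed
 hence yij: "y$i - y$j = ?D *\<^sub>R x" by (simp add: yk flip: scaleR_diff_left)
 have "point A y (i # w) - point A y (j # w') = ?D *\<^sub>R x + (A$i *v point A y w - A$j *v point A y w')"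
  by (simp add: yij[symmetric])
 moreover have "norm (A$i *v point A y w - A$j *v point A y w') <= (op_norm (A$i) + op_norm (A$j))*radius v * norm x"
  using norm_triangle_ineq4[of "A$i *v point A y w" "A$j *v point A y w'"] Ap[of i w] Ap[of j w']
  by (simp add: algebra_simps)
 moreover have "(op_norm (A$i) + op_norm (A$j))*radius v * norm x <= ?D/2*norm x"
  by (intro mult_right_mono small[OF ij]) simp
 moreover have "norm (?D *\<^sub>R x) - norm (A$i *v point A y w - A$j *v point A y w') <=
   norm (?D *\<^sub>R x + (A$i *v point A y w - A$j *v point A y w'))"
  by (rule norm_diff_ineq)
 moreover have "norm (?D *\<^sub>R x) = ?D*norm x" by simp
 moreover have "gap/2*norm x <= ?D/2*norm x" using gap(2)[OF ij] by (intro mult_right_mono) auto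
 ultimately show ?thesis unfolding y_def[symmetric] by (simp add: algebra_simps)
qed

text \<open>The factor \<open>2 powr t\<close> and the 8 come from recentring a slice, which doubles
  its radii; the radius \<open>R + 1\<close> allows for base points of unit slices that meet the
  ball of radius \<open>R\<close>.\<close>

definition trans_const :: "real => real => real" where
 "trans_const R t = measure lborel (cball (0::real^'d^'d) (R + 1)) *
   ((8*real CARD('d))^CARD('d) * svf_const (CARD('d))*(1/(gap/2)) powr t*2 powr t)"

text \<open>Integrate the indicator of the bad set at \<open>B + outer x e\<close> over all
  \<open>B\<close> and over \<open>x\<close> in the unit ball. For fixed \<open>x\<close>
  translation invariance gives the full volume of the bad set; for fixed \<open>B\<close> the slice
  has small volume by \<open>ellipsoid_volume_linear\<close>.\<close>

theorem transversality:
 assumes ij: "i \<noteq> j" and r: "0 < r" and t: "0 <= t" "t <= real CARD('d)" and R: "0 <= R"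
 shows "emeasure lborel {B \<in> cball 0 R. norm (point A (mat_vecs B v) (u @ i # w) - point A (mat_vecs B v) (u @ j # w')) <= r}
  <= ennreal (trans_const R t*(r powr t/phi t u))"
proof -
 define M where "M = word_mat A u"
 have M: "invertible M" by (simp add: M_def)
 define T where "T B = point A (mat_vecs B v) (i # w) - point A (mat_vecs B v) (j # w')" for B
 have T_add: "T (B + C) = T B + T C" for B C
  unfolding T_def mat_vecs_add point_add by simp
 have T_scale: "T (c *\<^sub>R B) = c *\<^sub>R T B" for c B
 proof -
  have "mat_vecs (c *\<^sub>R B) v = c *\<^sub>R mat_vecs B v" by (simp add: mat_vecs_def vec_eq_iff scaleR_matrix_vector_assoc)
  thus ?thesis by (simp only: T_def point_scale scaleR_diff_right)
 qed
 have T_lin: "linear T" by (rule linearI) (rule T_add T_scale)+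
 have Tcont: "continuous_on S T" for S using linear_continuous_on[OF linear_conv_bounded_linear[THEN iffD1, OF T_lin]] .
 define e where "e = (v$i - v$j) /\<^sub>R norm (v$i - v$j)"
 have D: "0 < norm (v$i - v$j)" using gap(1) gap(2)[OF ij] by linarith
 have ne: "norm e = 1" using D by (simp add: e_def)
 define L where "L x = T (outer x e)" for x
 have L: "linear L" unfolding L_def by (rule linearI) (simp_all add: outer_add outer_scale T_add T_scale)
 have L_lower: "gap/2*norm x <= norm (L x)" for x
  unfolding L_def T_def by (rule transversality_slice[OF ij e_def])
 define S where "S = {B \<in> cball 0 R. norm (M *v T B) <= r}"
 have S_eq: "{B \<in> cball 0 R. norm (point A (mat_vecs B v) (u @ i # w) - point A (mat_vecs B v) (u @ j # w')) <= r} = S"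
  by (simp add: S_def T_def M_def point_append matrix_vector_mult_diff_distrib)
 have "closed S"
 proof -
  have "closed {B. norm (M *v T B) <= r}"
   by (intro closed_Collect_le continuous_on_norm continuous_on_const
     continuous_on_compose2[OF linear_continuous_on[OF matrix_vector_mul_bounded_linear] Tcont]) auto
  moreover have "S = cball 0 R \<inter> {B. norm (M *v T B) <= r}" by (auto simp: S_def)
  ultimately show ?thesis by (simp add: closed_Int)
 qed
 hence S_borel [measurable]: "S \<in> sets borel" by (rule borel_closed)
 let ?K = "cball (0::real^'d) 1"
 have K_borel [measurable]: "?K \<in> sets borel" by simp
 have outer_cont: "continuous_on UNIV (\<lambda>x. outer x e)" unfolding outer_def by (intro continuous_intros)
 have [measurable]: "(\<lambda>x. outer x e) \<in> borel_measurable borel" by (rule borel_measurable_continuous_onI[OF outer_cont])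
 define V where "V = unit_ball_vol (CARD('d))*(8*real CARD('d))^CARD('d) * svf_const (CARD('d))*(1/(gap/2)) powr t*(2*r) powr t/svf t M"
 have V0: "0 <= V" unfolding V_def using svf_const_pos svf_pos[OF M t] by simp
 \<comment> \<open>If the slice meets the bad set at all, subtracting one of its points
   \<open>x0\<close> moves it into a centred set with radii 2 and \<open>2 * r\<close>; it also
   forces \<open>B\<close> into the ball of radius \<open>R + 1\<close>.\<close>
 have slice: "(\<integral>\<^sup>+x. indicator ?K x*indicator S (B + outer x e) \<partial>lborel) <= ennreal V*indicator (cball 0 (R + 1)) B" for B
 proof (cases "\<exists>x0. x0 \<in> ?K \<and> B + outer x0 e \<in> S")
  case False
  hence z: "indicator ?K x*indicator S (B + outer x e) = (0::ennreal)" for x by (auto simp: indicator_def)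
  show ?thesis unfolding z by simp
 next
  case True
  then obtain x0 where x0: "x0 \<in> ?K" "B + outer x0 e \<in> S" by blast
  have "norm B <= norm (B + outer x0 e) + norm (outer x0 e)"
   using norm_triangle_ineq4[of "B + outer x0 e" "outer x0 e"] by simp
  also have "... <= R + 1" using x0 ne by (intro add_mono) (auto simp: S_def norm_outer)
  finally have B: "B \<in> cball 0 (R + 1)" by simp
  let ?E = "{z. norm z <= 2 \<and> norm (M *v L z) <= 2*r}"
  have E: "?E \<in> sets borel"
   using linear_continuous_on[OF linear_conv_bounded_linear[THEN iffD1, OF L]]
   by (intro borel_closed closed_Collect_conj closed_Collect_le continuous_on_norm continuous_on_const continuous_on_id
     continuous_on_compose2[OF linear_continuous_on[OF matrix_vector_mul_bounded_linear]]) auto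
  have "(\<integral>\<^sup>+x. indicator ?K x*indicator S (B + outer x e) \<partial>lborel) <= (\<integral>\<^sup>+x. indicator {z. z - x0 \<in> ?E} x \<partial>lborel)"
  proof (rule nn_integral_mono)
   fix x
   show "indicator ?K x*indicator S (B + outer x e) <= (indicator {z. z - x0 \<in> ?E} x :: ennreal)"
   proof (cases "x \<in> ?K \<and> B + outer x e \<in> S")
    case True
    have "norm (x - x0) <= 2" using True x0 norm_triangle_ineq4[of x x0] by simp
    moreover have "L (x - x0) = T (B + outer x e) - T (B + outer x0 e)"
     by (simp add: linear_diff[OF L] T_add) (simp add: L_def)
    hence "norm (M *v L (x - x0)) <= norm (M *v T (B + outer x e)) + norm (M *v T (B + outer x0 e))"
     using norm_triangle_ineq4[of "M *v T (B + outer x e)" "M *v T (B + outer x0 e)"] by (simp add: matrix_vector_mult_diff_distrib)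
    hence "norm (M *v L (x - x0)) <= 2*r" using True x0 by (simp add: S_def)
    ultimately show ?thesis using True by simp
   qed (auto simp: indicator_def)
  qed
  also have "... = emeasure lborel {z. z - x0 \<in> ?E}"
  proof (rule nn_integral_indicator)
   have "(\<lambda>z. z - x0) -` ?E \<inter> space lborel \<in> sets lborel" by (rule measurable_sets[OF _ E]) measurable
   thus "{z. z - x0 \<in> ?E} \<in> sets lborel" by (simp add: vimage_def)
  qed
  also have "... = emeasure lborel ?E" by (rule emeasure_lborel_translate[OF E])
  also have "... <= ennreal V"
   unfolding V_def by (rule ellipsoid_volume_linear[OF M L _ L_lower _ t]) (use gap r in auto)
  finally show ?thesis using B by simp
 qed
 have trans: "(\<integral>\<^sup>+B. indicator S (B + outer x e) \<partial>lborel) = emeasure lborel S" for x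
 proof -
  have "(\<integral>\<^sup>+B. indicator S B \<partial>lborel) = (\<integral>\<^sup>+B. indicator S B \<partial>(distr lborel borel ((+) (outer x e))))"
   by (simp only: lborel_distr_plus)
  also have "... = (\<integral>\<^sup>+B. indicator S (outer x e + B) \<partial>lborel)"
   by (rule nn_integral_distr) measurable
  finally show ?thesis by (simp add: add.commute)
 qed
 have "emeasure lborel ?K*emeasure lborel S = (\<integral>\<^sup>+x. indicator ?K x*emeasure lborel S \<partial>lborel)"
  by (subst nn_integral_multc) (auto intro!: borel_measurable_indicator)
 also have "... = (\<integral>\<^sup>+x. indicator ?K x*(\<integral>\<^sup>+B. indicator S (B + outer x e) \<partial>lborel) \<partial>lborel)"
  by (simp only: trans)
 also have "... = (\<integral>\<^sup>+x. (\<integral>\<^sup>+B. indicator ?K x*indicator S (B + outer x e) \<partial>lborel) \<partial>lborel)"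
  by (subst nn_integral_cmult) simp_all
 also have "... = (\<integral>\<^sup>+B. (\<integral>\<^sup>+x. indicator ?K x*indicator S (B + outer x e) \<partial>lborel) \<partial>lborel)"
  by (rule lborel_pair.Fubini') measurable
 also have "... <= (\<integral>\<^sup>+B. ennreal V*indicator (cball (0::real^'d^'d) (R + 1)) B \<partial>lborel)"
  by (rule nn_integral_mono) (rule slice)
 also have "... = ennreal V*emeasure lborel (cball (0::real^'d^'d) (R + 1))"
  by (rule nn_integral_cmult_indicator) simp
 also have "emeasure lborel (cball (0::real^'d^'d) (R + 1)) = ennreal (measure lborel (cball (0::real^'d^'d) (R + 1)))"
  by (rule emeasure_eq_ennreal_measure) (use emeasure_lborel_cball_finite[of "0::real^'d^'d" "R + 1"] in auto)
 also have "emeasure lborel ?K = ennreal (unit_ball_vol (CARD('d)))" by (simp add: emeasure_cball)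
 finally have *: "ennreal (unit_ball_vol (CARD('d)))*emeasure lborel S <= ennreal (V*measure lborel (cball (0::real^'d^'d) (R + 1)))"
  using V0 by (simp add: ennreal_mult)
 have Sfin: "emeasure lborel S < \<infinity>"
 proof (rule le_less_trans)
  show "emeasure lborel S <= emeasure lborel (cball (0::real^'d^'d) R)" by (rule emeasure_mono) (auto simp: S_def)
  show "emeasure lborel (cball (0::real^'d^'d) R) < \<infinity>" by (rule emeasure_lborel_cball_finite)
 qed
 define s where "s = measure lborel S"
 have s: "emeasure lborel S = ennreal s" unfolding s_def using Sfin by (intro emeasure_eq_ennreal_measure) auto
 have "unit_ball_vol (CARD('d)) * s <= V*measure lborel (cball (0::real^'d^'d) (R + 1))"
  using * V0 unfolding s by (subst (asm) ennreal_mult'[symmetric]) (auto simp: s_def)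
 also have "... = unit_ball_vol (CARD('d))*(trans_const R t*(r powr t/phi t u))"
  using r by (simp add: V_def trans_const_def phi_def M_def powr_mult mult_ac)
 finally have "s <= trans_const R t*(r powr t/phi t u)"
  by (subst (asm) mult_le_cancel_left_pos) auto
 thus ?thesis unfolding S_eq s by (rule ennreal_leI)
qed

end

section \<open>Energy estimates for almost every conjugate\<close>

lemma continuous_word_mat: "continuous_on UNIV (\<lambda>A :: real^'d^'d^'n. word_mat A w)"
proof (induction w)
 case (Cons i w)
 show ?case unfolding word_mat_Cons matrix_matrix_mult_def by (intro continuous_intros Cons)
qed simp

lemma sval_word_measurable:
 fixes w :: "'n::finite list"
 assumes "1 <= k" "k <= CARD('d)"
 shows "(\<lambda>A :: real^'d^'d^'n. sval k (word_mat A w)) \<in> borel_measurable borel"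
 by (rule borel_measurable_continuous_onI)
  (rule continuous_on_compose2[OF continuous_sval[OF assms] continuous_word_mat], simp)

lemma svf_word_measurable:
 fixes w :: "'n::finite list"
 assumes t: "0 <= t" "t <= real CARD('d)"
 shows "(\<lambda>A :: real^'d^'d^'n. svf t (word_mat A w)) \<in> borel_measurable borel"
proof -
 have [measurable]: "(\<lambda>A :: real^'d^'d^'n. sval j (word_mat A w)) \<in> borel_measurable borel" if "j <= CARD('d)" for j
 proof (cases "j = 0")
  case True
  hence "(\<lambda>A :: real^'d^'d^'n. sval j (word_mat A w)) = (\<lambda>A. sval 1 (word_mat A w))" by (simp add: sval_def)
  thus ?thesis using sval_word_measurable[of 1 w] by (simp add: Suc_leI)
 qed (use that sval_word_measurable[of j w] in simp)
 have c: "nat \<lceil>t\<rceil> <= CARD('d)" "nat \<lfloor>t\<rfloor> <= CARD('d)" using t by linarith+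
 show ?thesis unfolding svf_def using t c
  by (simp only: if_True, intro borel_measurable_times borel_measurable_prod powr_real_measurable) auto
qed

lemma op_norm_measurable: "(\<lambda>A :: real^'d^'d^'n. op_norm (A$i)) \<in> borel_measurable borel"
 using sval_word_measurable[of 1 "[i]"] by (simp add: op_norm_eq_sval Suc_leI)

lemma mat_tuple_norm_measurable: "(mat_tuple_norm :: real^'d^'d^'n => real) \<in> borel_measurable borel"
 unfolding mat_tuple_norm_def[abs_def] by (rule borel_measurable_Max) (auto intro: op_norm_measurable)

lemma GL_tuples_borel: "(GL_tuples :: (real^'d^'d^'n) set) \<in> sets borel"
proof -
 have "continuous_on UNIV (\<lambda>A :: real^'d^'d^'n. det (A$i))" for i
  unfolding det_def by (intro continuous_intros)
 hence o: "open {A :: real^'d^'d^'n. det (A$i) \<noteq> 0}" for i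
  by (intro open_Collect_neq continuous_on_const)
 have eq: "GL_tuples = (\<Inter>i. {A :: real^'d^'d^'n. det (A$i) \<noteq> 0})"
  by (auto simp: GL_tuples_def invertible_det_nz)
 show ?thesis unfolding eq by (intro borel_open open_INT ballI o) simp
qed

text \<open>Falconer's energy at a finite level. It counts a pair once for every common prefix and
  not only for the longest one; this only increases it and lets the sum over \<open>w'\<close> be
  carried out prefix by prefix.\<close>

definition pair_energy ::
  "real => (real^'d^'d^'n => 'n list => real) => (real^'d^'d^'n => 'n list => real) => nat => real^'d^'d^'n => real" where
 "pair_energy t W W' m A = (\<Sum>k\<le>m. \<Sum>w\<in>words m. \<Sum>w'\<in>words m.
   if take k w = take k w' then W A w*W' A w'/svf t (word_mat A (take k w)) else 0)"

text \<open>The indicator is that of a set of pairs, so that joint measurability in \<open>A\<close>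
  and \<open>B\<close> is at hand for Fubini's theorem.\<close>

definition close_pairs ::
  "real => real^'d^'n => (real^'d^'d^'n => 'n list => real) => (real^'d^'d^'n => 'n list => real) => nat =>
   real^'d^'d^'n => real^'d^'d => real" where
 "close_pairs L v W W' m A B = (\<Sum>w\<in>words m. \<Sum>w'\<in>words m. W A w*W' A w' *
   indicator {(A, B). norm (point A (mat_vecs B v) w - point A (mat_vecs B v) w') <= L/2^m} (A, B))"

lemma first_difference:
 assumes "length w = m" "length w' = m" "w \<noteq> w'"
 obtains k where "k < m" "take k w = take k w'" "w ! k \<noteq> w' ! k"
proof -
 define k where "k = (LEAST k. k < m \<and> w ! k \<noteq> w' ! k)"
 have ex: "\<exists>k. k < m \<and> w ! k \<noteq> w' ! k" using assms nth_equalityI[of w w'] by auto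
 have k: "k < m \<and> w ! k \<noteq> w' ! k" unfolding k_def by (rule LeastI_ex[OF ex])
 have "take k w = take k w'"
 proof (rule nth_equalityI)
  fix i assume "i < length (take k w)"
  hence i: "i < k" by simp
  hence "\<not> (i < m \<and> w ! i \<noteq> w' ! i)" unfolding k_def by (rule not_less_Least)
  thus "take k w ! i = take k w' ! i" using i k by auto
 qed (use assms in simp)
 thus thesis using k that by blast
qed

context transversal_tuple
begin

text \<open>Distinct words are handled by transversality at their first difference. For equal words
  the trivial volume bound is enough: as \<open>rho <= 1/2\<close>, the value \<open>phi t w\<close>
  is at most \<open>(L/2^m) powr t\<close>. This is why words of length \<open>m\<close> are paired
  with the scale \<open>1/2^m\<close>.\<close>

lemma pair_measure:
 assumes t: "0 <= t" "t <= real CARD('d)" and R: "0 <= R" and L: "1 <= L" and half: "rho <= 1/2"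
  and w: "w \<in> words m" "w' \<in> words m"
 obtains k where "k <= m" "take k w = take k w'"
  "emeasure lborel {B \<in> cball 0 R. norm (point A (mat_vecs B v) w - point A (mat_vecs B v) w') <= L/2^m}
   <= ennreal ((trans_const R t + measure lborel (cball (0::real^'d^'d) R))*((L/2^m) powr t/phi t (take k w)))"
proof -
 let ?r = "L/2^m" and ?B = "cball (0::real^'d^'d) R"
 let ?m = "measure lborel ?B" and ?C = "trans_const R t + measure lborel ?B" and ?p = "\<lambda>B. point A (mat_vecs B v)"
 have r: "0 < ?r" using L by simp
 have mc: "emeasure lborel ?B = ennreal (?m)"
  by (rule emeasure_eq_ennreal_measure) (use emeasure_lborel_cball_finite[of "0::real^'d^'d" R] in auto)
 have tc: "0 <= trans_const R t" using svf_const_pos by (simp add: trans_const_def)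
 show thesis
 proof (cases "w = w'")
  case True
  have "phi t w <= (rho^m) powr t" using phi_le_rho[OF t, of w] w by (simp add: words_def)
  also have "... <= ((1/2)^m) powr t" using half rho_pos t by (intro powr_mono2 power_mono) auto
  also have "... <= ?r powr t" using L t by (intro powr_mono2) (auto simp: power_divide divide_right_mono)
  finally have 1: "1 <= ?r powr t/phi t w" using phi_pos[OF t, of w] by simp
  have "emeasure lborel {B \<in> cball 0 R. norm (?p B w - ?p B w') <= ?r} <= emeasure lborel ?B"
   by (rule emeasure_mono) auto
  also have "... <= ennreal (?C*(?r powr t/phi t (take m w)))"
   unfolding mc
  proof (rule ennreal_leI)
   have "?m*1 <= ?C*(?r powr t/phi t w)"
    using 1 tc by (intro mult_mono) auto
   thus "?m <= ?C*(?r powr t/phi t (take m w))"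
    using w by (simp add: words_def)
  qed
  finally show thesis using True by (intro that[of m]) auto
 next
  case False
  obtain k where k: "k < m" "take k w = take k w'" "w ! k \<noteq> w' ! k"
   by (rule first_difference[OF _ _ False]) (use w in \<open>auto simp: words_def\<close>)
  have ww: "w = take k w @ w ! k # drop (Suc k) w" "w' = take k w @ w' ! k # drop (Suc k) w'"
   using id_take_nth_drop[of k w] id_take_nth_drop[of k w'] k w by (simp_all only: words_def mem_Collect_eq)
  have "emeasure lborel {B \<in> cball 0 R. norm (?p B (take k w @ w ! k # drop (Suc k) w) -
    ?p B (take k w @ w' ! k # drop (Suc k) w')) <= ?r} <= ennreal (trans_const R t*(?r powr t/phi t (take k w)))"
   by (rule transversality[OF k(3) r t R])
  also have "... <= ennreal (?C*(?r powr t/phi t (take k w)))"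
   using phi_pos[OF t, of "take k w"] by (intro ennreal_leI mult_right_mono) auto
  finally show thesis unfolding ww[symmetric] using k by (intro that[of k]) auto
 qed
qed

lemma nn_integral_close_pairs:
 assumes t: "0 <= t" "t <= real CARD('d)" and R: "0 <= R" and L: "1 <= L" and half: "rho <= 1/2"
  and W: "\<And>w. 0 <= W A w" "\<And>w. 0 <= W' A w"
 shows "(\<integral>\<^sup>+B. ennreal (close_pairs L v W W' m A B)*indicator (cball 0 R) B \<partial>lborel) <=
  ennreal ((trans_const R t + measure lborel (cball (0::real^'d^'d) R))*(L/2^m) powr t*pair_energy t W W' m A)"
proof -
 let ?C = "trans_const R t + measure lborel (cball (0::real^'d^'d) R)"
 let ?r = "L/2^m"
 let ?F = "\<lambda>k w w'. if take k w = take k w' then ?C*?r powr t*(W A w*W' A w'/phi t (take k w)) else 0"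
 have C0: "0 <= ?C" using svf_const_pos by (simp add: trans_const_def)
 define S where "S w w' = {B \<in> cball 0 R. norm (point A (mat_vecs B v) w - point A (mat_vecs B v) w') <= ?r}" for w w'
 have S_meas [measurable]: "S w w' \<in> sets borel" for w w'
 proof -
  have "continuous_on UNIV (\<lambda>B. point A (mat_vecs B v) u)" for u
   using continuous_on_compose2[OF continuous_point[of v u], of UNIV "\<lambda>B. (A, B)"]
   by (simp add: continuous_on_Pair case_prod_unfold)
  hence "closed {B. norm (point A (mat_vecs B v) w - point A (mat_vecs B v) w') <= ?r}"
   by (intro closed_Collect_le continuous_intros)
  moreover have "S w w' = cball 0 R \<inter> {B. norm (point A (mat_vecs B v) w - point A (mat_vecs B v) w') <= ?r}" by (auto simp: S_def)
  ultimately show ?thesis by (simp add: closed_Int borel_closed)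
 qed
 have eq: "ennreal (close_pairs L v W W' m A B)*indicator (cball 0 R) B =
   (\<Sum>w\<in>words m. \<Sum>w'\<in>words m. ennreal (W A w*W' A w')*indicator (S w w') B)" for B
 proof (cases "B \<in> cball 0 R")
  case True
  have "close_pairs L v W W' m A B = (\<Sum>w\<in>words m. \<Sum>w'\<in>words m. W A w*W' A w'*indicator (S w w') B)"
   unfolding close_pairs_def using True by (intro sum.cong refl) (auto simp: S_def indicator_def)
  also have "ennreal ... = (\<Sum>w\<in>words m. \<Sum>w'\<in>words m. ennreal (W A w*W' A w'*indicator (S w w') B))"
   using W by (simp add: sum_ennreal sum_nonneg)
  also have "... = (\<Sum>w\<in>words m. \<Sum>w'\<in>words m. ennreal (W A w*W' A w')*indicator (S w w') B)"
   by (intro sum.cong refl) (auto simp: indicator_def)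
  finally show ?thesis using True by simp
 next
  case False
  hence "indicator (S w w') B = (0::ennreal)" for w w' by (auto simp: S_def indicator_def)
  thus ?thesis using False by simp
 qed
 have "(\<integral>\<^sup>+B. ennreal (close_pairs L v W W' m A B)*indicator (cball 0 R) B \<partial>lborel) =
   (\<integral>\<^sup>+B. (\<Sum>w\<in>words m. \<Sum>w'\<in>words m. ennreal (W A w*W' A w')*indicator (S w w') B) \<partial>lborel)"
  by (simp only: eq)
 also have "... = (\<Sum>w\<in>words m. \<Sum>w'\<in>words m. ennreal (W A w*W' A w')*emeasure lborel (S w w'))"
 proof -
  have "(\<integral>\<^sup>+B. (\<Sum>w\<in>words m. \<Sum>w'\<in>words m. ennreal (W A w*W' A w')*indicator (S w w') B) \<partial>lborel) =
   (\<Sum>w\<in>words m. \<integral>\<^sup>+B. (\<Sum>w'\<in>words m. ennreal (W A w*W' A w')*indicator (S w w') B) \<partial>lborel)"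
   by (rule nn_integral_sum) measurable
  also have "... = (\<Sum>w\<in>words m. \<Sum>w'\<in>words m. \<integral>\<^sup>+B. ennreal (W A w*W' A w')*indicator (S w w') B \<partial>lborel)"
   by (intro sum.cong refl nn_integral_sum) measurable
  finally show ?thesis by (simp only: nn_integral_cmult_indicator[OF S_meas[unfolded sets_lborel[symmetric]]])
 qed
 also have "... <= (\<Sum>w\<in>words m. \<Sum>w'\<in>words m. ennreal (\<Sum>k\<le>m. ?F k w w'))"
 proof (intro sum_mono)
  fix w w' :: "'n list" assume w: "w \<in> words m" and w': "w' \<in> words m"
  obtain k where k: "k <= m" "take k w = take k w'" "emeasure lborel (S w w') <= ennreal (?C*(?r powr t/phi t (take k w)))"
   unfolding S_def by (rule pair_measure[OF t R L half w w'])
  have "ennreal (W A w*W' A w')*emeasure lborel (S w w') <= ennreal (W A w*W' A w')*ennreal (?C*(?r powr t/phi t (take k w)))"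
   by (intro mult_left_mono k) simp
  also have "... = ennreal (?C*?r powr t*(W A w*W' A w'/phi t (take k w)))"
   using W C0 phi_pos[OF t, of "take k w"] by (subst ennreal_mult[symmetric]) (auto simp: mult_ac)
  also have "... <= ennreal (\<Sum>k\<le>m. ?F k w w')"
  proof (rule ennreal_leI)
   have "?F k w w' <=
     (\<Sum>k\<le>m. ?F k w w')"
    using k W C0 phi_pos[OF t] by (intro member_le_sum) (auto simp: less_imp_le)
   thus "?C*?r powr t*(W A w*W' A w'/phi t (take k w)) <=
     (\<Sum>k\<le>m. ?F k w w')"
    using k by simp
  qed
  finally show "ennreal (W A w*W' A w')*emeasure lborel (S w w') <= ennreal (\<Sum>k\<le>m. ?F k w w')" .
 qed
 also have "... = ennreal (\<Sum>w\<in>words m. \<Sum>w'\<in>words m. \<Sum>k\<le>m. ?F k w w')"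
 proof -
  have "0 <= ?F k w w'" for k w w'
   using W C0 phi_pos[OF t, of "take k w"] by auto
  thus ?thesis by (simp add: sum_ennreal sum_nonneg)
 qed
 also have "(\<Sum>w\<in>words m. \<Sum>w'\<in>words m. \<Sum>k\<le>m. ?F k w w') =
   (\<Sum>w\<in>words m. \<Sum>k\<le>m. \<Sum>w'\<in>words m. ?F k w w')"
  by (rule sum.cong[OF refl], rule sum.swap)
 also have "... = (\<Sum>k\<le>m. \<Sum>w\<in>words m. \<Sum>w'\<in>words m. ?F k w w')"
  by (rule sum.swap)
 also have "... = ?C*?r powr t*pair_energy t W W' m A"
  unfolding pair_energy_def sum_distrib_left phi_def by (intro sum.cong refl) auto
 finally show ?thesis .
qed

end

context transversal_tuple begin

text \<open>The integral over \<open>B\<close> of the \<open>m\<close>-th term is at most a constant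
  times the \<open>m\<close>-th power of \<open>q * 2 powr (t' - t)\<close>, so the integral of the
  series is finite and the series is finite almost everywhere.\<close>

lemma AE_close_pairs:
 fixes t' q K :: real
 assumes t: "0 <= t" "t <= real CARD('d)" and R: "0 <= R" and L: "1 <= L" and half: "rho <= 1/2"
  and W: "\<And>w. 0 <= W A w" "\<And>w. 0 <= W' A w"
  and E: "\<And>m. pair_energy t W W' m A <= K*q^m" and q: "0 <= q" "q*2 powr (t' - t) < 1" and K: "0 <= K"
  and meas: "\<And>m. (\<lambda>B. close_pairs L v W W' m A B) \<in> borel_measurable borel"
 shows "AE B in lborel. B \<in> cball 0 R --> (\<Sum>m. ennreal (2 powr (m*t') * close_pairs L v W W' m A B)) < \<infinity>"
proof -
 let ?C = "trans_const R t + measure lborel (cball (0::real^'d^'d) R)"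
 have C0: "0 <= ?C" using svf_const_pos by (simp add: trans_const_def)
 have cp0: "0 <= close_pairs L v W W' m A B" for m B
  unfolding close_pairs_def using W by (intro sum_nonneg) auto
 define g where "g m B = ennreal (close_pairs L v W W' m A B)*indicator (cball 0 R) B" for m B
 have g: "g m \<in> borel_measurable lborel" for m
  unfolding g_def using meas[of m]
  by (intro borel_measurable_times_ennreal borel_measurable_indicator measurable_compose[OF _ measurable_ennreal]) simp_all
 let ?f = "\<lambda>B. (\<Sum>m. ennreal (2 powr (m*t') * close_pairs L v W W' m A B))*indicator (cball 0 R) B"
 have feq: "?f = (\<lambda>B. \<Sum>m. ennreal (2 powr (m*t'))*g m B)"
  by (rule ext) (simp only: g_def ennreal_suminf_multc[symmetric] ennreal_mult'[OF powr_ge_zero] mult.assoc)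
 hence "(\<integral>\<^sup>+B. ?f B \<partial>lborel) = (\<integral>\<^sup>+B. (\<Sum>m. ennreal (2 powr (m*t'))*g m B) \<partial>lborel)" by simp
 also have "... = (\<Sum>m. \<integral>\<^sup>+B. ennreal (2 powr (m*t'))*g m B \<partial>lborel)"
  by (rule nn_integral_suminf) (intro borel_measurable_times_ennreal borel_measurable_const g)
 also have "... = (\<Sum>m. ennreal (2 powr (m*t'))*(\<integral>\<^sup>+B. g m B \<partial>lborel))"
  by (rule suminf_cong, rule nn_integral_cmult, rule g)
 also have "... <= (\<Sum>m. ennreal (?C*L powr t*K*(q*2 powr (t' - t))^m))"
 proof (intro suminf_le allI)
  fix m
  have "ennreal (2 powr (m*t'))*(\<integral>\<^sup>+B. g m B \<partial>lborel) <=
   ennreal (2 powr (m*t'))*ennreal (?C*(L/2^m) powr t*pair_energy t W W' m A)"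
   unfolding g_def by (intro mult_left_mono nn_integral_close_pairs[where W = W and W' = W', OF t R L half W]) simp
  also have "... <= ennreal (2 powr (m*t'))*ennreal (?C*(L/2^m) powr t*(K*q^m))"
   using C0 by (intro mult_left_mono ennreal_leI E) auto
  also have "... = ennreal (2 powr (m*t')*(?C*(L/2^m) powr t*(K*q^m)))"
   by (rule ennreal_mult'[symmetric]) simp
  also have "2 powr (m*t')*(?C*(L/2^m) powr t*(K*q^m)) = ?C*L powr t*K*(q*2 powr (t' - t))^m"
  proof -
   have "(L/2^m) powr t = L powr t*2 powr (- (m*t))"
    using L by (simp add: powr_divide powr_minus powr_realpow[symmetric] powr_powr field_simps)
   moreover have "2 powr (m*t')*2 powr (- (m*t)) = (2 powr (t' - t))^m"
    by (simp add: powr_add[symmetric] powr_realpow[symmetric] powr_powr algebra_simps)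
   ultimately show ?thesis by (simp add: power_mult_distrib mult_ac)
  qed
  finally show "ennreal (2 powr (m*t'))*(\<integral>\<^sup>+B. g m B \<partial>lborel) <=
   ennreal (?C*L powr t*K*(q*2 powr (t' - t))^m)" .
 qed auto
 also have "... < \<infinity>"
 proof -
  have "summable (\<lambda>m. ?C*L powr t*K*(q*2 powr (t' - t))^m)"
   using q by (intro summable_mult summable_geometric) simp
  thus ?thesis using C0 K q by (subst suminf_ennreal2) auto
 qed
 finally have fin: "(\<integral>\<^sup>+B. ?f B \<partial>lborel) \<noteq> \<infinity>" by simp
 have "?f \<in> borel_measurable lborel"
  unfolding feq by (intro borel_measurable_suminf_order borel_measurable_times_ennreal borel_measurable_const g)
 hence "AE B in lborel. ?f B \<noteq> \<infinity>" using fin by (rule nn_integral_PInf_AE)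
 thus ?thesis by eventually_elim (auto simp: less_top)
qed

end

text \<open>The class that contains the conjugates of admissible tuples by matrices near the
  identity. The bound 1/2 matches word length to dyadic scale, the other condition is
  \<open>small\<close>.\<close>

definition relaxed_tuples :: "real^'d^'n => (real^'d^'d^'n) set" where
 "relaxed_tuples v = {A \<in> GL_tuples. mat_tuple_norm A <= 1/2 \<and>
   (\<forall>i j. i \<noteq> j --> (op_norm (A$i) + op_norm (A$j))*(vec_tuple_norm v/(1 - mat_tuple_norm A)) <= norm (v$i - v$j)/2)}"

lemma relaxed_tuples_borel: "relaxed_tuples v \<in> sets borel"
proof -
 note [measurable] = GL_tuples_borel op_norm_measurable mat_tuple_norm_measurable
 have "relaxed_tuples v = {A \<in> space borel. A \<in> GL_tuples \<and> mat_tuple_norm A <= 1/2 \<and>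
   (\<forall>i j. i \<noteq> j --> (op_norm (A$i) + op_norm (A$j))*(vec_tuple_norm v/(1 - mat_tuple_norm A)) <= norm (v$i - v$j)/2)}"
  by (simp add: relaxed_tuples_def)
 also have "... \<in> sets borel" by measurable
 finally show ?thesis .
qed

lemma relaxed_transversal:
 fixes v :: "real^'d^'n"
 assumes v: "\<And>i j. i \<noteq> j ==> v$i \<noteq> v$j" and A: "A \<in> relaxed_tuples v"
 obtains gap where "transversal_tuple A v gap"
proof -
 interpret contractive_tuple A using A by unfold_locales (auto simp: relaxed_tuples_def)
 \<comment> \<open>Inserting 1 gives a minimum even if there is no pair of distinct symbols.\<close>
 define S where "S = insert 1 ((\<lambda>(i, j). norm (v$i - v$j)) ` {(i, j). i \<noteq> j})"
 have S: "finite S" "S \<noteq> {}" unfolding S_def by auto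
 have "transversal_tuple A v (Min S)"
 proof
  show "0 < Min S" using v by (auto simp: Min_gr_iff[OF S]) (auto simp: S_def)
  show "Min S <= norm (v$i - v$j)" if "i \<noteq> j" for i j
   using that by (intro Min_le[OF S(1)]) (auto simp: S_def)
  show "(op_norm (A$i) + op_norm (A$j))*radius v <= norm (v$i - v$j)/2" if "i \<noteq> j" for i j
   using A that by (simp add: relaxed_tuples_def radius_def)
 qed
 thus thesis by (rule that)
qed

lemma close_pairs_measurable:
 assumes [measurable]: "\<And>w. (\<lambda>A. W A w) \<in> borel_measurable borel" "\<And>w. (\<lambda>A. W' A w) \<in> borel_measurable borel"
 shows "(\<lambda>x. close_pairs L v W W' m (fst x) (snd x)) \<in> borel_measurable borel"
proof -
 let ?E = "\<lambda>w w'. {(A, B). norm (point A (mat_vecs B v) w - point A (mat_vecs B v) w') <= L/2^m}"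
 have "closed (?E w w')" for w w'
  unfolding case_prod_unfold by (intro closed_Collect_le continuous_intros continuous_point)
 hence E: "?E w w' \<in> sets borel" for w w' by (rule borel_closed)
 have fst: "fst \<in> borel_measurable borel" by (intro borel_measurable_continuous_onI continuous_on_fst continuous_on_id)
 have "(\<lambda>x. W (fst x) w) \<in> borel_measurable borel" "(\<lambda>x. W' (fst x) w) \<in> borel_measurable borel" for w
  using measurable_compose[OF fst assms(1)[of w]] measurable_compose[OF fst assms(2)[of w]] by simp_all
 thus ?thesis unfolding close_pairs_def prod.collapse
  by (intro borel_measurable_sum borel_measurable_times borel_measurable_indicator E)
qed

text \<open>The estimate holds for each fixed tuple and almost every \<open>B\<close>. Exchanging
  the two quantifiers needs the exceptional set to be measurable in the product, hence the
  measurability assumptions on the weights in \<open>A\<close>.\<close>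

lemma AE_conjugates:
 fixes t t' q K L R :: real and v :: "real^'d^'n"
 assumes v: "\<And>i j. i \<noteq> j ==> v$i \<noteq> v$j"
  and t: "0 <= t" "t <= real CARD('d)" and R: "0 <= R" and L: "1 <= L"
  and W: "\<And>A w. A \<in> GL_tuples ==> 0 <= W A w" "\<And>A w. A \<in> GL_tuples ==> 0 <= W' A w"
  and meas: "\<And>w. (\<lambda>A. W A w) \<in> borel_measurable borel" "\<And>w. (\<lambda>A. W' A w) \<in> borel_measurable borel"
  and q: "0 <= q" "q*2 powr (t' - t) < 1" and K: "0 <= K"
 shows "AE B in lborel. AE A in lborel. A \<in> relaxed_tuples v \<and> (\<forall>m. pair_energy t W W' m A <= K*q^m) --> B \<in> cball 0 R -->
  (\<Sum>m. ennreal (2 powr (m*t') * close_pairs L v W W' m A B)) < \<infinity>"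
proof -
 define G where "G = {A \<in> relaxed_tuples v. \<forall>m. pair_energy t W W' m A <= K*q^m}"
 define F where "F x = (\<Sum>m. ennreal (2 powr (m*t') * close_pairs L v W W' m (fst x) (snd x)))" for x :: "(real^'d^'d^'n) \<times> (real^'d^'d)"
 have F: "F \<in> borel_measurable borel"
  unfolding F_def using close_pairs_measurable[OF meas]
  by (intro borel_measurable_suminf_order measurable_compose[OF _ measurable_ennreal] borel_measurable_times borel_measurable_const) auto
 have G: "G \<in> sets borel"
 proof -
  have [measurable]: "(\<lambda>A. pair_energy t W W' m A) \<in> borel_measurable borel" for m
   unfolding pair_energy_def
  proof (intro borel_measurable_sum)
   fix k :: nat and w w' :: "'n list"
   show "(\<lambda>A. if take k w = take k w' then W A w*W' A w'/svf t (word_mat A (take k w)) else 0) \<in> borel_measurable borel"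
    by (cases "take k w = take k w'") (simp, intro borel_measurable_times borel_measurable_divide meas svf_word_measurable[OF t], simp)
  qed
  note [measurable] = relaxed_tuples_borel
  have "G = {A \<in> space borel. A \<in> relaxed_tuples v \<and> (\<forall>m. pair_energy t W W' m A <= K*q^m)}" by (simp add: G_def)
  also have "... \<in> sets borel" by measurable
  finally show ?thesis .
 qed
 let ?P = "\<lambda>A B. A \<in> G --> B \<in> cball 0 R --> F (A, B) < \<infinity>"
 have "AE A in lborel. AE B in lborel. ?P A B"
 proof (rule AE_I2)
  fix A
  show "AE B in lborel. ?P A B"
  proof (cases "A \<in> G")
   case True
   hence A: "A \<in> relaxed_tuples v" "\<And>m. pair_energy t W W' m A <= K*q^m" by (auto simp: G_def)
   obtain gap where "transversal_tuple A v gap" by (rule relaxed_transversal[OF v A(1)])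
   then interpret transversal_tuple A v gap .
   have half: "rho <= 1/2" using A(1) by (simp add: relaxed_tuples_def)
   have m: "close_pairs L v W W' m A \<in> borel_measurable borel" for m
    using measurable_compose[OF borel_measurable_continuous_onI close_pairs_measurable[OF meas], of "\<lambda>B. (A, B)"]
    by (simp add: continuous_on_Pair)
   have "AE B\<in>cball 0 R in lborel. (\<Sum>m. ennreal (2 powr (m*t') * close_pairs L v W W' m A B)) < \<infinity>"
    by (rule AE_close_pairs[OF t R L half W(1)[OF GL] W(2)[OF GL] A(2) q K m])
   thus ?thesis by (simp add: F_def)
  qed simp
 qed
 moreover have "{x \<in> space (lborel \<Otimes>\<^sub>M lborel). ?P (fst x) (snd x)} \<in> sets (lborel \<Otimes>\<^sub>M lborel)"
 proof -
  have sets: "sets (lborel \<Otimes>\<^sub>M lborel) = sets (borel :: ((real^'d^'d^'n) \<times> (real^'d^'d)) measure)"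
   unfolding borel_prod[symmetric] by (rule sets_pair_measure_cong) simp_all
  have 1: "{x. F x < \<infinity>} \<in> sets borel" using borel_measurable_less[OF F borel_measurable_const] by simp
  have 2: "G \<times> cball 0 R \<in> sets (borel :: ((real^'d^'d^'n) \<times> (real^'d^'d)) measure)"
   unfolding borel_prod[symmetric] using G by (intro pair_measureI) auto
  have eq: "{x \<in> space (lborel \<Otimes>\<^sub>M lborel). ?P (fst x) (snd x)} = - (G \<times> cball 0 R) \<union> {x. F x < \<infinity>}"
   by (auto simp: space_pair_measure)
  show ?thesis unfolding eq sets by (intro sets.Un borel_comp 1 2)
 qed
 ultimately have "AE B in lborel. AE A in lborel. ?P A B" by (subst (asm) lborel_pair.AE_commute)
 thus ?thesis by (simp add: G_def F_def)
qed

section \<open>Conjugation\<close>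

definition conj_tuple :: "real^'d^'d => real^'d^'d => real^'d^'d^'n => real^'d^'d^'n" where
 "conj_tuple B C A = (\<chi> i. B**A$i**C)"

lemma conj_tuple_nth [simp]: "conj_tuple B C A$i = B**A$i**C"
 by (simp add: conj_tuple_def)

text \<open>\<open>B\<close> changes lengths by a factor between \<open>1 - 1/4\<close> and
  \<open>1 + 1/4\<close>; 4/3 is the reciprocal of the former.\<close>

lemma near_identity_invertible:
 fixes B :: "real^'d^'d"
 assumes B: "op_norm (B - mat 1) <= 1/4"
 obtains C where "B**C = mat 1" "C**B = mat 1" "op_norm B <= 5/4" "op_norm C <= 4/3"
proof -
 have d: "norm (B *v x - x) <= 1/4*norm x" for x
  using norm_matrix_vector_le_op_norm[of "B - mat 1" x] mult_right_mono[OF B, of "norm x"]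
  by (simp add: matrix_vector_mult_diff_rdistrib)
 have lower: "3/4*norm x <= norm (B *v x)" for x
  using d[of x] norm_triangle_ineq4[of "B *v x" "B *v x - x"] by simp
 have "inj ((*v) B)"
 proof (rule injI)
  fix x y assume "B *v x = B *v y"
  hence "B *v (x - y) = 0" by (simp add: matrix_vector_mult_diff_distrib)
  thus "x = y" using lower[of "x - y"] by simp
 qed
 then obtain C where C: "C**B = mat 1" using matrix_left_invertible_injective[of B] by blast
 hence C': "B**C = mat 1" using matrix_left_right_inverse by blast
 have "op_norm B <= 5/4"
 proof (rule op_norm_le)
  show "norm (B *v x) <= 5/4*norm x" for x
   using d[of x] norm_triangle_ineq[of x "B *v x - x"] by simp
 qed
 moreover have "op_norm C <= 4/3"
 proof (rule op_norm_le)
  show "norm (C *v y) <= 4/3*norm y" for y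
   using lower[of "C *v y"] by (simp add: matrix_vector_mul_assoc C')
 qed
 ultimately show thesis using that C C' by blast
qed

locale conjugation =
 fixes B C :: "real^'d^'d"
 assumes inv: "B**C = mat 1" "C**B = mat 1"
begin

lemma invertible_BC: "invertible B" "invertible C"
 unfolding invertible_def using inv by blast+

lemma word_mat_conj: "word_mat (conj_tuple B C A) w = B**word_mat A w**C"
proof (induction w)
 case (Cons i w)
 have "word_mat (conj_tuple B C A) (i # w) = B**A$i**(C**B)**word_mat A w**C"
  by (simp add: Cons matrix_mul_assoc)
 thus ?case by (simp add: inv matrix_mul_assoc)
qed (simp add: inv)

lemma point_conj: "point (conj_tuple B C A) (mat_vecs B v) w = B *v point A v w"
proof (induction w)
 case (Cons i w)
 have "B**A$i**C *v (B *v x) = B *v (A$i *v x)" for x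
  by (simp add: matrix_vector_mul_assoc flip: matrix_mul_assoc) (simp add: inv matrix_mul_assoc)
 moreover have "mat_vecs B v$i = B *v v$i" by (simp add: mat_vecs_def)
 ultimately show ?case by (simp add: Cons matrix_vector_right_distrib)
qed simp

lemma conj_GL: "A \<in> GL_tuples ==> conj_tuple B C A \<in> GL_tuples"
 by (auto simp: GL_tuples_def intro!: invertible_mult invertible_BC)

lemma op_norm_conj: "op_norm (conj_tuple B C A$i) <= op_norm B * op_norm C * op_norm (A$i)"
proof -
 have "op_norm (B**A$i**C) <= op_norm (B**A$i) * op_norm C" by (rule op_norm_mult_le)
 also have "... <= op_norm B * op_norm (A$i) * op_norm C" by (intro mult_right_mono op_norm_mult_le op_norm_nonneg)
 finally show ?thesis by (simp add: mult_ac)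
qed

lemma svf_conj:
 assumes M: "invertible M" and t: "0 <= t" "t <= real CARD('d)"
 defines "c \<equiv> (svf_const (CARD('d)))\<^sup>2 * svf t B * svf t C"
 shows "0 < c" "svf t (B**M**C) <= c * svf t M" "svf t M <= c * svf t (B**M**C)"
proof -
 let ?k = "svf_const (CARD('d))"
 have k: "1 <= ?k" using svf_const_ge_1[of "CARD('d)"] by (simp add: Suc_leI)
 note pos = svf_pos[OF invertible_BC(1) t] svf_pos[OF invertible_BC(2) t]
 show "0 < c" using k pos by (simp add: c_def)
 have 2: "svf t (X**N**Y) <= ?k\<^sup>2 * svf t X * svf t N * svf t Y" if "invertible X" "invertible N" "invertible Y" for X N Y :: "real^'d^'d"
 proof -
  have "svf t (X**N**Y) <= ?k * svf t (X**N) * svf t Y" using that by (intro svf_mult t invertible_mult)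
  also have "... <= ?k*(?k * svf t X * svf t N) * svf t Y"
   using that k svf_pos[OF that(3) t] by (intro mult_right_mono mult_left_mono svf_mult t) auto
  finally show ?thesis by (simp add: power2_eq_square mult_ac)
 qed
 show "svf t (B**M**C) <= c * svf t M" using 2[OF invertible_BC(1) M invertible_BC(2)] by (simp add: c_def mult_ac)
 have "C**(B**M**C)**B = (C**B)**M**(C**B)" by (simp add: matrix_mul_assoc)
 hence "C**(B**M**C)**B = M" by (simp add: inv)
 thus "svf t M <= c * svf t (B**M**C)"
  using 2[OF invertible_BC(2) _ invertible_BC(1), of "B**M**C"] M invertible_BC
  by (simp add: c_def mult_ac invertible_mult)
qed

text \<open>Linear maps of a Euclidean space into itself preserve negligible sets, and the new
  exceptional set lies in the image of the old one under the inverse conjugation.\<close>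

lemma AE_conj:
 assumes P: "AE A in lborel. P A"
 shows "AE A :: real^'d^'d^'n in lebesgue. P (conj_tuple B C A)"
proof -
 obtain N where N: "{A. \<not> P A} \<subseteq> N" "N \<in> null_sets (lborel :: (real^'d^'d^'n) measure)"
  using P by (auto elim!: AE_E simp: null_sets_def)
 have "linear (conj_tuple C B :: real^'d^'d^'n => _)"
  by (rule linearI) (simp_all add: vec_eq_iff[of "conj_tuple C B _"] matrix_add_ldistrib matrix_scalar_ac scalar_matrix_assoc[symmetric],
   simp add: matrix_matrix_mult_def vec_eq_iff sum.distrib distrib_right)
 hence "negligible (conj_tuple C B ` N)"
  using N(2) by (intro negligible_differentiable_image_negligible linear_imp_differentiable_on)
   (auto simp: negligible_iff_null_sets intro: null_sets_completionI)
 moreover have "A = conj_tuple C B (conj_tuple B C A)" for A :: "real^'d^'d^'n"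
 proof -
  have "C**(B**M**C)**B = (C**B)**M**(C**B)" for M by (simp add: matrix_mul_assoc)
  thus ?thesis by (simp add: vec_eq_iff[of A] inv)
 qed
 hence "{A. \<not> P (conj_tuple B C A)} \<subseteq> conj_tuple C B ` N" using N(1) by blast
 ultimately show ?thesis by (intro AE_I') (auto simp: negligible_iff_null_sets)
qed

end

text \<open>\<open>400/231 <= sqrt 3\<close> gives the rational bound 31/200 for
  \<open>2/sqrt 3 - 1\<close>. Apply the separation to a pair containing the symbol of largest norm:
  its translations differ by at most \<open>2 * vec_tuple_norm v\<close>, so
  \<open>rho <= 31/100*(1 - rho)\<close>, which is below 6/25.\<close>

lemma admissible_bounds:
 fixes v :: "real^'d^'n"
 assumes A: "A \<in> admissible_tuples v" and N: "CARD('n) >= 2" and v: "\<And>i j. i \<noteq> j ==> v$i \<noteq> v$j"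
 shows "A \<in> GL_tuples" "mat_tuple_norm A <= 6/25"
  "i \<noteq> j ==> (op_norm (A$i) + op_norm (A$j)) * vec_tuple_norm v <= 31/200*(1 - mat_tuple_norm A)*norm (v$i - v$j)"
proof -
 show GL: "A \<in> GL_tuples" using A by (simp add: admissible_tuples_def)
 have lt1: "mat_tuple_norm A < 1" by (rule admissible_tuples_contractive[OF A N])
 interpret contractive_tuple A by unfold_locales (fact GL lt1)+
 define S where "S = {(op_norm (A$i) + op_norm (A$j))/norm (v$i - v$j) | i j. i \<noteq> j}"
 have "S = (\<lambda>(i, j). (op_norm (A$i) + op_norm (A$j))/norm (v$i - v$j)) ` {(i, j). i \<noteq> j}"
  unfolding S_def by auto
 hence fin: "finite S" by simp
 have "Max S*(vec_tuple_norm v/(1 - rho)) < 2/sqrt 3 - 1"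
  using A unfolding admissible_tuples_def Let_def S_def by blast
 also have "... <= 31/200"
 proof -
  have "(400/231)\<^sup>2 <= (3::real)" by (simp add: power2_eq_square)
  hence "400/231 <= sqrt 3" by (rule real_le_rsqrt)
  hence "2/sqrt 3 <= 2/(400/231)" by (intro divide_left_mono) auto
  thus ?thesis by simp
 qed
 finally have S: "Max S*(vec_tuple_norm v/(1 - rho)) <= 31/200" by simp
 have bound: "(op_norm (A$i) + op_norm (A$j)) * vec_tuple_norm v <= 31/200*(1 - rho)*norm (v$i - v$j)" if ij: "i \<noteq> j" for i j
 proof -
  have D: "0 < norm (v$i - v$j)" using v[OF ij] by simp
  have "(op_norm (A$i) + op_norm (A$j))/norm (v$i - v$j) \<in> S" unfolding S_def using ij by blast
  hence "(op_norm (A$i) + op_norm (A$j))/norm (v$i - v$j) <= Max S" by (rule Max_ge[OF fin])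
  hence "(op_norm (A$i) + op_norm (A$j))/norm (v$i - v$j)*(vec_tuple_norm v/(1 - rho)) <= 31/200"
   using S lt1 vec_tuple_norm_nonneg[of v] by (meson divide_nonneg_pos mult_right_mono order_trans diff_gt_0_iff_gt)
  thus ?thesis using D lt1 by (simp add: field_simps)
 qed
 thus "i \<noteq> j ==> (op_norm (A$i) + op_norm (A$j)) * vec_tuple_norm v <= 31/200*(1 - rho)*norm (v$i - v$j)" .
 have "rho \<in> range (\<lambda>i. op_norm (A$i))" unfolding mat_tuple_norm_def by (rule Max_in) auto
 then obtain k where k: "rho = op_norm (A$k)" by blast
 obtain l where l: "k \<noteq> l" using N by (metis (full_types) card_2_iff' ex_card)
 have D: "0 < norm (v$k - v$l)" "norm (v$k - v$l) <= 2 * vec_tuple_norm v"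
  using v[OF l] norm_triangle_ineq4[of "v$k" "v$l"] vec_tuple_norm_ge[of v k] vec_tuple_norm_ge[of v l] by auto
 hence V: "0 < vec_tuple_norm v" by linarith
 have "rho * vec_tuple_norm v <= (op_norm (A$k) + op_norm (A$l)) * vec_tuple_norm v"
  using k op_norm_nonneg V by (intro mult_right_mono) auto
 also have "... <= 31/200*(1 - rho)*norm (v$k - v$l)" by (rule bound[OF l])
 also have "... <= 31/200*(1 - rho)*(2 * vec_tuple_norm v)" using D lt1 by (intro mult_left_mono) auto
 finally have "rho * vec_tuple_norm v <= (31/100*(1 - rho)) * vec_tuple_norm v" by (simp add: algebra_simps)
 hence "rho <= 31/100*(1 - rho)" using V by (simp only: mult_le_cancel_right_pos)
 thus "rho <= 6/25" by simp
qed

text \<open>Conjugation multiplies norms by at most \<open>5/4*(4/3)\<close>, that is 5/3. So the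
  new maximal norm is at most 2/5, and the factor 31/200 grows to less than the 1/2 allowed, also
  after the contraction gap has shrunk.\<close>

lemma (in conjugation) conj_relaxed:
 fixes v :: "real^'d^'n"
 assumes A: "A \<in> admissible_tuples v" and N: "CARD('n) >= 2" and v: "\<And>i j. i \<noteq> j ==> v$i \<noteq> v$j"
  and BC: "op_norm B <= 5/4" "op_norm C <= 4/3"
 shows "conj_tuple B C A \<in> relaxed_tuples v"
proof -
 have a: "A \<in> GL_tuples" "mat_tuple_norm A <= 6/25"
  using admissible_bounds(1,2)[OF A N] v by blast+
 have a3: "(op_norm (A$i) + op_norm (A$j)) * vec_tuple_norm v <= 31/200*(1 - mat_tuple_norm A)*norm (v$i - v$j)" if "i \<noteq> j" for i j
  by (rule admissible_bounds(3)[OF A N]) (use v \<open>i \<noteq> j\<close> in auto)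
 let ?A = "conj_tuple B C A" and ?r = "mat_tuple_norm A"
 have "op_norm B * op_norm C <= 5/4*(4/3)" using BC op_norm_nonneg by (intro mult_mono) auto
 hence "op_norm B * op_norm C * op_norm (A$i) <= 5/3 * op_norm (A$i)" for i
  by (intro mult_right_mono op_norm_nonneg) simp
 hence op: "op_norm (?A$i) <= 5/3 * op_norm (A$i)" for i
  using op_norm_conj[of A i] order_trans by blast
 have Ar: "op_norm (A$i) <= ?r" for i unfolding mat_tuple_norm_def by (rule Max_ge) auto
 have "op_norm (?A$i) <= 5/3*?r" for i using op[of i] Ar[of i] by simp
 hence r: "mat_tuple_norm ?A <= 5/3*?r" unfolding mat_tuple_norm_def[of ?A] by (subst Max_le_iff) auto
 have "(op_norm (?A$i) + op_norm (?A$j))*(vec_tuple_norm v/(1 - mat_tuple_norm ?A)) <= norm (v$i - v$j)/2" if ij: "i \<noteq> j" for i j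
 proof -
  have "(op_norm (?A$i) + op_norm (?A$j)) * vec_tuple_norm v <= 5/3*((op_norm (A$i) + op_norm (A$j)) * vec_tuple_norm v)"
   using mult_right_mono[of "op_norm (?A$i) + op_norm (?A$j)" "5/3*(op_norm (A$i) + op_norm (A$j))" "vec_tuple_norm v"] op[of i] op[of j] vec_tuple_norm_nonneg[of v]
   by (simp add: distrib_right distrib_left)
  also have "... <= 5/3*(31/200*(1 - ?r)*norm (v$i - v$j))" by (intro mult_left_mono a3[OF ij]) simp
  also have "... <= (1/2*(1 - mat_tuple_norm ?A))*norm (v$i - v$j)"
   unfolding mult.assoc[symmetric] by (rule mult_right_mono) (use r a(2) in simp_all)
  finally show ?thesis using r a(2) by (simp add: field_simps)
 qed
 thus ?thesis using r a(2) conj_GL[OF a(1)] by (simp add: relaxed_tuples_def)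
qed

text \<open>One matrix \<open>B\<close> serves almost every tuple and all parameters at once, since
  \<open>t'\<close> and \<open>t\<close> are rational and \<open>k\<close>, which selects a weight,
  and \<open>K\<close>, which bounds its energy, are natural numbers. The energy may grow at half of
  the rate \<open>t - t'\<close>, and the other half leaves a convergent series.\<close>

theorem AE_admissible_energy:
 fixes v :: "real^'d^'n" and W W' :: "real => nat => real^'d^'d^'n => 'n list => real" and L :: real
 assumes N: "CARD('n) >= 2" and v: "\<And>i j. i \<noteq> j ==> v$i \<noteq> v$j" and L: "1 <= L"
  and W: "\<And>t k A w. 0 <= t ==> t <= real CARD('d) ==> A \<in> GL_tuples ==> 0 <= W t k A w \<and> 0 <= W' t k A w"
  and meas: "\<And>t k w. 0 <= t ==> t <= real CARD('d) ==>
   (\<lambda>A. W t k A w) \<in> borel_measurable borel \<and> (\<lambda>A. W' t k A w) \<in> borel_measurable borel"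
 obtains B C where "conjugation B C" "op_norm B <= 5/4" "op_norm C <= 4/3"
  "AE A in lebesgue. A \<in> admissible_tuples v --> (\<forall>(t' :: real) t k K. t' \<in> \<rat> --> t \<in> \<rat> --> 0 <= t' --> t' < t --> t <= real CARD('d) -->
   (\<forall>m. pair_energy t (W t k) (W' t k) m (conj_tuple B C A) <= real K*(2 powr ((t - t')/2))^m) -->
   (\<Sum>m. ennreal (2 powr (m*t') * close_pairs L v (W t k) (W' t k) m (conj_tuple B C A) B)) < \<infinity>)"
proof -
 let ?R = "norm (mat 1 :: real^'d^'d) + 1"
 define I :: "(real \<times> real \<times> nat \<times> nat) set" where
  "I = {(t', t, k, K). t' \<in> \<rat> \<and> t \<in> \<rat> \<and> 0 <= t' \<and> t' < t \<and> t <= real CARD('d)}"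
 have I: "countable I"
  by (rule countable_subset[of _ "\<rat> \<times> \<rat> \<times> UNIV \<times> UNIV"]) (auto simp: I_def intro!: countable_SIGMA countable_rat)
 define P where "P = (\<lambda>(t' :: real, t, k, K) A B. A \<in> relaxed_tuples v \<and>
   (\<forall>m. pair_energy t (W t k) (W' t k) m A <= real K*(2 powr ((t - t')/2))^m) --> B \<in> cball 0 ?R -->
   (\<Sum>m. ennreal (2 powr (m*t') * close_pairs L v (W t k) (W' t k) m A B)) < \<infinity>)"
 have "AE B in lborel. AE A in lborel. P i A B" if "i \<in> I" for i
 proof -
  obtain t' t k K where i: "i = (t', t, k, K)" by (cases i)
  have t: "0 <= t'" "t' < t" "t <= real CARD('d)" using that by (simp_all add: I_def i)
  have q: "2 powr ((t - t')/2)*2 powr (t' - t) < 1"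
   using t by (simp add: powr_add[symmetric] powr_less_one field_simps)
  show ?thesis unfolding P_def i prod.case
   by (rule AE_conjugates[OF v _ _ _ L _ _ _ _ _ q]) (use t W[of t] meas[of t] in auto)
 qed
 hence "AE B in lborel. \<forall>i\<in>I. AE A in lborel. P i A B" using I by (simp add: AE_ball_countable)
 then obtain N where N: "{B. \<not> (\<forall>i\<in>I. AE A in lborel. P i A B)} \<subseteq> N" "N \<in> null_sets (lborel :: (real^'d^'d) measure)"
  by (auto elim!: AE_E simp: null_sets_def)
 have neg: "negligible N" using N(2) by (auto simp: negligible_iff_null_sets intro: null_sets_completionI)
 let ?U = "{B :: real^'d^'d. op_norm (B - mat 1) < 1/4} \<inter> ball 0 ?R"
 have "continuous_on UNIV (\<lambda>B :: real^'d^'d. op_norm (B - mat 1))"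
  unfolding op_norm_eq_sval by (rule continuous_on_compose2[OF continuous_sval]) (auto intro!: continuous_intros simp: Suc_leI)
 hence "open ?U" by (intro open_Int open_ball open_Collect_less continuous_on_const)
 moreover have "op_norm (mat 1 - mat 1 :: real^'d^'d) <= 0" by (rule op_norm_le) simp
 hence "mat 1 \<in> ?U" by auto
 \<comment> \<open>A null set contains no neighbourhood of the identity, so some good
   \<open>B\<close> is close enough to it for the norm bounds.\<close>
 ultimately have "\<not> ?U \<subseteq> N" using neg open_not_negligible negligible_subset by blast
 then obtain B where B: "B \<in> ?U" "\<forall>i\<in>I. AE A in lborel. P i A B" using N(1) by blast
 obtain C where C: "B**C = mat 1" "C**B = mat 1" "op_norm B <= 5/4" "op_norm C <= 4/3"
  by (rule near_identity_invertible[of B]) (use B in auto)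
 interpret conjugation B C by unfold_locales (fact C)+
 have "AE A in lborel. \<forall>i\<in>I. P i A B" using B(2) I by (simp add: AE_ball_countable)
 hence "AE A :: real^'d^'d^'n in lebesgue. \<forall>i\<in>I. P i (conj_tuple B C A) B" by (rule AE_conj)
 hence "AE A in lebesgue. A \<in> admissible_tuples v --> (\<forall>(t' :: real) t k K. t' \<in> \<rat> --> t \<in> \<rat> --> 0 <= t' --> t' < t --> t <= real CARD('d) -->
   (\<forall>m. pair_energy t (W t k) (W' t k) m (conj_tuple B C A) <= real K*(2 powr ((t - t')/2))^m) -->
   (\<Sum>m. ennreal (2 powr (m*t') * close_pairs L v (W t k) (W' t k) m (conj_tuple B C A) B)) < \<infinity>)"
 proof (rule AE_mp, intro AE_I2 impI allI)
  fix A t' t k K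
  assume P: "\<forall>i\<in>I. P i (conj_tuple B C A) B" and A: "A \<in> admissible_tuples v"
   and t: "t' \<in> \<rat>" "t \<in> \<rat>" "0 <= t'" "t' < t" "t <= real CARD('d)"
   and E: "\<forall>m. pair_energy t (W t k) (W' t k) m (conj_tuple B C A) <= real K*(2 powr ((t - t')/2))^m"
  have "conj_tuple B C A \<in> relaxed_tuples v" by (rule conj_relaxed[OF A assms(1) v C(3,4)])
  moreover have "B \<in> cball 0 ?R" using B(1) by simp
  moreover have "(t', t, k, K) \<in> I" using t by (simp add: I_def)
  ultimately show "(\<Sum>m. ennreal (2 powr (m*t') * close_pairs L v (W t k) (W' t k) m (conj_tuple B C A) B)) < \<infinity>"
   using bspec[OF P, of "(t', t, k, K)"] E unfolding P_def prod.case by blast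
 qed
 thus thesis using C(3,4) by (intro that[of B C]) (unfold_locales)
qed

section \<open>From energies to local dimensions\<close>

context shift_measure
begin

lemma prob_split_words:
 assumes S: "S \<in> sets \<nu>"
 shows "prob S = (\<Sum>w\<in>words m. prob (S \<inter> cylinder w))"
proof -
 have "(\<Sum>w\<in>words m. prob (S \<inter> cylinder w)) = prob (\<Union>w\<in>words m. S \<inter> cylinder w)"
  using S by (intro finite_measure_finite_Union[symmetric] finite_words) (auto simp: disjoint_family_on_def cylinder_def words_def)
 also have "(\<Union>w\<in>words m. S \<inter> cylinder w) = S" by (auto simp: cylinder_def words_def)
 finally show ?thesis ..
qed

lemma nn_integral_stake:
 assumes S: "S \<in> sets \<nu>" and f: "\<And>w. 0 <= f w"
 shows "(\<integral>\<^sup>+\<xi>. ennreal (f (stake m \<xi>))*indicator S \<xi> \<partial>\<nu>) = ennreal (\<Sum>w\<in>words m. f w*prob (S \<inter> cylinder w))"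
proof -
 have "ennreal (f (stake m \<xi>))*indicator S \<xi> = (\<Sum>w\<in>words m. ennreal (f w)*indicator (S \<inter> cylinder w) \<xi>)" for \<xi>
 proof -
  have "(\<Sum>w\<in>words m. ennreal (f w)*indicator (S \<inter> cylinder w) \<xi>) =
   (\<Sum>w\<in>words m. if w = stake m \<xi> then ennreal (f w)*indicator S \<xi> else 0)"
   by (intro sum.cong) (auto simp: cylinder_def words_def indicator_def)
  thus ?thesis by simp
 qed
 hence "(\<integral>\<^sup>+\<xi>. ennreal (f (stake m \<xi>))*indicator S \<xi> \<partial>\<nu>) = (\<Sum>w\<in>words m. \<integral>\<^sup>+\<xi>. ennreal (f w)*indicator (S \<inter> cylinder w) \<xi> \<partial>\<nu>)"
  using S by (simp only:, intro nn_integral_sum borel_measurable_times_ennreal borel_measurable_const borel_measurable_indicator) auto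
 also have "... = (\<Sum>w\<in>words m. ennreal (f w*prob (S \<inter> cylinder w)))"
  using S f by (intro sum.cong refl) (simp add: nn_integral_cmult_indicator emeasure_eq_measure ennreal_mult)
 also have "... = ennreal (\<Sum>w\<in>words m. f w*prob (S \<inter> cylinder w))" using f by (intro sum_ennreal) simp
 finally show ?thesis .
qed

end

lemma ennreal_suminf_finite_tendsto:
 assumes "(\<Sum>m. ennreal (f m)) < \<infinity>" "\<And>m. 0 <= f m"
 shows "f \<longlonglongrightarrow> 0"
 by (rule summable_LIMSEQ_zero, rule summable_suminf_not_top) (use assms in \<open>simp_all add: less_top\<close>)

context ergodic_cocycle
begin

lemma coding_measurable_nu [measurable]: "coding_map A v \<in> borel_measurable \<nu>"
 using coding_measurable[of v] by (simp add: measurable_cong_sets[OF sets_nu refl])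

text \<open>Two points at distance at most \<open>1/2^m\<close> have truncations at distance at most
  \<open>(1 + 2*radius v)/2^m\<close>, and \<open>B\<close> adds the factor 5/4; this is the origin
  of \<open>L\<close>. So the integral over centres in \<open>G\<close> of the mass of
  \<open>G'\<close> in such balls is at most a constant times \<open>close_pairs\<close>. A
  convergent series of these integrals, weighted by \<open>2 powr (m*t')\<close>, makes the masses
  eventually at most \<open>2 powr - (m*t')\<close> almost everywhere.\<close>

lemma energy_local_bound:
 fixes \<kappa> L t' :: real
 assumes conj: "conjugation B C" "op_norm B <= 5/4" and half: "rho <= 1/2" and L: "5/4*(1 + 2*radius v) <= L"
  and G: "G \<in> sets \<nu>" "G' \<in> sets \<nu>" and \<kappa>: "0 <= \<kappa>"
  and W: "\<And>w. prob (G \<inter> cylinder w) <= \<kappa>*W (conj_tuple B C A) w" "\<And>w. prob (G' \<inter> cylinder w) <= \<kappa>*W' (conj_tuple B C A) w"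
  and fin: "(\<Sum>m. ennreal (2 powr (m*t') * close_pairs L v W W' m (conj_tuple B C A) B)) < \<infinity>"
 shows "AE \<xi> in \<nu>. \<xi> \<in> G --> (\<forall>\<^sub>F m in sequentially. prob {\<xi>' \<in> G'. dist (coding_map A v \<xi>) (coding_map A v \<xi>') <= 1/2^m} <= 2 powr - (m*t'))"
proof -
 interpret conjugation B C by fact
 let ?A = "conj_tuple B C A"
 define close where "close m w w' \<longleftrightarrow> norm (B *v (point A v w - point A v w')) <= L/2^m" for m w w'
 have cp: "close_pairs L v W W' m ?A B = (\<Sum>w\<in>words m. \<Sum>w'\<in>words m. W ?A w*W' ?A w'*(if close m w w' then 1 else 0))" for m
  unfolding close_pairs_def close_def
  by (intro sum.cong refl arg_cong2[of _ _ _ _ "(*)"]) (simp add: point_conj matrix_vector_mult_diff_distrib indicator_def)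
 \<comment> \<open>A bound, common to all centres whose code begins with \<open>w\<close>, for the
   mass of \<open>G'\<close> in the ball of radius \<open>1/2^m\<close>.\<close>
 define H where "H m w = (\<Sum>w'\<in>words m. prob (G' \<inter> cylinder w')*(if close m w w' then 1 else 0))" for m w
 have H0: "0 <= H m w" for m w unfolding H_def by (intro sum_nonneg) auto
 have near: "close m (stake m \<xi>) (stake m \<xi>')" if d: "dist (coding_map A v \<xi>) (coding_map A v \<xi>') <= 1/2^m" for m \<xi> \<xi>'
 proof -
  have a: "dist (coding_map A v \<xi>) (point A v (stake m \<xi>)) <= 1/2^m*radius v" for \<xi>
  proof -
   have "rho^m <= (1/2)^m" using half rho_pos by (intro power_mono) auto
   hence "rho^m*radius v <= 1/2^m*radius v" by (intro mult_right_mono radius_nonneg) (simp add: power_divide)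
   thus ?thesis using coding_approx[of v \<xi> m] by (simp add: dist_norm)
  qed
  have "dist (point A v (stake m \<xi>)) (point A v (stake m \<xi>')) <=
    dist (coding_map A v \<xi>) (point A v (stake m \<xi>)) + dist (coding_map A v \<xi>) (coding_map A v \<xi>') + dist (coding_map A v \<xi>') (point A v (stake m \<xi>'))"
   by metric
  also have "... <= (1 + 2*radius v)/2^m" using a[of \<xi>] a[of \<xi>'] d by (simp add: add_divide_distrib)
  finally have "norm (point A v (stake m \<xi>) - point A v (stake m \<xi>')) <= (1 + 2*radius v)/2^m" by (simp add: dist_norm)
  hence "norm (B *v (point A v (stake m \<xi>) - point A v (stake m \<xi>'))) <= 5/4*((1 + 2*radius v)/2^m)"
   using conj(2) op_norm_nonneg[of B] by (intro order_trans[OF norm_matrix_vector_le_op_norm] mult_mono) auto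
  also have "... <= L/2^m" using divide_right_mono[OF L, of "2^m"] by simp
  finally show ?thesis by (simp add: close_def)
 qed
 have le_H: "prob {\<xi>' \<in> G'. dist (coding_map A v \<xi>) (coding_map A v \<xi>') <= 1/2^m} <= H m (stake m \<xi>)" for m \<xi>
 proof -
  let ?S = "{\<xi>' \<in> G'. dist (coding_map A v \<xi>) (coding_map A v \<xi>') <= 1/2^m}"
  have S: "?S \<in> sets \<nu>"
  proof -
   note [measurable] = G(2)
   have "?S = {\<xi>' \<in> space \<nu>. \<xi>' \<in> G' \<and> dist (coding_map A v \<xi>) (coding_map A v \<xi>') <= 1/2^m}" by simp
   also have "... \<in> sets \<nu>" by measurable
   finally show ?thesis .
  qed
  show ?thesis unfolding prob_split_words[OF S, of m] H_def
  proof (rule sum_mono)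
   fix w' :: "'n list" assume "w' \<in> words m"
   show "prob (?S \<inter> cylinder w') <= prob (G' \<inter> cylinder w')*(if close m (stake m \<xi>) w' then 1 else 0)"
   proof (cases "close m (stake m \<xi>) w'")
    case False
    have "x \<notin> ?S" if "x \<in> cylinder w'" for x
    proof -
     have "stake m x = w'" using that \<open>w' \<in> words m\<close> by (simp add: cylinder_def words_def)
     thus ?thesis using near[of \<xi> x m] False by blast
    qed
    hence e: "?S \<inter> cylinder w' = {}" by blast
    show ?thesis unfolding e by simp
   qed (use G in \<open>auto intro!: finite_measure_mono\<close>)
  qed
 qed
 have le_cp: "(\<Sum>w\<in>words m. H m w*prob (G \<inter> cylinder w)) <= \<kappa>\<^sup>2 * close_pairs L v W W' m ?A B" for m
 proof -
  have "(\<Sum>w\<in>words m. H m w*prob (G \<inter> cylinder w)) =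
    (\<Sum>w\<in>words m. \<Sum>w'\<in>words m. prob (G \<inter> cylinder w)*prob (G' \<inter> cylinder w')*(if close m w w' then 1 else 0))"
   unfolding H_def sum_distrib_right by (intro sum.cong refl) auto
  also have "... <= (\<Sum>w\<in>words m. \<Sum>w'\<in>words m. (\<kappa>*W ?A w)*(\<kappa>*W' ?A w')*(if close m w w' then 1 else 0))"
  proof (intro sum_mono mult_right_mono)
   fix w w'
   show "prob (G \<inter> cylinder w)*prob (G' \<inter> cylinder w') <= (\<kappa>*W ?A w)*(\<kappa>*W' ?A w')"
    using order_trans[OF measure_nonneg W(1)[of w]] by (intro mult_mono W measure_nonneg)
  qed auto
  also have "... = \<kappa>\<^sup>2 * close_pairs L v W W' m ?A B"
   unfolding cp sum_distrib_left by (intro sum.cong refl) (simp add: power2_eq_square)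
  finally show ?thesis .
 qed
 let ?g = "\<lambda>m \<xi>. ennreal (2 powr (m*t')*H m (stake m \<xi>))*indicator G \<xi>"
 have g: "?g m \<in> borel_measurable \<nu>" for m
  using G(1) fun_stake_measurable[of "\<lambda>w. 2 powr (m*t')*H m w" m]
  by (intro borel_measurable_times_ennreal borel_measurable_indicator measurable_compose[OF _ measurable_ennreal]) auto
 have "(\<integral>\<^sup>+\<xi>. (\<Sum>m. ?g m \<xi>) \<partial>\<nu>) = (\<Sum>m. \<integral>\<^sup>+\<xi>. ?g m \<xi> \<partial>\<nu>)" by (rule nn_integral_suminf) (rule g)
 also have "... <= (\<Sum>m. ennreal (\<kappa>\<^sup>2)*ennreal (2 powr (m*t') * close_pairs L v W W' m ?A B))"
 proof (intro suminf_le allI)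
  fix m
  have "(\<integral>\<^sup>+\<xi>. ?g m \<xi> \<partial>\<nu>) = ennreal (\<Sum>w\<in>words m. 2 powr (m*t')*H m w*prob (G \<inter> cylinder w))"
   using H0 by (intro nn_integral_stake G(1)) simp
  also have "... = ennreal (2 powr (m*t')*(\<Sum>w\<in>words m. H m w*prob (G \<inter> cylinder w)))"
   by (simp add: sum_distrib_left mult.assoc)
  also have "... <= ennreal (2 powr (m*t')*(\<kappa>\<^sup>2 * close_pairs L v W W' m ?A B))"
   by (intro ennreal_leI mult_left_mono le_cp) simp
  also have "... = ennreal (\<kappa>\<^sup>2)*ennreal (2 powr (m*t') * close_pairs L v W W' m ?A B)"
   by (subst ennreal_mult'[symmetric]) (simp_all add: mult_ac)
  finally show "(\<integral>\<^sup>+\<xi>. ?g m \<xi> \<partial>\<nu>) <= ennreal (\<kappa>\<^sup>2)*ennreal (2 powr (m*t') * close_pairs L v W W' m ?A B)" .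
 qed auto
 also have "... < \<infinity>" using fin by (simp add: ennreal_mult_less_top)
 finally have "AE \<xi> in \<nu>. (\<Sum>m. ?g m \<xi>) \<noteq> \<infinity>" by (intro nn_integral_PInf_AE borel_measurable_suminf_order g) simp
 thus ?thesis
 proof eventually_elim
  case (elim \<xi>)
  show ?case
  proof
   assume "\<xi> \<in> G"
   hence "(\<Sum>m. ennreal (2 powr (m*t')*H m (stake m \<xi>))) < \<infinity>" using elim by (simp add: less_top)
   hence "(\<lambda>m. 2 powr (m*t')*H m (stake m \<xi>)) \<longlonglongrightarrow> 0"
    by (rule ennreal_suminf_finite_tendsto) (simp add: H0)
   hence "\<forall>\<^sub>F m in sequentially. 2 powr (m*t')*H m (stake m \<xi>) < 1" by (rule order_tendstoD) simp
   thus "\<forall>\<^sub>F m in sequentially. prob {\<xi>' \<in> G'. dist (coding_map A v \<xi>) (coding_map A v \<xi>') <= 1/2^m} <= 2 powr - (m*t')"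
   proof eventually_elim
    case (elim m)
    have "H m (stake m \<xi>) <= 2 powr - (m*t')" using elim by (simp add: powr_minus field_simps)
    thus ?case using le_H[of \<xi> m] by linarith
   qed
  qed
 qed
qed

definition good_words :: "real => real => 'n stream set" where
 "good_words t K = {\<xi>. \<forall>n. prob (cylinder (stake n \<xi>)) <= K*phi t (stake n \<xi>)}"

lemma good_words_sets [measurable]: "good_words t K \<in> sets \<nu>"
proof -
 have "{\<xi>. prob (cylinder (stake n \<xi>)) <= K*phi t (stake n \<xi>)} \<in> sets \<nu>" for n
  by (rule stake_pred_sets)
 hence 1: "(\<Inter>n. {\<xi>. prob (cylinder (stake n \<xi>)) <= K*phi t (stake n \<xi>)}) \<in> sets \<nu>"
  by (intro sets.countable_INT) auto
 have 2: "good_words t K = (\<Inter>n. {\<xi>. prob (cylinder (stake n \<xi>)) <= K*phi t (stake n \<xi>)})"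
  unfolding good_words_def by (rule Collect_all_eq)
 show ?thesis unfolding 2 by (rule 1)
qed

text \<open>Cylinder masses decay almost at the rate \<open>shift_entropy \<nu>\<close> or faster,
  \<open>phi t\<close> only at the smaller rate \<open>energy_rate t\<close>. The cap therefore
  holds from some level on, and \<open>K\<close> absorbs the finitely many earlier levels.\<close>

lemma AE_good_words:
 assumes t: "0 <= t" "t <= real CARD('d)" and h: "energy_rate t < shift_entropy \<nu>"
 shows "AE \<xi> in \<nu>. \<exists>K::nat. \<xi> \<in> good_words t K"
proof -
 define e where "e = (shift_entropy \<nu> - energy_rate t)/2"
 have e: "0 < e" using h by (simp add: e_def)
 show ?thesis using prob_cylinder_upper[OF e] phi_rate(1)[OF t]
 proof eventually_elim
  case (elim \<xi>)
  have "\<forall>\<^sub>F n in sequentially. - energy_rate t - e < ln (phi t (stake n \<xi>))/n"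
   using e by (intro order_tendstoD(1)[OF elim(2)]) simp
  hence "\<forall>\<^sub>F n in sequentially. prob (cylinder (stake n \<xi>)) <= phi t (stake n \<xi>)"
   using elim(1) eventually_gt_at_top[of 0]
  proof eventually_elim
   case (elim n)
   have "- (n*(shift_entropy \<nu> - e)) <= ln (phi t (stake n \<xi>))"
    using elim(1,3) by (simp add: e_def field_simps)
   hence "exp (- (n*(shift_entropy \<nu> - e))) <= phi t (stake n \<xi>)" using phi_pos[OF t] by (simp add: ln_ge_iff)
   thus ?case using elim(2) by linarith
  qed
  then obtain N where N: "\<And>n. n >= N ==> prob (cylinder (stake n \<xi>)) <= phi t (stake n \<xi>)" by (auto simp: eventually_sequentially)
  obtain K :: nat where K: "1 + (\<Sum>n<N. 1/phi t (stake n \<xi>)) <= K" using real_arch_simple by blast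
  have nn: "0 <= 1/phi t (stake n \<xi>)" for n using phi_pos[OF t, of "stake n \<xi>"] by simp
  have "prob (cylinder (stake n \<xi>)) <= K*phi t (stake n \<xi>)" for n
  proof (cases "N <= n")
   case True
   have "1 <= real K" using K sum_nonneg[of "{..<N}" "\<lambda>n. 1/phi t (stake n \<xi>)"] nn by simp
   hence "1*phi t (stake n \<xi>) <= K*phi t (stake n \<xi>)" using phi_pos[OF t, of "stake n \<xi>"] by (intro mult_right_mono) auto
   thus ?thesis using N[OF True] by simp
  next
   case False
   hence "1/phi t (stake n \<xi>) <= (\<Sum>n<N. 1/phi t (stake n \<xi>))" by (intro member_le_sum) (auto simp: nn simp del: divide_le_0_1_iff zero_le_divide_1_iff)
   hence "1/phi t (stake n \<xi>) <= K" using K by simp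
   hence "1 <= K*phi t (stake n \<xi>)" using phi_pos[OF t, of "stake n \<xi>"] by (simp add: field_simps)
   thus ?thesis using prob_le_1[of "cylinder (stake n \<xi>)"] by linarith
  qed
  thus ?case by (auto simp: good_words_def)
 qed
qed

end

lemma linear_times_geometric_bound:
 fixes a q :: real
 assumes "0 <= a" "a < q"
 obtains K :: nat where "\<And>m. (real m + 1)*a^m <= K*q^m"
proof -
 have "(\<lambda>m. (real m + 1)*(a/q)^m) \<longlonglongrightarrow> 0"
  using tendsto_add[OF powser_times_n_limit_0[of "a/q"] LIMSEQ_power_zero[of "a/q"]] assms by (simp add: distrib_right add.commute)
 hence "Bseq (\<lambda>m. (real m + 1)*(a/q)^m)" by (intro convergent_imp_Bseq convergentI)
 then obtain c where "\<forall>m. norm ((real m + 1)*(a/q)^m) <= c" by (rule BseqE)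
 hence c: "\<bar>(real m + 1)*(a/q)^m\<bar> <= c" for m unfolding real_norm_def by blast
 obtain K :: nat where "c <= K" using real_arch_simple by blast
 hence "(real m + 1)*(a/q)^m <= K" for m using c[of m] by linarith
 thus thesis using assms by (intro that[of K]) (simp add: power_divide field_simps)
qed

text \<open>The set \<open>good_words\<close> belongs to one tuple, whereas Fubini's theorem needs
  weights defined for all tuples and measurable in them. The cap is imposed on every prefix because
  the energy divides by \<open>svf\<close> of every common prefix.\<close>

definition capped_weight ::
  "'n stream measure => real => real => real^'d^'d^'n => 'n list => real" where
 "capped_weight \<nu> t K A w = (if \<forall>k\<le>length w. measure \<nu> (cylinder (take k w)) <= K * svf t (word_mat A (take k w))
   then measure \<nu> (cylinder w) else 0)"

lemma capped_weight_measurable: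
 assumes t: "0 <= t" "t <= real CARD('d)"
 shows "(\<lambda>A :: real^'d^'d^'n. capped_weight \<nu> t K A w) \<in> borel_measurable borel"
proof -
 note [measurable] = svf_word_measurable[OF t]
 show ?thesis unfolding capped_weight_def by measurable
qed

text \<open>For fixed \<open>w\<close> the words \<open>w'\<close> with the same prefix of length
  \<open>k\<close> have total mass equal to that of the prefix cylinder, and the cap on
  \<open>w\<close> cancels it against \<open>svf\<close>. Each of the \<open>m + 1\<close> levels
  contributes at most \<open>K\<close>; only one of the two weights has to be capped.\<close>

lemma (in shift_measure) capped_pair_energy:
 fixes A :: "real^'d^'d^'n"
 assumes A: "A \<in> GL_tuples" and t: "0 <= t" "t <= real CARD('d)" and K: "0 <= K"
 shows "pair_energy t (capped_weight \<nu> t K) (\<lambda>_ w. prob (cylinder w)) m A <= K*(m + 1)"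
proof -
 have inv: "invertible (word_mat A w)" for w
  using A by (induction w) (simp_all add: invertible_mult GL_tuples_def invertible_mat_1)
 let ?W = "capped_weight \<nu> t K A"
 have "pair_energy t (capped_weight \<nu> t K) (\<lambda>_ w. prob (cylinder w)) m A <= (\<Sum>k\<le>m. \<Sum>w\<in>words m. K*prob (cylinder w))"
  unfolding pair_energy_def
 proof (intro sum_mono)
  fix k and w :: "'n list" assume k: "k \<in> {..m}" and w: "w \<in> words m"
  let ?u = "take k w"
  note pos = svf_pos[OF inv[of ?u] t]
  have "(\<Sum>w'\<in>words m. if ?u = take k w' then ?W w*prob (cylinder w')/svf t (word_mat A ?u) else 0) =
    ?W w/svf t (word_mat A ?u)*(\<Sum>w'\<in>words m. if ?u = take k w' then prob (cylinder w') else 0)"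
   unfolding sum_distrib_left by (intro sum.cong refl) auto
  also have "(\<Sum>w'\<in>words m. if ?u = take k w' then prob (cylinder w') else 0) = (\<Sum>w'\<in>words m. prob (cylinder ?u \<inter> cylinder w'))"
  proof (intro sum.cong refl)
   fix w' :: "'n list" assume w': "w' \<in> words m"
   have "stake k \<xi> = take k w'" if "\<xi> \<in> cylinder w'" for \<xi>
    using w' k that take_stake[of k m \<xi>] by (auto simp: cylinder_def words_def min_def)
   hence "cylinder ?u \<inter> cylinder w' = (if ?u = take k w' then cylinder w' else {})"
    using w w' k by (auto simp: cylinder_def words_def min_def)
   thus "(if ?u = take k w' then prob (cylinder w') else 0) = prob (cylinder ?u \<inter> cylinder w')" by simp
  qed
  also have "... = prob (cylinder ?u)" by (rule prob_split_words[symmetric]) simp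
  also have "?W w/svf t (word_mat A ?u)*prob (cylinder ?u) <= K*prob (cylinder w)"
  proof (cases "\<forall>k\<le>length w. prob (cylinder (take k w)) <= K * svf t (word_mat A (take k w))")
   case True
   hence "prob (cylinder ?u) <= K * svf t (word_mat A ?u)" using k w by (simp add: words_def)
   hence "prob (cylinder w)*(prob (cylinder ?u)/svf t (word_mat A ?u)) <= prob (cylinder w)*K"
    using pos by (intro mult_left_mono) (simp_all add: field_simps)
   thus ?thesis using True by (simp add: capped_weight_def mult_ac)
  next
   case False
   hence "?W w = 0" unfolding capped_weight_def by (rule if_not_P)
   thus ?thesis using K by simp
  qed
  finally show "(\<Sum>w'\<in>words m. if ?u = take k w' then ?W w*prob (cylinder w')/svf t (word_mat A ?u) else 0) <= K*prob (cylinder w)" .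
 qed
 also have "... = K*(m + 1)" by (simp add: sum_prob_cylinder flip: sum_distrib_left)
 finally show ?thesis .
qed

text \<open>Split both words after the common prefix: by submultiplicativity the quotient is at most
  the value of the prefix times those of the two ends. The sum is then bounded by
  \<open>Zsum t k\<close> times the square of \<open>Zsum t (m - k)\<close>, which grows slowly if
  \<open>a\<close> is close to 1.\<close>

lemma (in contractive_tuple) phi_pair_energy:
 assumes t: "0 <= t" "t <= real CARD('d)" and Z: "\<And>n. Zsum t n <= D*a^n" and D: "0 <= D" and a: "1 <= a"
 shows "pair_energy t (\<lambda>A w. svf t (word_mat A w)) (\<lambda>A w. svf t (word_mat A w)) m A <= (svf_const (CARD('d)))\<^sup>2*D^3*((m + 1)*(a\<^sup>2)^m)"
proof -
 let ?C = "svf_const (CARD('d))"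
 have "pair_energy t (\<lambda>A w. svf t (word_mat A w)) (\<lambda>A w. svf t (word_mat A w)) m A <= (\<Sum>k\<le>m. ?C\<^sup>2*D^3*(a\<^sup>2)^m)"
  unfolding pair_energy_def phi_def[symmetric]
 proof (rule sum_mono)
  fix k assume "k \<in> {..m}"
  hence k: "k <= m" by simp
  have sp: "(\<Sum>w\<in>words m. f w) = (\<Sum>u\<in>words k. \<Sum>x\<in>words (m - k). f (u @ x))" for f :: "'n list => real"
   using sum_words_add[of f k "m - k"] k by simp
  have "(\<Sum>w\<in>words m. \<Sum>w'\<in>words m. if take k w = take k w' then phi t w*phi t w'/phi t (take k w) else 0) =
    (\<Sum>u\<in>words k. \<Sum>x\<in>words (m - k). \<Sum>u'\<in>words k. if u = u' then (\<Sum>y\<in>words (m - k). phi t (u @ x)*phi t (u' @ y)/phi t u) else 0)"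
   unfolding sp
  proof (intro sum.cong refl)
   fix u x u' :: "'n list" assume "u \<in> words k" "u' \<in> words k"
   hence "take k (u @ z) = u" "take k (u' @ z) = u'" for z by (simp_all add: words_def)
   thus "(\<Sum>y\<in>words (m - k). if take k (u @ x) = take k (u' @ y) then phi t (u @ x)*phi t (u' @ y)/phi t (take k (u @ x)) else 0) =
    (if u = u' then (\<Sum>y\<in>words (m - k). phi t (u @ x)*phi t (u' @ y)/phi t u) else 0)" by simp
  qed
  also have "... = (\<Sum>u\<in>words k. \<Sum>x\<in>words (m - k). \<Sum>y\<in>words (m - k). phi t (u @ x)*phi t (u @ y)/phi t u)"
   by (rule sum.cong[OF refl], rule sum.cong[OF refl], subst sum.delta'[OF finite_words]) simp
  also have "... <= (\<Sum>u\<in>words k. \<Sum>x\<in>words (m - k). \<Sum>y\<in>words (m - k). ?C\<^sup>2*(phi t u*(phi t x*phi t y)))"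
  proof (intro sum_mono)
   fix u x y
   have "phi t (u @ x)*phi t (u @ y) <= (?C*phi t u*phi t x)*(?C*phi t u*phi t y)"
    using phi_pos[OF t] svf_const_pos by (intro mult_mono phi_mult[OF t]) (auto simp: less_imp_le)
   thus "phi t (u @ x)*phi t (u @ y)/phi t u <= ?C\<^sup>2*(phi t u*(phi t x*phi t y))"
    using phi_pos[OF t, of u] by (simp add: divide_le_eq power2_eq_square mult_ac)
  qed
  also have "... = ?C\<^sup>2*(Zsum t k*(Zsum t (m - k)*Zsum t (m - k)))"
   by (simp only: Zsum_def sum_product) (simp only: sum_distrib_left)
  also have "... <= ?C\<^sup>2*((D*a^k)*((D*a^(m - k))*(D*a^(m - k))))"
   using Zsum_pos[OF t] D a by (intro mult_left_mono mult_mono Z) (auto simp: less_imp_le)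
  also have "... = ?C\<^sup>2*D^3*(a^(k + (m - k))*a^(m - k))"
   by (simp add: power_add power3_eq_cube mult_ac)
  also have "... <= ?C\<^sup>2*D^3*(a^m*a^m)"
   using k a D by (intro mult_left_mono) (auto intro!: power_increasing mult_left_mono)
  also have "a^m*a^m = (a\<^sup>2)^m" by (simp add: power2_eq_square power_mult_distrib)
  finally show "(\<Sum>w\<in>words m. \<Sum>w'\<in>words m. if take k w = take k w' then phi t w*phi t w'/phi t (take k w) else 0) <= ?C\<^sup>2*D^3*(a\<^sup>2)^m" .
 qed
 thus ?thesis by (simp add: mult_ac add.commute)
qed

section \<open>Upper bounds for the local dimension\<close>

context ergodic_cocycle
begin

definition cover_bound :: "real^'d^'n => real => 'n list => real" where
 "cover_bound v r w = (2*radius v * CARD('d) + 2)^CARD('d) * svcap (1/r) (word_mat A w)"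

lemma cover_bound_ge_1: "1 <= cover_bound v r w"
proof -
 have "1 <= (2*radius v * CARD('d) + 2)^CARD('d)" using radius_nonneg[of v] by (intro one_le_power) simp
 thus ?thesis unfolding cover_bound_def using mult_mono[OF _ svcap_ge_1] by fastforce
qed

definition ball_prob :: "real^'d^'n => real^'d => real => real" where
 "ball_prob v x r = prob {\<xi>. dist x (coding_map A v \<xi>) <= r}"

lemma ball_sets: "{\<xi>. dist x (coding_map A v \<xi>) <= r} \<in> sets \<nu>"
proof -
 have "{\<xi> \<in> space \<nu>. dist x (coding_map A v \<xi>) <= r} \<in> sets \<nu>" by measurable
 thus ?thesis by simp
qed

text \<open>Cover the image of each cylinder by balls of radius \<open>r n\<close>; the cells of the cover
 carrying less than the fraction \<open>\<delta> n\<close> of their fair share have total mass at most \<open>\<delta> n\<close>.\<close>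

lemma AE_ball_prob_lower:
 assumes r: "\<And>n. 0 < r n" and \<delta>: "\<And>n. 0 <= \<delta> n" "summable \<delta>"
 shows "AE \<xi> in \<nu>. \<forall>\<^sub>F n in sequentially.
  prob (cylinder (stake n \<xi>))*\<delta> n/cover_bound v (r n) (stake n \<xi>) <= ball_prob v (coding_map A v \<xi>) (2*r n)"
proof -
 have "\<exists>F. finite F \<and> card F <= cover_bound v (r n) w \<and> (*v) (word_mat A w) ` cball 0 (radius v) \<subseteq> (\<Union>c\<in>F. cball c (r n))" for n w
  using ellipsoid_covering[OF invertible_word[of w] r[of n] radius_nonneg[of v]] unfolding cover_bound_def by metis
 then obtain F where F: "finite (F n w)" "card (F n w) <= cover_bound v (r n) w"
  "(*v) (word_mat A w) ` cball 0 (radius v) \<subseteq> (\<Union>c\<in>F n w. cball c (r n))" for n w by metis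
 define cell where "cell n w c = cylinder w \<inter> {\<xi>. dist (point A v w + c) (coding_map A v \<xi>) <= r n}" for n w c
 have cell_sets: "cell n w c \<in> sets \<nu>" for n w c unfolding cell_def using ball_sets by auto
 define small where "small n w c \<longleftrightarrow> prob (cell n w c) <= prob (cylinder w)*\<delta> n/cover_bound v (r n) w" for n w c
 define bad where "bad n = (\<Union>w\<in>words n. \<Union>c\<in>{c \<in> F n w. small n w c}. cell n w c)" for n
 have bad_sets: "bad n \<in> sets \<nu>" for n unfolding bad_def using F(1) cell_sets by (intro sets.finite_UN) auto
 have bad_le: "prob (bad n) <= \<delta> n" for n
 proof -
  have "prob (bad n) <= (\<Sum>w\<in>words n. prob (\<Union>c\<in>{c \<in> F n w. small n w c}. cell n w c))"
   unfolding bad_def using F(1) cell_sets by (intro finite_measure_subadditive_finite) auto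
  also have "... <= (\<Sum>w\<in>words n. prob (cylinder w)*\<delta> n)"
  proof (rule sum_mono)
   fix w
   have "prob (\<Union>c\<in>{c \<in> F n w. small n w c}. cell n w c) <= (\<Sum>c\<in>{c \<in> F n w. small n w c}. prob (cell n w c))"
    using F(1) cell_sets by (intro finite_measure_subadditive_finite) auto
   also have "... <= (\<Sum>c\<in>{c \<in> F n w. small n w c}. prob (cylinder w)*\<delta> n/cover_bound v (r n) w)"
    by (rule sum_mono) (simp add: small_def)
   also have "... = card {c \<in> F n w. small n w c}*(prob (cylinder w)*\<delta> n/cover_bound v (r n) w)" by simp
   also have "... <= cover_bound v (r n) w*(prob (cylinder w)*\<delta> n/cover_bound v (r n) w)"
    using F(2)[of n w] card_mono[OF F(1), of "{c \<in> F n w. small n w c}" n w] \<delta>(1)[of n] cover_bound_ge_1[of v "r n" w]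
    by (intro mult_right_mono) auto
   also have "... = prob (cylinder w)*\<delta> n" using cover_bound_ge_1[of v "r n" w] by simp
   finally show "prob (\<Union>c\<in>{c \<in> F n w. small n w c}. cell n w c) <= prob (cylinder w)*\<delta> n" .
  qed
  also have "... = \<delta> n" by (simp add: sum_prob_cylinder flip: sum_distrib_right)
  finally show ?thesis .
 qed
 have "summable (\<lambda>n. prob (bad n))" by (rule summable_comparison_test'[OF \<delta>(2)]) (simp add: bad_le)
 hence "AE \<xi> in \<nu>. \<forall>\<^sub>F n in sequentially. \<xi> \<in> space \<nu> - bad n"
  by (intro borel_cantelli_AE1 bad_sets) (auto simp: emeasure_eq_measure)
 thus ?thesis
 proof eventually_elim
  case (elim \<xi>)
  thus ?case
  proof eventually_elim
   case (elim n)
   let ?w = "stake n \<xi>"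
   have "word_mat A ?w *v coding_map A v (sdrop n \<xi>) \<in> (*v) (word_mat A ?w) ` cball 0 (radius v)"
    using norm_coding_le by (intro imageI) simp
   then obtain c where c: "c \<in> F n ?w" "dist c (word_mat A ?w *v coding_map A v (sdrop n \<xi>)) <= r n" using F(3)[of ?w n] by auto
   have d: "dist (point A v ?w + c) (coding_map A v \<xi>) <= r n"
    using c(2) unfolding coding_split[of v \<xi> n] by (simp add: dist_norm)
   hence "\<xi> \<in> cell n ?w c" by (simp add: cell_def cylinder_def)
   hence "\<not> small n ?w c" using elim c(1) unfolding bad_def by auto
   hence "prob (cylinder ?w)*\<delta> n/cover_bound v (r n) ?w <= prob (cell n ?w c)" by (simp add: small_def)
   also have "... <= ball_prob v (coding_map A v \<xi>) (2*r n)"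
    unfolding ball_prob_def
   proof (rule finite_measure_mono[OF _ ball_sets], rule)
    fix \<xi>' assume "\<xi>' \<in> cell n ?w c"
    hence "dist (point A v ?w + c) (coding_map A v \<xi>') <= r n" by (simp add: cell_def)
    thus "\<xi>' \<in> {\<xi>'. dist (coding_map A v \<xi>) (coding_map A v \<xi>') <= 2*r n}"
     using d dist_triangle3[of "coding_map A v \<xi>" "coding_map A v \<xi>'" "point A v ?w + c"] by simp
   qed
   finally show ?case .
  qed
 qed
qed

text \<open>At scale \<open>exp (- c n)\<close> the \<open>j\<close>-th axis still matters exactly
  when \<open>c\<close> exceeds the \<open>j\<close>-th exponent, and then contributes the
  difference to the growth rate.\<close>

lemma svcap_rate:
 fixes c :: real
 shows "AE \<xi> in \<nu>. (\<lambda>n. ln (svcap (exp (c*n)) (word_mat A (stake n \<xi>)))/n) \<longlonglongrightarrow> (\<Sum>j=1..CARD('d). max 0 (c - lyapunov_exponent A \<nu> j))"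
proof -
 have "AE \<xi> in \<nu>. \<forall>k\<in>{1..CARD('d)}. (\<lambda>n. - (ln (sval k (word_mat A (stake n \<xi>)))/n)) \<longlonglongrightarrow> lyapunov_exponent A \<nu> k"
  by (rule AE_finite_allI) (use lyapunov_AE in auto)
 thus ?thesis
 proof eventually_elim
  case (elim \<xi>)
  have "(\<lambda>n. \<Sum>j=1..CARD('d). max 0 (c - (- (ln (sval j (word_mat A (stake n \<xi>)))/n)))) \<longlonglongrightarrow>
   (\<Sum>j=1..CARD('d). max 0 (c - lyapunov_exponent A \<nu> j))"
   by (intro tendsto_sum tendsto_max tendsto_diff tendsto_const) (use elim in auto)
  thus ?case
  proof (rule Lim_transform_eventually)
   show "\<forall>\<^sub>F n in sequentially. (\<Sum>j=1..CARD('d). max 0 (c - (- (ln (sval j (word_mat A (stake n \<xi>)))/n)))) =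
    ln (svcap (exp (c*n)) (word_mat A (stake n \<xi>)))/n"
    using eventually_gt_at_top[of 0]
   proof eventually_elim
    case (elim n)
    have "ln (max 1 (exp (c*n) * s)) = n*max 0 (c - (- (ln s/n)))" if "0 < s" for s
    proof -
     have "ln (max 1 (exp (c*n) * s)) = max 0 (ln (exp (c*n) * s))"
      using that by (simp add: max_def)
     also have "ln (exp (c*n) * s) = n*(c - (- (ln s/n)))" using that elim by (simp add: ln_mult_pos distrib_left)
     also have "max 0 (n*(c - (- (ln s/n)))) = n*max 0 (c - (- (ln s/n)))"
      using elim by (simp add: max_def zero_le_mult_iff)
     finally show ?thesis .
    qed
    moreover have "0 < sval j (word_mat A (stake n \<xi>))" if "j \<in> {1..CARD('d)}" for j
     using that sval_pos[OF invertible_word] by simp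
    moreover have "ln (svcap (exp (c*n)) (word_mat A (stake n \<xi>))) = (\<Sum>j=1..CARD('d). ln (max 1 (exp (c*n) * sval j (word_mat A (stake n \<xi>)))))"
     unfolding svcap_def by (rule ln_prod) (simp_all add: less_max_iff_disj)
    ultimately show ?case using elim by (simp add: sum_distrib_left[symmetric])
   qed
  qed
 qed
qed

lemma AE_ball_prob_exp:
 fixes b c h :: real
 assumes cyl: "AE \<xi> in \<nu>. (\<lambda>n. - (ln (prob (cylinder (stake n \<xi>)))/n)) \<longlonglongrightarrow> h"
  and pos: "\<And>w. 0 < prob (cylinder w)"
  and b: "h + (\<Sum>j=1..CARD('d). max 0 (c - lyapunov_exponent A \<nu> j)) < b"
 shows "AE \<xi> in \<nu>. \<forall>\<^sub>F n in sequentially. exp (- (n*b)) <= ball_prob v (coding_map A v \<xi>) (2*exp (- (c*n)))"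
proof -
 define S where "S = (\<Sum>j=1..CARD('d). max 0 (c - lyapunov_exponent A \<nu> j))"
 \<comment> \<open>A quarter of the room for each loss: cylinder mass, the summable factor
   \<open>exp (- e)^n\<close>, \<open>svcap\<close>, and the covering constant
   \<open>k\<close>.\<close>
 define e where "e = (b - h - S)/4"
 have e: "0 < e" using b by (simp add: e_def S_def)
 define k where "k = (2*radius v * CARD('d) + 2)^CARD('d)"
 have k: "1 <= k" unfolding k_def using radius_nonneg[of v] by (intro one_le_power) simp
 have "AE \<xi> in \<nu>. \<forall>\<^sub>F n in sequentially. prob (cylinder (stake n \<xi>))*exp (- e)^n/cover_bound v (exp (- (c*n))) (stake n \<xi>)
  <= ball_prob v (coding_map A v \<xi>) (2*exp (- (c*n)))"
  by (rule AE_ball_prob_lower) (use e in \<open>auto intro!: summable_geometric\<close>)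
 with cyl svcap_rate[of c] show ?thesis
 proof eventually_elim
  case (elim \<xi>)
  have "\<forall>\<^sub>F n in sequentially. - (ln (prob (cylinder (stake n \<xi>)))/n) < h + e"
   by (rule order_tendstoD(2)[OF elim(1)]) (use e in simp)
  moreover have "\<forall>\<^sub>F n in sequentially. ln (svcap (exp (c*n)) (word_mat A (stake n \<xi>)))/n < S + e"
   unfolding S_def by (rule order_tendstoD(2)[OF elim(2)]) (use e in simp)
  moreover have "\<forall>\<^sub>F n in sequentially. ln k/real n < e"
   by (rule order_tendstoD(2)[OF lim_const_over_n]) (use e in simp)
  ultimately show ?case using elim(3) eventually_gt_at_top[of 0]
  proof eventually_elim
   case (elim n)
   let ?w = "stake n \<xi>" and ?C = "svcap (exp (c*n)) (word_mat A (stake n \<xi>))"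
   have C1: "1 <= ?C" by (rule svcap_ge_1)
   have eq: "cover_bound v (exp (- (c*n))) ?w = k*?C" by (simp add: cover_bound_def k_def exp_minus divide_inverse)
   have "ln (prob (cylinder ?w)) > - (n*(h + e))" "ln ?C < n*(S + e)" "ln k < n*e"
    using elim by (simp_all add: field_simps)
   moreover have "- (n*b) = - (n*(h + e)) - n*e - n*(S + e) - n*e"
   proof -
    have "b = h + e + e + (S + e) + e" using e_def by simp
    thus ?thesis by (simp add: algebra_simps)
   qed
   moreover have "ln (prob (cylinder ?w)*exp (- e)^n/(k*?C)) = ln (prob (cylinder ?w)) - n*e - ln ?C - ln k"
    using pos[of ?w] k C1 by (simp add: ln_div ln_mult_pos ln_realpow)
   ultimately have "- (n*b) <= ln (prob (cylinder ?w)*exp (- e)^n/(k*?C))" by linarith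
   hence "exp (- (n*b)) <= prob (cylinder ?w)*exp (- e)^n/(k*?C)"
    using pos[of ?w] k C1 by (subst (asm) ln_ge_iff) (auto intro!: divide_pos_pos mult_pos_pos)
   thus ?case using elim(4) unfolding eq by linarith
  qed
 qed
qed

lemma measure_projected_cball: "measure (projected_measure A v \<nu>) (cball x r) = ball_prob v x r"
proof -
 have "measure (projected_measure A v \<nu>) (cball x r) = prob (coding_map A v -` cball x r \<inter> space \<nu>)"
  unfolding projected_measure_def by (rule measure_distr) (auto intro: coding_measurable_nu)
 also have "coding_map A v -` cball x r \<inter> space \<nu> = {\<xi>. dist x (coding_map A v \<xi>) <= r}" by auto
 finally show ?thesis by (simp add: ball_prob_def)
qed

lemma restricted_ball_sets: "G \<in> sets \<nu> ==> {\<xi> \<in> G. dist x (coding_map A v \<xi>) <= r} \<in> sets \<nu>"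
 using sets.Int[OF _ ball_sets[of x v r], of G] by (simp add: Int_def)

lemma restricted_ball_measurable:
 assumes [measurable]: "G \<in> sets \<nu>"
 shows "(\<lambda>x. prob {\<xi> \<in> G. dist x (coding_map A v \<xi>) <= r}) \<in> borel_measurable borel"
proof -
 have "{z \<in> space ((borel :: (real^'d) measure) \<Otimes>\<^sub>M \<nu>). snd z \<in> G \<and> dist (fst z) (coding_map A v (snd z)) <= r} \<in> sets (borel \<Otimes>\<^sub>M \<nu>)"
  by measurable
 from measurable_emeasure_Pair[OF this]
 have "(\<lambda>x. enn2real (emeasure \<nu> {\<xi> \<in> G. dist x (coding_map A v \<xi>) <= r})) \<in> borel_measurable borel"
  by (intro borel_measurable_enn2real) (simp add: space_pair_measure vimage_def)
 thus ?thesis by (simp add: measure_def)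
qed

lemma ball_prob_measurable: "(\<lambda>x. ball_prob v x r) \<in> borel_measurable borel"
 using restricted_ball_measurable[OF sets.top] by (simp add: ball_prob_def)

lemma AE_projected:
 assumes P: "AE \<xi> in \<nu>. \<forall>\<^sub>F n in sequentially. P n (ball_prob v (coding_map A v \<xi>) (r n))" and meas: "\<And>n. {y. P n y} \<in> sets borel"
 shows "AE x in projected_measure A v \<nu>. \<forall>\<^sub>F n in sequentially. P n (ball_prob v x (r n))"
 unfolding projected_measure_def
proof (subst AE_distr_iff)
 have *: "{x. P n (ball_prob v x (r n))} \<in> sets borel" for n
  using measurable_sets[OF ball_prob_measurable meas[of n], of v "r n"] by (simp add: vimage_def)
 have "{x \<in> space borel. \<forall>\<^sub>F n in sequentially. P n (ball_prob v x (r n))} = (\<Union>N. \<Inter>n\<in>{N..}. {x. P n (ball_prob v x (r n))})"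
  by (auto simp: eventually_sequentially)
 also have "... \<in> sets borel" using * by (intro sets.countable_UN' sets.countable_INT') auto
 finally show "{x \<in> space borel. \<forall>\<^sub>F n in sequentially. P n (ball_prob v x (r n))} \<in> sets borel" .
qed (use P coding_measurable_nu in auto)

end

text \<open>Both bounds are known along discrete scales only; monotonicity transfers them to all
  radii, and rounding to the next scale costs a factor tending to 1. Rational exponents suffice, so
  that almost every point satisfies all bounds at once.\<close>

lemma local_dimension_limit:
 fixes P :: "real => real" and D :: real
 assumes mono: "\<And>r s. r <= s ==> P r <= P s" and P1: "\<And>r. P r <= 1"
  and lower: "\<And>t :: real. t \<in> \<rat> ==> 0 <= t ==> t < D ==> \<forall>\<^sub>F m in sequentially. P (1/2^m) <= 2 powr - (m*t)"
  and upper: "\<And>u. u \<in> \<rat> ==> D < u ==> \<exists>b c :: real. 0 < c \<and> 0 <= b \<and> b/c < u \<and> (\<forall>\<^sub>F n in sequentially. exp (- (real n*b)) <= P (2*exp (- (c*real n))))"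
 shows "((\<lambda>r. ln (P r)/ln r) \<longlongrightarrow> D) (at_right 0)"
proof -
 have less1: "\<forall>\<^sub>F r in at_right 0. r < (1::real)" unfolding eventually_at_right_field by (intro exI[of _ 1]) simp
 have upper': "\<forall>\<^sub>F r in at_right 0. 0 < P r \<and> ln (P r)/ln r < u" if Du: "D < u" for u
 proof -
  obtain u' where u': "u' \<in> \<rat>" "D < u'" "u' < u" using Rats_dense_in_real[OF Du] by blast
  obtain b c where bc: "0 < c" "0 <= b" "b/c < u'" "\<forall>\<^sub>F n in sequentially. exp (- (real n*b)) <= P (2*exp (- (c*n)))"
   using upper[OF u'(1,2)] by blast
  \<comment> \<open>Large enough for \<open>2*exp (- (c*n)) <= r\<close>, and at most one above the
    real solution of the equality.\<close>
  let ?n = "\<lambda>r :: real. Suc (nat \<lfloor>(ln 2 - ln r)/c\<rfloor>)"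
  have lim: "filterlim ?n sequentially (at_right 0)"
  proof -
   have "filterlim (\<lambda>r. (ln 2 - ln r)/c) at_top (at_right (0::real))" using bc(1) by real_asymp
   thus ?thesis
    by (intro filterlim_compose[OF filterlim_Suc] filterlim_compose[OF filterlim_nat_sequentially] filterlim_compose[OF filterlim_floor_sequentially])
  qed
  have "\<forall>\<^sub>F r in at_right 0. exp (- (real (?n r)*b)) <= P (2*exp (- (c*?n r)))"
   by (rule eventually_compose_filterlim[OF bc(4) lim])
  moreover have "((\<lambda>r. b/c*((ln 2 + c - ln r)/(- ln r))) \<longlongrightarrow> b/c*1) (at_right (0::real))" by (intro tendsto_mult tendsto_const) real_asymp
  hence "\<forall>\<^sub>F r in at_right 0. b/c*((ln 2 + c - ln r)/(- ln r)) < u" by (rule order_tendstoD(2)) (use bc(3) u'(3) in simp)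
  ultimately show ?thesis using eventually_at_right_less[of 0] less1
  proof eventually_elim
   case (elim r)
   have lr: "ln r < 0" using elim(3,4) by simp
   have a0: "0 <= (ln 2 - ln r)/c" using lr bc(1) ln_gt_zero[of "2::real"] by (intro divide_nonneg_pos) linarith+
   hence n: "(ln 2 - ln r)/c <= ?n r" "?n r <= (ln 2 - ln r)/c + 1" by linarith+
   have "ln 2 - ln r <= c*?n r" using n(1) bc(1) by (simp add: field_simps)
   hence "exp (- (c*?n r)) <= exp (ln r - ln 2)" by simp
   also have "... = r/2" using elim(3) by (simp add: exp_diff)
   finally have "P (2*exp (- (c*?n r))) <= P r" by (intro mono) simp
   hence e: "exp (- (?n r*b)) <= P r" using elim(1) by linarith
   hence pos: "0 < P r" using exp_gt_zero less_le_trans by blast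
   have "- (b*((ln 2 - ln r)/c + 1)) <= - (?n r*b)" using mult_left_mono[OF n(2) bc(2)] by (simp only: neg_le_iff_le mult.commute)
   also have "... <= ln (P r)" using e pos by (simp add: ln_ge_iff)
   finally have "ln (P r)/ln r <= - (b*((ln 2 - ln r)/c + 1))/ln r" using lr by (intro divide_right_mono_neg) simp_all
   also have "... = b/c*((ln 2 + c - ln r)/(- ln r))" using lr bc(1) by (simp add: field_simps)
   finally show ?case using pos elim(2) by linarith
  qed
 qed
 have "\<forall>\<^sub>F r in at_right 0. t < ln (P r)/ln r" if tD: "t < D" for t
 proof (cases "t < 0")
  case True
  have "\<forall>\<^sub>F r in at_right 0. 0 < P r" using upper'[of "D + 1"] by (auto elim: eventually_mono)
  thus ?thesis using eventually_at_right_less[of 0] less1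
  proof eventually_elim
   case (elim r)
   have "0 <= ln (P r)/ln r" using elim P1[of r] by (intro divide_nonpos_nonpos) simp_all
   thus ?case using True by linarith
  qed
 next
  case False
  obtain t' where t': "t' \<in> \<rat>" "t < t'" "t' < D" using Rats_dense_in_real[OF tD] by blast
  let ?m = "\<lambda>r :: real. nat \<lfloor>- ln r/ln 2\<rfloor>"
  have lim: "filterlim ?m sequentially (at_right 0)"
  proof -
   have "filterlim (\<lambda>r. - ln r/ln 2) at_top (at_right (0::real))" by real_asymp
   thus ?thesis
    by (intro filterlim_compose[OF filterlim_nat_sequentially] filterlim_compose[OF filterlim_floor_sequentially])
  qed
  have "\<forall>\<^sub>F r in at_right 0. P (1/2 ^ ?m r) <= 2 powr - (?m r*t')"
   using t' False by (intro eventually_compose_filterlim[OF lower[of t'] lim]) auto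
  moreover have "((\<lambda>r. t'*((ln r + ln 2)/ln r)) \<longlongrightarrow> t'*1) (at_right (0::real))" by (intro tendsto_mult tendsto_const) real_asymp
  hence "\<forall>\<^sub>F r in at_right 0. t < t'*((ln r + ln 2)/ln r)" by (rule order_tendstoD(1)) (use t' in simp)
  moreover have "\<forall>\<^sub>F r in at_right 0. 0 < P r" using upper'[of "D + 1"] by (auto elim: eventually_mono)
  ultimately show ?thesis using eventually_at_right_less[of 0] less1
  proof eventually_elim
   case (elim r)
   have lr: "ln r < 0" using elim(4,5) by simp
   have a0: "0 <= - ln r/ln 2" using lr by (intro divide_nonneg_pos) simp_all
   hence m: "?m r <= - ln r/ln 2" "- ln r/ln 2 - 1 <= ?m r" by linarith+
   have "ln r <= - (?m r*ln 2)" using m(1) by (simp add: field_simps)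
   hence "exp (ln r) <= exp (- (?m r*ln 2))" by simp
   hence "r <= 1/2 ^ ?m r" using elim(4) by (simp add: exp_minus exp_of_nat_mult inverse_eq_divide)
   hence "P r <= 2 powr - (?m r*t')" using mono[of r "1/2 ^ ?m r"] elim(1) by linarith
   hence "ln (P r) <= - (?m r*t')*ln 2" using elim(3) by (metis ln_mono ln_powr powr_gt_zero zero_less_numeral)
   also have "... <= - ((- ln r/ln 2 - 1)*t')*ln 2"
    using m(2) t' False mult_right_mono[OF m(2), of t'] by (intro mult_right_mono) simp_all
   also have "... = t'*(ln r + ln 2)" by (simp add: field_simps)
   finally have "t'*(ln r + ln 2)/ln r <= ln (P r)/ln r" using lr by (intro divide_right_mono_neg) simp_all
   thus ?case using elim(2) by simp
  qed
 qed
 moreover have "\<forall>\<^sub>F r in at_right 0. ln (P r)/ln r < u" if "D < u" for u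
  using upper'[OF that] by eventually_elim simp
 ultimately show ?thesis by (rule order_tendstoI)
qed

section \<open>Exact dimensionality\<close>

context ergodic_cocycle
begin

lemma lyapunov_dim_le:
 "lyapunov_dim A \<nu> <= real CARD('d)"
 "k < CARD('d) ==> lyapunov_dim A \<nu> <= k + (shift_entropy \<nu> - (\<Sum>j=1..k. lyapunov_exponent A \<nu> j))/lyapunov_exponent A \<nu> (k + 1)"
 unfolding lyapunov_dim_def by (rule Min_le; force)+

text \<open>For \<open>k\<close> the integer part of \<open>t\<close>, the \<open>k\<close>-th entry
  of the minimum in \<open>lyapunov_dim\<close> exceeds \<open>t\<close>; multiplied by the exponent
  of index \<open>k + 1\<close> this is the claim.\<close>

lemma energy_rate_less_entropy:
 assumes t: "0 <= t" "t < lyapunov_dim A \<nu>"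
 shows "energy_rate t < shift_entropy \<nu>"
proof -
 define k where "k = nat \<lfloor>t\<rfloor>"
 have td: "t < real CARD('d)" using t lyapunov_dim_le(1) by linarith
 have k: "k <= t" "t < k + 1" using t unfolding k_def by linarith+
 hence kd: "k < CARD('d)" using td by linarith
 let ?\<chi> = "lyapunov_exponent A \<nu>"
 have pos: "0 < ?\<chi> (k + 1)" using kd by (intro lyapunov_pos) auto
 have "energy_rate t = (\<Sum>j=1..k. ?\<chi> j) + (t - k)*?\<chi> (k + 1)"
 proof (cases "t = k")
  case True
  thus ?thesis using sum_svexp_eq[of t "CARD('d)" ?\<chi>] t td by (simp add: energy_rate_def k_def)
 next
  case False
  hence "nat \<lceil>t\<rceil> = k + 1" "real_of_int \<lfloor>t\<rfloor> = k" using k t unfolding k_def by linarith+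
  thus ?thesis using sum_svexp_eq[of t "CARD('d)" ?\<chi>] t td by (simp add: energy_rate_def k_def)
 qed
 also have "t - k < (shift_entropy \<nu> - (\<Sum>j=1..k. ?\<chi> j))/?\<chi> (k + 1)" using lyapunov_dim_le(2)[OF kd] t by linarith
 hence "(\<Sum>j=1..k. ?\<chi> j) + (t - k)*?\<chi> (k + 1) < shift_entropy \<nu>" using pos by (simp add: pos_less_divide_eq)
 finally show ?thesis .
qed

text \<open>The quotient is the dimension bound obtained from scales \<open>exp (- c n)\<close>. At
  \<open>c\<close> equal to the exponent of index \<open>k + 1\<close> it is the \<open>k\<close>-th
  entry of the minimum, and for large \<open>c\<close> it approaches d, so every possible value of
  the minimum is reached or approached.\<close>

lemma lyapunov_dim_less:
 assumes u: "lyapunov_dim A \<nu> < u"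
 obtains c where "0 < c" "(shift_entropy \<nu> + (\<Sum>j=1..CARD('d). max 0 (c - lyapunov_exponent A \<nu> j)))/c < u"
proof -
 let ?\<chi> = "lyapunov_exponent A \<nu>" and ?h = "shift_entropy \<nu>"
 have "lyapunov_dim A \<nu> \<in> (\<lambda>k. real k + (?h - (\<Sum>j=1..k. ?\<chi> j))/?\<chi> (k + 1)) ` {0..CARD('d) - 1} \<union> {real CARD('d)}"
  unfolding lyapunov_dim_def by (rule Min_in) auto
 then consider k where "k < CARD('d)" "lyapunov_dim A \<nu> = k + (?h - (\<Sum>j=1..k. ?\<chi> j))/?\<chi> (k + 1)" | "lyapunov_dim A \<nu> = real CARD('d)"
  by (auto simp: less_eq_Suc_le[symmetric]) (metis One_nat_def Suc_leI Suc_pred le_imp_less_Suc zero_less_card_finite)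
 thus thesis
 proof cases
  case (1 k)
  have pos: "0 < ?\<chi> (k + 1)" using 1 by (intro lyapunov_pos) auto
  have "(\<Sum>j=1..CARD('d). max 0 (?\<chi> (k + 1) - ?\<chi> j)) = (\<Sum>j=1..k. ?\<chi> (k + 1) - ?\<chi> j)"
  proof (rule sum.mono_neutral_cong_right)
   show "\<forall>j\<in>{1..CARD('d)} - {1..k}. max 0 (?\<chi> (k + 1) - ?\<chi> j) = 0"
    using lyapunov_mono[of "k + 1"] by auto
   show "max 0 (?\<chi> (k + 1) - ?\<chi> j) = ?\<chi> (k + 1) - ?\<chi> j" if "j \<in> {1..k}" for j
    using lyapunov_mono[of j "k + 1"] that 1 by auto
  qed (use 1 in auto)
  also have "... = k*?\<chi> (k + 1) - (\<Sum>j=1..k. ?\<chi> j)" by (simp add: sum_subtractf)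
  finally have S: "(\<Sum>j=1..CARD('d). max 0 (?\<chi> (k + 1) - ?\<chi> j)) = k*?\<chi> (k + 1) - (\<Sum>j=1..k. ?\<chi> j)" .
  have "(?h + (\<Sum>j=1..CARD('d). max 0 (?\<chi> (k + 1) - ?\<chi> j)))/?\<chi> (k + 1) = lyapunov_dim A \<nu>"
   unfolding S 1(2) using pos by (simp add: field_simps)
  thus thesis using pos u by (intro that[of "?\<chi> (k + 1)"]) auto
 next
  case 2
  define c where "c = (\<bar>?h\<bar> + 1)/(u - real CARD('d))"
  have c: "0 < c" using u 2 unfolding c_def by (intro divide_pos_pos) auto
  have "(\<Sum>j=1..CARD('d). max 0 (c - ?\<chi> j)) <= (\<Sum>j=1..CARD('d). c)"
   using lyapunov_pos c by (intro sum_mono) (auto simp: less_imp_le)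
  hence "?h + (\<Sum>j=1..CARD('d). max 0 (c - ?\<chi> j)) < (\<bar>?h\<bar> + 1) + CARD('d) * c" by simp
  also have "\<bar>?h\<bar> + 1 = c*(u - real CARD('d))" using u 2 by (simp add: c_def)
  finally have "?h + (\<Sum>j=1..CARD('d). max 0 (c - ?\<chi> j)) < u * c" by (simp add: algebra_simps)
  thus thesis using c by (intro that[of c]) (simp_all add: divide_less_eq)
 qed
qed

theorem exact_dimensional_projection:
 assumes cyl: "AE \<xi> in \<nu>. (\<lambda>n. - (ln (prob (cylinder (stake n \<xi>)))/n)) \<longlonglongrightarrow> shift_entropy \<nu>"
  and pos: "\<And>w. 0 < prob (cylinder w)"
  and lower: "\<And>t :: real. t \<in> \<rat> ==> 0 <= t ==> t < lyapunov_dim A \<nu> ==>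
   AE \<xi> in \<nu>. \<forall>\<^sub>F m in sequentially. ball_prob v (coding_map A v \<xi>) (1/2^m) <= 2 powr - (m*t)"
 shows "exact_dimensional (projected_measure A v \<nu>) (lyapunov_dim A \<nu>)"
proof -
 let ?D = "lyapunov_dim A \<nu>" and ?\<mu> = "projected_measure A v \<nu>"
 have "AE \<xi> in \<nu>. 0 <= shift_entropy \<nu>"
  using cyl
 proof eventually_elim
  case (elim \<xi>)
  have "ln (prob (cylinder (stake n \<xi>))) <= 0" for n using pos[of "stake n \<xi>"] prob_le_1 by simp
  thus ?case by (intro LIMSEQ_le_const[OF elim]) (auto simp: divide_nonpos_nonneg)
 qed
 hence h0: "0 <= shift_entropy \<nu>" by simp
 have L: "AE x in ?\<mu>. \<forall>t\<in>\<rat>. 0 <= t --> t < ?D --> (\<forall>\<^sub>F m in sequentially. ball_prob v x (1/2^m) <= 2 powr - (m*t))"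
 proof (intro AE_ball_countable[THEN iffD2] countable_rat ballI)
  fix t :: real assume t: "t \<in> \<rat>"
  show "AE x in ?\<mu>. 0 <= t --> t < ?D --> (\<forall>\<^sub>F m in sequentially. ball_prob v x (1/2^m) <= 2 powr - (m*t))"
  proof (cases "0 <= t \<and> t < ?D")
   case True
   have "AE x in ?\<mu>. \<forall>\<^sub>F m in sequentially. ball_prob v x (1/2^m) <= 2 powr - (m*t)"
    by (rule AE_projected[OF lower[OF t]]) (use True in auto)
   thus ?thesis by eventually_elim simp
  qed auto
 qed
 have U: "AE x in ?\<mu>. \<forall>u\<in>\<rat>. ?D < u --> (\<exists>b c :: real. 0 < c \<and> 0 <= b \<and> b/c < u \<and>
   (\<forall>\<^sub>F n in sequentially. exp (- (real n*b)) <= ball_prob v x (2*exp (- (c*real n)))))"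
 proof (intro AE_ball_countable[THEN iffD2] countable_rat ballI)
  fix u :: real
  show "AE x in ?\<mu>. ?D < u --> (\<exists>b c :: real. 0 < c \<and> 0 <= b \<and> b/c < u \<and>
   (\<forall>\<^sub>F n in sequentially. exp (- (real n*b)) <= ball_prob v x (2*exp (- (c*real n)))))"
  proof (cases "?D < u")
   case True
   let ?S = "\<lambda>c. \<Sum>j=1..CARD('d). max 0 (c - lyapunov_exponent A \<nu> j)"
   obtain c where c: "0 < c" "(shift_entropy \<nu> + ?S c)/c < u" by (rule lyapunov_dim_less[OF True])
   hence "shift_entropy \<nu> + ?S c < u * c" by (simp add: divide_less_eq)
   then obtain b where b: "shift_entropy \<nu> + ?S c < b" "b < u * c" using dense by blast
   have "0 <= ?S c" by (intro sum_nonneg) simp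
   hence "0 <= b" "b/c < u" using b h0 c by (simp_all add: divide_less_eq)
   moreover have "AE x in ?\<mu>. \<forall>\<^sub>F n in sequentially. exp (- (real n*b)) <= ball_prob v x (2*exp (- (c*real n)))"
    by (rule AE_projected[OF AE_ball_prob_exp[OF cyl pos b(1)]]) simp
   ultimately show ?thesis using c(1) by (auto elim!: eventually_mono)
  qed simp
 qed
 show ?thesis unfolding exact_dimensional_def measure_projected_cball
  using L U
 proof eventually_elim
  case (elim x)
  show ?case
  proof (rule local_dimension_limit)
   show "ball_prob v x r <= ball_prob v x s" if "r <= s" for r s
    unfolding ball_prob_def using that by (intro finite_measure_mono ball_sets) auto
   show "ball_prob v x r <= 1" for r by (simp add: ball_prob_def)
  qed (use elim in auto)
 qed
qed

end

text \<open>Minus the logarithm of the cylinder mass is additive along the shift, so Kingman's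
  theorem applies with constant 0; its means are \<open>ent n\<close>, which identifies the
  limit.\<close>

lemma bernoulli_cylinder_rate:
 fixes p :: "real^'n"
 assumes p: "prob_vector p"
 shows "AE \<xi> in bernoulli_measure p. (\<lambda>n. - (ln (measure (bernoulli_measure p) (cylinder (stake n \<xi>)))/n)) \<longlonglongrightarrow> shift_entropy (bernoulli_measure p)"
  and "0 < measure (bernoulli_measure p) (cylinder w)"
proof -
 let ?\<nu> = "bernoulli_measure p"
 interpret ergodic_shift ?\<nu> by (rule bernoulli_shift(1)[OF p])
 have pp: "0 < p$i" for i using p by (simp add: prob_vector_def)
 have cyl: "prob (cylinder w) = prod_list (map (($) p) w)" for w by (rule bernoulli_shift(2)[OF p])
 show pos: "0 < prob (cylinder w)" for w unfolding cyl by (induction w) (simp_all add: pp)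
 define f where "f n \<xi> = - ln (prob (cylinder (stake n \<xi>)))" for n \<xi>
 have add: "f (m + n) \<xi> = f m \<xi> + f n ((stl ^^ m) \<xi>)" for m n \<xi>
 proof -
  have "prob (cylinder (stake (m + n) \<xi>)) = prob (cylinder (stake m \<xi>))*prob (cylinder (stake n ((stl ^^ m) \<xi>)))"
   unfolding cyl by (simp add: funpow_stl flip: stake_add)
  thus ?thesis using pos by (simp add: f_def ln_mult_pos)
 qed
 define K where "K = Max (range (\<lambda>i. \<bar>ln (p$i)\<bar>))"
 have K: "\<bar>f n \<xi>\<bar> <= K*real n" for n \<xi>
 proof (induction n)
  case (Suc n)
  have "\<bar>f 1 ((stl ^^ n) \<xi>)\<bar> <= K" unfolding f_def cyl K_def by (auto intro: Max_ge)
  thus ?case using Suc add[of n 1 \<xi>] by (simp add: distrib_left)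
 qed (simp add: f_def cyl)
 have "f n \<in> borel_measurable ?\<nu>" for n unfolding f_def[abs_def] by (rule fun_stake_measurable)
 hence "\<exists>c. (AE \<xi> in ?\<nu>. (\<lambda>n. f n \<xi>/n) \<longlonglongrightarrow> c) \<and> (\<lambda>n. expectation (f n)/n) \<longlonglongrightarrow> c"
  by (rule kingman[where C = 0, OF _ _ K]) (simp add: add)
 moreover have "expectation (f n) = ent n" for n
  unfolding f_def expectation_stake[of "\<lambda>w. - ln (prob (cylinder w))"] ent_def by (simp add: sum_negf)
 ultimately show "AE \<xi> in ?\<nu>. (\<lambda>n. - (ln (prob (cylinder (stake n \<xi>)))/n)) \<longlonglongrightarrow> shift_entropy ?\<nu>"
  using LIMSEQ_unique[OF _ ent_limit(1)] by (auto simp: f_def)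
qed

text \<open>The scale \<open>L\<close> has to be fixed before \<open>B\<close> and the tuple are
  chosen; the uniform bound 6/25 makes it depend on \<open>v\<close> only.\<close>

lemma (in contractive_tuple) radius_bound:
 assumes "rho <= 6/25"
 shows "5/4*(1 + 2*radius v) <= 2 + 5 * vec_tuple_norm v"
proof -
 have "radius v <= vec_tuple_norm v/(19/25)"
  unfolding radius_def using assms vec_tuple_norm_nonneg[of v] by (intro divide_left_mono) auto
 thus ?thesis using vec_tuple_norm_nonneg[of v] by simp
qed

theorem AE_exact_dimensional_bernoulli:
 fixes v :: "real^'d^'n" and p :: "real^'n"
 assumes N: "CARD('n) >= 2" and v: "\<And>i j. i \<noteq> j ==> v$i \<noteq> v$j" and p: "prob_vector p"
 shows "AE A in lebesgue. A \<in> admissible_tuples v -->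
  exact_dimensional (projected_measure A v (bernoulli_measure p)) (lyapunov_dim A (bernoulli_measure p))"
proof -
 let ?\<nu> = "bernoulli_measure p" and ?L = "2 + 5 * vec_tuple_norm v"
 define W :: "real => nat => real^'d^'d^'n => 'n list => real" where "W t k = capped_weight ?\<nu> t (real k)" for t k
 define W' :: "real^'d^'d^'n => 'n list => real" where "W' A w = measure ?\<nu> (cylinder w)" for A w
 obtain B C where BC: "conjugation B C" "op_norm B <= 5/4" "op_norm C <= 4/3"
  "AE A in lebesgue. A \<in> admissible_tuples v --> (\<forall>(t' :: real) t k K. t' \<in> \<rat> --> t \<in> \<rat> --> 0 <= t' --> t' < t --> t <= real CARD('d) -->
   (\<forall>m. pair_energy t (W t k) W' m (conj_tuple B C A) <= real K*(2 powr ((t - t')/2))^m) -->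
   (\<Sum>m. ennreal (2 powr (m*t') * close_pairs ?L v (W t k) W' m (conj_tuple B C A) B)) < \<infinity>)"
 proof (rule AE_admissible_energy[where L = ?L and W = W and W' = "\<lambda>_ _. W'", OF N v])
  show "1 <= ?L" using vec_tuple_norm_nonneg[of v] by simp
  show "(\<lambda>A. W t k A w) \<in> borel_measurable borel \<and> (\<lambda>A. W' A w) \<in> borel_measurable borel"
   if "0 <= t" "t <= real CARD('d)" for t k w
   unfolding W_def W'_def using that by (intro conjI capped_weight_measurable) auto
 qed (auto simp: W_def W'_def capped_weight_def)
 interpret conjugation B C by (rule BC(1))
 show ?thesis using BC(4)
 proof eventually_elim
  case (elim A)
  show ?case
  proof
   assume adm: "A \<in> admissible_tuples v"
   note fin = elim[rule_format, OF adm]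
   have GL: "A \<in> GL_tuples" and r: "mat_tuple_norm A <= 6/25" using admissible_bounds(1,2)[OF adm N] v by blast+
   interpret ergodic_cocycle A ?\<nu>
    by (intro ergodic_cocycle.intro contractive_tuple.intro bernoulli_shift(1)[OF p]) (use GL r in auto)
   show "exact_dimensional (projected_measure A v ?\<nu>) (lyapunov_dim A ?\<nu>)"
   proof (rule exact_dimensional_projection)
    fix t' :: real assume t': "t' \<in> \<rat>" "0 <= t'" "t' < lyapunov_dim A ?\<nu>"
    obtain t where t: "t \<in> \<rat>" "t' < t" "t < lyapunov_dim A ?\<nu>" using Rats_dense_in_real[OF t'(3)] by blast
    have td: "0 <= t" "t <= real CARD('d)" using t t' lyapunov_dim_le(1) by linarith+
    obtain c where c: "0 < c" "\<And>w. phi t w <= c * svf t (word_mat (conj_tuple B C A) w)"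
     using svf_conj(1,3)[OF invertible_word td] by (auto simp: phi_def word_mat_conj)
    have "AE \<xi> in ?\<nu>. \<forall>K::nat. \<xi> \<in> good_words t K -->
     (\<forall>\<^sub>F m in sequentially. ball_prob v (coding_map A v \<xi>) (1/2^m) <= 2 powr - (m*t'))"
    proof (rule AE_all_countable[THEN iffD2], rule allI)
     fix K :: nat
     \<comment> \<open>The weights test the cap with the singular values of the conjugate tuple; the
       factor \<open>c\<close> pays for passing to it from \<open>A\<close>.\<close>
     obtain K1 :: nat where K1: "K * c <= K1" using real_arch_simple by blast
     have "1 < 2 powr ((t - t')/2)" using t by simp
     then obtain K2 :: nat where K2: "\<And>m. (real m + 1)*1^m <= K2*(2 powr ((t - t')/2))^m"
      using linear_times_geometric_bound[of 1] by auto
     have "pair_energy t (W t K1) W' m (conj_tuple B C A) <= real (K1*K2)*(2 powr ((t - t')/2))^m" for m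
     proof -
      have "pair_energy t (W t K1) W' m (conj_tuple B C A) <= real K1*(real m + 1)"
       unfolding W_def W'_def[abs_def] using capped_pair_energy[OF conj_GL[OF GL] td, of "real K1" m] by (simp add: add.commute)
      also have "... <= real K1*(K2*(2 powr ((t - t')/2))^m)" using K2[of m] by (intro mult_left_mono) auto
      finally show ?thesis by (simp add: mult.assoc)
     qed
     note sum = fin[OF t'(1) t(1) t'(2) t(2) td(2) this]
     have "AE \<xi> in ?\<nu>. \<xi> \<in> good_words t K --> (\<forall>\<^sub>F m in sequentially. prob {\<xi>' \<in> UNIV. dist (coding_map A v \<xi>) (coding_map A v \<xi>') <= 1/2^m} <= 2 powr - (m*t'))"
     proof (rule energy_local_bound[where \<kappa> = 1, OF BC(1,2) _ radius_bound[OF r] good_words_sets _ _ _ _ sum])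
      show "UNIV \<in> sets ?\<nu>" using sets.top[of ?\<nu>] by simp
      show "prob (UNIV \<inter> cylinder w) <= 1*W' (conj_tuple B C A) w" for w by (simp add: W'_def)
      show "prob (good_words t K \<inter> cylinder w) <= 1*W t K1 (conj_tuple B C A) w" for w
      proof (cases "good_words t K \<inter> cylinder w = {}")
       case True
       thus ?thesis by (simp add: W_def capped_weight_def)
      next
       case False
       then obtain \<xi> where \<xi>: "\<xi> \<in> good_words t K" "\<xi> \<in> cylinder w" by blast
       have "prob (cylinder (take k w)) <= K1 * svf t (word_mat (conj_tuple B C A) (take k w))" if "k <= length w" for k
       proof -
        have tk: "take k w = stake k \<xi>" using \<xi>(2) that take_stake[of k "length w" \<xi>] by (simp add: cylinder_def min_def)
        have "prob (cylinder (take k w)) <= K*phi t (take k w)" using \<xi>(1) unfolding tk by (simp add: good_words_def)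
        also have "... <= K*(c * svf t (word_mat (conj_tuple B C A) (take k w)))" by (intro mult_left_mono c) simp
        also have "... <= K1 * svf t (word_mat (conj_tuple B C A) (take k w))"
         unfolding mult.assoc[symmetric] using c phi_pos[OF td, of "take k w"] less_le_trans[of 0 "phi t (take k w)" "c * svf t (word_mat (conj_tuple B C A) (take k w))"]
         by (intro mult_right_mono K1) (simp add: zero_less_mult_iff)
        finally show ?thesis .
       qed
       hence "W t K1 (conj_tuple B C A) w = prob (cylinder w)" by (simp add: W_def capped_weight_def)
       thus ?thesis by (auto intro: finite_measure_mono)
      qed
     qed (use r in auto)
     thus "AE \<xi> in ?\<nu>. \<xi> \<in> good_words t K -->
      (\<forall>\<^sub>F m in sequentially. ball_prob v (coding_map A v \<xi>) (1/2^m) <= 2 powr - (m*t'))"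
      by (simp add: ball_prob_def)
    qed
    thus "AE \<xi> in ?\<nu>. \<forall>\<^sub>F m in sequentially. ball_prob v (coding_map A v \<xi>) (1/2^m) <= 2 powr - (m*t')"
     using AE_good_words[OF td energy_rate_less_entropy[OF td(1) t(3)]] by eventually_elim blast
   qed (use bernoulli_cylinder_rate[OF p] in auto)
  qed
 qed
qed

section \<open>Hausdorff and Minkowski dimension\<close>

lemma hausdorff_measure_eq_0_iff:
 "hausdorff_measure u S = 0 \<longleftrightarrow> (\<forall>\<delta>>0. \<forall>e>0. \<exists>U :: nat => 'a::metric_space set. S \<subseteq> (\<Union>i. U i) \<and>
   (\<forall>i. bounded (U i) \<and> diameter (U i) <= \<delta>) \<and> (\<Sum>i. ennreal (diameter (U i) powr u)) < ennreal e)"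
 (is "_ \<longleftrightarrow> (\<forall>\<delta>>0. ?P \<delta>)")
proof -
 have less: "?P \<delta> \<longleftrightarrow> (\<forall>e>0. hausdorff_content u \<delta> S < ennreal e)" for \<delta>
  unfolding hausdorff_content_def INF_less_iff by (simp only: Bex_def mem_Collect_eq conj_assoc)
 have "hausdorff_content u \<delta> S = 0 \<longleftrightarrow> ?P \<delta>" for \<delta>
 proof
  assume "hausdorff_content u \<delta> S = 0"
  thus "?P \<delta>" unfolding less by simp
 next
  assume "?P \<delta>"
  hence "hausdorff_content u \<delta> S <= 0 + ennreal e" if "0 < e" for e
   unfolding less using that by (simp add: less_imp_le)
  hence "hausdorff_content u \<delta> S <= 0" by (rule ennreal_le_epsilon)
  thus "hausdorff_content u \<delta> S = 0" by simp
 qed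
 moreover have "hausdorff_measure u S = 0 \<longleftrightarrow> (\<forall>\<delta>\<in>{0<..}. hausdorff_content u \<delta> S = 0)"
  unfolding hausdorff_measure_def bot_ennreal[symmetric] by (rule SUP_bot_conv(1))
 ultimately show ?thesis by (simp only: greaterThan_iff Ball_def)
qed

lemma hausdorff_measure_null_subset: "hausdorff_measure u T = 0 ==> S \<subseteq> T ==> hausdorff_measure u S = 0"
 unfolding hausdorff_measure_eq_0_iff by (meson order_trans)

lemma hausdorff_measure_null_UN:
 fixes S :: "nat => 'a::metric_space set"
 assumes S: "\<And>n. hausdorff_measure u (S n) = 0"
 shows "hausdorff_measure u (\<Union>n. S n) = 0"
 unfolding hausdorff_measure_eq_0_iff
proof (intro allI impI)
 fix \<delta> e :: real assume de: "0 < \<delta>" "0 < e"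
 \<comment> \<open>The additional factor 1/2 keeps the final inequality strict after summation over
   \<open>n\<close>.\<close>
 have "\<exists>U. S n \<subseteq> (\<Union>i. U i) \<and> (\<forall>i :: nat. bounded (U i) \<and> diameter (U i) <= \<delta>) \<and>
   (\<Sum>i. ennreal (diameter (U i) powr u)) < ennreal (e/2*(1/2)^Suc n)" for n
  using S[of n] de unfolding hausdorff_measure_eq_0_iff by simp
 then obtain U :: "nat => nat => 'a set" where U: "S n \<subseteq> (\<Union>i. U n i)" "bounded (U n i)" "diameter (U n i) <= \<delta>"
   "(\<Sum>i. ennreal (diameter (U n i) powr u)) < ennreal (e/2*(1/2)^Suc n)" for n i by metis
 define V where "V m = (case prod_decode m of (n, i) => U n i)" for m
 have "(\<Union>n. S n) \<subseteq> (\<Union>m. V m)"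
 proof
  fix x assume "x \<in> (\<Union>n. S n)"
  then obtain n i where "x \<in> U n i" using U(1) by blast
  hence "x \<in> V (prod_encode (n, i))" by (simp add: V_def)
  thus "x \<in> (\<Union>m. V m)" by blast
 qed
 moreover have "bounded (V m) \<and> diameter (V m) <= \<delta>" for m using U(2,3) by (simp add: V_def split: prod.split)
 moreover have "(\<Sum>m. ennreal (diameter (V m) powr u)) < ennreal e"
 proof -
  have "(\<Sum>m. ennreal (diameter (V m) powr u)) = (\<Sum>m. (\<lambda>(n, i). ennreal (diameter (U n i) powr u)) (prod_decode m))"
   by (intro suminf_cong) (simp add: V_def split: prod.split)
  also have "... = (\<Sum>n. \<Sum>i. ennreal (diameter (U n i) powr u))" by (rule suminf_ennreal_2dimen) simp
  also have "... <= (\<Sum>n. ennreal (e/2*(1/2)^Suc n))" using U(4) by (intro suminf_le) (auto simp: less_imp_le)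
  also have "... = ennreal (e/2)"
  proof (rule suminf_ennreal_eq)
   show "(\<lambda>n. e/2*(1/2)^Suc n) sums (e/2)" using sums_mult[OF power_half_series, of "e/2"] by simp
  qed (use de in simp)
  also have "... < ennreal e" using de by (simp add: ennreal_less_iff)
  finally show ?thesis .
 qed
 ultimately show "\<exists>U. (\<Union>n. S n) \<subseteq> (\<Union>i. U i) \<and> (\<forall>i. bounded (U i) \<and> diameter (U i) <= \<delta>) \<and> (\<Sum>i. ennreal (diameter (U i) powr u)) < ennreal e"
  by blast
qed

definition covered :: "'a::metric_space set => real => real => bool" where
 "covered S m r \<longleftrightarrow> (\<exists>F. finite F \<and> real (card F) <= m \<and> S \<subseteq> (\<Union>x\<in>F. cball x r))"

lemma hausdorff_measure_null_covered:
 fixes S :: "'a::euclidean_space set"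
 assumes cov: "\<forall>\<^sub>F r in at_right 0. covered S (C*(1/r) powr t) r" and u: "t < u"
 shows "hausdorff_measure u S = 0"
 unfolding hausdorff_measure_eq_0_iff
proof (intro allI impI)
 fix \<delta> e :: real assume de: "0 < \<delta>" "0 < e"
 have "((\<lambda>r. C*2 powr u*r powr (u - t)) \<longlongrightarrow> C*2 powr u*0) (at_right 0)"
  using u by (intro tendsto_mult tendsto_const) real_asymp
 hence "\<forall>\<^sub>F r in at_right 0. C*2 powr u*r powr (u - t) < e" by (rule order_tendstoD(2)) (use de in simp)
 moreover have "\<forall>\<^sub>F r in at_right 0. r < \<delta>/2" unfolding eventually_at_right_field using de by (intro exI[of _ "\<delta>/2"]) simp
 ultimately have "\<forall>\<^sub>F r in at_right 0. 0 < r \<and> r < \<delta>/2 \<and> C*2 powr u*r powr (u - t) < e \<and> covered S (C*(1/r) powr t) r"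
  using cov eventually_at_right_less[of 0] by eventually_elim blast
 then obtain r where r: "0 < r" "r < \<delta>/2" "C*2 powr u*r powr (u - t) < e" "covered S (C*(1/r) powr t) r"
  using eventually_happens trivial_limit_at_right_real by blast
 obtain F where F: "finite F" "card F <= C*(1/r) powr t" "S \<subseteq> (\<Union>x\<in>F. cball x r)" using r(4) by (auto simp: covered_def)
 obtain f where f: "bij_betw f {0..<card F} F" using ex_bij_betw_nat_finite[OF F(1)] by blast
 \<comment> \<open>Empty sets pad the finite cover to a sequence; their diameter is 0, and
   \<open>0 powr u\<close> is 0.\<close>
 define U where "U i = (if i < card F then cball (f i) r else {})" for i
 have "S \<subseteq> (\<Union>i. U i)"
 proof
  fix x assume "x \<in> S"
  then obtain y where "y \<in> F" "x \<in> cball y r" using F(3) by blast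
  moreover from this obtain i where "i < card F" "f i = y" using f by (metis atLeastLessThan_iff bij_betw_def imageE)
  ultimately show "x \<in> (\<Union>i. U i)" by (auto simp: U_def intro!: exI[of _ i])
 qed
 moreover have "bounded (U i) \<and> diameter (U i) <= \<delta>" for i using r de by (simp add: U_def diameter_cball)
 moreover have "(\<Sum>i. ennreal (diameter (U i) powr u)) < ennreal e"
 proof -
  have "(\<Sum>i. ennreal (diameter (U i) powr u)) = (\<Sum>i<card F. ennreal (diameter (U i) powr u))"
   by (rule suminf_finite) (auto simp: U_def)
  also have "... = ennreal (card F*(2*r) powr u)" using r by (simp add: U_def diameter_cball ennreal_mult ennreal_of_nat_eq_real_of_nat)
  also have "... <= ennreal (C*2 powr u*r powr (u - t))"
  proof (rule ennreal_leI)
   have "card F*(2*r) powr u <= C*(1/r) powr t*(2*r) powr u" using F(2) by (intro mult_right_mono) auto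
   also have "... = C*2 powr u*r powr (u - t)" using r by (simp add: powr_divide powr_mult powr_diff)
   finally show "card F*(2*r) powr u <= C*2 powr u*r powr (u - t)" .
  qed
  also have "... < ennreal e" using r(3) de by (intro ennreal_lessI)
  finally show ?thesis .
 qed
 ultimately show "\<exists>U. S \<subseteq> (\<Union>i. U i) \<and> (\<forall>i. bounded (U i) \<and> diameter (U i) <= \<delta>) \<and> (\<Sum>i. ennreal (diameter (U i) powr u)) < ennreal e"
  by blast
qed

lemma covered_cball:
 fixes R r :: real
 assumes R: "0 <= R" and r: "0 < r" "r <= 1"
 shows "covered (cball (0::real^'d) R) ((2 * R*CARD('d) + 2)^CARD('d)*(1/r) powr CARD('d)) r"
proof -
 obtain F where F: "finite F" "card F <= (2 * R*CARD('d) + 2)^CARD('d) * svcap (1/r) (mat 1 :: real^'d^'d)"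
  "(*v) (mat 1) ` cball (0::real^'d) R \<subseteq> (\<Union>c\<in>F. cball c r)"
  by (rule ellipsoid_covering[OF invertible_mat_1 r(1) R])
 have "svcap (1/r) (mat 1 :: real^'d^'d) <= (\<Prod>j=1..CARD('d). 1/r)"
  unfolding svcap_def
 proof (intro prod_mono conjI)
  fix j assume j: "j \<in> {1..CARD('d)}"
  have "op_norm (mat 1 :: real^'d^'d) <= 1" by (rule op_norm_le) simp
  hence "sval j (mat 1 :: real^'d^'d) <= 1" using sval_le_op_norm[of j "mat 1 :: real^'d^'d"] j by simp
  thus "max 1 (1/r * sval j (mat 1 :: real^'d^'d)) <= 1/r" using r by (simp add: divide_right_mono)
 qed auto
 also have "... = (1/r) powr CARD('d)" using r by (simp add: powr_realpow)
 finally have "(2 * R*CARD('d) + 2)^CARD('d) * svcap (1/r) (mat 1 :: real^'d^'d) <= (2 * R*CARD('d) + 2)^CARD('d)*(1/r) powr CARD('d)"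
  using R by (intro mult_left_mono) auto
 thus ?thesis unfolding covered_def using F by (intro exI[of _ F]) auto
qed

lemma eventually_at_right_le_1: "\<forall>\<^sub>F r in at_right 0. 0 < r \<and> r < (1::real)"
 using eventually_at_right_less[of "0::real"] eventually_at_right_field[of "\<lambda>r. r < (1::real)" 0]
 by (auto simp: eventually_conj_iff intro!: exI[of _ 1])

text \<open>This makes the set in the definition of \<open>hausdorff_dim\<close> nonempty, so that
  its infimum is meaningful.\<close>

lemma hausdorff_measure_null:
 assumes "real CARD('d) < u"
 shows "hausdorff_measure u (S :: (real^'d) set) = 0"
proof (rule hausdorff_measure_null_subset)
 show "hausdorff_measure u (\<Union>n. cball (0 :: real^'d) (real n)) = 0"
 proof (rule hausdorff_measure_null_UN)
  fix n :: nat
  show "hausdorff_measure u (cball (0 :: real^'d) (real n)) = 0"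
  proof (rule hausdorff_measure_null_covered[OF _ assms])
   show "\<forall>\<^sub>F r in at_right 0. covered (cball (0 :: real^'d) (real n)) ((2*real n*CARD('d) + 2)^CARD('d)*(1/r) powr CARD('d)) r"
    using eventually_at_right_le_1 by eventually_elim (rule covered_cball, auto)
  qed
 qed
 show "S \<subseteq> (\<Union>n. cball (0 :: real^'d) (real n))" using real_arch_simple by auto
qed

lemma hausdorff_dim_le:
 assumes "0 < u" "hausdorff_measure u S = 0"
 shows "hausdorff_dim S <= u"
 unfolding hausdorff_dim_def using assms by (intro cInf_lower) (auto intro: bdd_belowI[of _ 0])

lemma hausdorff_dim_ge:
 fixes S :: "(real^'d) set"
 assumes "\<And>u. 0 < u ==> hausdorff_measure u S = 0 ==> t <= u"
 shows "t <= hausdorff_dim S"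
 unfolding hausdorff_dim_def
proof (rule cInf_greatest)
 have "real CARD('d) + 1 \<in> {s. 0 < s \<and> hausdorff_measure s S = 0}" by (simp add: hausdorff_measure_null)
 thus "{s. 0 < s \<and> hausdorff_measure s S = 0} \<noteq> {}" by blast
qed (use assms in auto)

lemma upper_minkowski_dim_le:
 assumes "\<forall>\<^sub>F r in at_right 0. covered S (C*(1/r) powr t) r" and t: "0 <= t"
 shows "upper_minkowski_dim S <= ereal t"
proof -
 define C' where "C' = max 1 C"
 let ?g = "\<lambda>r. (ln C' + t*ln (1/r))/ln (1/r)"
 have "(?g \<longlongrightarrow> t) (at_right 0)" by real_asymp
 hence lim: "Limsup (at_right 0) (\<lambda>r. ereal (?g r)) = ereal t"
  by (intro lim_imp_Limsup tendsto_ereal trivial_limit_at_right_real)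
 have "\<forall>\<^sub>F r in at_right 0. ereal (ln (real (covering_number S r))/ln (1/r)) <= ereal (?g r)"
  using assms(1) eventually_at_right_le_1
 proof eventually_elim
  case (elim r)
  then obtain F where F: "finite F" "card F <= C*(1/r) powr t" "S \<subseteq> (\<Union>x\<in>F. cball x r)" by (auto simp: covered_def)
  have "covering_number S r <= card F" unfolding covering_number_def by (rule Least_le) (use F in blast)
  hence "real (covering_number S r) <= C*(1/r) powr t" using F(2) by linarith
  also have "... <= C'*(1/r) powr t" unfolding C'_def by (intro mult_right_mono) auto
  finally have le: "real (covering_number S r) <= C'*(1/r) powr t" .
  have "1 <= (1/r) powr t" using elim t by (intro ge_one_powr_ge_zero) auto
  hence 1: "1*1 <= C'*(1/r) powr t" unfolding C'_def by (intro mult_mono) auto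
  have "ln (real (covering_number S r)) <= ln (C'*(1/r) powr t)"
  proof (cases "covering_number S r = 0")
   case True
   thus ?thesis using 1 by simp
  qed (use le in simp)
  also have "... = ln C' + t*ln (1/r)" using elim by (simp add: C'_def ln_mult_pos ln_powr)
  finally have le2: "ln (real (covering_number S r)) <= ln C' + t*ln (1/r)" .
  have "0 <= ln (1/r)" using elim by simp
  from divide_right_mono[OF le2 this] show ?case by (simp only: ereal_less_eq)
 qed
 hence "upper_minkowski_dim S <= Limsup (at_right 0) (\<lambda>r. ereal (?g r))" unfolding upper_minkowski_dim_def by (rule Limsup_mono)
 thus ?thesis using lim by simp
qed

text \<open>Finite covers exist at every scale by assumption, so the \<open>LEAST\<close> in
  \<open>covering_number\<close> is attained and yields an actual cover.\<close>

lemma hausdorff_dim_le_minkowski: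
 fixes S :: "(real^'d) set"
 assumes S: "\<And>r. 0 < r ==> \<exists>F. finite F \<and> S \<subseteq> (\<Union>x\<in>F. cball x r)" and t: "upper_minkowski_dim S < ereal t" "t < u" "0 < u"
 shows "hausdorff_dim S <= u"
proof (rule hausdorff_dim_le[OF t(3) hausdorff_measure_null_covered[OF _ t(2)]])
 have "\<forall>\<^sub>F r in at_right 0. ereal (ln (real (covering_number S r))/ln (1/r)) < ereal t"
  using t(1) unfolding upper_minkowski_dim_def by (rule Limsup_lessD)
 thus "\<forall>\<^sub>F r in at_right 0. covered S (1*(1/r) powr t) r"
  using eventually_at_right_le_1
 proof eventually_elim
  case (elim r)
  have "\<exists>n F. finite F \<and> card F = n \<and> S \<subseteq> (\<Union>x\<in>F. cball x r)" using S[of r] elim by blast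
  hence "\<exists>F. finite F \<and> card F = covering_number S r \<and> S \<subseteq> (\<Union>x\<in>F. cball x r)"
   unfolding covering_number_def by (rule LeastI_ex)
  moreover have "real (covering_number S r) <= (1/r) powr t"
  proof (cases "covering_number S r = 0")
   case False
   have "ln (real (covering_number S r)) < t*ln (1/r)" using elim by (simp add: pos_divide_less_eq)
   also have "... = ln ((1/r) powr t)" using elim by (simp add: ln_powr)
   finally have "real (covering_number S r) < (1/r) powr t" using False elim by (subst (asm) ln_less_cancel_iff) auto
   thus ?thesis by simp
  qed simp
  ultimately show ?case unfolding covered_def by auto
 qed
qed

section \<open>The self-affine set\<close>

text \<open>All singular values of the inverse \<open>N\<close> are at least 1, so
  \<open>svcap\<close> of it at scale 1 is its determinant. A cover of the image of the unit ball
  under \<open>N\<close> by unit balls, mapped back by \<open>M\<close>, covers the ball by that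
  many translates of its image.\<close>

lemma measure_contraction_lower:
 fixes M :: "real^'d^'d" and R :: real
 assumes M: "invertible M" and contr: "\<And>x. norm (M *v x) <= norm x" and R: "0 <= R"
 shows "measure lborel (cball (0::real^'d) R)*\<bar>det M\<bar> <= (2*real CARD('d) + 2)^CARD('d)*measure lborel ((*v) M ` cball 0 R)"
proof -
 let ?K = "cball (0::real^'d) R" and ?c = "(2*real CARD('d) + 2)^CARD('d)"
 obtain N where N: "M**N = mat 1" "N**M = mat 1" using M unfolding invertible_def by blast
 have invN: "invertible N" unfolding invertible_def using N by blast
 have 1: "1*norm x <= norm (N *v x)" for x using contr[of "N *v x"] by (simp add: matrix_vector_mul_assoc N)
 have "svcap (1/1) N = \<bar>det N\<bar>"
  unfolding svcap_def abs_det_eq_prod_sval using sval_ge[OF _ _ 1] by (intro prod.cong refl) auto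
 moreover have "\<bar>det N\<bar>*\<bar>det M\<bar> = 1" using N(2) det_mul[of N M] by (simp flip: abs_mult)
 ultimately have sv: "svcap (1/1) N*\<bar>det M\<bar> = 1" by simp
 obtain F where F: "finite F" "card F <= (2*1*real CARD('d) + 2)^CARD('d) * svcap (1/1) N" "(*v) N ` cball 0 1 \<subseteq> (\<Union>c\<in>F. cball c 1)"
  by (rule ellipsoid_covering[OF invN zero_less_one zero_le_one])
 have MK: "compact ((*v) M ` ?K)" by (intro compact_continuous_image linear_continuous_on matrix_vector_mul_bounded_linear) simp
 have MK_b: "(*v) M ` ?K \<in> sets borel" using MK by (intro borel_closed compact_imp_closed)
 have MK_fin: "emeasure lborel ((*v) M ` ?K) = ennreal (measure lborel ((*v) M ` ?K))"
  using emeasure_compact_finite[OF MK] by (intro emeasure_eq_ennreal_measure) auto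
 have tr_b: "{z. z - c \<in> (*v) M ` ?K} \<in> sets lborel" for c
 proof -
  have "(\<lambda>z. z - c) -` ((*v) M ` ?K) \<inter> space lborel \<in> sets lborel" by (rule measurable_sets[OF _ MK_b]) measurable
  thus ?thesis by (simp add: vimage_def)
 qed
 have sub: "?K \<subseteq> (\<Union>c\<in>F. {z. z - M *v (R *\<^sub>R c) \<in> (*v) M ` ?K})"
 proof
  fix z assume z: "z \<in> ?K"
  obtain y where y: "norm y <= 1" "z = R *\<^sub>R y"
  proof (cases "R = 0")
   case False
   thus thesis using z R that[of "z /\<^sub>R R"] by (simp add: divide_simps)
  qed (use z that[of 0] in simp)
  then obtain c where c: "c \<in> F" "norm (N *v y - c) <= 1" using F(3) by (fastforce simp: dist_norm norm_minus_commute)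
  have "M *v (R *\<^sub>R (N *v y - c)) = z - M *v (R *\<^sub>R c)"
   by (simp add: y(2) scaleR_diff_right matrix_vector_mult_diff_distrib matrix_vector_mult_scaleR matrix_vector_mul_assoc N)
  moreover have "R *\<^sub>R (N *v y - c) \<in> ?K" using c(2) R mult_left_mono[of "norm (N *v y - c)" 1 R] by simp
  ultimately have "z - M *v (R *\<^sub>R c) \<in> (*v) M ` ?K" by (metis imageI)
  thus "z \<in> (\<Union>c\<in>F. {z. z - M *v (R *\<^sub>R c) \<in> (*v) M ` ?K})" using c(1) by blast
 qed
 have K_fin: "emeasure lborel ?K = ennreal (measure lborel ?K)"
  by (rule emeasure_eq_ennreal_measure) (use emeasure_lborel_cball_finite[of "0::real^'d" R] in auto)
 have "emeasure lborel ?K <= emeasure lborel (\<Union>c\<in>F. {z. z - M *v (R *\<^sub>R c) \<in> (*v) M ` ?K})"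
  using F(1) tr_b by (intro emeasure_mono sub sets.finite_UN) auto
 also have "... <= (\<Sum>c\<in>F. emeasure lborel {z. z - M *v (R *\<^sub>R c) \<in> (*v) M ` ?K})"
  using F(1) tr_b by (intro emeasure_subadditive_finite) auto
 also have "... = ennreal (card F*measure lborel ((*v) M ` ?K))"
  by (simp add: emeasure_lborel_translate[OF MK_b] MK_fin ennreal_mult ennreal_of_nat_eq_real_of_nat)
 finally have "measure lborel ?K <= card F*measure lborel ((*v) M ` ?K)" unfolding K_fin by (simp add: ennreal_le_iff)
 also have "... <= (?c * svcap (1/1) N)*measure lborel ((*v) M ` ?K)" using F(2) by (intro mult_right_mono) auto
 finally have "measure lborel ?K*\<bar>det M\<bar> <= (?c * svcap (1/1) N)*measure lborel ((*v) M ` ?K)*\<bar>det M\<bar>" by (intro mult_right_mono) auto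
 also have "... = ?c*measure lborel ((*v) M ` ?K)*(svcap (1/1) N*\<bar>det M\<bar>)" by (simp only: mult_ac)
 finally show ?thesis unfolding sv by simp
qed

context contractive_tuple
begin

lemma norm_le_image: "norm x <= radius v ==> norm (point A v w + word_mat A w *v x) <= radius v"
proof (induction w)
 case (Cons i w)
 have eq: "point A v (i # w) + word_mat A (i # w) *v x = v$i + A$i *v (point A v w + word_mat A w *v x)"
  by (simp add: matrix_vector_right_distrib matrix_vector_mul_assoc)
 show ?case unfolding eq by (rule map_norm_le[OF Cons.IH[OF Cons.prems]])
qed simp

text \<open>By strict separation the level \<open>n\<close> images of the ball are disjoint and stay
  inside it. Comparing volumes bounds the \<open>n\<close>-th power of the sum by a constant
  independent of \<open>n\<close>, which forces the sum to be at most 1.\<close>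

lemma sum_det_le_1:
 assumes sep: "\<And>i j. i \<noteq> j ==> (op_norm (A$i) + op_norm (A$j))*radius v < norm (v$i - v$j)"
  and R: "0 < radius v"
 shows "(\<Sum>i\<in>UNIV. \<bar>det (A$i)\<bar>) <= 1"
proof (rule ccontr)
 let ?K = "cball (0::real^'d) (radius v)" and ?S = "\<Sum>i\<in>UNIV. \<bar>det (A$i)\<bar>" and ?c = "(2*real CARD('d) + 2)^CARD('d)"
 assume "\<not> ?S <= 1"
 hence S: "1 < ?S" by simp
 define f where "f w x = point A v w + word_mat A w *v x" for w x
 have f_app: "f (u @ w) x = f u (f w x)" for u w x
  by (simp add: f_def point_append word_mat_append matrix_vector_right_distrib matrix_vector_mul_assoc)
 have disj: "f w ` ?K \<inter> f w' ` ?K = {}" if w: "w \<in> words n" "w' \<in> words n" "w \<noteq> w'" for n w w'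
 proof -
  obtain k where k: "k < n" "take k w = take k w'" "w ! k \<noteq> w' ! k"
   by (rule first_difference[OF _ _ w(3)]) (use w in \<open>auto simp: words_def\<close>)
  define u where "u = take k w"
  have ww: "w = u @ w ! k # drop (Suc k) w" "w' = u @ w' ! k # drop (Suc k) w'"
   unfolding u_def using id_take_nth_drop[of k w] id_take_nth_drop[of k w'] k w by (simp_all only: words_def mem_Collect_eq)
  have "f w x \<noteq> f w' y" if x: "x \<in> ?K" and y: "y \<in> ?K" for x y
  proof
   let ?i = "w ! k" and ?j = "w' ! k"
   define a b where "a = f (drop (Suc k) w) x" and "b = f (drop (Suc k) w') y"
   have ab: "norm a <= radius v" "norm b <= radius v" unfolding a_def b_def f_def using x y by (auto intro: norm_le_image)
   assume "f w x = f w' y"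
   hence "f u (f [?i] a) = f u (f [?j] b)" unfolding a_def b_def f_app[symmetric] append_Cons append_Nil using ww by simp
   hence "word_mat A u *v (f [?i] a - f [?j] b) = 0" by (simp add: f_def matrix_vector_mult_diff_distrib)
   hence "f [?i] a - f [?j] b = 0" by (rule invertible_mult_vec_inj[OF invertible_word])
   hence "v $ ?i - v $ ?j = A $ ?j *v b - A $ ?i *v a" by (simp add: f_def algebra_simps)
   hence "norm (v $ ?i - v $ ?j) <= norm (A $ ?j *v b) + norm (A $ ?i *v a)" by (simp add: norm_triangle_ineq4)
   also have "... <= op_norm (A $ ?j)*radius v + op_norm (A $ ?i)*radius v"
    using ab by (intro add_mono order_trans[OF norm_matrix_vector_le_op_norm] mult_left_mono op_norm_nonneg)
   finally show False using sep[OF k(3)] by (simp add: algebra_simps)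
  qed
  thus ?thesis by blast
 qed
 have cont: "continuous_on X (f w)" for w X
  unfolding f_def by (intro continuous_intros linear_continuous_on matrix_vector_mul_bounded_linear)
 have fK: "compact (f w ` ?K)" for w by (intro compact_continuous_image cont) simp
 have meas: "measure lborel (f w ` ?K) = measure lborel ((*v) (word_mat A w) ` ?K)" for w
 proof -
  have "compact ((*v) (word_mat A w) ` ?K)" by (intro compact_continuous_image linear_continuous_on matrix_vector_mul_bounded_linear) simp
  hence b: "(*v) (word_mat A w) ` ?K \<in> sets borel" by (intro borel_closed compact_imp_closed)
  have "f w ` ?K = {z. z - point A v w \<in> (*v) (word_mat A w) ` ?K}" by (auto simp: f_def image_iff algebra_simps)
  thus ?thesis unfolding measure_def by (simp only: emeasure_lborel_translate[OF b])
 qed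
 have cpos: "0 < ?c" by (intro zero_less_power) simp
 have mK: "0 < measure lborel ?K"
  using emeasure_cball[of "radius v" "0::real^'d"] R by (simp add: measure_def)
 have "?S^n <= ?c" for n
 proof -
  have "measure lborel ?K*?S^n = (\<Sum>w\<in>words n. measure lborel ?K*\<bar>det (word_mat A w)\<bar>)"
   using sum_det_powr[where n = n and x = 1] by (simp flip: sum_distrib_left)
  also have "... <= (\<Sum>w\<in>words n. ?c*measure lborel (f w ` ?K))"
  proof (rule sum_mono)
   fix w
   have "norm (word_mat A w *v x) <= norm x" for x
    using norm_word_le[of w x] rho_pos contractive mult_right_mono[of "rho^length w" 1 "norm x"] power_le_one[of rho "length w"] by simp
   thus "measure lborel ?K*\<bar>det (word_mat A w)\<bar> <= ?c*measure lborel (f w ` ?K)"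
    unfolding meas using R by (intro measure_contraction_lower) auto
  qed
  also have "... = ?c*measure lborel (\<Union>w\<in>words n. f w ` ?K)"
  proof -
   have "measure lborel (\<Union>w\<in>words n. f w ` ?K) = (\<Sum>w\<in>words n. measure lborel (f w ` ?K))"
    using fK emeasure_compact_finite[OF fK]
    by (intro measure_finite_Union finite_words) (auto simp: disjoint_family_on_def disj less_top intro: borel_closed compact_imp_closed)
   thus ?thesis by (simp add: sum_distrib_left)
  qed
  also have "... <= ?c*measure lborel ?K"
  proof (intro mult_left_mono measure_mono_fmeasurable)
   show "(\<Union>w\<in>words n. f w ` ?K) \<subseteq> ?K" unfolding f_def using norm_le_image by auto
   show "(\<Union>w\<in>words n. f w ` ?K) \<in> sets lborel" using fK by (intro sets.finite_UN) (auto intro: borel_closed compact_imp_closed)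
   show "?K \<in> fmeasurable lborel" by (rule fmeasurableI) (simp_all add: emeasure_lborel_cball_finite[unfolded infinity_ennreal_def])
  qed auto
  finally show ?thesis using mK by (simp add: mult.commute)
 qed
 moreover obtain n where "?c < ?S^n" using real_arch_pow[OF S] by blast
 ultimately show False by (meson not_le)
qed

text \<open>Taking the closure makes compactness immediate, without a topology on streams.\<close>

definition limit_set :: "real^'d^'n => (real^'d) set" where
 "limit_set v = closure (range (coding_map A v))"

lemma limit_set_compact: "compact (limit_set v)"
 unfolding limit_set_def
proof (subst compact_closure, rule boundedI)
 show "norm x <= radius v" if "x \<in> range (coding_map A v)" for x using that norm_coding_le by auto
qed

lemma limit_set_eq: "self_affine_set A v = limit_set v"
 unfolding self_affine_set_def
proof (rule the_equality)
 let ?f = "\<lambda>i x. A$i *v x + v$i"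
 have cod: "coding_map A v (i ## \<xi>) = ?f i (coding_map A v \<xi>)" for i \<xi>
  using coding_split[of v "i ## \<xi>" 1] by simp
 have range: "range (coding_map A v) = (\<Union>i. ?f i ` range (coding_map A v))"
 proof safe
  fix \<xi>
  have "coding_map A v \<xi> = ?f (shd \<xi>) (coding_map A v (stl \<xi>))" using cod[of "shd \<xi>" "stl \<xi>"] by simp
  thus "coding_map A v \<xi> \<in> (\<Union>i. ?f i ` range (coding_map A v))" by blast
 next
  fix i \<xi>
  show "?f i (coding_map A v \<xi>) \<in> range (coding_map A v)" unfolding cod[symmetric] by (rule rangeI)
 qed
 have "limit_set v = closure (\<Union>i. ?f i ` range (coding_map A v))"
  unfolding limit_set_def by (rule arg_cong[OF range])
 also have "... = (\<Union>i. closure (?f i ` range (coding_map A v)))"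
 proof -
  have "closure (\<Union>i\<in>I. X i) = (\<Union>i\<in>I. closure (X i))" if "finite I" for I :: "'n set" and X :: "'n => (real^'d) set"
   using that by induction auto
  thus ?thesis by simp
 qed
 also have "... = (\<Union>i. ?f i ` limit_set v)"
 proof -
  have "closure (?f i ` X) = ?f i ` closure X" for i X
  proof -
   have im: "?f i ` Y = (+) (v$i) ` (*v) (A$i) ` Y" for Y by (auto simp: image_image add.commute)
   have "inj ((*v) (A$i))"
    using invertible_mult_vec_inj[OF invertible_A] by (intro injI) (metis eq_iff_diff_eq_0 matrix_vector_mult_diff_distrib)
   hence "(*v) (A$i) ` closure X = closure ((*v) (A$i) ` X)" by (intro closure_injective_linear_image) auto
   thus ?thesis unfolding im by (simp add: closure_translation)
  qed
  thus ?thesis by (simp add: limit_set_def)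
 qed
 finally have inv: "limit_set v = (\<Union>i. ?f i ` limit_set v)" .
 have "limit_set v \<noteq> {}" by (simp add: limit_set_def)
 thus "limit_set v \<noteq> {} \<and> compact (limit_set v) \<and> limit_set v = (\<Union>i. ?f i ` limit_set v)"
  using limit_set_compact inv by (intro conjI)
 fix E assume "E \<noteq> {} \<and> compact E \<and> E = (\<Union>i. ?f i ` E)"
 hence E: "E \<noteq> {}" "compact E" "E = (\<Union>i. ?f i ` E)" by blast+
 have E_in: "?f i z \<in> E" if "z \<in> E" for i z by (subst E(3)) (use that in blast)
 have E_out: "\<exists>i z. z \<in> E \<and> y = ?f i z" if "y \<in> E" for y using that by (subst (asm) E(3)) blast
 \<comment> \<open>Points of an arbitrary compact solution \<open>E\<close> are pushed forward along
   words here and written as such images in \<open>pre\<close>. An image under a word of length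
   \<open>n\<close> is within a constant times \<open>rho^n\<close> of every coded point that begins
   with the word, so closedness gives both inclusions.\<close>
 have im: "point A v w + word_mat A w *v x \<in> E" if "x \<in> E" for w x
 proof (induction w)
  case (Cons i w)
  have "point A v (i # w) + word_mat A (i # w) *v x = ?f i (point A v w + word_mat A w *v x)"
   by (simp add: matrix_vector_right_distrib matrix_vector_mul_assoc)
  thus ?case using E_in[OF Cons.IH] by (simp only:)
 qed (use that in simp)
 have pre: "\<exists>w\<in>words n. \<exists>x\<in>E. y = point A v w + word_mat A w *v x" if "y \<in> E" for n y
  using that
 proof (induction n arbitrary: y)
  case (Suc n)
  obtain i z where z: "z \<in> E" "y = ?f i z" using E_out[OF Suc.prems] by blast
  obtain w x where w: "w \<in> words n" "x \<in> E" "z = point A v w + word_mat A w *v x" using Suc.IH[OF z(1)] by blast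
  show ?case
  proof (intro bexI)
   show "y = point A v (i # w) + word_mat A (i # w) *v x" using z w by (simp add: matrix_vector_right_distrib matrix_vector_mul_assoc)
  qed (use w in \<open>auto simp: words_def\<close>)
 qed simp
 obtain b where b: "\<And>x. x \<in> E ==> norm x <= b" using compact_imp_bounded[OF E(2)] unfolding bounded_iff by blast
 have b0: "0 <= b" using E(1) b order_trans[OF norm_ge_zero] by blast
 have lim: "(\<lambda>n. rho^n*(b + radius v)) \<longlonglongrightarrow> 0"
  using rho_pos contractive by (intro tendsto_mult_left_zero LIMSEQ_power_zero) simp
 have near: "dist (coding_map A v \<xi>) (point A v (stake n \<xi>) + word_mat A (stake n \<xi>) *v x) <= rho^n*(b + radius v)" if "x \<in> E" for \<xi> n x
 proof -
  have "norm (word_mat A (stake n \<xi>) *v x) <= rho^n*b"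
   by (rule order_trans[OF norm_word_le]) (use b[OF that] rho_pos in \<open>simp add: mult_left_mono\<close>)
  thus ?thesis
   using coding_approx[of v \<xi> n] norm_triangle_ineq4[of "coding_map A v \<xi> - point A v (stake n \<xi>)" "word_mat A (stake n \<xi>) *v x"]
   by (simp add: dist_norm algebra_simps)
 qed
 have small: "\<exists>n. rho^n*(b + radius v) < e" if "0 < e" for e
  using order_tendstoD(2)[OF lim that] by (auto simp: eventually_sequentially)
 show "E = limit_set v"
 proof
  show "E \<subseteq> limit_set v"
  proof
   fix y assume y: "y \<in> E"
   show "y \<in> limit_set v" unfolding limit_set_def closure_approachable
   proof (intro allI impI)
    fix e :: real assume "0 < e"
    then obtain n where n: "rho^n*(b + radius v) < e" using small by blast
    obtain w x where w: "w \<in> words n" "x \<in> E" "y = point A v w + word_mat A w *v x" using pre[OF y] by blast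
    have "stake n (w @- sconst undefined) = w" using w(1) by (simp add: words_def stake_shift)
    hence "dist (coding_map A v (w @- sconst undefined)) y < e" using near[OF w(2), of "w @- sconst undefined" n] n w(3) by simp
    thus "\<exists>z\<in>range (coding_map A v). dist z y < e" by blast
   qed
  qed
  have "range (coding_map A v) \<subseteq> closure E"
  proof (clarsimp simp: closure_approachable)
   fix \<xi> and e :: real assume "0 < e"
   then obtain n where n: "rho^n*(b + radius v) < e" using small by blast
   obtain x where x: "x \<in> E" using E(1) by blast
   show "\<exists>y\<in>E. dist y (coding_map A v \<xi>) < e"
    using im[OF x, of "stake n \<xi>"] near[OF x, of \<xi> n] n by (intro bexI[of _ "point A v (stake n \<xi>) + word_mat A (stake n \<xi>) *v x"]) (auto simp: dist_commute)
  qed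
  thus "limit_set v \<subseteq> E"
   unfolding limit_set_def using compact_imp_closed[OF E(2)] by (intro closure_minimal) auto
 qed
qed

end

section \<open>Covering the self-affine set\<close>

context contractive_tuple
begin

text \<open>Appending a letter lowers \<open>svf j\<close> and raises \<open>svf (j - 1)\<close> by
  at most bounded factors, and the \<open>j\<close>-th singular value is their quotient. It thus
  cannot skip a scale when words grow by one letter.\<close>

lemma ex_snoc_ratio:
 assumes j: "1 <= j" "j <= CARD('d)"
 shows "\<exists>b. 0 < b \<and> b < 1 \<and> (\<forall>w i. b * sval j (word_mat A w) <= sval j (word_mat A (w @ [i])))"
proof -
 have t: "0 <= real j" "real j <= real CARD('d)" "0 <= real (j - 1)" "real (j - 1) <= real CARD('d)" using j by auto
 let ?C = "svf_const (CARD('d))"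
 have eq: "phi (real j) w = phi (real (j - 1)) w * sval j (word_mat A w)" for w
  unfolding phi_def using j svf_nat[OF invertible_word[of w], of j] svf_nat[OF invertible_word[of w], of "j - 1"]
  by (cases j) (simp_all add: prod.nat_ivl_Suc')
 have "\<forall>i. \<exists>B. A$i**B = mat 1 \<and> invertible B" using invertible_A unfolding invertible_def by metis
 then obtain inv where inv: "A$i**inv i = mat 1" "invertible (inv i)" for i by metis
 define X Y where "X = 1 + ?C*(\<Sum>i\<in>UNIV. svf (real j) (inv i))" and "Y = 1 + ?C*(\<Sum>i\<in>UNIV. phi (real (j - 1)) [i])"
 have pos: "0 <= svf (real j) (inv i)" "0 <= phi (real (j - 1)) [i]" for i
  using svf_pos[OF inv(2) t(1,2)] phi_pos[OF t(3,4)] by (auto simp: less_imp_le)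
 have XY1: "1 <= X" "1 <= Y" unfolding X_def Y_def using pos svf_const_pos by (auto intro!: mult_nonneg_nonneg sum_nonneg)
 have X: "phi (real j) w <= X*phi (real j) (w @ [i])" for w i
 proof -
  have "word_mat A w = word_mat A (w @ [i])**inv i" by (simp add: word_mat_append inv flip: matrix_mul_assoc)
  hence "phi (real j) w <= ?C*phi (real j) (w @ [i]) * svf (real j) (inv i)"
   using svf_mult[OF invertible_word[of "w @ [i]"] inv(2) t(1,2)] by (simp add: phi_def)
  also have "... = (?C * svf (real j) (inv i))*phi (real j) (w @ [i])" by simp
  also have "... <= X*phi (real j) (w @ [i])"
  proof (rule mult_right_mono)
   have "svf (real j) (inv i) <= (\<Sum>i\<in>UNIV. svf (real j) (inv i))" using pos by (intro member_le_sum) auto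
   thus "?C * svf (real j) (inv i) <= X" unfolding X_def using svf_const_pos mult_left_mono[of _ _ ?C] by (smt (verit))
  qed (use phi_pos[OF t(1,2)] in \<open>simp add: less_imp_le\<close>)
  finally show ?thesis .
 qed
 have Y: "phi (real (j - 1)) (w @ [i]) <= Y*phi (real (j - 1)) w" for w i
 proof -
  have "phi (real (j - 1)) (w @ [i]) <= (?C*phi (real (j - 1)) [i])*phi (real (j - 1)) w"
   using phi_mult[OF t(3,4), of w "[i]"] by (simp add: mult_ac)
  also have "... <= Y*phi (real (j - 1)) w"
  proof (rule mult_right_mono)
   have "phi (real (j - 1)) [i] <= (\<Sum>i\<in>UNIV. phi (real (j - 1)) [i])" using pos by (intro member_le_sum) auto
   thus "?C*phi (real (j - 1)) [i] <= Y" unfolding Y_def using svf_const_pos mult_left_mono[of _ _ ?C] by (smt (verit))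
  qed (use phi_pos[OF t(3,4)] in \<open>simp add: less_imp_le\<close>)
  finally show ?thesis .
 qed
 define b where "b = 1/(2*X*Y)"
 have "b * sval j (word_mat A w) <= sval j (word_mat A (w @ [i]))" for w i
 proof -
  have "phi (real (j - 1)) w * sval j (word_mat A w) <= X*(phi (real (j - 1)) (w @ [i]) * sval j (word_mat A (w @ [i])))"
   using X[of w i] by (simp only: eq)
  also have "... <= X*(Y*phi (real (j - 1)) w * sval j (word_mat A (w @ [i])))"
   using XY1 sval_nonneg[OF j] by (intro mult_left_mono mult_right_mono Y) auto
  also have "... <= 2*..." using XY1 sval_nonneg[OF j] phi_pos[OF t(3,4), of w] by simp
  finally have "phi (real (j - 1)) w * sval j (word_mat A w) <= phi (real (j - 1)) w*(2*X*Y * sval j (word_mat A (w @ [i])))"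
   by (simp only: mult_ac)
  hence "sval j (word_mat A w) <= 2*X*Y * sval j (word_mat A (w @ [i]))" using phi_pos[OF t(3,4), of w] by simp
  thus ?thesis unfolding b_def using XY1 by (simp add: divide_le_eq mult_ac)
 qed
 moreover have "0 < b" "b < 1" unfolding b_def using XY1 mult_mono[OF XY1(1) XY1(2)] by auto
 ultimately show ?thesis by blast
qed

text \<open>When the singular value of index \<open>k + 1\<close> is comparable to \<open>r\<close>,
  earlier factors of \<open>svcap\<close> carry exponent 1 as in \<open>phi t\<close>, later ones
  are 1, and the one in between is 1 as well while its counterpart is at least 1.\<close>

lemma svcap_le_phi:
 assumes t: "k < CARD('d)" "real k < t" "t <= real k + 1" and r: "0 < b" "b <= 1" "0 < r"
  and s: "b*r < sval (k + 1) (word_mat A w)" "sval (k + 1) (word_mat A w) <= r"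
 shows "svcap (1/r) (word_mat A w) <= (1/(b*r)) powr t*phi t w"
proof -
 have td: "0 <= t" "t <= real CARD('d)" using t by linarith+
 let ?s = "\<lambda>j. sval j (word_mat A w)"
 have pos: "0 < ?s j" if "j \<in> {1..CARD('d)}" for j using that sval_pos[OF invertible_word] by simp
 have "svcap (1/r) (word_mat A w) <= (\<Prod>j=1..CARD('d). (1/(b*r)*?s j) powr svexp t j)"
  unfolding svcap_def
 proof (intro prod_mono conjI)
  fix j assume j: "j \<in> {1..CARD('d)}"
  show "max 1 (1/r*?s j) <= (1/(b*r)*?s j) powr svexp t j"
  proof (cases "j <= k + 1")
   case True
   have "b*r < ?s j" using s(1) sval_antimono[of j "k + 1" "word_mat A w"] True j t by simp
   hence 1: "1 <= 1/(b*r)*?s j" using r by simp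
   show ?thesis
   proof (cases "j = k + 1")
    case True
    hence "1/r*?s j <= 1" using s(2) r by simp
    moreover have "1 <= (1/(b*r)*?s j) powr svexp t j" by (intro ge_one_powr_ge_zero 1 svexp_nonneg)
    ultimately show ?thesis by simp
   next
    case False
    hence "svexp t j = 1" using True t j by (simp add: svexp_def)
    moreover have "1/r*?s j <= 1/(b*r)*?s j"
     using r pos[OF j] by (intro mult_right_mono frac_le) (auto simp: mult_left_le_one_le)
    moreover have "(1/(b*r)*?s j) powr 1 = 1/(b*r)*?s j" using 1 by (intro powr_one) linarith
    ultimately show ?thesis using 1 by (simp only: max.bounded_iff)
   qed
  next
   case False
   have "?s j <= r" using s(2) sval_antimono[of "k + 1" j "word_mat A w"] False j by simp
   moreover have "svexp t j = 0" using False t by (simp add: svexp_def)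
   ultimately show ?thesis using r pos[OF j] by simp
  qed
 qed auto
 also have "... = (\<Prod>j=1..CARD('d). (1/(b*r)) powr svexp t j)*(\<Prod>j=1..CARD('d). ?s j powr svexp t j)"
  unfolding prod.distrib[symmetric] using r pos by (intro prod.cong refl powr_mult)
 also have "(\<Prod>j=1..CARD('d). (1/(b*r)) powr svexp t j) = (1/(b*r)) powr t"
  using r sum_svexp[OF td] by (simp add: powr_sum[symmetric])
 finally show ?thesis by (simp add: phi_def svf_eq_prod[OF invertible_word td])
qed

lemma Zsum_geometric:
 assumes t: "0 <= t" "t <= real CARD('d)" and a: "pressure A t < ln a" "0 < a"
 obtains D where "0 <= D" "\<And>n. Zsum t n <= D*a^n"
proof -
 have "\<forall>\<^sub>F n in sequentially. ln (Zsum t n)/n < ln a" by (rule order_tendstoD(2)[OF pressure_limit(1)[OF t] a(1)])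
 hence "\<forall>\<^sub>F n in sequentially. Zsum t n <= a^n" using eventually_gt_at_top[of 0]
 proof eventually_elim
  case (elim n)
  hence "ln (Zsum t n) < ln (a^n)" using a(2) by (simp add: ln_realpow divide_less_eq mult.commute)
  thus ?case using Zsum_pos[OF t, of n] a(2) by (subst (asm) ln_less_cancel_iff) auto
 qed
 then obtain M where M: "\<And>n. M <= n ==> Zsum t n <= a^n" by (auto simp: eventually_sequentially)
 define D where "D = 1 + (\<Sum>n<M. Zsum t n/a^n)"
 have nn: "0 <= Zsum t n/a^n" for n using Zsum_pos[OF t, of n] a(2) by simp
 have D1: "1 <= D" unfolding D_def using nn by (simp add: sum_nonneg)
 have "Zsum t n <= D*a^n" for n
 proof (cases "M <= n")
  case True
  have "1*a^n <= D*a^n" using D1 a(2) by (intro mult_right_mono) auto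
  thus ?thesis using M[OF True] by linarith
 next
  case False
  hence "Zsum t n/a^n <= (\<Sum>n<M. Zsum t n/a^n)" using nn by (intro member_le_sum) auto
  hence "Zsum t n/a^n <= D" by (simp add: D_def)
  thus ?thesis using a(2) by (simp add: divide_le_eq)
 qed
 thus thesis using D1 by (intro that[of D]) auto
qed

text \<open>The words for which the singular value \<open>k + 1\<close> is comparable to \<open>r\<close> form a cut set.\<close>

lemma limit_set_covered:
 assumes t: "0 < t" "t <= real CARD('d)" and P: "pressure A t < 0"
 obtains C where "\<And>r. 0 < r ==> r < 1 ==> covered (limit_set v) (C*(1/r) powr t) r"
proof -
 define k where "k = nat \<lceil>t\<rceil> - 1"
 have k: "real k < t" "t <= real k + 1" using t unfolding k_def by linarith+
 hence kd: "k < CARD('d)" using t by linarith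
 hence k1: "1 <= k + 1" "k + 1 <= CARD('d)" by auto
 have t0: "0 <= t" using t by simp
 let ?s = "\<lambda>w. sval (k + 1) (word_mat A w)"
 obtain b where b: "0 < b" "b < 1" "\<And>w i. b*?s w <= ?s (w @ [i])" using ex_snoc_ratio[OF k1] by blast
 \<comment> \<open>A rate strictly between the pressure and 0 makes the sum of
   \<open>Zsum t n\<close> over all levels converge.\<close>
 obtain a where a: "pressure A t < ln a" "0 < a" "a < 1"
 proof (rule that[of "exp (pressure A t/2)"])
 qed (use P in auto)
 obtain D where D: "0 <= D" "\<And>n. Zsum t n <= D*a^n" using Zsum_geometric[OF t0 t(2) a(1,2)] by blast
 let ?R = "radius v"
 define c where "c = (2*?R*CARD('d) + 2)^CARD('d)"
 have c0: "0 <= c" unfolding c_def using radius_nonneg[of v] by simp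
 have "covered (limit_set v) ((c*(1/b) powr t*(D/(1 - a)))*(1/r) powr t) r" if r: "0 < r" "r < 1" for r
 proof -
  obtain N where N: "rho^N < r" using real_arch_pow_inv[OF r(1) contractive] by blast
  define W where "W = {w \<in> (\<Union>n\<le>N. words n). b*r < ?s w \<and> ?s w <= r}"
  have finW: "finite W" unfolding W_def by simp
  have "\<exists>F. finite F \<and> card F <= c * svcap (1/r) (word_mat A w) \<and> (*v) (word_mat A w) ` cball 0 ?R \<subseteq> (\<Union>x\<in>F. cball x r)" for w
   using ellipsoid_covering[OF invertible_word[of w] r(1) radius_nonneg[of v]] unfolding c_def by metis
  then obtain F where F: "finite (F w)" "card (F w) <= c * svcap (1/r) (word_mat A w)"
   "(*v) (word_mat A w) ` cball 0 ?R \<subseteq> (\<Union>x\<in>F w. cball x r)" for w by metis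
  define G where "G = (\<Union>w\<in>W. (+) (point A v w) ` F w)"
  have finG: "finite G" unfolding G_def using finW F(1) by simp
  have "real (card G) <= (\<Sum>w\<in>W. real (card (F w)))"
  proof -
   have "card G <= (\<Sum>w\<in>W. card ((+) (point A v w) ` F w))" unfolding G_def by (rule card_UN_le[OF finW])
   also have "... <= (\<Sum>w\<in>W. card (F w))" by (intro sum_mono card_image_le F(1))
   finally show ?thesis by (simp flip: of_nat_sum)
  qed
  also have "... <= (\<Sum>w\<in>W. c*((1/(b*r)) powr t*phi t w))"
  proof (intro sum_mono order_trans[OF F(2)] mult_left_mono c0)
   show "svcap (1/r) (word_mat A w) <= (1/(b*r)) powr t*phi t w" if "w \<in> W" for w
    using that b r by (intro svcap_le_phi[OF kd k, of b]) (auto simp: W_def)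
  qed
  also have "... = c*(1/(b*r)) powr t*(\<Sum>w\<in>W. phi t w)" by (simp only: sum_distrib_left mult.assoc)
  also have "... <= c*(1/(b*r)) powr t*(D/(1 - a))"
  proof (rule mult_left_mono)
   have "(\<Sum>w\<in>W. phi t w) <= (\<Sum>w\<in>(\<Union>n\<le>N. words n). phi t w)"
    using phi_pos[OF t0 t(2)] by (intro sum_mono2) (auto simp: W_def less_imp_le)
   also have "... = (\<Sum>n\<le>N. Zsum t n)" unfolding Zsum_def
    by (rule sum.UNION_disjoint) (simp, simp, auto simp: words_def)
   also have "... <= (\<Sum>n\<le>N. D*a^n)" by (intro sum_mono D(2))
   also have "... <= (\<Sum>n. D*a^n)"
    using a D(1) by (intro sum_le_suminf summable_mult summable_geometric) auto
   also have "... = D/(1 - a)" using a by (subst suminf_mult) (simp_all add: summable_geometric suminf_geometric)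
   finally show "(\<Sum>w\<in>W. phi t w) <= D/(1 - a)" .
  qed (use c0 in simp)
  also have "... = (c*(1/b) powr t*(D/(1 - a)))*(1/r) powr t"
   using b r by (simp add: powr_divide powr_mult)
  finally have cardG: "real (card G) <= (c*(1/b) powr t*(D/(1 - a)))*(1/r) powr t" .
  have "coding_map A v \<xi> \<in> (\<Union>x\<in>G. cball x r)" for \<xi>
  proof -
   \<comment> \<open>The first prefix whose singular value drops to \<open>r\<close>; by the choice
     of \<open>b\<close> it is still above \<open>b * r\<close>, and \<open>N\<close> bounds its
     length.\<close>
   define n where "n = (LEAST n. ?s (stake n \<xi>) <= r)"
   have sN: "?s (stake N \<xi>) <= r" using sval_word_bounds(2)[OF k1, of "stake N \<xi>"] N by simp
   have n: "?s (stake n \<xi>) <= r" "n <= N" unfolding n_def by (rule LeastI[of "\<lambda>n. ?s (stake n \<xi>) <= r", OF sN], rule Least_le[of "\<lambda>n. ?s (stake n \<xi>) <= r", OF sN])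
   have "b*r < ?s (stake n \<xi>)"
   proof (cases n)
    case 0
    have "1 <= ?s []" by (rule sval_ge[OF k1]) simp
    moreover have "b*r < 1*1" using b r by (intro mult_strict_mono) auto
    ultimately show ?thesis using 0 by simp
   next
    case (Suc m)
    hence "\<not> ?s (stake m \<xi>) <= r" using not_less_Least[of m "\<lambda>n. ?s (stake n \<xi>) <= r"] by (simp add: n_def)
    hence "b*r < b*?s (stake m \<xi>)" using b by simp
    also have "... <= ?s (stake m \<xi> @ [\<xi> !! m])" by (rule b(3))
    finally show ?thesis unfolding Suc stake_Suc .
   qed
   hence w: "stake n \<xi> \<in> W" using n by (auto simp: W_def intro!: bexI[of _ n])
   have "word_mat A (stake n \<xi>) *v coding_map A v (sdrop n \<xi>) \<in> (*v) (word_mat A (stake n \<xi>)) ` cball 0 ?R"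
    using norm_coding_le by (intro imageI) simp
   then obtain x where x: "x \<in> F (stake n \<xi>)" "dist x (word_mat A (stake n \<xi>) *v coding_map A v (sdrop n \<xi>)) <= r"
    using F(3)[of "stake n \<xi>"] by auto
   have "dist (point A v (stake n \<xi>) + x) (coding_map A v \<xi>) <= r" using x(2) unfolding coding_split[of v \<xi> n] by (simp add: dist_norm)
   moreover have "point A v (stake n \<xi>) + x \<in> G" unfolding G_def using w x(1) by blast
   ultimately show ?thesis by auto
  qed
  hence "range (coding_map A v) \<subseteq> (\<Union>x\<in>G. cball x r)" by blast
  hence "limit_set v \<subseteq> (\<Union>x\<in>G. cball x r)"
   unfolding limit_set_def using finG by (intro closure_minimal closed_UN) auto
  thus ?thesis unfolding covered_def using finG cardG by blast
 qed
 thus thesis by (rule that)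
qed

lemma limit_set_covered_d:
 assumes "0 < r" "r < 1"
 shows "covered (limit_set v) ((2*radius v * CARD('d) + 2)^CARD('d)*(1/r) powr CARD('d)) r"
proof -
 have "limit_set v \<subseteq> cball 0 (radius v)"
  unfolding limit_set_def using norm_coding_le by (intro closure_minimal) auto
 thus ?thesis using covered_cball[where 'd = 'd, OF radius_nonneg[of v], of r] assms unfolding covered_def by (meson less_imp_le order_trans)
qed

end

section \<open>Hausdorff dimension of projected equilibrium states\<close>

lemma dyadic_scale:
 fixes D :: real
 assumes "0 < D" "D <= 1"
 obtains m :: nat where "1/2^Suc m < D" "D <= 1/2^m"
proof -
 define m where "m = (LEAST m. 1/2^Suc m < D)"
 obtain n where "(1/2)^n < D" using real_arch_pow_inv[OF assms(1), of "1/2"] by auto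
 hence "1/2^Suc n < D" by (simp add: power_divide field_simps)
 hence "1/2^Suc m < D" unfolding m_def by (rule LeastI)
 moreover have "D <= 1/2^m"
 proof (cases m)
  case (Suc k)
  thus ?thesis using not_less_Least[of k "\<lambda>m. 1/2^Suc m < D"] by (simp add: m_def)
 qed (use assms in simp)
 ultimately show thesis by (rule that)
qed

context ergodic_cocycle
begin

text \<open>Mass distribution principle, used separately for the restriction of the measure to each
  \<open>G k\<close>. Were \<open>u < t\<close> with vanishing Hausdorff measure, covers of
  \<open>X\<close> with small sums would show that the part of \<open>G k\<close> above
  \<open>X\<close> where the bound holds from level \<open>M\<close> on is null.\<close>

lemma hausdorff_dim_ge_local:
 fixes t :: real and G :: "nat => 'n stream set"
 assumes G: "\<And>k. G k \<in> sets \<nu>" "AE \<xi> in \<nu>. \<exists>k. \<xi> \<in> G k"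
  and loc: "\<And>k. AE \<xi> in \<nu>. \<xi> \<in> G k --> (\<forall>\<^sub>F m in sequentially. prob {\<xi>' \<in> G k. dist (coding_map A v \<xi>) (coding_map A v \<xi>') <= 1/2^m} <= 2 powr - (m*t))"
  and X: "X \<in> sets borel" "0 < emeasure (projected_measure A v \<nu>) X"
 shows "t <= hausdorff_dim X"
proof (rule hausdorff_dim_ge, rule ccontr)
 let ?p = "coding_map A v"
 fix u :: real assume u: "0 < u" "hausdorff_measure u X = 0" "\<not> t <= u"
 define q where "q k m x = prob {\<xi>' \<in> G k. dist x (?p \<xi>') <= 1/2^m}" for k m x
 define S where "S k M = {\<xi> \<in> G k. ?p \<xi> \<in> X \<and> (\<forall>m\<ge>M. q k m (?p \<xi>) <= 2 powr - (m*t))}" for k M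
 have S_sets: "S k M \<in> sets \<nu>" for k M
 proof -
  note [measurable] = G(1) X(1)
  have [measurable]: "(\<lambda>\<xi>. q k m (?p \<xi>)) \<in> borel_measurable \<nu>" for m
   unfolding q_def by (rule measurable_compose[OF coding_measurable_nu restricted_ball_measurable[OF G(1)]])
  have "{\<xi> \<in> space \<nu>. \<xi> \<in> G k \<and> ?p \<xi> \<in> X \<and> (\<forall>m\<in>{M..}. q k m (?p \<xi>) <= 2 powr - (m*t))} \<in> sets \<nu>"
   by measurable
  thus ?thesis by (simp add: S_def Ball_def)
 qed
 have null: "emeasure \<nu> (S k M) = 0" for k M
 proof -
  have le: "emeasure \<nu> (S k M) <= 0 + ennreal e" if e: "0 < e" for e
  proof -
   have "0 < e/2 powr t" "(0::real) < 1/2^M" using e by auto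
   then obtain U where U: "X \<subseteq> (\<Union>i :: nat. U i)" "\<And>i. bounded (U i)" "\<And>i. diameter (U i) <= 1/2^M"
    "(\<Sum>i. ennreal (diameter (U i) powr u)) < ennreal (e/2 powr t)"
    using u(2) unfolding hausdorff_measure_eq_0_iff by metis
   \<comment> \<open>The mass bound is known only for balls centred at points coming from
     \<open>S k M\<close>, so a covering set is replaced by such a ball about one of its
     points.\<close>
   define B where "B i = (if \<exists>\<xi>\<in>S k M. ?p \<xi> \<in> U i
    then {\<xi>' \<in> G k. dist (?p (SOME \<xi>. \<xi> \<in> S k M \<and> ?p \<xi> \<in> U i)) (?p \<xi>') <= diameter (U i)} else {})" for i
   have B_sets: "B i \<in> sets \<nu>" for i unfolding B_def using restricted_ball_sets[OF G(1)] by simp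
   have pick: "(SOME \<xi>. \<xi> \<in> S k M \<and> ?p \<xi> \<in> U i) \<in> S k M \<and> ?p (SOME \<xi>. \<xi> \<in> S k M \<and> ?p \<xi> \<in> U i) \<in> U i"
    if "\<exists>\<xi>\<in>S k M. ?p \<xi> \<in> U i" for i
    by (rule someI_ex) (use that in blast)
   have sub: "S k M \<subseteq> (\<Union>i. B i)"
   proof
    fix \<xi> assume \<xi>: "\<xi> \<in> S k M"
    then obtain i where i: "?p \<xi> \<in> U i" using U(1) by (auto simp: S_def)
    hence ex: "\<exists>\<xi>\<in>S k M. ?p \<xi> \<in> U i" using \<xi> by blast
    have "\<xi> \<in> B i" unfolding B_def using ex \<xi> diameter_bounded_bound[OF U(2) pick[OF ex, THEN conjunct2] i] by (simp add: S_def)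
    thus "\<xi> \<in> (\<Union>i. B i)" by blast
   qed
   have pB: "prob (B i) <= 2 powr t*diameter (U i) powr u" for i
   proof (cases "\<exists>\<xi>\<in>S k M. ?p \<xi> \<in> U i")
    case True
    let ?x = "?p (SOME \<xi>. \<xi> \<in> S k M \<and> ?p \<xi> \<in> U i)" and ?D = "diameter (U i)"
    have B: "B i = {\<xi>' \<in> G k. dist ?x (?p \<xi>') <= ?D}" using True by (simp add: B_def)
    have qm: "prob (B i) <= 2 powr - (m*t)" if m: "M <= m" "?D <= 1/2^m" for m
    proof -
     have "prob (B i) <= q k m ?x" unfolding B q_def using m(2) by (intro finite_measure_mono restricted_ball_sets G(1)) auto
     also have "... <= 2 powr - (m*t)" using pick[OF True] m(1) unfolding S_def by blast
     finally show ?thesis .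
    qed
    have D0: "0 <= ?D" by (rule diameter_ge_0[OF U(2)])
    show ?thesis
    proof (cases "?D = 0")
     case D: True
     \<comment> \<open>A set of diameter 0 fits into balls of all dyadic radii, so its mass is
       0.\<close>
     have "(\<lambda>m. 2 powr - (real m*t)) \<longlonglongrightarrow> 0" using u by real_asymp
     hence "prob (B i) <= 0" by (rule LIMSEQ_le_const) (use qm D in \<open>auto intro!: exI[of _ M]\<close>)
     thus ?thesis using D by simp
    next
     case False
     have D1: "?D <= 1" using U(3)[of i] by (rule order_trans) simp
     obtain m where m: "1/2^Suc m < ?D" "?D <= 1/2^m" by (rule dyadic_scale[OF _ D1]) (use D0 False in auto)
     have "M <= m"
     proof (rule ccontr)
      assume "\<not> M <= m"
      hence "1/2^M <= (1/2^Suc m :: real)" by (intro divide_left_mono power_increasing) auto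
      thus False using m(1) U(3)[of i] by linarith
     qed
     hence "prob (B i) <= 2 powr - (m*t)" using qm m(2) by blast
     also have "... = 2 powr t*(1/2^Suc m) powr t"
     proof -
      have "1/2^Suc m = (2::real) powr - real (Suc m)"
       by (simp only: powr_minus_divide powr_realpow zero_less_numeral)
      thus ?thesis by (simp only: powr_powr powr_add[symmetric]) (simp add: algebra_simps)
     qed
     also have "... <= 2 powr t*?D powr t" using m(1) u by (intro mult_left_mono powr_mono2) auto
     also have "... <= 2 powr t*?D powr u" using D0 D1 u by (intro mult_left_mono powr_mono') auto
     finally show ?thesis .
    qed
   qed (simp add: B_def)
   have "emeasure \<nu> (S k M) <= emeasure \<nu> (\<Union>i. B i)" using B_sets by (intro emeasure_mono sub) auto
   also have "... <= (\<Sum>i. emeasure \<nu> (B i))" using B_sets by (intro emeasure_subadditive_countably) auto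
   also have "... <= (\<Sum>i. ennreal (2 powr t)*ennreal (diameter (U i) powr u))"
    using pB by (intro suminf_le) (auto simp: emeasure_eq_measure simp flip: ennreal_mult)
   also have "... = ennreal (2 powr t)*(\<Sum>i. ennreal (diameter (U i) powr u))" by (rule ennreal_suminf_cmult)
   also have "... <= ennreal (2 powr t)*ennreal (e/2 powr t)" using U(4) by (intro mult_left_mono) (auto simp: less_imp_le)
   also have "... = ennreal e" using e by (simp flip: ennreal_mult)
   finally show ?thesis by simp
  qed
  have "emeasure \<nu> (S k M) <= 0" by (rule ennreal_le_epsilon) (rule le)
  thus ?thesis by simp
 qed
 have "AE \<xi> in \<nu>. \<forall>k M. \<xi> \<notin> S k M"
  using null S_sets by (intro AE_all_countable[THEN iffD2] allI AE_not_in) auto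
 moreover have "AE \<xi> in \<nu>. \<forall>k. \<xi> \<in> G k --> (\<forall>\<^sub>F m in sequentially. q k m (?p \<xi>) <= 2 powr - (m*t))"
  using loc by (intro AE_all_countable[THEN iffD2] allI) (simp add: q_def)
 ultimately have "AE \<xi> in \<nu>. ?p \<xi> \<notin> X" using G(2)
 proof eventually_elim
  case (elim \<xi>)
  obtain k where k: "\<xi> \<in> G k" using elim(3) by blast
  then obtain M where "\<forall>m\<ge>M. q k m (?p \<xi>) <= 2 powr - (m*t)" using elim(2) by (auto simp: eventually_sequentially)
  thus ?case using elim(1) k unfolding S_def by blast
 qed
 hence "emeasure \<nu> {\<xi> \<in> space \<nu>. ?p \<xi> \<in> X} = 0"
  using AE_iff_measurable[of _ \<nu> "\<lambda>\<xi>. ?p \<xi> \<notin> X"] measurable_sets[OF coding_measurable_nu X(1), of v]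
  by (simp add: vimage_def)
 moreover have "emeasure (projected_measure A v \<nu>) X = emeasure \<nu> {\<xi> \<in> space \<nu>. ?p \<xi> \<in> X}"
  unfolding projected_measure_def by (subst emeasure_distr[OF coding_measurable_nu X(1)]) (simp add: vimage_def Int_def conj_commute)
 ultimately show False using X(2) by simp
qed

lemma energy_rate_strict_mono:
 assumes t: "0 <= t" "t < s" "s <= real CARD('d)"
 shows "energy_rate t < energy_rate s"
proof -
 have lr: "0 < - ln rho" using rho_pos contractive by simp
 have "(s - t)*- ln rho = (\<Sum>j=1..CARD('d). (svexp s j - svexp t j)*- ln rho)"
  using sum_svexp[of s "CARD('d)"] sum_svexp[of t "CARD('d)"] t
  by (simp only: sum_distrib_right[symmetric] sum_subtractf)
 also have "... <= (\<Sum>j=1..CARD('d). (svexp s j - svexp t j)*lyapunov_exponent A \<nu> j)"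
  using svexp_mono[of t s] t lyapunov_bounds by (intro sum_mono mult_left_mono) auto
 also have "... = energy_rate s - energy_rate t" by (simp add: energy_rate_def sum_subtractf left_diff_distrib)
 finally show ?thesis using mult_pos_pos[of "s - t" "- ln rho"] t lr by linarith
qed

lemma lower_hausdorff_dim_bounds:
 assumes E: "closed E" "range (coding_map A v) \<subseteq> E"
  and t: "\<And>X. X \<in> sets borel ==> 0 < emeasure (projected_measure A v \<nu>) X ==> t <= hausdorff_dim X"
 shows "t <= lower_hausdorff_dim (projected_measure A v \<nu>)" "lower_hausdorff_dim (projected_measure A v \<nu>) <= hausdorff_dim E"
proof -
 have "coding_map A v -` E \<inter> space \<nu> = space \<nu>" using E(2) by auto
 hence "emeasure (projected_measure A v \<nu>) E = 1"
  unfolding projected_measure_def using E(1) emeasure_space_1 by (subst emeasure_distr[OF coding_measurable_nu]) (auto intro: borel_closed)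
 hence mem: "hausdorff_dim E \<in> {hausdorff_dim B | B. B \<in> sets borel \<and> 0 < emeasure (projected_measure A v \<nu>) B}"
  using borel_closed[OF E(1)] by (auto intro!: exI[of _ E])
 show "t <= lower_hausdorff_dim (projected_measure A v \<nu>)"
  unfolding lower_hausdorff_dim_def using mem t by (intro cInf_greatest) auto
 show "lower_hausdorff_dim (projected_measure A v \<nu>) <= hausdorff_dim E"
  unfolding lower_hausdorff_dim_def using mem by (intro cInf_lower bdd_belowI[of _ t]) (auto intro: t)
qed

end

lemma (in contractive_tuple) limit_set_upper:
 assumes s: "0 <= s" "s <= real CARD('d)" "pressure A s = 0"
 shows "hausdorff_dim (limit_set v) <= s" "upper_minkowski_dim (limit_set v) <= ereal s"
proof -
 have cov: "\<exists>C t. 0 <= t \<and> t < u \<and> (\<forall>\<^sub>F r in at_right 0. covered (limit_set v) (C*(1/r) powr t) r)" if u: "s < u" for u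
 proof (cases "s = real CARD('d)")
  case True
  have "\<forall>\<^sub>F r in at_right 0. covered (limit_set v) ((2*radius v * CARD('d) + 2)^CARD('d)*(1/r) powr real CARD('d)) r"
   using eventually_at_right_le_1 by eventually_elim (simp add: limit_set_covered_d)
  thus ?thesis using u True by (intro exI[of _ "(2*radius v * CARD('d) + 2)^CARD('d)"] exI[of _ "real CARD('d)"]) auto
 next
  case False
  define t where "t = min ((s + u)/2) (real CARD('d))"
  have t: "s < t" "t < u" "t <= real CARD('d)" "0 < t" using u s False by (auto simp: t_def min_def)
  have "ln rho < 0" using rho_pos contractive by simp
  hence "pressure A t < 0" using pressure_mono(1)[of s t] s t mult_pos_neg[of "t - s" "ln rho"] by simp
  then obtain C where C: "\<And>r. 0 < r ==> r < 1 ==> covered (limit_set v) (C*(1/r) powr t) r"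
   using limit_set_covered[OF t(4,3)] by blast
  have "\<forall>\<^sub>F r in at_right 0. covered (limit_set v) (C*(1/r) powr t) r"
   using eventually_at_right_le_1 by eventually_elim (simp add: C)
  thus ?thesis using t by (intro exI[of _ C] exI[of _ t]) auto
 qed
 have "hausdorff_dim (limit_set v) <= u" if "s < u" for u
  using cov[OF that] s that by (auto intro!: hausdorff_dim_le hausdorff_measure_null_covered)
 thus "hausdorff_dim (limit_set v) <= s" by (rule dense_ge)
 have "upper_minkowski_dim (limit_set v) <= ereal u" if u: "s < u" for u
 proof -
  obtain C t where "0 <= t" "t < u" "\<forall>\<^sub>F r in at_right 0. covered (limit_set v) (C*(1/r) powr t) r" using cov[OF u] by blast
  hence "upper_minkowski_dim (limit_set v) <= ereal t" by (intro upper_minkowski_dim_le)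
  thus ?thesis using \<open>t < u\<close> by (meson ereal_less_eq(3) less_imp_le order_trans)
 qed
 thus "upper_minkowski_dim (limit_set v) <= ereal s"
  by (metis ereal_dense2 ereal_less_eq(3) linorder_not_less less_ereal.simps(1))
qed

lemma (in contractive_tuple) limit_set_minkowski_lower:
 assumes "0 < s" "s <= hausdorff_dim (limit_set v)"
 shows "ereal s <= upper_minkowski_dim (limit_set v)"
proof (rule ccontr)
 assume "\<not> ereal s <= upper_minkowski_dim (limit_set v)"
 hence "upper_minkowski_dim (limit_set v) < ereal s" by simp
 then obtain t where t: "upper_minkowski_dim (limit_set v) < ereal t" "t < s" using ereal_dense2 by force
 obtain u where u: "max t 0 < u" "u < s" using dense[of "max t 0" s] assms(1) t(2) by auto
 have "hausdorff_dim (limit_set v) <= u"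
 proof (rule hausdorff_dim_le_minkowski[OF _ t(1)])
  fix r :: real assume "0 < r"
  thus "\<exists>F. finite F \<and> limit_set v \<subseteq> (\<Union>x\<in>F. cball x r)"
   using compactE_image[OF limit_set_compact[of v], of "limit_set v" "\<lambda>x. ball x r"] ball_subset_cball
   by (metis (no_types, lifting) UN_mono UN_iff centre_in_ball open_ball order_trans subsetI order_refl)
 qed (use u in auto)
 thus False using u assms(2) by linarith
qed

lemma (in ergodic_cocycle) good_words_local:
 fixes t t' L :: real and K :: nat
 assumes conj: "conjugation B C" "op_norm B <= 5/4" and half: "rho <= 1/2" and L: "5/4*(1 + 2*radius v) <= L"
  and c: "0 < c" "\<And>w. phi t w <= c * svf t (word_mat (conj_tuple B C A) w)"
  and fin: "(\<Sum>m. ennreal (2 powr (m*t') * close_pairs L v (\<lambda>A w. svf t (word_mat A w)) (\<lambda>A w. svf t (word_mat A w)) m (conj_tuple B C A) B)) < \<infinity>"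
  and t: "0 <= t" "t <= real CARD('d)"
 shows "AE \<xi> in \<nu>. \<xi> \<in> good_words t K --> (\<forall>\<^sub>F m in sequentially.
  prob {\<xi>' \<in> good_words t K. dist (coding_map A v \<xi>) (coding_map A v \<xi>') <= 1/2^m} <= 2 powr - (m*t'))"
proof -
 have b: "prob (good_words t K \<inter> cylinder w) <= K * c * svf t (word_mat (conj_tuple B C A) w)" for w
 proof (cases "good_words t K \<inter> cylinder w = {}")
  case True
  have "0 < c * svf t (word_mat (conj_tuple B C A) w)" using c(2)[of w] phi_pos[OF t, of w] by linarith
  thus ?thesis using True by (simp add: mult.assoc mult_nonneg_nonneg less_imp_le)
 next
  case False
  then obtain \<xi> where \<xi>: "\<xi> \<in> good_words t K" "stake (length w) \<xi> = w" by (auto simp: cylinder_def)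
  have "prob (cylinder (stake (length w) \<xi>)) <= K*phi t (stake (length w) \<xi>)" using \<xi>(1) unfolding good_words_def by blast
  hence "prob (cylinder w) <= K*phi t w" unfolding \<xi>(2) .
  also have "... <= K*(c * svf t (word_mat (conj_tuple B C A) w))" by (intro mult_left_mono c) simp
  finally have "prob (cylinder w) <= K * c * svf t (word_mat (conj_tuple B C A) w)" by (simp add: mult.assoc)
  moreover have "prob (good_words t K \<inter> cylinder w) <= prob (cylinder w)" by (intro finite_measure_mono) auto
  ultimately show ?thesis by linarith
 qed
 show ?thesis
  by (rule energy_local_bound[OF conj half L good_words_sets good_words_sets _ b b fin]) (use c in simp)
qed

text \<open>The weights are \<open>svf\<close> of the tuple and do not involve \<mu>, so one null
  set of tuples serves all equilibrium states. Energies at exponents slightly below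
  \<open>dim_aff A\<close> bound below the dimension of every set of positive projected mass. The
  existence of one equilibrium state transfers this to the self-affine set, and the coverings give
  the reverse inequality.\<close>

theorem AE_limit_set_dimensions:
 fixes v :: "real^'d^'n"
 assumes N: "CARD('n) >= 2" and v: "\<And>i j. i \<noteq> j ==> v$i \<noteq> v$j"
 shows "AE A in lebesgue. A \<in> admissible_tuples v -->
  (\<exists>\<mu>. equilibrium_state A (dim_aff A) \<mu>) \<and>
  (\<forall>\<mu>. equilibrium_state A (dim_aff A) \<mu> --> lower_hausdorff_dim (projected_measure A v \<mu>) = dim_aff A) \<and>
  hausdorff_dim (self_affine_set A v) = dim_aff A \<and> upper_minkowski_dim (self_affine_set A v) = ereal (dim_aff A)"
proof -
 let ?L = "2 + 5 * vec_tuple_norm v"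
 define W where "W t A w = svf t (word_mat A w)" for t and A :: "real^'d^'d^'n" and w
 have W0: "0 <= W t A w" if "0 <= t" "t <= real CARD('d)" "A \<in> GL_tuples" for t A w
 proof -
  have "invertible (word_mat A w)" using that(3) by (induction w) (simp_all add: invertible_mult GL_tuples_def invertible_mat_1)
  thus ?thesis unfolding W_def using that by (intro less_imp_le[OF svf_pos]) auto
 qed
 obtain B C where BC: "conjugation B C" "op_norm B <= 5/4" "op_norm C <= 4/3"
  "AE A in lebesgue. A \<in> admissible_tuples v --> (\<forall>(t' :: real) t (k :: nat) K. t' \<in> \<rat> --> t \<in> \<rat> --> 0 <= t' --> t' < t --> t <= real CARD('d) -->
   (\<forall>m. pair_energy t (W t) (W t) m (conj_tuple B C A) <= real K*(2 powr ((t - t')/2))^m) -->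
   (\<Sum>m. ennreal (2 powr (m*t') * close_pairs ?L v (W t) (W t) m (conj_tuple B C A) B)) < \<infinity>)"
 proof (rule AE_admissible_energy[where L = ?L and W = "\<lambda>t _. W t" and W' = "\<lambda>t _. W t", OF N v])
  show "1 <= ?L" using vec_tuple_norm_nonneg[of v] by simp
  show "(\<lambda>A. W t A w) \<in> borel_measurable borel \<and> (\<lambda>A. W t A w) \<in> borel_measurable borel"
   if "0 <= t" "t <= real CARD('d)" for t w
   unfolding W_def using that by (intro conjI svf_word_measurable) auto
 qed (use W0 in auto)
 interpret conjugation B C by (rule BC(1))
 show ?thesis using BC(4)
 proof eventually_elim
  case (elim A)
  show ?case
  proof
   assume adm: "A \<in> admissible_tuples v"
   note fin = elim[rule_format, OF adm]
   have GL: "A \<in> GL_tuples" and r: "mat_tuple_norm A <= 6/25" using admissible_bounds(1,2)[OF adm N] v by blast+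
   have sep0: "(op_norm (A$i) + op_norm (A$j)) * vec_tuple_norm v <= 31/200*(1 - mat_tuple_norm A)*norm (v$i - v$j)" if "i \<noteq> j" for i j
    by (rule admissible_bounds(3)[OF adm N]) (use v \<open>i \<noteq> j\<close> in auto)
   interpret contractive_tuple A by unfold_locales (use GL r in auto)
   let ?s = "dim_aff A"
   have sep: "(op_norm (A$i) + op_norm (A$j))*radius v < norm (v$i - v$j)" if ij: "i \<noteq> j" for i j
   proof -
    have "(op_norm (A$i) + op_norm (A$j))*radius v <= 31/200*norm (v$i - v$j)"
     unfolding radius_def using sep0[OF ij] contractive by (simp add: field_simps)
    moreover have "0 < norm (v$i - v$j)" using v[OF ij] by simp
    ultimately show ?thesis by linarith
   qed
   have "0 < radius v"
   proof -
    obtain k l :: 'n where l: "k \<noteq> l" using N by (metis (full_types) card_2_iff' ex_card)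
    have "v$k \<noteq> 0 \<or> v$l \<noteq> 0" using v[OF l] by metis
    hence "0 < norm (v$k) \<or> 0 < norm (v$l)" by simp
    hence "0 < vec_tuple_norm v" using vec_tuple_norm_ge[of v k] vec_tuple_norm_ge[of v l] by linarith
    thus ?thesis unfolding radius_def using contractive by simp
   qed
   with sum_det_le_1[OF sep] have "(\<Sum>i\<in>UNIV. \<bar>det (A$i)\<bar>) <= 1" by blast
   note s = dim_aff_root[OF this N]
   have s0: "0 <= ?s" using s(1) by simp
   interpret crit: critical_tuple A ?s by unfold_locales (use s in auto)
   have E: "closed (limit_set v)" "range (coding_map A v) \<subseteq> limit_set v" by (simp_all add: limit_set_def closure_subset)
   note up = limit_set_upper[OF s0 s(2,3), of v]
   have lower: "t' <= lower_hausdorff_dim (projected_measure A v \<mu>) \<and> lower_hausdorff_dim (projected_measure A v \<mu>) <= hausdorff_dim (limit_set v)"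
    if \<mu>: "equilibrium_state A ?s \<mu>" and t': "t' \<in> \<rat>" "0 <= t'" "t' < ?s" for \<mu> t'
   proof -
    interpret ergodic_cocycle A \<mu>
     using \<mu> by (intro ergodic_cocycle.intro contractive_tuple_axioms) (simp add: equilibrium_state_def ergodic_shift_measure_iff)
    have h: "shift_entropy \<mu> = energy_rate ?s" using \<mu> equilibrium_state_iff[OF s0 s(2)] by blast
    define l where "l = - ln lower_rate"
    have l: "0 < l" using lower_rate by (simp add: l_def)
    define g where "g = ?s - t'"
    have g: "0 < g" using t' by (simp add: g_def)
    \<comment> \<open>\<open>t\<close> has to be so close to \<open>dim_aff A\<close> that
      \<open>t - t'\<close> is more than half of \<open>g\<close> and that the pressure at
      \<open>t\<close>, at most \<open>(?s - t)*l\<close>, is below \<open>(t - t')/8\<close> times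
      \<open>ln 2\<close>.\<close>
    have mx: "max (?s - g/2) (?s - g*ln 2/(16*l)) < ?s" using g l by (simp add: divide_pos_pos)
    obtain t where tm: "t \<in> \<rat>" "max (?s - g/2) (?s - g*ln 2/(16*l)) < t" "t < ?s"
     using Rats_dense_in_real[OF mx] by blast
    hence t: "t \<in> \<rat>" "?s - g/2 < t" "?s - g*ln 2/(16*l) < t" "t < ?s" by (simp_all only: max_less_iff_conj)
    have gs: "?s = t' + g" by (simp add: g_def)
    have t4: "g/2 < t - t'" using t(2) unfolding gs by simp
    have t0: "0 <= t" "t <= real CARD('d)" "t' < t" "g/2 < t - t'" using t4 t(4) t'(2) s(2) g by auto
    have P: "pressure A t < ln (2 powr ((t - t')/8))"
    proof -
     have "pressure A t <= (?s - t)*l"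
      using pressure_mono(2)[of t ?s] t0 t(4) s by (simp add: l_def)
     also have "... < (g*ln 2/(16*l))*l" using t(3) l by (intro mult_strict_right_mono) auto
     also have "... = g/2*(ln 2/8)" using l by simp
     also have "... < (t - t')*(ln 2/8)" using t0(4) by (intro mult_strict_right_mono) auto
     finally show ?thesis by (simp add: ln_powr)
    qed
    let ?a = "2 powr ((t - t')/8)" and ?q = "2 powr ((t - t')/2)"
    have a1: "1 <= ?a" using t0 by (intro ge_one_powr_ge_zero) auto
    obtain D where D: "0 <= D" "\<And>n. Zsum t n <= D*?a^n" by (rule Zsum_geometric[OF t0(1,2) P]) auto
    obtain c where c: "0 < c" "\<And>w. phi t w <= c * svf t (word_mat (conj_tuple B C A) w)"
     "\<And>w. svf t (word_mat (conj_tuple B C A) w) <= c*phi t w"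
     using svf_conj[OF invertible_word t0(1,2)] by (auto simp: phi_def word_mat_conj)
    have rel: "conj_tuple B C A \<in> relaxed_tuples v" by (rule conj_relaxed[OF adm N v BC(2,3)])
    interpret Cj: contractive_tuple "conj_tuple B C A" by unfold_locales (use rel in \<open>auto simp: relaxed_tuples_def\<close>)
    have Z: "Cj.Zsum t n <= c*D*?a^n" for n
    proof -
     have "Cj.Zsum t n <= (\<Sum>w\<in>words n. c*phi t w)" unfolding Cj.Zsum_def Cj.phi_def by (intro sum_mono c)
     also have "... <= c*(D*?a^n)" unfolding sum_distrib_left[symmetric] Zsum_def[symmetric] using c(1) by (intro mult_left_mono D(2)) simp
     finally show ?thesis by simp
    qed
    \<comment> \<open>The energy grows like the square of \<open>?a\<close>, that is at rate
      \<open>(t - t')/4\<close> in powers of 2, which is below the rate \<open>(t - t')/2\<close>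
      that the energy theorem allows.\<close>
    have "?a\<^sup>2 < ?q" using t0 by (simp add: powr_power)
    then obtain K1 :: nat where K1: "\<And>m. (real m + 1)*(?a\<^sup>2)^m <= K1*?q^m" using linear_times_geometric_bound[of "?a\<^sup>2" ?q] by auto
    let ?k = "(svf_const (CARD('d)))\<^sup>2*(c*D)^3"
    have k0: "0 <= ?k" using c D by simp
    obtain K :: nat where K: "?k*K1 <= K" using real_arch_simple by blast
    have "pair_energy t (W t) (W t) m (conj_tuple B C A) <= K*?q^m" for m
    proof -
     have "pair_energy t (W t) (W t) m (conj_tuple B C A) <= ?k*((real m + 1)*(?a\<^sup>2)^m)"
      using Cj.phi_pair_energy[OF t0(1,2) Z _ a1, of m] c(1) D(1) unfolding W_def[abs_def] by simp
     also have "... <= ?k*(K1*?q^m)" by (intro mult_left_mono K1 k0)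
     also have "... <= K*?q^m" unfolding mult.assoc[symmetric] using K by (intro mult_right_mono) auto
     finally show ?thesis .
    qed
    hence sum: "(\<Sum>m. ennreal (2 powr (m*t') * close_pairs ?L v (\<lambda>A w. svf t (word_mat A w)) (\<lambda>A w. svf t (word_mat A w)) m (conj_tuple B C A) B)) < \<infinity>"
     using fin[OF t'(1) t(1) t'(2) t0(3,2)] unfolding W_def[abs_def] by blast
    have ex: "AE \<xi> in \<mu>. \<exists>K::nat. \<xi> \<in> good_words t K"
     by (rule AE_good_words[OF t0(1,2)]) (use energy_rate_strict_mono[OF t0(1) t(4) s(2)] h in simp)
    have half: "rho <= 1/2" using r by simp
    have "t' <= hausdorff_dim X" if X: "X \<in> sets borel" "0 < emeasure (projected_measure A v \<mu>) X" for X
     by (rule hausdorff_dim_ge_local[OF good_words_sets ex good_words_local[OF BC(1,2) half radius_bound[OF r] c(1,2) sum t0(1,2)] X])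
    from lower_hausdorff_dim_bounds[OF E this] show ?thesis by blast
   qed
   have eq: "lower_hausdorff_dim (projected_measure A v \<mu>) = ?s \<and> hausdorff_dim (limit_set v) = ?s" if \<mu>: "equilibrium_state A ?s \<mu>" for \<mu>
   proof -
    have "?s <= lower_hausdorff_dim (projected_measure A v \<mu>)"
    proof (rule ccontr)
     assume "\<not> ?s <= lower_hausdorff_dim (projected_measure A v \<mu>)"
     hence "max 0 (lower_hausdorff_dim (projected_measure A v \<mu>)) < ?s" using s(1) by simp
     then obtain t' where "t' \<in> \<rat>" "max 0 (lower_hausdorff_dim (projected_measure A v \<mu>)) < t'" "t' < ?s" using Rats_dense_in_real by blast
     thus False using lower[OF \<mu>, of t'] by simp
    qed
    moreover have "lower_hausdorff_dim (projected_measure A v \<mu>) <= hausdorff_dim (limit_set v)"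
     using lower[OF \<mu> Rats_0 order_refl s(1)] by blast
    ultimately show ?thesis using up(1) by linarith
   qed
   obtain \<mu> where \<mu>: "equilibrium_state A ?s \<mu>" by (rule crit.equilibrium_state_exists)
   have "upper_minkowski_dim (limit_set v) = ereal ?s"
    using up(2) limit_set_minkowski_lower[OF s(1), of v] eq[OF \<mu>] by (intro antisym) auto
   thus "(\<exists>\<mu>. equilibrium_state A ?s \<mu>) \<and>
    (\<forall>\<mu>. equilibrium_state A ?s \<mu> --> lower_hausdorff_dim (projected_measure A v \<mu>) = ?s) \<and>
    hausdorff_dim (self_affine_set A v) = ?s \<and> upper_minkowski_dim (self_affine_set A v) = ereal ?s"
    unfolding limit_set_eq using \<mu> eq by blast
  qed
 qed
qed

theorem theorem2:
  fixes v :: "real^'d^'n"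
  assumes "CARD('n) \<ge> 2" and "CARD('d) \<ge> 3"
    and "\<And>i j. i \<noteq> j \<Longrightarrow> v $ i \<noteq> v $ j"
  shows
    "(\<forall>p :: real^'n. prob_vector p \<longrightarrow>
        (AE A :: real^'d^'d^'n in lebesgue. A \<in> admissible_tuples v \<longrightarrow>
           exact_dimensional (projected_measure A v (bernoulli_measure p))
             (lyapunov_dim A (bernoulli_measure p)) \<and>
           lyapunov_dim A (bernoulli_measure p) =
             Min ((\<lambda>k. real k
                     + (vector_entropy p
                          - (\<Sum>j=1..k. lyapunov_exponent A (bernoulli_measure p) j))
                       / lyapunov_exponent A (bernoulli_measure p) (k + 1)) ` {0..CARD('d) - 1}
                  \<union> {real CARD('d)})))
     \<and>
     (AE A :: real^'d^'d^'n in lebesgue. A \<in> admissible_tuples v \<inter> dominated_tuples \<longrightarrow>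
        (\<exists>\<mu>. equilibrium_state A (dim_aff A) \<mu>) \<and>
        (\<forall>\<mu>. equilibrium_state A (dim_aff A) \<mu> \<longrightarrow>
           lower_hausdorff_dim (projected_measure A v \<mu>) = dim_aff A) \<and>
        hausdorff_dim (self_affine_set A v) = dim_aff A \<and>
        upper_minkowski_dim (self_affine_set A v) = ereal (dim_aff A))"
  proof (intro conjI allI impI)
 fix p :: "real^'n" assume p: "prob_vector p"
 show "AE A :: real^'d^'d^'n in lebesgue. A \<in> admissible_tuples v -->
      exact_dimensional (projected_measure A v (bernoulli_measure p)) (lyapunov_dim A (bernoulli_measure p)) \<and>
      lyapunov_dim A (bernoulli_measure p) =
       Min ((\<lambda>k. real k + (vector_entropy p - (\<Sum>j=1..k. lyapunov_exponent A (bernoulli_measure p) j))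
            / lyapunov_exponent A (bernoulli_measure p) (k + 1)) ` {0..CARD('d) - 1} \<union> {real CARD('d)})"
  by (rule eventually_mono[OF AE_exact_dimensional_bernoulli[OF assms(1,3) p]])
   (simp_all add: lyapunov_dim_def bernoulli_entropy[OF p])
next
 show "AE A :: real^'d^'d^'n in lebesgue. A \<in> admissible_tuples v \<inter> dominated_tuples -->
    (\<exists>\<mu>. equilibrium_state A (dim_aff A) \<mu>) \<and>
    (\<forall>\<mu>. equilibrium_state A (dim_aff A) \<mu> --> lower_hausdorff_dim (projected_measure A v \<mu>) = dim_aff A) \<and>
    hausdorff_dim (self_affine_set A v) = dim_aff A \<and>
    upper_minkowski_dim (self_affine_set A v) = ereal (dim_aff A)"
  by (rule eventually_mono[OF AE_limit_set_dimensions[OF assms(1,3)]]) (assumption, blast)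
qed

end
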